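(* As $X\to\infty$, \[ S_{\mathrm{sq}}(X)=\mathfrak S_{\mathcal R}^{\mathrm{sq}}\,N(X)+O\big(X^{19/10+o(1)}\big), \] that is, for every $\varepsilon>0$ there is a constant $C_\varepsilon$ such that $|S_{\mathrm{sq}}(X)-\mathfrak S_{\mathcal R}^{\mathrm{sq}}N(X)|\le C_\varepsilon X^{19/10+\varepsilon}$ for all sufficiently large real $X$.
   Context: For $\gamma=\begin{pmatrix}a_1&a_2\\ a_3&a_4\end{pmatrix}\in \mathrm{SL}_2(\mathbb Z)$ put $\mathcal R(\gamma)=a_1^2+a_2^2+a_3^2+a_4^2$ and $\|\gamma\|_\infty=\max\{|a_1|,|a_2|,|a_3|,|a_4|\}$. For $X\ge 1$ let $\Gamma_X=\{\gamma\in \mathrm{SL}_2(\mathbb Z):\|\gamma\|_\infty\le X\}$, $N(X)=\#\Gamma_X$, and $S_{\mathrm{sq}}(X)=\#\{\gamma\in\Gamma_X:\mathcal R(\gamma)\text{ is squarefree}\}$. Define $\beta_{2^2}=0$ and, for an odd prime $p$, \[ \beta_{p^2}=\frac{p^2+1-2p\left(\frac{-1}{p}\right)}{p^2(p^2-1)}, \] where $\left(\frac{\cdot}{p}\right)$ is the Legendre symbol. The constant is the absolutely convergent product over all primes $\mathfrak S_{\mathcal R}^{\mathrm{sq}}=\prod_p(1-\beta_{p^2})$. *)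

theory Defs
  imports
    "HOL-Analysis.Analysis"
    "HOL-Computational_Algebra.Squarefree"
    "HOL-Number_Theory.Residues"
begin

definition SL2Z :: "(int ^ 2 ^ 2) set" where
  "SL2Z = {A. det A = 1}"

definition R_form :: "int ^ 2 ^ 2 \<Rightarrow> int" where
  "R_form A = (A $ 1 $ 1)\<^sup>2 + (A $ 1 $ 2)\<^sup>2 + (A $ 2 $ 1)\<^sup>2 + (A $ 2 $ 2)\<^sup>2"

definition norm_infty :: "int ^ 2 ^ 2 \<Rightarrow> int" where
  "norm_infty A = Max {\<bar>A $ 1 $ 1\<bar>, \<bar>A $ 1 $ 2\<bar>, \<bar>A $ 2 $ 1\<bar>, \<bar>A $ 2 $ 2\<bar>}"

definition Gamma_ball :: "real \<Rightarrow> (int ^ 2 ^ 2) set" where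
  "Gamma_ball X = {A \<in> SL2Z. real_of_int (norm_infty A) \<le> X}"

definition N_count :: "real \<Rightarrow> nat" where
  "N_count X = card (Gamma_ball X)"

definition S_sq :: "real \<Rightarrow> nat" where
  "S_sq X = card {A \<in> Gamma_ball X. squarefree (R_form A)}"

(* beta_sq p stands for beta_{p^2}; only its values at primes p are meaningful. *)
definition beta_sq :: "nat \<Rightarrow> real" where
  "beta_sq p =
     (if p = 2 then 0
      else ((real p)\<^sup>2 + 1 - 2 * real p * of_int (Legendre (-1) (int p))) /
           ((real p)\<^sup>2 * ((real p)\<^sup>2 - 1)))"

definition sing_series_sq :: real where
  "sing_series_sq = prodinf (\<lambda>p. if prime p then 1 - beta_sq p else 1)"


text \<open>The sets being counted are finite, and the product defining the constant converges
  absolutely, so neither \<^term>\<open>card\<close> nor \<^term>\<open>prodinf\<close> takes a default value.\<close>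

lemma finite_Gamma_ball: "finite (Gamma_ball X)"
proof -
  define K where "K = {-\<lfloor>X\<rfloor>..\<lfloor>X\<rfloor>}"
  define f where "f = (\<lambda>(a, b, c, d). (vector [vector [a, b], vector [c, d]] :: int ^ 2 ^ 2))"
  have "A \<in> f ` (K \<times> K \<times> K \<times> K)" if "A \<in> Gamma_ball X" for A
  proof -
    from that have "norm_infty A \<le> \<lfloor>X\<rfloor>"
      by (simp add: Gamma_ball_def le_floor_iff)
    then have "A $ 1 $ 1 \<in> K" "A $ 1 $ 2 \<in> K" "A $ 2 $ 1 \<in> K" "A $ 2 $ 2 \<in> K"
      by (auto simp: norm_infty_def K_def)
    moreover have "A = f (A $ 1 $ 1, A $ 1 $ 2, A $ 2 $ 1, A $ 2 $ 2)"
      by (simp add: f_def vec_eq_iff forall_2)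
    ultimately show ?thesis
      by blast
  qed
  then have "Gamma_ball X \<subseteq> f ` (K \<times> K \<times> K \<times> K)"
    by blast
  moreover have "finite (f ` (K \<times> K \<times> K \<times> K))"
    by (simp add: K_def)
  ultimately show ?thesis
    by (rule finite_subset)
qed

lemma abs_convergent_prod_sing_series_sq:
  "abs_convergent_prod (\<lambda>p. if prime p then 1 - beta_sq p else 1)"
proof -
  have bound: "\<bar>if prime p then - beta_sq p else 0\<bar> \<le> 4 * inverse ((real p)\<^sup>2)" for p
  proof (cases "prime p \<and> p \<noteq> 2")
    case False
    then show ?thesis by (auto simp: beta_sq_def)
  next
    case True
    define x where "x = real p"
    define l where "l = real_of_int (Legendre (-1) (int p))"
    have "p \<ge> 3"
      using True prime_ge_2_nat[of p] by linarith
    then have x: "x \<ge> 3"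
      by (simp add: x_def)
    have l: "\<bar>l\<bar> \<le> 1"
      by (simp add: l_def Legendre_def)
    have "\<bar>2 * x * l\<bar> \<le> 2 * x"
      using l x by (simp add: abs_mult)
    then have "\<bar>x\<^sup>2 + 1 - 2 * x * l\<bar> \<le> x\<^sup>2 + 1 + 2 * x"
      by (smt (verit) zero_le_power2)
    also have "\<dots> \<le> 4 * (x\<^sup>2 - 1)"
    proof -
      have "3 * x \<le> x\<^sup>2"
        unfolding power2_eq_square using x by (intro mult_right_mono) auto
      with x show ?thesis
        by (smt (verit))
    qed
    finally have num: "\<bar>x\<^sup>2 + 1 - 2 * x * l\<bar> \<le> 4 * (x\<^sup>2 - 1)" .
    have pos: "x\<^sup>2 - 1 > 0" "x\<^sup>2 > 0"
      using x by auto
    have "\<bar>beta_sq p\<bar> = \<bar>x\<^sup>2 + 1 - 2 * x * l\<bar> / (x\<^sup>2 * (x\<^sup>2 - 1))"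
      using True pos by (simp add: beta_sq_def x_def l_def abs_mult)
    also have "\<dots> \<le> 4 * (x\<^sup>2 - 1) / (x\<^sup>2 * (x\<^sup>2 - 1))"
      using num pos by (intro divide_right_mono) auto
    also have "\<dots> = 4 * inverse (x\<^sup>2)"
      using pos mult_divide_mult_cancel_right[of "x\<^sup>2 - 1" 4 "x\<^sup>2"]
      by (metis divide_inverse less_irrefl)
    finally show ?thesis
      using True by (simp add: x_def)
  qed
  have "summable (\<lambda>p. \<bar>if prime p then - beta_sq p else 0\<bar>)"
  proof (rule summable_comparison_test)
    show "summable (\<lambda>p. 4 * inverse ((real p)\<^sup>2))"
      by (intro summable_mult inverse_power_summable) simp
    show "\<exists>N. \<forall>n\<ge>N. norm \<bar>if prime n then - beta_sq n else 0\<bar> \<le> 4 * inverse ((real n)\<^sup>2)"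
      using bound by simp
  qed
  moreover have "(\<lambda>p. norm ((if prime p then 1 - beta_sq p else 1) - 1)) =
      (\<lambda>p. \<bar>if prime p then - beta_sq p else 0\<bar>)"
    by (auto simp: fun_eq_iff)
  ultimately show ?thesis
    by (simp only: abs_convergent_prod_conv_summable)
qed

lemma has_prod_sing_series_sq:
  "(\<lambda>p. if prime p then 1 - beta_sq p else 1) has_prod sing_series_sq"
  unfolding sing_series_sq_def
  by (intro convergent_prod_has_prod abs_convergent_prod_imp_convergent_prod
      abs_convergent_prod_sing_series_sq)

end

theory Submission
  imports Defs
begin

text \<open>Up to negligible overlaps, symmetry makes the number \<open>A\<^sub>d\<close> of matrices with \<open>d\<^sup>2\<close> dividing the form
  eight times the number of \<open>(a, b, c)\<close> with \<open>0 < a \<le> X\<close>, \<open>b\<close> and \<open>c\<close> in \<open>[-a, a)\<close>, and \<open>a\<close> dividing \<open>b c + 1\<close>, the last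
  entry being determined. Write \<open>a = m r\<close> with \<open>m\<close> prime to \<open>d\<close> and \<open>r\<close> composed of primes of \<open>d\<close>; divisibility
  by \<open>d\<^sup>2\<close> is then a condition on \<open>(b, c)\<close> modulo \<open>r d\<^sup>2\<close>, and one needs equidistribution of the modular
  hyperbola \<open>b c = -1\<close> mod \<open>m\<close> in such classes. Cover the square by translates of boxes of side \<open>T\<close>. The
  variance of the number of hyperbola points in a box is a sum over Kloosterman sums \<open>K(h, k)\<close>; averaging over
  \<open>K(h, k) = K(u h, k / u)\<close> and bounding the fourth moment by the divisor function replaces Weil's bound.
  With \<open>x = X powr (1 / 20)\<close> and \<open>T\<close> about \<open>m / (x\<^sup>2 d)\<close> this gives \<open>A\<^sub>d\<close> for \<open>d \<le> x\<^sup>2\<close> with error of order \<open>x ^ 38 / d\<close>.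

  For larger \<open>d\<close>, a matrix at which the form equals \<open>R\<close> satisfies \<open>(a + e)\<^sup>2 + (b - c)\<^sup>2 = R + 2\<close> and
  \<open>(a - e)\<^sup>2 + (b + c)\<^sup>2 = R - 2\<close>, so few matrices share a value \<open>R\<close>, and \<open>A\<^sub>d\<close> is at most of order
  \<open>X\<^sup>2 / d\<^sup>2\<close> up to divisor functions. Even \<open>d\<close> contribute nothing, since \<open>4\<close> never divides \<open>R\<close>. Summing
  \<open>A\<^sub>d\<close> against the Moebius function proves the theorem.\<close>

section \<open>Kloosterman sums\<close>

text \<open>The variance of a box count weights \<open>|K(h, k)|^2\<close> by two squared geometric
  sums, which are large only where \<open>h\<close> and \<open>k\<close> have small least residues.
  \<open>K\<close> is constant along the orbits \<open>(u h, k / u)\<close> and the weight is not,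
  so the weight may be replaced by its mean over an orbit. Along an orbit the product of the two
  least residues stays in one class modulo \<open>m\<close>, and a given product has few
  factorizations; hence the mean is small as soon as \<open>m \<le> T\<^sup>2\<close>. Up to factors
  \<open>X^o(1)\<close>, discarding \<open>d > D\<close> costs \<open>X^2 / D\<close>. Covering by
  boxes blurs the edge of the square by the proportion \<open>T d^2 / m\<close>, which for
  \<open>T = m / (D d)\<close> amounts to \<open>X^2 / (D d)\<close>. So \<open>D = x^2\<close> is
  what the exponent 19/10 asks for; the variance contributes only \<open>x^37 / d\<close>. The main
  term for \<open>d\<close> is \<open>16 kap 1 beta_d d M^2\<close>. The case \<open>d = 1\<close>
  is \<open>N(X)\<close> itself, so the factor \<open>16 kap 1\<close> cancels and the sum of
  \<open>mu d * beta_d d\<close> is left, which approximates the product over primes.\<close>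

definition ee :: "int \<Rightarrow> int \<Rightarrow> complex" where
  "ee m t = cis (2 * pi * of_int t / of_int m)"

lemma ee_add: "ee m (s + t) = ee m s * ee m t"
  by (simp add: ee_def cis_mult add_divide_distrib distrib_left)

lemma ee_0 [simp]: "ee m 0 = 1"
  by (simp add: ee_def)

lemma norm_ee [simp]: "cmod (ee m t) = 1"
  by (simp add: ee_def)

lemma ee_minus: "ee m (- t) = cnj (ee m t)"
  by (simp add: ee_def cis_cnj)

lemma ee_eq_1_iff:
  assumes "m > 0"
  shows "ee m t = 1 \<longleftrightarrow> m dvd t"
proof
  assume "ee m t = 1"
  then have "cos (2 * pi * of_int t / of_int m) = 1"
    by (metis cis.sel(1) ee_def one_complex.sel(1))
  then obtain k :: int where k: "2 * pi * of_int t / of_int m = of_int k * 2 * pi"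
    by (auto simp: cos_one_2pi_int)
  then have "real_of_int t = of_int k * of_int m"
    using assms by (simp add: field_simps)
  then have "t = k * m" by (metis of_int_eq_iff of_int_mult)
  then show "m dvd t" by simp
next
  assume "m dvd t"
  then obtain k where k: "t = m * k" by blast
  have "ee m t = cis (2 * pi * of_int k)"
    unfolding ee_def k using assms by (intro arg_cong[of _ _ cis]) simp
  also have "\<dots> = 1" by (rule cis_multiple_2pi) auto
  finally show "ee m t = 1" .
qed

lemma ee_cong:
  assumes "m > 0" "m dvd s - t"
  shows "ee m s = ee m t"
proof -
  have "ee m s = ee m (t + (s - t))" by simp
  also have "\<dots> = ee m t" using assms ee_eq_1_iff[of m "s - t"] by (simp only: ee_add) simp
  finally show ?thesis .
qed

lemma ee_power: "ee m t ^ k = ee m (t * int k)"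
  by (induction k) (simp_all add: ee_add[symmetric] algebra_simps)

lemma sum_int_nat: "(\<Sum>u\<in>{0..<m::int}. f u) = (\<Sum>k<nat m. f (int k))"
  by (rule sum.reindex_bij_witness[of _ int nat]) auto

lemma sum_ee:
  assumes "m > 0"
  shows "(\<Sum>u\<in>{0..<m}. ee m (t * u)) = (if m dvd t then of_int m else 0)"
proof (cases "m dvd t")
  case True
  then have "ee m (t * u) = 1" for u using assms by (simp add: ee_eq_1_iff)
  then show ?thesis using True assms by simp
next
  case False
  then have ne: "ee m t \<noteq> 1" using assms by (simp add: ee_eq_1_iff)
  have "(\<Sum>u\<in>{0..<m}. ee m (t * u)) = (\<Sum>k<nat m. ee m t ^ k)"
    by (simp add: sum_int_nat ee_power)
  also have "\<dots> = (ee m t ^ nat m - 1) / (ee m t - 1)"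
    using ne by (simp add: geometric_sum)
  also have "ee m t ^ nat m = 1"
    using assms by (simp add: ee_power ee_eq_1_iff)
  finally show ?thesis using False by simp
qed

section \<open>Parseval's identity modulo m\<close>

lemma parseval:
  fixes c :: "int \<Rightarrow> complex"
  assumes "m > 0"
  shows "(\<Sum>u\<in>{0..<m}. (cmod (\<Sum>h\<in>{0..<m}. c h * ee m (h * u)))\<^sup>2)
    = of_int m * (\<Sum>h\<in>{0..<m}. (cmod (c h))\<^sup>2)"
proof -
  let ?R = "{0..<m}"
  have "complex_of_real (\<Sum>u\<in>?R. (cmod (\<Sum>h\<in>?R. c h * ee m (h * u)))\<^sup>2)
      = (\<Sum>u\<in>?R. (\<Sum>h\<in>?R. c h * ee m (h * u)) * cnj (\<Sum>h\<in>?R. c h * ee m (h * u)))"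
    by (simp only: of_real_sum complex_norm_square)
  also have "\<dots> = (\<Sum>u\<in>?R. \<Sum>h\<in>?R. \<Sum>h'\<in>?R. c h * cnj (c h') * ee m ((h - h') * u))"
  proof (rule sum.cong[OF refl])
    fix u
    have "ee m ((h - h') * u) = ee m (h * u) * cnj (ee m (h' * u))" for h h'
      by (simp flip: ee_minus ee_add add: algebra_simps)
    then show "(\<Sum>h\<in>?R. c h * ee m (h * u)) * cnj (\<Sum>h\<in>?R. c h * ee m (h * u))
        = (\<Sum>h\<in>?R. \<Sum>h'\<in>?R. c h * cnj (c h') * ee m ((h - h') * u))"
      by (simp add: sum_product algebra_simps)
  qed
  also have "\<dots> = (\<Sum>h\<in>?R. \<Sum>u\<in>?R. \<Sum>h'\<in>?R. c h * cnj (c h') * ee m ((h - h') * u))"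
    by (rule sum.swap)
  also have "\<dots> = (\<Sum>h\<in>?R. \<Sum>h'\<in>?R. \<Sum>u\<in>?R. c h * cnj (c h') * ee m ((h - h') * u))"
    by (intro sum.cong[OF refl] sum.swap)
  also have "\<dots> = (\<Sum>h\<in>?R. \<Sum>h'\<in>?R. c h * cnj (c h') * (if h' = h then of_int m else 0))"
  proof (intro sum.cong[OF refl])
    fix h h' assume "h \<in> ?R" "h' \<in> ?R"
    then have "m dvd (h - h') \<longleftrightarrow> h' = h"
      by (metis atLeastLessThan_iff diff_self dvd_0_right mod_eq_dvd_iff mod_pos_pos_trivial)
    then show "(\<Sum>u\<in>?R. c h * cnj (c h') * ee m ((h - h') * u))
        = c h * cnj (c h') * (if h' = h then of_int m else 0)"
      using sum_ee[OF assms, of "h - h'"] by (simp flip: sum_distrib_left)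
  qed
  also have "\<dots> = (\<Sum>h\<in>?R. c h * cnj (c h) * of_int m)"
    by (simp add: if_distrib[where f="\<lambda>x. _ * x"] cong: if_cong)
  also have "\<dots> = complex_of_real (of_int m * (\<Sum>h\<in>?R. (cmod (c h))\<^sup>2))"
    by (simp only: of_real_mult of_real_of_int_eq of_real_sum complex_norm_square sum_distrib_left
        mult.commute[of "of_int m"])
  finally show ?thesis by (simp only: of_real_eq_iff)
qed

lemma parseval2:
  fixes c :: "int \<Rightarrow> int \<Rightarrow> complex"
  assumes "m > 0"
  shows "(\<Sum>u\<in>{0..<m}. \<Sum>v\<in>{0..<m}.
            (cmod (\<Sum>h\<in>{0..<m}. \<Sum>k\<in>{0..<m}. c h k * ee m (h * u) * ee m (k * v)))\<^sup>2)
    = (of_int m)\<^sup>2 * (\<Sum>h\<in>{0..<m}. \<Sum>k\<in>{0..<m}. (cmod (c h k))\<^sup>2)"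
proof -
  let ?R = "{0..<m}"
  have "(\<Sum>u\<in>?R. \<Sum>v\<in>?R. (cmod (\<Sum>h\<in>?R. \<Sum>k\<in>?R. c h k * ee m (h * u) * ee m (k * v)))\<^sup>2)
      = (\<Sum>v\<in>?R. \<Sum>u\<in>?R. (cmod (\<Sum>h\<in>?R. (\<Sum>k\<in>?R. c h k * ee m (k * v)) * ee m (h * u)))\<^sup>2)"
    by (subst sum.swap) (simp add: sum_distrib_right sum_distrib_left mult_ac)
  also have "\<dots> = (\<Sum>v\<in>?R. of_int m * (\<Sum>h\<in>?R. (cmod (\<Sum>k\<in>?R. c h k * ee m (k * v)))\<^sup>2))"
    by (simp add: parseval[OF assms])
  also have "\<dots> = of_int m * (\<Sum>h\<in>?R. \<Sum>v\<in>?R. (cmod (\<Sum>k\<in>?R. c h k * ee m (k * v)))\<^sup>2)"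
    by (subst sum.swap) (simp add: sum_distrib_left)
  also have "\<dots> = of_int m * (\<Sum>h\<in>?R. of_int m * (\<Sum>k\<in>?R. (cmod (c h k))\<^sup>2))"
    by (simp only: parseval[OF assms])
  also have "\<dots> = (of_int m)\<^sup>2 * (\<Sum>h\<in>?R. \<Sum>k\<in>?R. (cmod (c h k))\<^sup>2)"
    by (simp only: power2_eq_square[of "real_of_int m"] mult.assoc flip: sum_distrib_left)
  finally show ?thesis .
qed

text \<open>For \<open>n\<close> coprime to \<open>m\<close> this is the graph of the bijection
  \<open>x -> n / x\<close> on the units modulo \<open>m\<close>. In particular
  \<open>hyp m 1\<close> stands for the unit group, each unit \<open>l\<close> carried along with
  its inverse \<open>l'\<close>; sums over units are written as sums over
  \<open>hyp m 1\<close>.\<close>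

definition hyp :: "int \<Rightarrow> int \<Rightarrow> (int \<times> int) set" where
  "hyp m n = {(x, y) \<in> {0..<m} \<times> {0..<m}. m dvd x * y - n}"

definition Kloos :: "int \<Rightarrow> int \<Rightarrow> int \<Rightarrow> int \<Rightarrow> complex" where
  "Kloos m n h k = (\<Sum>(x, y)\<in>hyp m n. ee m (h * x + k * y))"

definition exp_sum :: "int \<Rightarrow> int \<Rightarrow> int \<Rightarrow> complex" where
  "exp_sum m T h = (\<Sum>i\<in>{0..<T}. ee m (h * i))"

definition tau :: "int \<Rightarrow> nat" where
  "tau n = card {d. 0 < d \<and> d dvd n}"

lemma finite_hyp [simp]: "finite (hyp m n)"
  unfolding hyp_def by (rule finite_subset[of _ "{0..<m} \<times> {0..<m}"]) auto

lemma hyp_swap: "(x, y) \<in> hyp m n \<longleftrightarrow> (y, x) \<in> hyp m n"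
  by (auto simp: hyp_def mult.commute)

lemma dvd_diff_range_eq:
  fixes m x y :: int
  assumes "x \<in> {0..<m}" "y \<in> {0..<m}" "m dvd x - y"
  shows "x = y"
  using assms by (metis atLeastLessThan_iff mod_eq_dvd_iff mod_pos_pos_trivial)

lemma hyp_coprime:
  assumes "(x, y) \<in> hyp m n" "coprime n m"
  shows "coprime x m"
proof -
  have d: "m dvd x * y - n" using assms(1) by (simp add: hyp_def)
  have "gcd x m dvd n"
  proof -
    have "gcd x m dvd x * y" "gcd x m dvd x * y - n"
      using d by (auto intro: dvd_mult2 dvd_trans[of _ m])
    then have "gcd x m dvd x * y - (x * y - n)" by (rule dvd_diff)
    then show ?thesis by simp
  qed
  then have "gcd x m dvd gcd n m" by simp
  then show ?thesis using assms(2)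
    by (metis coprime_iff_gcd_eq_1 gcd_ge_0_int is_unit_gcd_iff zdvd1_eq abs_of_nonneg)
qed

lemma hyp_unique:
  assumes "(x, y) \<in> hyp m n" "(x, y') \<in> hyp m n" "coprime n m"
  shows "y = y'"
proof -
  have "m dvd x * y - n" "m dvd x * y' - n" using assms by (simp_all add: hyp_def)
  then have "m dvd (x * y - n) - (x * y' - n)" by (rule dvd_diff)
  then have "m dvd x * (y - y')" by (simp add: algebra_simps)
  then have "m dvd y - y'"
    using hyp_coprime[OF assms(1,3)] by (simp add: coprime_commute coprime_dvd_mult_right_iff)
  then show ?thesis using assms(1,2) by (intro dvd_diff_range_eq[of _ m]) (auto simp: hyp_def)
qed

lemma unit_scale_inv:
  assumes "m > 0" "(l, l') \<in> hyp m 1" "x \<in> {0..<m}"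
  shows "l' * (l * x mod m) mod m = x"
proof -
  have "m dvd (l * l' - 1) * x" using assms by (simp add: hyp_def)
  then have "m dvd l' * (l * x) - x" by (simp add: algebra_simps)
  then have "l' * (l * x) mod m = x mod m" by (simp add: mod_eq_dvd_iff)
  then show ?thesis using assms(3) by (simp add: mod_mult_right_eq)
qed

lemma hyp_scale:
  assumes "m > 0" "(l, l') \<in> hyp m 1" "(x, y) \<in> hyp m n"
  shows "(l * x mod m, l' * y mod m) \<in> hyp m n"
proof -
  have "m dvd (l * l' - 1) * (x * y)" using assms by (simp add: hyp_def)
  moreover have "m dvd x * y - n" using assms by (simp add: hyp_def)
  ultimately have "m dvd (l * l' - 1) * (x * y) + (x * y - n)" by (rule dvd_add)
  then have "m dvd (l * x) * (l' * y) - n" by (simp add: algebra_simps)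
  then have "(l * x) * (l' * y) mod m = n mod m" by (simp add: mod_eq_dvd_iff)
  then have "(l * x mod m) * (l' * y mod m) mod m = n mod m" by (simp add: mod_mult_eq)
  then have "m dvd (l * x mod m) * (l' * y mod m) - n" by (simp add: mod_eq_dvd_iff)
  then show ?thesis using assms(1) by (simp add: hyp_def)
qed

lemma Kloos_cong:
  assumes "m > 0" "m dvd h - h'" "m dvd k - k'"
  shows "Kloos m n h k = Kloos m n h' k'"
  unfolding Kloos_def
proof (rule sum.cong[OF refl], clarify)
  fix x y
  have "m dvd (h - h') * x + (k - k') * y" using assms by simp
  then show "ee m (h * x + k * y) = ee m (h' * x + k' * y)"
    by (intro ee_cong[OF assms(1)]) (simp add: algebra_simps)
qed

lemma exp_sum_cong:
  assumes "m > 0" "m dvd h - h'"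
  shows "exp_sum m T h = exp_sum m T h'"
  unfolding exp_sum_def
proof (rule sum.cong[OF refl])
  fix i
  have "m dvd (h - h') * i" using assms by simp
  then show "ee m (h * i) = ee m (h' * i)"
    by (intro ee_cong[OF assms(1)]) (simp add: algebra_simps)
qed

lemma Kloos_mod:
  assumes "m > 0" shows "Kloos m n (h mod m) (k mod m) = Kloos m n h k"
  by (rule Kloos_cong[OF assms]) (simp_all add: mod_eq_dvd_iff[symmetric])

lemma exp_sum_mod:
  assumes "m > 0" shows "exp_sum m T (h mod m) = exp_sum m T h"
  by (rule exp_sum_cong[OF assms]) (simp_all add: mod_eq_dvd_iff[symmetric])

lemma Kloos_swap: "Kloos m n h k = Kloos m n k h"
  unfolding Kloos_def
  by (rule sum.reindex_bij_witness[of _ prod.swap prod.swap])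
     (auto simp: hyp_swap[of _ _ m n] add.commute)

text \<open>The substitution \<open>(x, y) -> (l * x, l' * y)\<close> permutes the hyperbola. This
  invariance is what permits averaging over units.\<close>

lemma Kloos_scale:
  assumes "m > 0" "(l, l') \<in> hyp m 1"
  shows "Kloos m n (l * h) (l' * k) = Kloos m n h k"
proof -
  have l2: "(l', l) \<in> hyp m 1" using assms(2) hyp_swap by blast
  have "(\<Sum>(x, y)\<in>hyp m n. ee m (l * h * x + l' * k * y))
      = (\<Sum>(x, y)\<in>hyp m n. ee m (h * x + k * y))"
  proof (rule sum.reindex_bij_witness[of _ "\<lambda>(x, y). (l' * x mod m, l * y mod m)"
        "\<lambda>(x, y). (l * x mod m, l' * y mod m)"], goal_cases)
    case (1 a)
    then show ?case using unit_scale_inv[OF assms] unit_scale_inv[OF assms(1) l2]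
      by (auto simp: hyp_def)
  next
    case (2 a)
    then show ?case by (cases a) (use hyp_scale[OF assms] in simp)
  next
    case (3 b)
    then show ?case using unit_scale_inv[OF assms] unit_scale_inv[OF assms(1) l2]
      by (auto simp: hyp_def)
  next
    case (4 b)
    then show ?case by (cases b) (use hyp_scale[OF assms(1) l2] in simp)
  next
    case (5 a)
    obtain x y where a: "a = (x, y)" by force
    have "m dvd (l * x mod m - l * x)" "m dvd (l' * y mod m - l' * y)"
      by (simp_all add: mod_eq_dvd_iff[symmetric])
    then have "m dvd h * (l * x mod m - l * x) + k * (l' * y mod m - l' * y)" by simp
    then have "ee m (h * (l * x mod m) + k * (l' * y mod m)) = ee m (l * h * x + l' * k * y)"
      by (intro ee_cong[OF assms(1)]) (simp add: algebra_simps)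
    then show ?case by (simp add: a)
  qed
  then show ?thesis by (simp add: Kloos_def)
qed

lemma Kloos_0_0: "Kloos m n 0 0 = of_nat (card (hyp m n))"
  by (simp add: Kloos_def case_prod_unfold)

section \<open>Bounds for geometric sums\<close>

lemma exp_sum_0: "T \<ge> 0 \<Longrightarrow> exp_sum m T 0 = of_int T"
  by (simp add: exp_sum_def)

lemma norm_exp_sum_le: "T \<ge> 0 \<Longrightarrow> cmod (exp_sum m T h) \<le> of_int T"
  unfolding exp_sum_def by (rule order_trans[OF norm_sum]) simp

text \<open>Taylor's bound gives \<open>sin x \<ge> x - x^3 / 6\<close> for
  \<open>x = pi * y\<close>. As \<open>x \<le> 2\<close>, the cubic term is at most
  \<open>2 x / 3\<close>, and \<open>x / 3 \<ge> y\<close> because \<open>pi > 3\<close>.\<close>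

lemma sin_pi_ge:
  assumes "0 \<le> y" "y \<le> 1/2"
  shows "y \<le> sin (pi * y)"
proof -
  define x where "x = pi * y"
  have x0: "0 \<le> x" using assms by (simp add: x_def)
  have "x \<le> 4 * (1/2)" unfolding x_def using assms pi_less_4 by (intro mult_mono) auto
  then have x2: "x \<le> 2" by simp
  have "\<bar>sin x - (\<Sum>m<3. sin_coeff m * x ^ m)\<bar> \<le> inverse (fact 3) * \<bar>x\<bar> ^ 3"
    by (rule Maclaurin_sin_bound)
  moreover have "(\<Sum>m<3. sin_coeff m * x ^ m) = x"
    by (simp add: sin_coeff_def numeral_eq_Suc)
  moreover have "(fact 3 :: real) = 6" by (simp add: fact_numeral)
  ultimately have "\<bar>sin x - x\<bar> \<le> inverse 6 * \<bar>x\<bar> ^ 3" by simp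
  moreover have "inverse 6 * \<bar>x\<bar> ^ 3 = x ^ 3 / 6" using x0 by simp
  ultimately have "sin x \<ge> x - x ^ 3 / 6" by linarith
  moreover have "x ^ 3 \<le> 4 * x"
  proof -
    have "x * x \<le> 2 * 2" using x0 x2 by (intro mult_mono) auto
    then have "x * (x * x) \<le> x * 4" using x0 by (intro mult_left_mono) auto
    then show ?thesis by (simp add: power3_eq_cube mult_ac)
  qed
  ultimately have "sin x \<ge> x / 3" by linarith
  moreover have "3 * y \<le> x" unfolding x_def using assms pi_gt3 by (intro mult_right_mono) auto
  ultimately show ?thesis by (simp add: x_def)
qed

lemma cmod_cis_minus_1: "cmod (cis t - 1) = 2 * \<bar>sin (t / 2)\<bar>"
proof -
  have "(cmod (cis t - 1))\<^sup>2 = (cos t - 1)\<^sup>2 + (sin t)\<^sup>2"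
    by (simp add: cmod_power2)
  also have "\<dots> = 2 - 2 * cos t"
    using sin_cos_squared_add[of t] by (simp add: power2_eq_square algebra_simps)
  also have "cos t = 1 - 2 * (sin (t / 2))\<^sup>2"
    using cos_double_sin[of "t / 2"] by simp
  finally have "(cmod (cis t - 1))\<^sup>2 = (2 * \<bar>sin (t / 2)\<bar>)\<^sup>2" by (simp add: power_mult_distrib)
  then show ?thesis by (rule power2_eq_imp_eq) auto
qed

lemma cmod_ee_minus_1_ge:
  assumes "m > 0" "2 * \<bar>h\<bar> \<le> m"
  shows "2 * \<bar>real_of_int h\<bar> / of_int m \<le> cmod (ee m h - 1)"
proof -
  define y where "y = \<bar>real_of_int h\<bar> / of_int m"
  have "2 * \<bar>real_of_int h\<bar> \<le> of_int m"
    using assms(2) by linarith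
  then have y: "0 \<le> y" "y \<le> 1/2"
    using assms by (auto simp: y_def field_simps)
  have "cmod (ee m h - 1) = 2 * \<bar>sin (pi * (of_int h / of_int m))\<bar>"
    by (simp add: ee_def cmod_cis_minus_1)
  also have "\<bar>sin (pi * (of_int h / of_int m))\<bar> = \<bar>sin (pi * y)\<bar>"
    using assms by (simp add: y_def abs_if)
  finally have "cmod (ee m h - 1) \<ge> 2 * y" using sin_pi_ge[OF y] by linarith
  then show ?thesis by (simp add: y_def)
qed

text \<open>Summing the geometric series leaves a numerator of modulus at most 2 over
  \<open>|ee m h - 1|\<close>, which is at least \<open>2 |h| / m\<close> because \<open>|h|\<close>
  is at most half the modulus.\<close>

lemma norm_exp_sum_le_div:
  assumes "m > 0" "T \<ge> 0" "h \<noteq> 0" "2 * \<bar>h\<bar> \<le> m"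
  shows "cmod (exp_sum m T h) \<le> of_int m / \<bar>of_int h\<bar>"
proof -
  have ge: "2 * \<bar>real_of_int h\<bar> / of_int m \<le> cmod (ee m h - 1)"
    using cmod_ee_minus_1_ge assms by blast
  have pos: "0 < 2 * \<bar>real_of_int h\<bar> / of_int m" using assms by simp
  with ge have ne: "ee m h \<noteq> 1" by auto
  have "exp_sum m T h = (\<Sum>k<nat T. ee m h ^ k)"
    by (simp add: exp_sum_def sum_int_nat ee_power)
  also have "\<dots> = (ee m h ^ nat T - 1) / (ee m h - 1)"
    using ne by (simp add: geometric_sum)
  finally have "cmod (exp_sum m T h) = cmod (ee m h ^ nat T - 1) / cmod (ee m h - 1)"
    by (simp add: norm_divide)
  also have "\<dots> \<le> 2 / cmod (ee m h - 1)"
    using norm_triangle_ineq4[of "ee m h ^ nat T" 1]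
    by (intro divide_right_mono) (auto simp: norm_power)
  also have "\<dots> \<le> 2 / (2 * \<bar>real_of_int h\<bar> / of_int m)"
    using ge pos ne by (intro divide_left_mono mult_pos_pos) auto
  finally show ?thesis by simp
qed

text \<open>The representative in \<open>(-m/2, m/2]\<close>. The bound \<open>m / |h|\<close> for a
  geometric sum asks for this choice of \<open>h\<close>.\<close>

definition least_residue :: "int \<Rightarrow> int \<Rightarrow> int" where
  "least_residue m x = (if 2 * (x mod m) \<le> m then x mod m else x mod m - m)"

lemma least_residue_props:
  assumes "m > 0"
  shows "m dvd least_residue m x - x" "2 * \<bar>least_residue m x\<bar> \<le> m" "least_residue m x = 0 \<longleftrightarrow> m dvd x"
proof -
  have r: "0 \<le> x mod m" "x mod m < m" using assms by simp_all
  have "m dvd x mod m - x" by (simp add: mod_eq_dvd_iff[symmetric])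
  then show "m dvd least_residue m x - x"
    using dvd_diff[of m "x mod m - x" m] by (auto simp: least_residue_def algebra_simps)
  show "2 * \<bar>least_residue m x\<bar> \<le> m" using r by (auto simp: least_residue_def)
  show "least_residue m x = 0 \<longleftrightarrow> m dvd x" using r by (auto simp: least_residue_def dvd_eq_mod_eq_0)
qed

lemma exp_sum_least_residue: "m > 0 \<Longrightarrow> exp_sum m T (least_residue m x) = exp_sum m T x"
  by (intro exp_sum_cong least_residue_props)

section \<open>Averaging geometric sums over units\<close>

lemma hyp_zero_dvd:
  assumes "m > 0" "(l, l') \<in> hyp m 1"
  shows "m dvd l * h \<longleftrightarrow> m dvd h"
proof -
  have "coprime l m" using hyp_coprime[OF assms(2)] by simp
  then show ?thesis by (simp add: coprime_commute coprime_dvd_mult_right_iff)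
qed

lemma dvd_mult_gcd_iff:
  fixes m :: int
  assumes "m dvd s * h" "m dvd s * k"
  shows "m dvd s * gcd h k"
proof -
  have "m dvd gcd (s * h) (s * k)" using assms by simp
  then have "m dvd \<bar>s\<bar> * gcd h k" by (simp add: gcd_mult_distrib_int[symmetric])
  then show ?thesis by (cases "s \<ge> 0") (simp_all add: abs_if)
qed

text \<open>With \<open>m = g * w\<close> the condition says that \<open>l\<close> lies in one class
  modulo \<open>w\<close>, so \<open>l div w\<close>, which takes at most \<open>g\<close> values,
  determines \<open>l\<close>.\<close>

lemma card_multiples:
  fixes m g :: int
  assumes "m > 0" "g > 0" "g dvd m"
  shows "card {l \<in> {0..<m}. m dvd (l - r) * g} \<le> nat g"
proof -
  obtain w where w: "m = g * w" using assms by blast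
  have wpos: "w > 0" using assms w by (simp add: zero_less_mult_iff)
  let ?A = "{l \<in> {0..<m}. m dvd (l - r) * g}"
  have "inj_on (\<lambda>l. l div w) ?A"
  proof (rule inj_onI)
    fix x y assume a: "x \<in> ?A" "y \<in> ?A" "x div w = y div w"
    have "m dvd (x - r) * g - (y - r) * g" using a by (intro dvd_diff) auto
    then have "w * g dvd (x - y) * g" by (simp add: w algebra_simps)
    then have "w dvd x - y" using assms by simp
    then have "x mod w = y mod w" by (simp add: mod_eq_dvd_iff)
    then show "x = y" using a(3) by (metis div_mult_mod_eq)
  qed
  moreover have "(\<lambda>l. l div w) ` ?A \<subseteq> {0..<g}"
  proof clarify
    fix l assume l: "l \<in> {0..<m}"
    have "l div w * w \<le> l" using wpos by (metis add.commute div_mult_mod_eq le_add_same_cancel2 pos_mod_sign)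
    then have "l div w * w < g * w" using l w by simp
    then have "l div w < g" using wpos by (simp add: mult_less_cancel_right)
    then show "l div w \<in> {0..<g}" using wpos l by (simp add: pos_imp_zdiv_nonneg_iff)
  qed
  ultimately have "card ?A \<le> card {0..<g}" by (intro card_inj_on_le) auto
  then show ?thesis by simp
qed

lemma sum_inverse_squares_le: "(\<Sum>j\<in>{1..J::nat}. 1 / (real j)\<^sup>2) \<le> 2"
proof -
  have "(\<Sum>j\<in>{1..K}. 1 / (real j)\<^sup>2) \<le> 2 - 1 / real K" if "K \<ge> 1" for K
    using that
  proof (induction K rule: dec_induct)
    case (step K)
    have "1 / (real (Suc K))\<^sup>2 \<le> 1 / real K - 1 / real (Suc K)"
    proof -
      have "1 / (real (Suc K))\<^sup>2 \<le> 1 / (real K * real (Suc K))"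
        unfolding power2_eq_square using step(1) by (intro divide_left_mono mult_right_mono) auto
      then show ?thesis using step(1) by (simp add: field_simps)
    qed
    then show ?case using step by simp
  qed simp
  from this[of J] show ?thesis
    by (cases "J = 0") (simp_all, smt (verit) divide_nonneg_nonneg of_nat_0_le_iff)
qed

lemma finite_posdvd: "n \<noteq> 0 \<Longrightarrow> finite {d::int. 0 < d \<and> d dvd n}"
  by (rule finite_subset[of _ "{0..\<bar>n\<bar>}"]) (auto dest: dvd_imp_le_int)

lemma card_dvd_le:
  assumes "N \<noteq> 0"
  shows "card {x::int. x dvd N} \<le> 2 * tau N" "finite {x::int. x dvd N}"
proof -
  let ?P = "{d::int. 0 < d \<and> d dvd N}"
  have sub: "{x. x dvd N} \<subseteq> ?P \<union> uminus ` ?P"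
  proof
    fix x assume "x \<in> {x. x dvd N}"
    then have x: "x dvd N" "x \<noteq> 0" using assms by auto
    show "x \<in> ?P \<union> uminus ` ?P"
    proof (cases "x > 0")
      case False
      then have "- x \<in> ?P" using x by simp
      then have "- (- x) \<in> uminus ` ?P" by (rule imageI)
      then show ?thesis by simp
    qed (use x in simp)
  qed
  have fin: "finite ?P" using assms by (rule finite_posdvd)
  show "finite {x. x dvd N}" using finite_subset[OF sub] fin by simp
  have "card {x. x dvd N} \<le> card (?P \<union> uminus ` ?P)" using sub fin by (intro card_mono) auto
  also have "\<dots> \<le> card ?P + card (uminus ` ?P)" by (rule card_Un_le)
  also have "\<dots> \<le> card ?P + card ?P" using fin card_image_le by (intro add_left_mono) blast
  finally show "card {x. x dvd N} \<le> 2 * tau N" by (simp add: tau_def)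
qed

text \<open>All \<open>N\<close> in \<open>A\<close> lie in one class modulo \<open>m\<close>, hence
  differ by multiples of \<open>m\<close>. If \<open>|N| \<ge> m * j\<close> with
  \<open>j > 0\<close>, then \<open>m\<^sup>2 / |N| \<le> m / j \<le> T\<^sup>2 / j\<close>, so the
  term is at most \<open>T^4 / j^2\<close>. Each \<open>j\<close> occurs at most twice, once on each
  side of zero, and \<open>j = 0\<close> costs \<open>T^4\<close>: in total
  \<open>2 * (1 + 2) * T^4\<close>.\<close>

lemma sum_weights_le:
  fixes m r T :: int
  assumes m: "m > 0" and T: "T > 0" and Tm: "m \<le> T\<^sup>2" and fin: "finite A"
    and A: "\<And>N. N \<in> A \<Longrightarrow> m dvd N - r \<and> N \<noteq> 0"
  shows "(\<Sum>N\<in>A. (min ((of_int T)\<^sup>2) ((of_int m)\<^sup>2 / \<bar>of_int N\<bar>))\<^sup>2) \<le> 6 * (of_int T :: real) ^ 4"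
proof -
  define w :: "int \<Rightarrow> real" where "w N = (min ((of_int T)\<^sup>2) ((of_int m)\<^sup>2 / \<bar>of_int N\<bar>))\<^sup>2" for N
  define v :: "nat \<Rightarrow> real" where "v j = (if j = 0 then of_int T ^ 4 else of_int T ^ 4 / (real j)\<^sup>2)" for j
  define f where "f N = (N - r mod m) div m" for N
  \<comment> \<open>For \<open>N = m * f N + r mod m\<close> the index satisfies
    \<open>|N| \<ge> m * g (f N)\<close>: the values 0 and -1 of \<open>f N\<close> both get index
    0, the values 1 and -2 get index 1, and so on.\<close>
  define g where "g j = (if j \<ge> 0 then nat j else nat (- j - 1))" for j
  have f: "N = m * f N + r mod m" if "N \<in> A" for N
  proof -
    have "m dvd N - r mod m"
      using A[OF that] by (metis mod_eq_dvd_iff mod_mod_trivial)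
    then show ?thesis by (simp add: f_def)
  qed
  have wv: "w N \<le> v (g (f N))" if N: "N \<in> A" for N
  proof (cases "g (f N) = 0")
    case True
    have "w N \<le> ((of_int T)\<^sup>2)\<^sup>2" unfolding w_def
      by (intro power_mono) (auto simp: min_def)
    then show ?thesis using True by (simp add: v_def)
  next
    case False
    define j where "j = g (f N)"
    have j: "j > 0" using False by (simp add: j_def)
    have r: "0 \<le> r mod m" "r mod m < m" using m by simp_all
    have "m * int j \<le> \<bar>N\<bar>"
    proof (cases "f N \<ge> 0")
      case True
      then have "int j = f N" by (simp add: j_def g_def)
      then have "N = m * int j + r mod m" using f[OF N] by simp
      then show ?thesis using r by linarith
    next
      case neg: False
      then have "int j = - f N - 1" by (simp add: j_def g_def)
      then have "m * int j = m * (- f N - 1)" by (simp only:)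
      also have "\<dots> = - (m * f N) - m" by (simp add: algebra_simps)
      finally have "m * int j = - (m * f N) - m" .
      then have "N = r mod m - m - m * int j" using f[OF N] by linarith
      then show ?thesis using r by linarith
    qed
    then have "real_of_int m * real j \<le> \<bar>of_int N\<bar>"
      by (metis of_int_abs of_int_le_iff of_int_mult of_int_of_nat_eq)
    then have "(of_int m)\<^sup>2 / \<bar>of_int N\<bar> \<le> (of_int m)\<^sup>2 / (real_of_int m * real j)"
      using m j A[OF N] by (intro divide_left_mono mult_pos_pos) auto
    also have "\<dots> = of_int m / real j" using m j by (simp add: power2_eq_square)
    also have "\<dots> \<le> (of_int T)\<^sup>2 / real j"
      using Tm by (intro divide_right_mono) (auto simp flip: of_int_power)
    finally have "w N \<le> ((of_int T)\<^sup>2 / real j)\<^sup>2" unfolding w_def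
      by (intro power_mono) (auto simp: min_def)
    also have "\<dots> = v j" using j by (simp add: v_def power_divide)
    finally show ?thesis by (simp add: j_def)
  qed
  define J where "J = Max (insert 0 ((\<lambda>N. nat \<bar>f N\<bar>) ` A))"
  have J: "f N \<in> int ` {0..J} \<union> (\<lambda>j. - int j - 1) ` {0..J}" if "N \<in> A" for N
  proof -
    have *: "nat \<bar>f N\<bar> \<le> J" unfolding J_def using fin that by (intro Max_ge) auto
    show ?thesis
    proof (cases "f N \<ge> 0")
      case True
      then have "f N = int (nat (f N))" "nat (f N) \<in> {0..J}" using * by simp_all
      then show ?thesis by blast
    next
      case False
      then have "f N = - int (nat (- f N - 1)) - 1" by linarith
      moreover have "nat (- f N - 1) \<in> {0..J}" using * False by simp
      ultimately show ?thesis by blast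
    qed
  qed
  have inj: "inj_on f A"
    by (rule inj_onI) (metis f)
  have "(\<Sum>N\<in>A. w N) \<le> (\<Sum>N\<in>A. v (g (f N)))" by (intro sum_mono wv)
  also have "\<dots> = (\<Sum>j\<in>f ` A. v (g j))" using inj by (simp add: sum.reindex)
  also have "\<dots> \<le> (\<Sum>j\<in>int ` {0..J} \<union> (\<lambda>j. - int j - 1) ` {0..J}. v (g j))"
  proof (rule sum_mono2)
    show "f ` A \<subseteq> int ` {0..J} \<union> (\<lambda>j. - int j - 1) ` {0..J}" using J by blast
  qed (simp_all add: v_def)
  also have "\<dots> = (\<Sum>j\<in>int ` {0..J}. v (g j)) + (\<Sum>j\<in>(\<lambda>j. - int j - 1) ` {0..J}. v (g j))"
    by (intro sum.union_disjoint) auto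
  also have "\<dots> = (\<Sum>j\<in>{0..J}. v j) + (\<Sum>j\<in>{0..J}. v j)"
    by (simp add: sum.reindex inj_on_def g_def)
  also have "(\<Sum>j\<in>{0..J}. v j) = of_int T ^ 4 + (\<Sum>j\<in>{1..J}. of_int T ^ 4 * (1 / (real j)\<^sup>2))"
    by (simp add: sum.atLeast_Suc_atMost v_def)
  also have "(\<Sum>j\<in>{1..J}. of_int T ^ 4 * (1 / (real j)\<^sup>2)) \<le> of_int T ^ 4 * 2"
    unfolding sum_distrib_left[symmetric] using sum_inverse_squares_le T
    by (intro mult_left_mono) auto
  finally show ?thesis unfolding w_def by simp
qed

text \<open>If \<open>l\<close> and \<open>l0\<close> have the same images, then
  \<open>l - l0\<close> is annihilated modulo \<open>m\<close> by \<open>h\<close> and by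
  \<open>k\<close>, hence by \<open>g = gcd (gcd h k) m\<close>; such \<open>l\<close> form one
  class modulo \<open>m / g\<close>.\<close>

lemma card_unit_fibre2:
  assumes m: "m > 0"
  shows "card {(l, l') \<in> hyp m 1. m dvd l * h - r \<and> m dvd l' * k - s} \<le> nat (gcd (gcd h k) m)"
    (is "card ?A \<le> _")
proof (cases "?A = {}")
  case False
  then obtain l0 l0' where l0: "(l0, l0') \<in> hyp m 1" "m dvd l0 * h - r" "m dvd l0' * k - s"
    by blast
  let ?B = "{l \<in> {0..<m}. m dvd (l - l0) * gcd (gcd h k) m}"
  have "inj_on fst ?A"
    using hyp_unique[of _ _ m 1] by (auto simp: inj_on_def)
  moreover have "fst ` ?A \<subseteq> ?B"
  proof clarsimp
    fix l l' assume l: "(l, l') \<in> hyp m 1" "m dvd l * h - r" "m dvd l' * k - s"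
    have "m dvd (l * h - r) - (l0 * h - r)" by (rule dvd_diff[OF l(2) l0(2)])
    then have 1: "m dvd (l - l0) * h" by (simp add: algebra_simps)
    have a: "m dvd l * l' - 1" "m dvd l0 * l0' - 1" using l l0 by (simp_all add: hyp_def)
    have "m dvd (l' * k - s) - (l0' * k - s)" by (rule dvd_diff[OF l(3) l0(3)])
    \<comment> \<open>Multiplying the congruence between the inverses by \<open>l * l0\<close> turns
      it into \<open>(l - l0) * k = 0\<close> modulo \<open>m\<close>.\<close>
    then have "m dvd - (l * l0) * ((l' * k - s) - (l0' * k - s))" by (rule dvd_mult)
    moreover have "m dvd (l * l' - 1) * (l0 * k)" "m dvd (l0 * l0' - 1) * (l * k)"
      using a by simp_all
    ultimately have "m dvd - (l * l0) * ((l' * k - s) - (l0' * k - s)) + (l * l' - 1) * (l0 * k) - (l0 * l0' - 1) * (l * k)"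
      by (intro dvd_diff[OF dvd_add])
    then have 2: "m dvd (l - l0) * k" by (simp add: algebra_simps)
    have "m dvd (l - l0) * gcd (gcd h k) m"
      by (intro dvd_mult_gcd_iff 1 2) simp
    then show "0 \<le> l \<and> l < m \<and> m dvd (l - l0) * gcd (gcd h k) m" using l by (simp add: hyp_def)
  qed
  moreover have "finite ?B" by (rule finite_subset[of _ "{0..<m}"]) auto
  ultimately have "card ?A \<le> card ?B" by (rule card_inj_on_le)
  also have "\<dots> \<le> nat (gcd (gcd h k) m)" using m by (intro card_multiples) auto
  finally show ?thesis .
next
  case True
  then show ?thesis by (simp only: card.empty)
qed

lemma card_unit_fibre1:
  assumes m: "m > 0"
  shows "card {(l, l') \<in> hyp m 1. m dvd l' * k - s} \<le> nat (gcd k m)"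
  using card_unit_fibre2[OF m, of 0 0 k s] by simp

lemma hyp_scale_residue:
  assumes m: "m > 0" and U: "(l, l') \<in> hyp m 1" and h: "h \<in> {1..<m}"
  shows "l * h mod m \<in> {1..<m}"
proof -
  have "\<not> m dvd h" using h zdvd_not_zless by auto
  then have "l * h mod m \<noteq> 0" using hyp_zero_dvd[OF m U] by (simp add: dvd_eq_mod_eq_0)
  moreover have "0 \<le> l * h mod m" "l * h mod m < m" using m by simp_all
  ultimately show ?thesis by simp
qed

text \<open>The least residues of \<open>l * h\<close> and \<open>l' * k\<close> multiply to some
  nonzero \<open>N\<close> congruent to \<open>h * k\<close>, of size at most
  \<open>m\<^sup>2\<close>. The weight is bounded in terms of \<open>N\<close> alone, by the square
  of \<open>min (T\<^sup>2) (m\<^sup>2 / |N|)\<close>. A given \<open>N\<close> has at most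
  \<open>2 * tau N\<close> signed factorizations, and each comes from at most
  \<open>gcd (gcd h k) m\<close> units. Summing the bound over the values \<open>N\<close> costs
  \<open>6 * T^4\<close>.\<close>

lemma orbit_sum_le:
  fixes m T :: int and TM :: real
  assumes m: "m > 0" and T: "T > 0" and Tm: "m \<le> T\<^sup>2"
    and TM: "\<And>N. N \<noteq> 0 \<Longrightarrow> \<bar>N\<bar> \<le> m\<^sup>2 \<Longrightarrow> real (tau N) \<le> TM"
    and h: "h \<in> {1..<m}" and k: "k \<in> {1..<m}"
  shows "(\<Sum>(l, l')\<in>hyp m 1. (cmod (exp_sum m T (l * h)))\<^sup>2 * (cmod (exp_sum m T (l' * k)))\<^sup>2)
    \<le> real_of_int (gcd (gcd h k) m) * (12 * TM * of_int T ^ 4)"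
proof -
  define g where "g = gcd (gcd h k) m"
  define w :: "int \<Rightarrow> real" where "w N = (min ((of_int T)\<^sup>2) ((of_int m)\<^sup>2 / \<bar>of_int N\<bar>))\<^sup>2" for N
  define F where "F = (\<lambda>(l, l'). least_residue m (l * h) * least_residue m (l' * k))"
  let ?U = "hyp m 1"
  have g0: "g > 0" using m by (simp add: g_def)
  have TM0: "TM \<ge> 0" using TM[of 1] m by (smt (verit) of_nat_0_le_iff zero_less_power zle_diff1_eq abs_one)
  have nz: "least_residue m (l * h) \<noteq> 0" "least_residue m (l' * k) \<noteq> 0" if "(l, l') \<in> ?U" for l l'
  proof -
    have "(l', l) \<in> ?U" using that hyp_swap by blast
    then show "least_residue m (l * h) \<noteq> 0" "least_residue m (l' * k) \<noteq> 0"
      using h k hyp_zero_dvd[OF m] that least_residue_props(3)[OF m] zdvd_not_zless by auto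
  qed
  have W: "(cmod (exp_sum m T (l * h)))\<^sup>2 * (cmod (exp_sum m T (l' * k)))\<^sup>2 \<le> w (F (l, l'))"
    if U: "(l, l') \<in> ?U" for l l'
  proof -
    define x where "x = least_residue m (l * h)"
    define y where "y = least_residue m (l' * k)"
    have xy: "x \<noteq> 0" "y \<noteq> 0" using nz[OF U] by (simp_all add: x_def y_def)
    have e: "exp_sum m T (l * h) = exp_sum m T x" "exp_sum m T (l' * k) = exp_sum m T y"
      using m by (simp_all add: x_def y_def exp_sum_least_residue)
    have "cmod (exp_sum m T x) * cmod (exp_sum m T y) \<le> of_int T * of_int T"
      using T by (intro mult_mono norm_exp_sum_le) auto
    moreover have "cmod (exp_sum m T x) * cmod (exp_sum m T y) \<le> (of_int m / \<bar>of_int x\<bar>) * (of_int m / \<bar>of_int y\<bar>)"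
      using T m xy least_residue_props(2)[OF m] by (intro mult_mono norm_exp_sum_le_div) (auto simp: x_def y_def)
    ultimately have "cmod (exp_sum m T x) * cmod (exp_sum m T y) \<le> min ((of_int T)\<^sup>2) ((of_int m)\<^sup>2 / \<bar>of_int (x * y)\<bar>)"
      by (simp add: power2_eq_square abs_mult)
    then have "(cmod (exp_sum m T x) * cmod (exp_sum m T y))\<^sup>2 \<le> w (x * y)"
      unfolding w_def by (intro power_mono) auto
    then show ?thesis by (simp add: e F_def power_mult_distrib flip: x_def y_def)
  qed
  have FA: "m dvd N - h * k \<and> N \<noteq> 0 \<and> \<bar>N\<bar> \<le> m\<^sup>2" if N: "N \<in> F ` ?U" for N
  proof -
    obtain l l' where U: "(l, l') \<in> ?U" and N: "N = least_residue m (l * h) * least_residue m (l' * k)"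
      using N by (auto simp: F_def)
    have d: "m dvd l * l' - 1" using U by (simp add: hyp_def)
    have "m dvd (least_residue m (l * h) - l * h) * least_residue m (l' * k) + (l * h) * (least_residue m (l' * k) - l' * k) + (l * l' - 1) * (h * k)"
      using least_residue_props(1)[OF m] d by (intro dvd_add dvd_mult dvd_mult2)
    then have 1: "m dvd N - h * k" by (simp add: N algebra_simps)
    have "\<bar>least_residue m (l * h)\<bar> * \<bar>least_residue m (l' * k)\<bar> \<le> m * m"
      using least_residue_props(2)[OF m, of "l * h"] least_residue_props(2)[OF m, of "l' * k"]
      by (intro mult_mono) auto
    then show ?thesis using 1 nz[OF U] by (simp add: N abs_mult power2_eq_square)
  qed
  have fib: "real (card {z \<in> ?U. F z = N}) \<le> 2 * TM * g" if N: "N \<in> F ` ?U" for N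
  proof -
    have N0: "N \<noteq> 0" "\<bar>N\<bar> \<le> m\<^sup>2" using FA[OF N] by auto
    let ?C = "\<lambda>x. {(l, l') \<in> ?U. m dvd l * h - x \<and> m dvd l' * k - N div x}"
    have "{z \<in> ?U. F z = N} \<subseteq> (\<Union>x\<in>{x. x dvd N}. ?C x)"
    proof
      fix z assume "z \<in> {z \<in> ?U. F z = N}"
      then obtain l l' where z: "z = (l, l')" "(l, l') \<in> ?U" "least_residue m (l * h) * least_residue m (l' * k) = N"
        by (cases z) (auto simp: F_def)
      have "N div least_residue m (l * h) = least_residue m (l' * k)" using z(3) nz[OF z(2)] by auto
      moreover have "m dvd l * h - least_residue m (l * h)" "m dvd l' * k - least_residue m (l' * k)"
        using least_residue_props(1)[OF m] by (metis dvd_minus_iff minus_diff_eq)+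
      ultimately have "z \<in> ?C (least_residue m (l * h))" using z by simp
      moreover have "least_residue m (l * h) dvd N" using z(3) by auto
      ultimately show "z \<in> (\<Union>x\<in>{x. x dvd N}. ?C x)" by blast
    qed
    then have "card {z \<in> ?U. F z = N} \<le> card (\<Union>x\<in>{x. x dvd N}. ?C x)"
      using card_dvd_le(2)[OF N0(1)] by (intro card_mono) (auto intro: finite_subset[OF _ finite_hyp])
    also have "\<dots> \<le> (\<Sum>x\<in>{x. x dvd N}. card (?C x))"
      by (rule card_UN_le[OF card_dvd_le(2)[OF N0(1)]])
    also have "\<dots> \<le> (\<Sum>x\<in>{x. x dvd N}. nat g)"
      unfolding g_def by (intro sum_mono card_unit_fibre2 m)
    also have "\<dots> = card {x. x dvd N} * nat g" by simp
    also have "\<dots> \<le> 2 * tau N * nat g" using card_dvd_le(1)[OF N0(1)] by (intro mult_right_mono) auto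
    finally have "real (card {z \<in> ?U. F z = N}) \<le> real (2 * tau N * nat g)" by (simp only: of_nat_le_iff)
    also have "\<dots> = 2 * real (tau N) * real_of_int g" using g0 by simp
    also have "\<dots> \<le> 2 * TM * real_of_int g" using TM[OF N0] g0 by (intro mult_right_mono) auto
    finally show ?thesis .
  qed
  have "(\<Sum>(l, l')\<in>?U. (cmod (exp_sum m T (l * h)))\<^sup>2 * (cmod (exp_sum m T (l' * k)))\<^sup>2) \<le> (\<Sum>z\<in>?U. w (F z))"
    using W by (intro sum_mono) auto
  also have "\<dots> = (\<Sum>N\<in>F ` ?U. of_nat (card {z \<in> ?U. F z = N}) * w N)"
    by (intro sum_fun_comp) auto
  also have "\<dots> \<le> (\<Sum>N\<in>F ` ?U. (2 * TM * g) * w N)"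
    using fib by (intro sum_mono mult_right_mono) (auto simp: w_def)
  also have "\<dots> = (2 * TM * g) * (\<Sum>N\<in>F ` ?U. w N)" by (simp add: sum_distrib_left)
  also have "\<dots> \<le> (2 * TM * g) * (6 * of_int T ^ 4)"
    unfolding w_def using FA TM0 g0
    by (intro mult_left_mono sum_weights_le[OF m T Tm, of _ "h * k"]) auto
  finally show ?thesis by (simp add: g_def mult_ac)
qed

section \<open>Sums over multiples, gcd weights and the axes\<close>

definition harm_int :: "int \<Rightarrow> real" where
  "harm_int m = (\<Sum>j\<in>{1..nat m}. 1 / real j)"

lemma harm_int_ge_1: "m > 0 \<Longrightarrow> harm_int m \<ge> 1"
proof -
  assume "m > 0"
  then have "(\<Sum>j\<in>{1::nat}. 1 / real j) \<le> harm_int m" unfolding harm_int_def by (intro sum_mono2) auto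
  then show ?thesis by simp
qed

lemma sum_recip_multiples_le:
  fixes m g :: int
  assumes "m > 0" "g > 0"
  shows "(\<Sum>h\<in>{h \<in> {1..<m}. g dvd h}. 1 / real_of_int h) \<le> harm_int m / g"
proof -
  let ?A = "{h \<in> {1..<m}. g dvd h}"
  have "(\<Sum>h\<in>?A. 1 / real_of_int h) = (\<Sum>h\<in>?A. (1 / real (nat (h div g))) / g)"
  proof (rule sum.cong[OF refl])
    fix h assume h: "h \<in> ?A"
    then obtain j where j: "h = g * j" by blast
    then have "j > 0" using h assms zero_less_mult_pos[of g j] by simp
    then show "1 / real_of_int h = (1 / real (nat (h div g))) / g" using assms by (simp add: j)
  qed
  also have "\<dots> = (\<Sum>j\<in>(\<lambda>h. nat (h div g)) ` ?A. 1 / real j) / g"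
  proof -
    have "inj_on (\<lambda>h. nat (h div g)) ?A"
    proof (rule inj_onI)
      fix x y assume a: "x \<in> ?A" "y \<in> ?A" "nat (x div g) = nat (y div g)"
      then have "x div g = y div g" using assms by (simp add: pos_imp_zdiv_nonneg_iff nat_eq_iff2)
      then show "x = y" using a by (metis (lifting) dvd_mult_div_cancel mem_Collect_eq)
    qed
    then show ?thesis by (simp add: sum.reindex sum_divide_distrib)
  qed
  also have "\<dots> \<le> harm_int m / g"
  proof -
    have "(\<lambda>h. nat (h div g)) ` ?A \<subseteq> {1..nat m}"
    proof (rule image_subsetI)
      fix h assume "h \<in> ?A"
      then have h: "1 \<le> h" "h < m" "g dvd h" by auto
      then obtain j where j: "h = g * j" by blast
      then have "j > 0" using h assms zero_less_mult_pos[of g j] by simp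
      moreover have "1 * j \<le> g * j" using assms \<open>j > 0\<close> by (intro mult_right_mono) auto
      ultimately have "0 < j" "j \<le> m" using h j by linarith+
      then show "nat (h div g) \<in> {1..nat m}" using assms by (auto simp: j)
    qed
    then have "(\<Sum>j\<in>(\<lambda>h. nat (h div g)) ` ?A. 1 / real j) \<le> harm_int m"
      unfolding harm_int_def by (intro sum_mono2) auto
    then show ?thesis using assms by (intro divide_right_mono) auto
  qed
  finally show ?thesis .
qed

text \<open>One of the two factors is bounded by \<open>T\<close>, the other by \<open>m\<close>
  over the least residue, which is \<open>h\<close> or \<open>h - m\<close>. This leaves two
  harmonic sums over multiples of \<open>g\<close>, equal under \<open>h -> m - h\<close>.\<close>

lemma sum_exp_sum_multiples_le:
  fixes m g T :: int
  assumes m: "m > 0" and g: "g > 0" "g dvd m" and T: "T > 0"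
  shows "(\<Sum>h\<in>{h \<in> {1..<m}. g dvd h}. (cmod (exp_sum m T h))\<^sup>2) \<le> 2 * of_int T * of_int m * harm_int m / g"
proof -
  let ?A = "{h \<in> {1..<m}. g dvd h}"
  have "(cmod (exp_sum m T h))\<^sup>2 \<le> of_int T * of_int m * (1 / of_int h + 1 / of_int (m - h))" if h: "h \<in> ?A" for h
  proof -
    have hm: "h mod m = h" using h by simp
    have "\<not> m dvd h" using h zdvd_not_zless by auto
    then have ne: "least_residue m h \<noteq> 0" using least_residue_props(3)[OF m] by simp
    have "cmod (exp_sum m T h) * cmod (exp_sum m T h) \<le> of_int T * (of_int m / \<bar>of_int (least_residue m h)\<bar>)"
      using exp_sum_least_residue[OF m, of T h] norm_exp_sum_le_div[OF m _ ne least_residue_props(2)[OF m], of T] T norm_exp_sum_le[of T m h]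
      by (intro mult_mono) auto
    also have "1 / \<bar>real_of_int (least_residue m h)\<bar> \<le> 1 / of_int h + 1 / of_int (m - h)"
      using h by (auto simp: least_residue_def hm)
    then have "of_int T * (of_int m / \<bar>real_of_int (least_residue m h)\<bar>) \<le> of_int T * of_int m * (1 / of_int h + 1 / of_int (m - h))"
      using T m mult_left_mono[of "1 / \<bar>real_of_int (least_residue m h)\<bar>" _ "of_int T * of_int m"] by simp
    finally show ?thesis by (simp add: power2_eq_square)
  qed
  then have "(\<Sum>h\<in>?A. (cmod (exp_sum m T h))\<^sup>2) \<le> (\<Sum>h\<in>?A. of_int T * of_int m * (1 / of_int h + 1 / of_int (m - h)))"
    by (intro sum_mono)
  also have "\<dots> = of_int T * of_int m * ((\<Sum>h\<in>?A. 1 / of_int h) + (\<Sum>h\<in>?A. 1 / of_int (m - h)))"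
    by (simp only: sum_distrib_left[symmetric] sum.distrib)
  also have "(\<Sum>h\<in>?A. 1 / real_of_int (m - h)) = (\<Sum>h\<in>?A. 1 / of_int h)"
    using g(2) by (intro sum.reindex_bij_witness[of _ "\<lambda>h. m - h" "\<lambda>h. m - h"]) auto
  also have "of_int T * of_int m * ((\<Sum>h\<in>?A. 1 / real_of_int h) + (\<Sum>h\<in>?A. 1 / of_int h))
      \<le> of_int T * of_int m * (harm_int m / g + harm_int m / g)"
    using T m by (intro mult_left_mono add_mono sum_recip_multiples_le g) auto
  also have "\<dots> = 2 * of_int T * of_int m * harm_int m / g" using g by (simp add: field_simps)
  finally show ?thesis .
qed

text \<open>The gcd is at most the sum of all divisors \<open>g\<close> of \<open>m\<close> that
  divide both \<open>h\<close> and \<open>k\<close>. For fixed \<open>g\<close> the double sum is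
  the square of a sum over multiples of \<open>g\<close>, at most \<open>(Q / g)\<^sup>2\<close>;
  this outweighs the factor \<open>g\<close>, so each divisor contributes at most
  \<open>Q\<^sup>2\<close>.\<close>

lemma sum_gcd_weight_le:
  fixes m T :: int
  assumes m: "m > 0" and T: "T > 0"
  shows "(\<Sum>(h, k)\<in>{1..<m} \<times> {1..<m}. real_of_int (gcd (gcd h k) m) * ((cmod (exp_sum m T h))\<^sup>2 * (cmod (exp_sum m T k))\<^sup>2))
    \<le> 4 * (of_int T)\<^sup>2 * (of_int m)\<^sup>2 * (harm_int m)\<^sup>2 * tau m"
proof -
  let ?P = "{d. 0 < d \<and> d dvd m}" and ?Om = "{1..<m} \<times> {1..<m}"
  define a where "a h = (cmod (exp_sum m T h))\<^sup>2" for h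
  define Q where "Q = 2 * of_int T * of_int m * harm_int m"
  have a0: "a h \<ge> 0" for h by (simp add: a_def)
  have fin: "finite ?P" using m by (intro finite_posdvd) auto
  have "(\<Sum>(h, k)\<in>?Om. real_of_int (gcd (gcd h k) m) * (a h * a k))
      \<le> (\<Sum>(h, k)\<in>?Om. \<Sum>g\<in>?P. if g dvd h \<and> g dvd k then real_of_int g * (a h * a k) else 0)"
  proof (intro sum_mono, clarsimp)
    fix h k
    define g where "g = gcd (gcd h k) m"
    have "(if g dvd h \<and> g dvd k then real_of_int g * (a h * a k) else 0)
        \<le> (\<Sum>g\<in>?P. if g dvd h \<and> g dvd k then real_of_int g * (a h * a k) else 0)"
    proof (rule member_le_sum)
      show "g \<in> ?P" using m by (simp add: g_def)
    qed (use fin a0 in auto)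
    moreover have "g dvd h" "g dvd k" by (simp_all add: g_def gcd_dvdI1)
    ultimately show "real_of_int (gcd (gcd h k) m) * (a h * a k)
        \<le> (\<Sum>g | 0 < g \<and> g dvd m. if g dvd h \<and> g dvd k then real_of_int g * (a h * a k) else 0)"
      by (simp add: g_def)
  qed
  also have "\<dots> = (\<Sum>g\<in>?P. \<Sum>(h, k)\<in>?Om. if g dvd h \<and> g dvd k then real_of_int g * (a h * a k) else 0)"
    by (subst sum.swap) (simp add: case_prod_unfold)
  also have "\<dots> = (\<Sum>g\<in>?P. real_of_int g * (\<Sum>h\<in>{h\<in>{1..<m}. g dvd h}. a h)\<^sup>2)"
  proof (rule sum.cong[OF refl])
    fix g
    let ?B = "{h\<in>{1..<m}. g dvd h}"
    have "(\<Sum>(h, k)\<in>?Om. if g dvd h \<and> g dvd k then real_of_int g * (a h * a k) else 0)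
        = (\<Sum>(h, k)\<in>?B \<times> ?B. real_of_int g * (a h * a k))"
      by (rule sum.mono_neutral_cong_right) (auto split: if_splits)
    also have "\<dots> = (\<Sum>h\<in>?B. \<Sum>k\<in>?B. real_of_int g * (a h * a k))"
      by (simp only: sum.cartesian_product)
    also have "\<dots> = real_of_int g * (\<Sum>h\<in>?B. \<Sum>k\<in>?B. a h * a k)"
      by (simp only: sum_distrib_left)
    also have "\<dots> = real_of_int g * (\<Sum>h\<in>?B. a h)\<^sup>2"
      by (simp only: power2_eq_square sum_product)
    finally show "(\<Sum>(h, k)\<in>?Om. if g dvd h \<and> g dvd k then real_of_int g * (a h * a k) else 0)
        = real_of_int g * (\<Sum>h\<in>?B. a h)\<^sup>2" .
  qed
  also have "\<dots> \<le> (\<Sum>g\<in>?P. real_of_int g * (Q / g)\<^sup>2)"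
    using sum_exp_sum_multiples_le[OF m _ _ T] a0
    by (intro sum_mono mult_left_mono power_mono sum_nonneg) (auto simp: Q_def a_def)
  also have "\<dots> \<le> (\<Sum>g\<in>?P. Q\<^sup>2)"
  proof (rule sum_mono)
    fix g assume g: "g \<in> ?P"
    then have "real_of_int g * (Q / g)\<^sup>2 = Q\<^sup>2 / real_of_int g" by (simp add: power2_eq_square)
    also have "\<dots> \<le> Q\<^sup>2 / 1" using g by (intro divide_left_mono) auto
    also have "\<dots> = Q\<^sup>2" by simp
    finally show "real_of_int g * (Q / g)\<^sup>2 \<le> Q\<^sup>2" .
  qed
  also have "\<dots> = Q\<^sup>2 * tau m" by (simp add: tau_def)
  finally show ?thesis by (simp add: a_def Q_def power_mult_distrib)
qed

lemma card_hyp_le_units: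
  assumes m: "m > 0" and n: "coprime n m"
  shows "card (hyp m n) \<le> card (hyp m 1)"
proof -
  obtain n' where n': "[n * n' = 1] (mod m)" using n cong_solve_coprime_int by blast
  then have d: "m dvd n * n' - 1" by (simp add: cong_iff_dvd_diff)
  have "inj_on fst (hyp m n)"
    using hyp_unique[OF _ _ n] by (auto simp: inj_on_def)
  then have "card (hyp m n) = card (fst ` hyp m n)" by (simp add: card_image)
  also have "\<dots> \<le> card (fst ` hyp m 1)"
  proof (rule card_mono)
    show "fst ` hyp m n \<subseteq> fst ` hyp m 1"
    proof clarsimp
      fix x y assume xy: "(x, y) \<in> hyp m n"
      have "m dvd (y * n') mod m - y * n'" by (simp add: mod_eq_dvd_iff[symmetric])
      moreover have "m dvd x * y - n" using xy by (simp add: hyp_def)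
      ultimately have "m dvd x * ((y * n') mod m - y * n') + (x * y - n) * n' + (n * n' - 1)"
        using d by (intro dvd_add dvd_mult dvd_mult2)
      then have "m dvd x * ((y * n') mod m) - 1" by (simp add: algebra_simps)
      then have "(x, (y * n') mod m) \<in> hyp m 1" using m xy by (simp add: hyp_def)
      then show "x \<in> fst ` hyp m 1" by (force simp: image_iff)
    qed
  qed simp
  also have "\<dots> \<le> card (hyp m 1)" by (rule card_image_le) simp
  finally show ?thesis .
qed

lemma card_units_pos: "m > 0 \<Longrightarrow> card (hyp m 1) > 0"
proof -
  assume m: "m > 0"
  have "m dvd (1 mod m) * (1 mod m) - 1"
    by (simp add: mod_eq_dvd_iff[symmetric] mod_mult_eq)
  then have "(1 mod m, 1 mod m) \<in> hyp m 1" using m by (simp add: hyp_def)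
  then show ?thesis by (metis card_gt_0_iff empty_iff finite_hyp)
qed

text \<open>As the unit varies, \<open>l' * k\<close> runs through nonzero multiples of
  \<open>g = gcd k m\<close>, each attained at most \<open>g\<close> times. The factor
  \<open>1 / g\<close> in the sum over multiples cancels this.\<close>

lemma sum_units_exp_sum_le:
  assumes m: "m > 0" and T: "T > 0" and k: "k \<in> {1..<m}"
  shows "(\<Sum>(l, l')\<in>hyp m 1. (cmod (exp_sum m T (l' * k)))\<^sup>2) \<le> 2 * of_int T * of_int m * harm_int m"
proof -
  define g where "g = gcd k m"
  have g: "g > 0" "g dvd m" "g dvd k" using m by (simp_all add: g_def)
  define F where "F = (\<lambda>(l::int, l'). l' * k mod m)"
  let ?U = "hyp m 1" and ?A = "{h \<in> {1..<m}. g dvd h}"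
  have finA: "finite ?A" by (rule finite_subset[of _ "{1..<m}"]) auto
  have FA: "F ` ?U \<subseteq> ?A"
  proof (rule image_subsetI)
    fix z assume "z \<in> ?U"
    then obtain l l' where z: "z = (l, l')" and U: "(l, l') \<in> ?U" by (cases z) auto
    then have "(l', l) \<in> ?U" using hyp_swap by blast
    then have "l' * k mod m \<in> {1..<m}" using hyp_scale_residue[OF m _ k] by blast
    moreover have "g dvd l' * k mod m" using g by (simp add: dvd_mod_iff)
    ultimately show "F z \<in> ?A" by (simp add: F_def z)
  qed
  have fib: "card {z \<in> ?U. F z = s} \<le> nat g" for s
  proof -
    have "{z \<in> ?U. F z = s} \<subseteq> {(l, l') \<in> ?U. m dvd l' * k - s}"
      by (auto simp: F_def mod_eq_dvd_iff[symmetric])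
    then have "card {z \<in> ?U. F z = s} \<le> card {(l, l') \<in> ?U. m dvd l' * k - s}"
      by (intro card_mono) (auto intro: finite_subset[OF _ finite_hyp])
    also have "\<dots> \<le> nat g" unfolding g_def by (rule card_unit_fibre1[OF m])
    finally show ?thesis .
  qed
  have "(\<Sum>(l, l')\<in>?U. (cmod (exp_sum m T (l' * k)))\<^sup>2) = (\<Sum>z\<in>?U. (cmod (exp_sum m T (F z)))\<^sup>2)"
    by (rule sum.cong) (auto simp: F_def exp_sum_mod[OF m])
  also have "\<dots> = (\<Sum>s\<in>?A. of_nat (card {z \<in> ?U. F z = s}) * (cmod (exp_sum m T s))\<^sup>2)"
    by (rule sum_fun_comp[OF finite_hyp finA FA])
  also have "\<dots> \<le> (\<Sum>s\<in>?A. real_of_int g * (cmod (exp_sum m T s))\<^sup>2)"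
  proof (intro sum_mono mult_right_mono)
    fix s
    have "int (card {z \<in> ?U. F z = s}) \<le> g" using fib[of s] g by linarith
    then show "real (card {z \<in> ?U. F z = s}) \<le> real_of_int g"
      by (metis of_int_le_iff of_int_of_nat_eq)
  qed simp
  also have "\<dots> = real_of_int g * (\<Sum>s\<in>?A. (cmod (exp_sum m T s))\<^sup>2)" by (simp add: sum_distrib_left)
  also have "\<dots> \<le> real_of_int g * (2 * of_int T * of_int m * harm_int m / g)"
    using g by (intro mult_left_mono sum_exp_sum_multiples_le m T) auto
  finally show ?thesis using g by simp
qed

text \<open>For \<open>h = 0\<close> the Kloosterman sum is a Ramanujan sum, the Fourier transform
  of the indicator of the second coordinates of the hyperbola, and Parseval applies.\<close>

lemma sum_Kloos_0_sq:
  assumes m: "m > 0" and n: "coprime n m"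
  shows "(\<Sum>k\<in>{0..<m}. (cmod (Kloos m n 0 k))\<^sup>2) = of_int m * card (hyp m n)"
proof -
  let ?Y = "snd ` hyp m n"
  have inj: "inj_on snd (hyp m n)"
    using hyp_unique[OF _ _ n] hyp_swap by (fastforce simp: inj_on_def)
  have Y: "?Y \<subseteq> {0..<m}" by (auto simp: hyp_def)
  define c :: "int \<Rightarrow> complex" where "c y = of_bool (y \<in> ?Y)" for y
  have "Kloos m n 0 k = (\<Sum>y\<in>{0..<m}. c y * ee m (y * k))" for k
  proof -
    have "Kloos m n 0 k = (\<Sum>y\<in>?Y. ee m (y * k))"
      by (simp add: Kloos_def sum.reindex[OF inj] case_prod_unfold mult.commute)
    also have "\<dots> = (\<Sum>y\<in>{0..<m}. c y * ee m (y * k))"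
      using Y by (intro sum.mono_neutral_cong_left) (auto simp: c_def)
    finally show ?thesis .
  qed
  then have "(\<Sum>k\<in>{0..<m}. (cmod (Kloos m n 0 k))\<^sup>2) = of_int m * (\<Sum>y\<in>{0..<m}. (cmod (c y))\<^sup>2)"
    by (simp add: parseval[OF m])
  also have "(\<Sum>y\<in>{0..<m}. (cmod (c y))\<^sup>2) = (\<Sum>y\<in>?Y. 1)"
    using Y by (intro sum.mono_neutral_cong_right) (auto simp: c_def)
  finally show ?thesis by (simp add: card_image[OF inj])
qed

text \<open>\<open>Kloos m n 0 k\<close> does not change when \<open>k\<close> is multiplied by a
  unit, so the sum equals its average over units with the weight taken at \<open>l' * k\<close>. The
  averaged weight is bounded uniformly in \<open>k\<close>, and the remaining second moment is
  \<open>m * card (hyp m n)\<close>, whose cardinality cancels against the number of units.\<close>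

lemma axis_sum_le:
  assumes m: "m > 0" and T: "T > 0" and n: "coprime n m"
  shows "(\<Sum>k\<in>{1..<m}. (cmod (Kloos m n 0 k))\<^sup>2 * (cmod (exp_sum m T k))\<^sup>2)
    \<le> 2 * of_int T * (of_int m)\<^sup>2 * harm_int m" (is "?S \<le> _")
proof -
  let ?U = "hyp m 1"
  define B where "B = 2 * of_int T * of_int m * harm_int m"
  have B0: "B \<ge> 0" using m T harm_int_ge_1[OF m] by (simp add: B_def)
  have each: "(\<Sum>k\<in>{1..<m}. (cmod (Kloos m n 0 k))\<^sup>2 * (cmod (exp_sum m T (l' * k)))\<^sup>2) = ?S"
    if U: "(l, l') \<in> ?U" for l l'
  proof -
    have U': "(l', l) \<in> ?U" using U hyp_swap by blast
    show ?thesis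
    proof (rule sum.reindex_bij_witness[of _ "\<lambda>k. l * k mod m" "\<lambda>k. l' * k mod m"], goal_cases)
      case (1 k) then show ?case using unit_scale_inv[OF m U'] by simp
    next
      case (2 k) then show ?case using hyp_scale_residue[OF m U'] by blast
    next
      case (3 k) then show ?case using unit_scale_inv[OF m U] by simp
    next
      case (4 k) then show ?case using hyp_scale_residue[OF m U] by blast
    next
      case (5 k)
      have "Kloos m n 0 (l' * k mod m) = Kloos m n 0 k"
        using Kloos_mod[OF m, of n 0 "l' * k"] Kloos_scale[OF m U, of n 0 k] by simp
      then show ?case by (simp add: exp_sum_mod[OF m])
    qed
  qed
  have "real (card ?U) * ?S = (\<Sum>(l, l')\<in>?U. \<Sum>k\<in>{1..<m}. (cmod (Kloos m n 0 k))\<^sup>2 * (cmod (exp_sum m T (l' * k)))\<^sup>2)"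
  proof -
    have "(\<Sum>(l, l')\<in>?U. \<Sum>k\<in>{1..<m}. (cmod (Kloos m n 0 k))\<^sup>2 * (cmod (exp_sum m T (l' * k)))\<^sup>2) = (\<Sum>z\<in>?U. ?S)"
      by (rule sum.cong) (auto simp: each)
    then show ?thesis by simp
  qed
  also have "\<dots> = (\<Sum>k\<in>{1..<m}. (cmod (Kloos m n 0 k))\<^sup>2 * (\<Sum>(l, l')\<in>?U. (cmod (exp_sum m T (l' * k)))\<^sup>2))"
    by (simp only: case_prod_unfold sum_distrib_left) (rule sum.swap)
  also have "\<dots> \<le> (\<Sum>k\<in>{1..<m}. (cmod (Kloos m n 0 k))\<^sup>2 * B)"
    unfolding B_def by (intro sum_mono mult_left_mono sum_units_exp_sum_le m T) auto
  also have "\<dots> = (\<Sum>k\<in>{1..<m}. (cmod (Kloos m n 0 k))\<^sup>2) * B" by (simp add: sum_distrib_right)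
  also have "\<dots> \<le> (\<Sum>k\<in>{0..<m}. (cmod (Kloos m n 0 k))\<^sup>2) * B"
    using B0 by (intro mult_right_mono sum_mono2) auto
  also have "\<dots> = of_int m * card (hyp m n) * B" by (simp add: sum_Kloos_0_sq[OF m n])
  also have "\<dots> \<le> of_int m * card ?U * B"
    using m B0 card_hyp_le_units[OF m n] by (intro mult_right_mono mult_left_mono) auto
  finally have "real (card ?U) * ?S \<le> real (card ?U) * (of_int m * B)" by (simp add: mult_ac)
  then have "?S \<le> of_int m * B" using card_units_pos[OF m] by simp
  then show ?thesis by (simp add: B_def power2_eq_square mult_ac)
qed

section \<open>Energy of modular hyperbolas\<close>

text \<open>By the Chinese remainder theorem the solutions fill at most one class modulo the lcm,
  which divides \<open>m\<close>.\<close>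

lemma card_two_congruences_le:
  fixes m a1 a2 :: int
  assumes m: "m > 0" and a: "a1 > 0" "a2 > 0" "a1 dvd m" "a2 dvd m"
  shows "real (card {t \<in> {0..<m}. a1 dvd t - r1 \<and> a2 dvd t - r2}) \<le> of_int m / of_int (lcm a1 a2)"
    (is "real (card ?A) \<le> _")
proof -
  define l where "l = lcm a1 a2"
  have l: "l > 0" "l dvd m" using a by (simp_all add: l_def lcm_pos_int)
  define g where "g = m div l"
  have g: "m = l * g" using l by (simp add: g_def)
  then have g0: "g > 0" using m l zero_less_mult_pos[of l g] by simp
  have "card ?A \<le> nat g"
  proof (cases "?A = {}")
    case False
    then obtain t0 where t0: "a1 dvd t0 - r1" "a2 dvd t0 - r2" by blast
    have "?A \<subseteq> {t \<in> {0..<m}. m dvd (t - t0) * g}"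
    proof clarify
      fix t assume t: "a1 dvd t - r1" "a2 dvd t - r2"
      have "a1 dvd t - t0" "a2 dvd t - t0"
        using dvd_diff[OF t(1) t0(1)] dvd_diff[OF t(2) t0(2)] by simp_all
      then have "l dvd t - t0" by (simp add: l_def)
      then show "m dvd (t - t0) * g" by (simp add: g mult_dvd_mono)
    qed
    then have "card ?A \<le> card {t \<in> {0..<m}. m dvd (t - t0) * g}"
      by (intro card_mono) (auto intro: finite_subset[of _ "{0..<m}"])
    also have "\<dots> \<le> nat g" using m g0 g by (intro card_multiples) auto
    finally show ?thesis .
  next
    case True
    then show ?thesis by (simp only: card.empty)
  qed
  then have "real (card ?A) \<le> of_int g" using g0 by linarith
  also have "\<dots> = of_int m / of_int l" using l g by simp
  finally show ?thesis by (simp add: l_def)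
qed

text \<open>The modulus splits as \<open>m1 * m2 * m3\<close> with \<open>m1\<close> dividing
  \<open>b\<close>, \<open>m2\<close> dividing \<open>c\<close> and \<open>m3\<close> dividing
  \<open>b + c + 2 * x\<close>; there are at most \<open>(tau m)\<^sup>2\<close> splittings. For a
  fixed one, \<open>b\<close> and \<open>c\<close> are counted by congruences. The overlaps of the
  moduli cancel except for a common divisor of \<open>b\<close> and \<open>b + 2 * x\<close>, which
  divides 2 because \<open>x\<close> is a unit.\<close>

lemma card_product_dvd_le:
  fixes m x :: int
  assumes m: "m > 0" and x: "coprime x m"
  shows "real (card {(b, c) \<in> {0..<m} \<times> {0..<m}. m dvd b * c * (b + c + 2 * x)}) \<le> 2 * real_of_int m * (real (tau m))\<^sup>2"
proof -
  let ?R = "{0..<m}" and ?P = "{d. 0 < d \<and> d dvd m}"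
  have finP: "finite ?P" using m by (intro finite_posdvd) auto
  define I where "I = {p \<in> ?P \<times> ?P. fst p * snd p dvd m}"
  define A where "A p = {(b, c) \<in> ?R \<times> ?R. fst p dvd b \<and> snd p dvd c \<and> m div (fst p * snd p) dvd b + c + 2 * x}" for p
  have finI: "finite I" unfolding I_def using finP by auto
  have finA: "finite (A p)" for p unfolding A_def by (rule finite_subset[of _ "?R \<times> ?R"]) auto
  have cover: "{(b, c) \<in> ?R \<times> ?R. m dvd b * c * (b + c + 2 * x)} \<subseteq> (\<Union>p\<in>I. A p)"
  proof clarify
    fix b c assume bc: "b \<in> ?R" "c \<in> ?R" "m dvd b * c * (b + c + 2 * x)"
    define m1 where "m1 = gcd b m"
    define n1 where "n1 = m div m1"
    have m1: "m1 > 0" "m1 dvd m" "m1 dvd b" using m by (simp_all add: m1_def)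
    have mn: "m = m1 * n1" using m1 by (simp add: n1_def)
    then have n1: "n1 > 0" using m m1 zero_less_mult_pos[of m1 n1] by simp
    define m2 where "m2 = gcd c n1"
    define n2 where "n2 = n1 div m2"
    have m2: "m2 > 0" "m2 dvd n1" "m2 dvd c" using n1 by (simp_all add: m2_def)
    have nn: "n1 = m2 * n2" using m2 by (simp add: n2_def)
    obtain b' where b': "b = m1 * b'" using m1 by blast
    obtain c' where c': "c = m2 * c'" using m2 by blast
    have "coprime b' n1"
    proof -
      have "coprime (b div m1) (m div m1)" unfolding m1_def using m by (intro div_gcd_coprime) simp
      moreover have "b div m1 = b'" using b' m1 by simp
      ultimately show ?thesis by (simp add: n1_def)
    qed
    have "coprime c' n2"
    proof -
      have "coprime (c div m2) (n1 div m2)" unfolding m2_def using n1 by (intro div_gcd_coprime) simp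
      moreover have "c div m2 = c'" using c' m2 by simp
      ultimately show ?thesis by (simp add: n2_def)
    qed
    have "m1 * n1 dvd m1 * (b' * (c * (b + c + 2 * x)))" using bc(3) mn b' by (simp add: mult_ac)
    then have "n1 dvd b' * (c * (b + c + 2 * x))" using m1 by simp
    then have "n1 dvd c * (b + c + 2 * x)"
      using \<open>coprime b' n1\<close> by (simp add: coprime_commute coprime_dvd_mult_right_iff)
    then have "m2 * n2 dvd m2 * (c' * (b + c + 2 * x))" using nn c' by (simp add: mult_ac)
    then have "n2 dvd c' * (b + c + 2 * x)" using m2 by simp
    then have "n2 dvd b + c + 2 * x"
      using \<open>coprime c' n2\<close> by (simp add: coprime_commute coprime_dvd_mult_right_iff)
    moreover have "m div (m1 * m2) = n2" using mn nn m1 m2 by simp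
    moreover have "m1 * m2 dvd m" using mn nn by simp
    moreover have "m2 dvd m" using mn nn by simp
    ultimately have "(m1, m2) \<in> I" "(b, c) \<in> A (m1, m2)"
      using m1 m2 bc by (simp_all add: I_def A_def)
    then show "(b, c) \<in> (\<Union>p\<in>I. A p)" by blast
  qed
  have A_le: "real (card (A p)) \<le> 2 * of_int m" if p: "p \<in> I" for p
  proof -
    define m1 m2 where "m1 = fst p" and "m2 = snd p"
    have mm: "m1 > 0" "m2 > 0" "m1 dvd m" "m2 dvd m" "m1 * m2 dvd m"
      using p by (auto simp: I_def m1_def m2_def)
    define m3 where "m3 = m div (m1 * m2)"
    have m3: "m = m1 * m2 * m3" using mm by (simp add: m3_def)
    then have m30: "m3 > 0" using m mm zero_less_mult_pos[of "m1 * m2" m3] by simp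
    \<comment> \<open>A suitable \<open>c\<close> exists only if \<open>e\<close> divides
      \<open>b + 2 * x\<close>. This condition on \<open>b\<close> pays for the factor
      \<open>e\<close> by which \<open>lcm m2 m3\<close> falls short of
      \<open>m2 * m3\<close>.\<close>
    define e where "e = gcd m2 m3"
    have e: "e > 0" "e dvd m2" "e dvd m3" "e dvd m" using mm m3 by (auto simp: e_def intro: dvd_trans)
    let ?B = "{b \<in> ?R. m1 dvd b - 0 \<and> e dvd b - (- (2 * x))}"
    let ?C = "\<lambda>b. {c \<in> ?R. m2 dvd c - 0 \<and> m3 dvd c - (- (2 * x) - b)}"
    have finB: "finite ?B" by (rule finite_subset[of _ ?R]) auto
    have finC: "finite (?C b)" for b by (rule finite_subset[of _ ?R]) auto
    have sub: "A p \<subseteq> Sigma ?B ?C"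
    proof
      fix z assume "z \<in> A p"
      then obtain b c where z: "z = (b, c)" and bc: "b \<in> ?R" "c \<in> ?R" "m1 dvd b" "m2 dvd c" "m3 dvd b + c + 2 * x"
        by (auto simp: A_def m1_def m2_def m3_def)
      have "e dvd (b + c + 2 * x) - c" using bc e by (intro dvd_diff) (auto intro: dvd_trans)
      then have "e dvd b - (- (2 * x))" by (simp add: algebra_simps)
      moreover have "m3 dvd c - (- (2 * x) - b)" using bc(5) by (simp add: algebra_simps)
      ultimately show "z \<in> Sigma ?B ?C" using bc z by simp
    qed
    show ?thesis
    proof (cases "?B = {}")
      case True
      then have "A p = {}" using sub by blast
      then show ?thesis using m by simp
    next
      case False
      then obtain b0 where b0: "m1 dvd b0" "e dvd b0 + 2 * x" by auto
      define f where "f = gcd m1 e"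
      have f: "f > 0" "f dvd m1" "f dvd e" "f dvd m" using mm e by (auto simp: f_def intro: dvd_trans)
      have "f dvd (b0 + 2 * x) - b0" using b0 f by (intro dvd_diff) (auto intro: dvd_trans)
      then have "f dvd 2 * x" by simp
      moreover have "coprime f x" using x f(4) by (metis coprime_commute coprime_divisors dvd_refl)
      ultimately have "f dvd 2" by (simp add: coprime_dvd_mult_left_iff)
      then have f2: "f \<le> 2" by (simp add: zdvd_imp_le)
      have "lcm m1 e * f = m1 * e" unfolding f_def using mm e by (simp add: lcm_mult_gcd[of m1 e])
      then have l1: "real_of_int (lcm m1 e) * f = of_int m1 * of_int e" by (metis of_int_mult)
      have "lcm m2 m3 * e = m2 * m3" unfolding e_def using mm m30 by (simp add: lcm_mult_gcd[of m2 m3])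
      then have l2: "real_of_int (lcm m2 m3) * e = of_int m2 * of_int m3" by (metis of_int_mult)
      have lp: "lcm m1 e > 0" "lcm m2 m3 > 0" using mm m30 e by (simp_all add: lcm_pos_int)
      have m2m3: "m3 dvd m" using m3 by simp
      have "card (A p) \<le> card (Sigma ?B ?C)" by (rule card_mono[OF finite_SigmaI[OF finB finC] sub])
      also have "\<dots> = (\<Sum>b\<in>?B. card (?C b))" by (rule card_SigmaI[OF finB]) (intro ballI finC)
      finally have "real (card (A p)) \<le> real (\<Sum>b\<in>?B. card (?C b))" by (simp only: of_nat_le_iff)
      also have "\<dots> = (\<Sum>b\<in>?B. real (card (?C b)))" by (simp only: of_nat_sum)
      finally have "real (card (A p)) \<le> (\<Sum>b\<in>?B. real (card (?C b)))" .
      also have "\<dots> \<le> (\<Sum>b\<in>?B. of_int m / of_int (lcm m2 m3))"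
        using mm m30 m2m3 m by (intro sum_mono card_two_congruences_le) auto
      also have "\<dots> = real (card ?B) * (of_int m / of_int (lcm m2 m3))" by simp
      also have "\<dots> \<le> (of_int m / of_int (lcm m1 e)) * (of_int m / of_int (lcm m2 m3))"
        using mm e m lp by (intro mult_right_mono card_two_congruences_le) auto
      also have "\<dots> = real_of_int m * of_int f"
      proof -
        define u v where "u = real_of_int (lcm m1 e)" and "v = real_of_int (lcm m2 m3)"
        have uv: "u > 0" "v > 0" using lp by (simp_all only: u_def v_def of_int_0_less_iff)
        have "(u * v * of_int f) * of_int e = (u * of_int f) * (v * of_int e)" by (simp only: mult_ac)
        also have "\<dots> = (of_int m1 * of_int e) * (of_int m2 * of_int m3)"
          unfolding u_def v_def by (simp only: l1 l2)
        also have "\<dots> = of_int m * of_int e" unfolding m3 of_int_mult by (simp only: mult_ac)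
        finally have L: "u * v * of_int f = of_int m" using e(1) by simp
        have "(of_int m / u) * (of_int m / v) = real_of_int m * ((u * v * of_int f) / (u * v))"
          unfolding L by simp
        also have "\<dots> = real_of_int m * of_int f" using uv by simp
        finally show ?thesis unfolding u_def v_def .
      qed
      also have "\<dots> \<le> of_int m * 2" using f2 m by (intro mult_left_mono) auto
      finally show ?thesis by simp
    qed
  qed
  have "card {(b, c) \<in> ?R \<times> ?R. m dvd b * c * (b + c + 2 * x)} \<le> card (\<Union>p\<in>I. A p)"
    using cover finI finA by (intro card_mono) auto
  also have "\<dots> \<le> (\<Sum>p\<in>I. card (A p))" by (rule card_UN_le[OF finI])
  finally have "real (card {(b, c) \<in> ?R \<times> ?R. m dvd b * c * (b + c + 2 * x)}) \<le> (\<Sum>p\<in>I. real (card (A p)))"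
    by (simp only: of_nat_sum[symmetric] of_nat_le_iff)
  also have "\<dots> \<le> (\<Sum>p\<in>I. 2 * of_int m)" by (intro sum_mono A_le)
  also have "\<dots> = real (card I) * (2 * real_of_int m)" by simp
  also have "\<dots> \<le> (real (tau m))\<^sup>2 * (2 * of_int m)"
  proof (intro mult_right_mono)
    have "card I \<le> card (?P \<times> ?P)" unfolding I_def using finP by (intro card_mono) auto
    then show "real (card I) \<le> (real (tau m))\<^sup>2" by (simp add: card_cartesian_product tau_def power2_eq_square flip: of_nat_mult)
  qed (use m in simp)
  finally show ?thesis by (simp add: mult_ac)
qed

definition pair_sum :: "int \<Rightarrow> ((int \<times> int) \<times> (int \<times> int)) \<Rightarrow> int \<times> int" where
  "pair_sum m z = ((fst (fst z) + fst (snd z)) mod m, (snd (fst z) + snd (snd z)) mod m)"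

text \<open>With \<open>Y = y1 + y2\<close>, \<open>S = x1 + x2\<close> and
  \<open>p = x1 * x2\<close>, adding \<open>n / x1\<close> and \<open>n / x2\<close> gives
  \<open>Y * p = n * S\<close> modulo \<open>m\<close>. A second pair with the same sums gives this
  relation with \<open>r = x3 * x4\<close>, and \<open>Y\<close> is eliminated; the multiples of
  \<open>m\<close> are kept explicit.\<close>

lemma dvd_energy:
  fixes m :: int
  assumes 1: "Y * p = n * S + m * A" and 2: "(Y + m * c) * r = n * (S + m * b) + m * B"
  shows "m dvd n * (S * (r - p))"
proof -
  have "n * (S * (r - p)) = r * (n * S) - p * (n * S)" by (simp add: algebra_simps)
  also have "\<dots> = r * (Y * p - m * A) - p * ((Y + m * c) * r - n * m * b - m * B)"
  proof -
    have "n * S = Y * p - m * A" using 1 by linarith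
    moreover have "n * S = (Y + m * c) * r - n * m * b - m * B" using 2 by (simp add: distrib_left)
    ultimately show ?thesis by simp
  qed
  also have "\<dots> = m * (- (r * A) - p * c * r + p * n * b + p * B)" by (simp add: algebra_simps)
  finally show ?thesis by simp
qed

text \<open>The left side is the additive energy of the hyperbola. Equal coordinate sums force
  \<open>(x1 + x2) * (x3 * x4 - x1 * x2) = 0\<close> modulo \<open>m\<close>, and with
  \<open>x4 = x1 + x2 - x3\<close> the second factor is \<open>- (x3 - x1) * (x3 - x2)\<close>. For
  fixed \<open>x1\<close> the substitution \<open>b = x3 - x1\<close>, \<open>c = x2 - x3\<close>
  turns this into \<open>b * c * (b + c + 2 * x1) = 0\<close>.\<close>

lemma hyp_energy_le:
  assumes m: "m > 0" and n: "coprime n m"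
  shows "(\<Sum>z\<in>hyp m n \<times> hyp m n. real (card {z' \<in> hyp m n \<times> hyp m n. pair_sum m z' = pair_sum m z}))
    \<le> real (card (hyp m n)) * (2 * real_of_int m * (real (tau m))\<^sup>2)"
proof -
  let ?H = "hyp m n" and ?R = "{0..<m}"
  define E where "E = (SIGMA z:?H \<times> ?H. {z' \<in> ?H \<times> ?H. pair_sum m z' = pair_sum m z})"
  define G where "G x1 = {(x2, x3) \<in> ?R \<times> ?R. m dvd (x1 + x2) * (x3 - x1) * (x3 - x2)}" for x1
  have finG: "finite (G x)" for x unfolding G_def by (rule finite_subset[of _ "?R \<times> ?R"]) auto
  \<comment> \<open>The coordinates \<open>x1, x2, x3\<close> determine everything else:
    \<open>x4\<close> comes from the sum, and each \<open>y\<close> is \<open>n / x\<close>.\<close>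
  define \<psi> where "\<psi> = (\<lambda>(((x1::int, y1::int), (x2::int, y2::int)), ((x3::int, y3::int), (x4::int, y4::int))). ((x1, y1), (x2, x3)))"
  have "inj_on \<psi> E"
  proof (rule inj_onI)
    fix z z' assume zE: "z \<in> E" "z' \<in> E" and eq: "\<psi> z = \<psi> z'"
    obtain x1 y1 x2 y2 x3 y3 x4 y4 where z: "z = (((x1, y1), (x2, y2)), ((x3, y3), (x4, y4)))" by (cases z) auto
    obtain x1' y1' x2' y2' x3' y3' x4' y4' where z': "z' = (((x1', y1'), (x2', y2')), ((x3', y3'), (x4', y4')))" by (cases z') auto
    have e: "x1' = x1" "y1' = y1" "x2' = x2" "x3' = x3" using eq by (simp_all add: \<psi>_def z z')
    have H: "(x2, y2) \<in> ?H" "(x2, y2') \<in> ?H" "(x3, y3) \<in> ?H" "(x3, y3') \<in> ?H" "(x4, y4) \<in> ?H" "(x4', y4') \<in> ?H"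
      using zE by (auto simp: E_def z z' e)
    have "(x3 + x4) mod m = (x1 + x2) mod m" "(x3 + x4') mod m = (x1 + x2) mod m"
      using zE by (auto simp: E_def z z' e pair_sum_def)
    then have "m dvd (x3 + x4) - (x3 + x4')" by (metis mod_eq_dvd_iff)
    then have "x4 = x4'" using H by (intro dvd_diff_range_eq[of _ m]) (auto simp: hyp_def)
    then show "z = z'" using H hyp_unique[OF _ _ n] by (simp add: z z' e)
  qed
  moreover have "\<psi> ` E \<subseteq> (SIGMA p:?H. G (fst p))"
  proof (rule image_subsetI)
    fix z assume zE: "z \<in> E"
    obtain x1 y1 x2 y2 x3 y3 x4 y4 where z: "z = (((x1, y1), (x2, y2)), ((x3, y3), (x4, y4)))" by (cases z) auto
    have H: "(x1, y1) \<in> ?H" "(x2, y2) \<in> ?H" "(x3, y3) \<in> ?H" "(x4, y4) \<in> ?H"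
      using zE by (auto simp: E_def z)
    have "(x3 + x4) mod m = (x1 + x2) mod m" "(y3 + y4) mod m = (y1 + y2) mod m"
      using zE by (auto simp: E_def z pair_sum_def)
    then have "m dvd (x3 + x4) - (x1 + x2)" "m dvd (y3 + y4) - (y1 + y2)" by (simp_all add: mod_eq_dvd_iff)
    then obtain b c where bc: "x3 + x4 - (x1 + x2) = m * b" "y3 + y4 - (y1 + y2) = m * c" by blast
    have "m dvd x1 * y1 - n" "m dvd x2 * y2 - n" "m dvd x3 * y3 - n" "m dvd x4 * y4 - n"
      using H by (simp_all add: hyp_def)
    then obtain a1 a2 a3 a4 where a: "x1 * y1 - n = m * a1" "x2 * y2 - n = m * a2" "x3 * y3 - n = m * a3" "x4 * y4 - n = m * a4"
      by (elim dvdE) blast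
    define A where "A = a1 * x2 + a2 * x1"
    define B where "B = a3 * x4 + a4 * x3"
    have e: "x1 * y1 = n + m * a1" "x2 * y2 = n + m * a2" "x3 * y3 = n + m * a3" "x4 * y4 = n + m * a4"
      using a by linarith+
    have "(y1 + y2) * (x1 * x2) = (x1 * y1) * x2 + (x2 * y2) * x1" by (simp add: algebra_simps)
    also have "\<dots> = n * (x1 + x2) + m * A" unfolding e A_def by (simp add: algebra_simps)
    finally have 1: "(y1 + y2) * (x1 * x2) = n * (x1 + x2) + m * A" .
    have s: "x3 + x4 = x1 + x2 + m * b" "y3 + y4 = y1 + y2 + m * c" using bc by linarith+
    have "(y3 + y4) * (x3 * x4) = (x3 * y3) * x4 + (x4 * y4) * x3" by (simp add: algebra_simps)
    also have "\<dots> = n * (x3 + x4) + m * B" unfolding e B_def by (simp add: algebra_simps)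
    finally have "(y1 + y2 + m * c) * (x3 * x4) = n * (x1 + x2 + m * b) + m * B" by (simp only: s)
    then have "m dvd n * ((x1 + x2) * (x3 * x4 - x1 * x2))" by (rule dvd_energy[OF 1])
    then have "m dvd (x1 + x2) * (x3 * x4 - x1 * x2)"
      using n by (simp add: coprime_commute coprime_dvd_mult_right_iff)
    then have "m dvd (x1 + x2) * x3 * (m * b) - (x1 + x2) * (x3 * x4 - x1 * x2)" by (intro dvd_diff) simp_all
    moreover have "(x1 + x2) * x3 * (m * b) - (x1 + x2) * (x3 * x4 - x1 * x2) = (x1 + x2) * (x3 - x1) * (x3 - x2)"
    proof -
      have x4: "x4 = x1 + x2 - x3 + m * b" using s(1) by linarith
      show ?thesis unfolding x4 by (simp add: algebra_simps)
    qed
    ultimately have "(x2, x3) \<in> G x1" using H by (simp add: G_def hyp_def)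
    then show "\<psi> z \<in> (SIGMA p:?H. G (fst p))" using H by (simp add: \<psi>_def z)
  qed
  moreover have "finite (SIGMA p:?H. G (fst p))" using finG by simp
  ultimately have "card E \<le> card (SIGMA p:?H. G (fst p))" by (rule card_inj_on_le)
  also have "\<dots> = (\<Sum>p\<in>?H. card (G (fst p)))" using finG by (intro card_SigmaI) auto
  finally have "real (card E) \<le> (\<Sum>p\<in>?H. real (card (G (fst p))))"
    by (simp only: of_nat_sum[symmetric] of_nat_le_iff)
  also have "\<dots> \<le> (\<Sum>p\<in>?H. 2 * real_of_int m * (real (tau m))\<^sup>2)"
  proof (rule sum_mono)
    fix p assume "p \<in> ?H"
    then have cop: "coprime (fst p) m" using hyp_coprime[OF _ n] by (cases p) auto
    define x1 where "x1 = fst p"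
    let ?S = "{(b, c) \<in> ?R \<times> ?R. m dvd b * c * (b + c + 2 * x1)}"
    have "card (G x1) \<le> card ?S"
    proof (rule card_inj_on_le)
      show "inj_on (\<lambda>(x2, x3). ((x3 - x1) mod m, (x2 - x3) mod m)) (G x1)"
      proof (rule inj_onI, clarify)
        fix x2 x3 x2' x3' assume g: "(x2, x3) \<in> G x1" "(x2', x3') \<in> G x1"
          and e: "(x3 - x1) mod m = (x3' - x1) mod m" "(x2 - x3) mod m = (x2' - x3') mod m"
        have "m dvd (x3 - x1) - (x3' - x1)" using e(1) by (simp only: mod_eq_dvd_iff)
        then have "x3 = x3'" using g by (intro dvd_diff_range_eq[of _ m]) (auto simp: G_def)
        moreover have "m dvd (x2 - x3) - (x2' - x3')" using e(2) by (simp only: mod_eq_dvd_iff)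
        ultimately have "x2 = x2'" using g by (intro dvd_diff_range_eq[of _ m]) (auto simp: G_def)
        then show "x2 = x2' \<and> x3 = x3'" using \<open>x3 = x3'\<close> by simp
      qed
    next
      show "(\<lambda>(x2, x3). ((x3 - x1) mod m, (x2 - x3) mod m)) ` G x1 \<subseteq> ?S"
      proof (rule image_subsetI)
        fix q assume q: "q \<in> G x1"
        obtain x2 x3 where x: "q = (x2, x3)" by (cases q)
        have d: "m dvd (x1 + x2) * (x3 - x1) * (x3 - x2)" using q by (simp add: G_def x)
        define b where "b = (x3 - x1) mod m"
        define c where "c = (x2 - x3) mod m"
        have "m dvd b - (x3 - x1)" "m dvd c - (x2 - x3)"
          by (simp_all add: b_def c_def mod_eq_dvd_iff[symmetric])
        then obtain s t where st: "b - (x3 - x1) = m * s" "c - (x2 - x3) = m * t" by blast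
        obtain w where w: "(x1 + x2) * (x3 - x1) * (x3 - x2) = m * w" using d by blast
        have bb: "b = x3 - x1 + m * s" and cc: "c = x2 - x3 + m * t" using st by linarith+
        have E: "b + c + 2 * x1 = (x1 + x2) + m * (s + t)"
          unfolding bb cc by (simp add: distrib_left)
        have id: "(\<beta> + m * s) * (\<gamma> + m * t) * (S + m * (s + t)) = m * (s * (\<gamma> + m * t) * (S + m * (s + t))
            + \<beta> * t * (S + m * (s + t)) + \<beta> * \<gamma> * (s + t)) + \<beta> * \<gamma> * S" for \<beta> \<gamma> S
          by (simp add: distrib_left distrib_right mult_ac)
        have "m dvd (x3 - x1) * (x2 - x3) * (x1 + x2)"
        proof -
          have "(x3 - x1) * (x2 - x3) * (x1 + x2) = - (m * w)" unfolding w[symmetric] by (simp add: algebra_simps)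
          then show ?thesis by simp
        qed
        then have "m dvd (x3 - x1 + m * s) * (x2 - x3 + m * t) * ((x1 + x2) + m * (s + t))"
          unfolding id by (intro dvd_add dvd_triv_left)
        then have "m dvd b * c * (b + c + 2 * x1)" unfolding E unfolding bb cc .
        then show "(case q of (x2, x3) \<Rightarrow> ((x3 - x1) mod m, (x2 - x3) mod m)) \<in> ?S"
          using m by (simp add: x b_def c_def)
      qed
    next
      show "finite ?S" by (rule finite_subset[of _ "?R \<times> ?R"]) auto
    qed
    then have "real (card (G x1)) \<le> real (card ?S)" by simp
    also have "\<dots> \<le> 2 * real_of_int m * (real (tau m))\<^sup>2"
      using card_product_dvd_le[OF m, of x1] cop by (simp add: x1_def)
    finally show "real (card (G (fst p))) \<le> 2 * real_of_int m * (real (tau m))\<^sup>2" by (simp add: x1_def)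
  qed
  finally have "real (card E) \<le> real (card ?H) * (2 * real_of_int m * (real (tau m))\<^sup>2)" by simp
  moreover have "card E = (\<Sum>z\<in>?H \<times> ?H. card {z' \<in> ?H \<times> ?H. pair_sum m z' = pair_sum m z})"
    unfolding E_def by (intro card_SigmaI) auto
  ultimately show ?thesis by simp
qed

text \<open>The square of \<open>Kloos m n h k\<close> is the Fourier transform of the number of
  representations of \<open>(s, t)\<close> as a sum of two hyperbola points. Parseval in both
  variables turns the fourth moment into the additive energy.\<close>

lemma sum_Kloos_4_le:
  assumes m: "m > 0" and n: "coprime n m"
  shows "(\<Sum>h\<in>{0..<m}. \<Sum>k\<in>{0..<m}. (cmod (Kloos m n h k)) ^ 4)
    \<le> (real_of_int m)\<^sup>2 * (real (card (hyp m n)) * (2 * real_of_int m * (real (tau m))\<^sup>2))"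
proof -
  let ?H = "hyp m n" and ?R = "{0..<m}"
  define N where "N s t = card {z \<in> ?H \<times> ?H. pair_sum m z = (s, t)}" for s t
  have img: "pair_sum m ` (?H \<times> ?H) \<subseteq> ?R \<times> ?R" using m by (auto simp: pair_sum_def)
  have sq: "(Kloos m n h k)\<^sup>2 = (\<Sum>s\<in>?R. \<Sum>t\<in>?R. of_nat (N s t) * ee m (s * h) * ee m (t * k))" for h k
  proof -
    have "(Kloos m n h k)\<^sup>2 = (\<Sum>p\<in>?H. \<Sum>p'\<in>?H. ee m (h * fst p + k * snd p) * ee m (h * fst p' + k * snd p'))"
      by (simp add: Kloos_def power2_eq_square sum_product case_prod_unfold)
    also have "\<dots> = (\<Sum>z\<in>?H \<times> ?H. ee m (h * fst (fst z) + k * snd (fst z)) * ee m (h * fst (snd z) + k * snd (snd z)))"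
      by (simp add: sum.cartesian_product case_prod_unfold)
    also have "\<dots> = (\<Sum>z\<in>?H \<times> ?H. (\<lambda>w. ee m (fst w * h) * ee m (snd w * k)) (pair_sum m z))"
    proof (rule sum.cong[OF refl])
      fix z :: "(int \<times> int) \<times> (int \<times> int)"
      define S where "S = fst (fst z) + fst (snd z)"
      define T where "T = snd (fst z) + snd (snd z)"
      have "m dvd S mod m - S" "m dvd T mod m - T" by (simp_all add: mod_eq_dvd_iff[symmetric])
      then have "ee m (S mod m * h) = ee m (S * h)" "ee m (T mod m * k) = ee m (T * k)"
        by (auto intro!: ee_cong[OF m] simp flip: left_diff_distrib)
      then have "(\<lambda>w. ee m (fst w * h) * ee m (snd w * k)) (pair_sum m z) = ee m (S * h + T * k)"
        by (simp add: pair_sum_def S_def T_def ee_add)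
      also have "\<dots> = ee m (h * fst (fst z) + k * snd (fst z)) * ee m (h * fst (snd z) + k * snd (snd z))"
        by (simp add: S_def T_def algebra_simps flip: ee_add)
      finally show "ee m (h * fst (fst z) + k * snd (fst z)) * ee m (h * fst (snd z) + k * snd (snd z))
        = (\<lambda>w. ee m (fst w * h) * ee m (snd w * k)) (pair_sum m z)" ..
    qed
    also have "\<dots> = (\<Sum>w\<in>?R \<times> ?R. of_nat (card {z \<in> ?H \<times> ?H. pair_sum m z = w}) * (\<lambda>w. ee m (fst w * h) * ee m (snd w * k)) w)"
      by (rule sum_fun_comp[OF _ _ img]) auto
    also have "\<dots> = (\<Sum>s\<in>?R. \<Sum>t\<in>?R. of_nat (N s t) * ee m (s * h) * ee m (t * k))"
      by (simp add: sum.cartesian_product case_prod_unfold N_def mult.assoc)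
    finally show ?thesis .
  qed
  have "(\<Sum>h\<in>?R. \<Sum>k\<in>?R. (cmod (Kloos m n h k)) ^ 4) = (\<Sum>h\<in>?R. \<Sum>k\<in>?R. (cmod ((Kloos m n h k)\<^sup>2))\<^sup>2)"
    by (simp add: norm_power flip: power_mult)
  also have "\<dots> = (of_int m)\<^sup>2 * (\<Sum>s\<in>?R. \<Sum>t\<in>?R. (real (N s t))\<^sup>2)"
    unfolding sq using parseval2[OF m, of "\<lambda>s t. of_nat (N s t)"] by simp
  also have "(\<Sum>s\<in>?R. \<Sum>t\<in>?R. (real (N s t))\<^sup>2)
      = (\<Sum>w\<in>?R \<times> ?R. of_nat (card {z \<in> ?H \<times> ?H. pair_sum m z = w}) * real (card {z \<in> ?H \<times> ?H. pair_sum m z = w}))"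
    by (simp add: sum.cartesian_product case_prod_unfold N_def power2_eq_square)
  also have "\<dots> = (\<Sum>z\<in>?H \<times> ?H. real (card {z' \<in> ?H \<times> ?H. pair_sum m z' = pair_sum m z}))"
    by (rule sum_fun_comp[OF _ _ img, symmetric]) auto
  also have "(of_int m)\<^sup>2 * \<dots> \<le> (real_of_int m)\<^sup>2 * (real (card (hyp m n)) * (2 * real_of_int m * (real (tau m))\<^sup>2))"
    by (intro mult_left_mono hyp_energy_le m n) auto
  finally show ?thesis by simp
qed

section \<open>Variance of hyperbola points in boxes\<close>

lemma gcd_unit_scale:
  assumes m: "m > 0" and U: "(l, l') \<in> hyp m 1"
  shows "gcd (l * h mod m) m = gcd h m"
proof -
  have "coprime l m" using hyp_coprime[OF U] by simp
  then have "gcd (l * h) m = gcd h m" 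
    by (intro gcd_mult_left_left_cancel) (simp add: coprime_commute)
  then show ?thesis by (metis gcd.commute gcd_red_int)
qed

lemma gcd_gcd_unit_scale:
  assumes m: "m > 0" and U: "(l, l') \<in> hyp m 1"
  shows "gcd (gcd (l * h mod m) (l' * k mod m)) m = gcd (gcd h k) m"
proof -
  have U': "(l', l) \<in> hyp m 1" using U hyp_swap by blast
  have *: "gcd (gcd a b) m = gcd (gcd a m) (gcd b m)" for a b :: int
    by (simp add: gcd.assoc gcd.left_commute)
  show ?thesis by (simp only: * gcd_unit_scale[OF m U] gcd_unit_scale[OF m U'])
qed

text \<open>Cauchy-Schwarz, with \<open>g = gcd (gcd h k) m\<close> distributed so that
  \<open>A\<close> carries \<open>g * W\<close> and \<open>B\<close> carries
  \<open>W * K^4 / g\<close>. Since \<open>K\<close> and \<open>g\<close> are invariant under the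
  units, \<open>W\<close> may be replaced in \<open>B\<close> by its orbit average, whose factor
  \<open>g\<close> cancels the denominator; the fourth moment remains. In \<open>A\<close> the
  factor \<open>g\<close> costs only a divisor function.\<close>

lemma off_axis_sum_le:
  fixes m T :: int and TM :: real
  assumes m: "m > 0" and T: "T > 0" and Tm: "m \<le> T\<^sup>2" and n: "coprime n m"
    and TM: "\<And>N. N \<noteq> 0 \<Longrightarrow> \<bar>N\<bar> \<le> m\<^sup>2 \<Longrightarrow> real (tau N) \<le> TM"
  shows "(\<Sum>(h, k)\<in>{1..<m} \<times> {1..<m}. (cmod (Kloos m n h k))\<^sup>2 * ((cmod (exp_sum m T h))\<^sup>2 * (cmod (exp_sum m T k))\<^sup>2))
    \<le> 10 * of_int T ^ 3 * (of_int m)\<^sup>2 * sqrt (of_int m) * harm_int m * TM\<^sup>2"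
    (is "?S \<le> ?rhs")
proof -
  let ?Om = "{1..<m} \<times> {1..<m}" and ?U = "hyp m 1"
  define g :: "int \<Rightarrow> int \<Rightarrow> real" where "g h k = real_of_int (gcd (gcd h k) m)" for h k
  define W :: "int \<Rightarrow> int \<Rightarrow> real" where "W h k = (cmod (exp_sum m T h))\<^sup>2 * (cmod (exp_sum m T k))\<^sup>2" for h k
  define K where "K h k = cmod (Kloos m n h k)" for h k
  have g0: "g h k > 0" for h k using m by (simp add: g_def)
  have W0: "W h k \<ge> 0" for h k by (simp add: W_def)
  have "m \<le> m\<^sup>2" using m by (simp add: power2_eq_square)
  then have tauTM: "real (tau m) \<le> TM" using m TM[of m] by simp
  then have TM0: "TM \<ge> 0" by (smt (verit) of_nat_0_le_iff)
  define A where "A = (\<Sum>(h, k)\<in>?Om. g h k * W h k)"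
  define B where "B = (\<Sum>(h, k)\<in>?Om. W h k * K h k ^ 4 / g h k)"
  have "?S\<^sup>2 \<le> A * B"
  proof -
    have "?S = (\<Sum>p\<in>?Om. (sqrt (g (fst p) (snd p)) * sqrt (W (fst p) (snd p)))
        * ((K (fst p) (snd p))\<^sup>2 * sqrt (W (fst p) (snd p)) / sqrt (g (fst p) (snd p))))"
    proof (rule sum.cong[OF refl])
      fix p
      have "(sqrt (g (fst p) (snd p)) * sqrt (W (fst p) (snd p)))
        * ((K (fst p) (snd p))\<^sup>2 * sqrt (W (fst p) (snd p)) / sqrt (g (fst p) (snd p)))
        = (K (fst p) (snd p))\<^sup>2 * (sqrt (W (fst p) (snd p)))\<^sup>2"
        using g0[of "fst p" "snd p"] by (simp add: power2_eq_square)
      then show "(case p of (h, k) \<Rightarrow> (cmod (Kloos m n h k))\<^sup>2 * ((cmod (exp_sum m T h))\<^sup>2 * (cmod (exp_sum m T k))\<^sup>2))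
        = (sqrt (g (fst p) (snd p)) * sqrt (W (fst p) (snd p)))
        * ((K (fst p) (snd p))\<^sup>2 * sqrt (W (fst p) (snd p)) / sqrt (g (fst p) (snd p)))"
        using W0 by (simp add: case_prod_unfold) (simp add: K_def W_def)
    qed
    then have "?S\<^sup>2 \<le> (\<Sum>p\<in>?Om. (sqrt (g (fst p) (snd p)) * sqrt (W (fst p) (snd p)))\<^sup>2)
        * (\<Sum>p\<in>?Om. ((K (fst p) (snd p))\<^sup>2 * sqrt (W (fst p) (snd p)) / sqrt (g (fst p) (snd p)))\<^sup>2)"
      by (simp only: Cauchy_Schwarz_ineq_sum)
    also have "(\<Sum>p\<in>?Om. (sqrt (g (fst p) (snd p)) * sqrt (W (fst p) (snd p)))\<^sup>2) = A"
      unfolding A_def using W0 g0 by (intro sum.cong) (auto simp: power_mult_distrib less_imp_le)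
    also have "(\<Sum>p\<in>?Om. ((K (fst p) (snd p))\<^sup>2 * sqrt (W (fst p) (snd p)) / sqrt (g (fst p) (snd p)))\<^sup>2) = B"
      unfolding B_def using W0 g0
      by (intro sum.cong) (auto simp: power_mult_distrib power_divide less_imp_le mult.commute simp flip: power_mult)
    finally show ?thesis .
  qed
  moreover have A_le: "A \<le> 4 * (of_int T)\<^sup>2 * (of_int m)\<^sup>2 * (harm_int m)\<^sup>2 * TM"
  proof -
    have "A \<le> 4 * (of_int T)\<^sup>2 * (of_int m)\<^sup>2 * (harm_int m)\<^sup>2 * tau m"
      unfolding A_def W_def g_def by (rule sum_gcd_weight_le[OF m T])
    also have "\<dots> \<le> 4 * (of_int T)\<^sup>2 * (of_int m)\<^sup>2 * (harm_int m)\<^sup>2 * TM"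
      using tauTM by (intro mult_left_mono) auto
    finally show ?thesis .
  qed
  moreover have B_le: "B \<le> 24 * TM * of_int T ^ 4 * of_int m ^ 3 * TM\<^sup>2"
  proof -
    have each: "(\<Sum>(h, k)\<in>?Om. W (l * h) (l' * k) * K h k ^ 4 / g h k) = B"
      if U: "(l, l') \<in> ?U" for l l'
    proof -
      have U': "(l', l) \<in> ?U" using U hyp_swap by blast
      show ?thesis unfolding B_def
      proof (rule sum.reindex_bij_witness[of _ "\<lambda>(h, k). (l' * h mod m, l * k mod m)"
            "\<lambda>(h, k). (l * h mod m, l' * k mod m)"], goal_cases)
        case (1 p) then show ?case using unit_scale_inv[OF m U'] unit_scale_inv[OF m U] by auto
      next
        case (2 p) then show ?case using hyp_scale_residue[OF m U'] hyp_scale_residue[OF m U] by (auto simp del: atLeastLessThan_iff)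
      next
        case (3 p) then show ?case using unit_scale_inv[OF m U'] unit_scale_inv[OF m U] by auto
      next
        case (4 p) then show ?case using hyp_scale_residue[OF m U'] hyp_scale_residue[OF m U] by (auto simp del: atLeastLessThan_iff)
      next
        case (5 p)
        obtain h k where p: "p = (h, k)" by (cases p)
        have "K (l * h mod m) (l' * k mod m) = K h k"
          using Kloos_mod[OF m, of n "l * h" "l' * k"] Kloos_scale[OF m U, of n h k] by (simp add: K_def)
        moreover have "g (l * h mod m) (l' * k mod m) = g h k"
          by (simp add: g_def gcd_gcd_unit_scale[OF m U])
        ultimately show ?case by (simp add: p W_def exp_sum_mod[OF m])
      qed
    qed
    have "real (card ?U) * B = (\<Sum>z\<in>?U. B)" by simp
    also have "\<dots> = (\<Sum>z\<in>?U. \<Sum>p\<in>?Om. W (fst z * fst p) (snd z * snd p) * K (fst p) (snd p) ^ 4 / g (fst p) (snd p))"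
      by (intro sum.cong refl) (auto simp: each[symmetric] case_prod_unfold)
    also have "\<dots> = (\<Sum>p\<in>?Om. \<Sum>z\<in>?U. W (fst z * fst p) (snd z * snd p) * K (fst p) (snd p) ^ 4 / g (fst p) (snd p))"
      by (rule sum.swap)
    also have "\<dots> = (\<Sum>p\<in>?Om. (K (fst p) (snd p) ^ 4 / g (fst p) (snd p)) * (\<Sum>z\<in>?U. W (fst z * fst p) (snd z * snd p)))"
      unfolding sum_distrib_left by (intro sum.cong refl) simp
    also have "\<dots> \<le> (\<Sum>p\<in>?Om. (K (fst p) (snd p) ^ 4 / g (fst p) (snd p)) * (g (fst p) (snd p) * (12 * TM * of_int T ^ 4)))"
    proof (intro sum_mono mult_left_mono)
      fix p assume "p \<in> ?Om"
      then show "(\<Sum>z\<in>?U. W (fst z * fst p) (snd z * snd p)) \<le> g (fst p) (snd p) * (12 * TM * of_int T ^ 4)"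
        using orbit_sum_le[OF m T Tm TM, of "fst p" "snd p"]
        by (auto simp: W_def g_def case_prod_unfold)
      show "0 \<le> K (fst p) (snd p) ^ 4 / g (fst p) (snd p)"
        using g0[of "fst p" "snd p"] by (simp add: K_def)
    qed
    also have "\<dots> = (12 * TM * of_int T ^ 4) * (\<Sum>p\<in>?Om. K (fst p) (snd p) ^ 4)"
      unfolding sum_distrib_left using g0 by (intro sum.cong) (auto simp: less_imp_neq[symmetric])
    also have "\<dots> \<le> (12 * TM * of_int T ^ 4) * ((real_of_int m)\<^sup>2 * (real (card ?U) * (2 * real_of_int m * TM\<^sup>2)))"
    proof (rule mult_left_mono)
      have "(\<Sum>p\<in>?Om. K (fst p) (snd p) ^ 4) \<le> (\<Sum>p\<in>{0..<m} \<times> {0..<m}. K (fst p) (snd p) ^ 4)"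
        by (intro sum_mono2) (auto simp: K_def)
      also have "\<dots> = (\<Sum>h\<in>{0..<m}. \<Sum>k\<in>{0..<m}. (cmod (Kloos m n h k)) ^ 4)"
        by (simp add: sum.cartesian_product case_prod_unfold K_def)
      also have "\<dots> \<le> (real_of_int m)\<^sup>2 * (real (card (hyp m n)) * (2 * real_of_int m * (real (tau m))\<^sup>2))"
        by (rule sum_Kloos_4_le[OF m n])
      also have "\<dots> \<le> (real_of_int m)\<^sup>2 * (real (card ?U) * (2 * real_of_int m * TM\<^sup>2))"
        using m tauTM card_hyp_le_units[OF m n] by (intro mult_left_mono mult_mono power_mono) auto
      finally show "(\<Sum>p\<in>?Om. K (fst p) (snd p) ^ 4) \<le> (real_of_int m)\<^sup>2 * (real (card ?U) * (2 * real_of_int m * TM\<^sup>2))" .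
    qed (use TM0 in simp)
    also have "\<dots> = real (card ?U) * (24 * TM * of_int T ^ 4 * of_int m ^ 3 * TM\<^sup>2)"
      by (simp add: power3_eq_cube power2_eq_square)
    finally show ?thesis using card_units_pos[OF m] by simp
  qed
  moreover have "A \<ge> 0" unfolding A_def using W0 g0 by (intro sum_nonneg) (auto simp: less_imp_le)
  moreover have "B \<ge> 0" unfolding B_def using W0 g0 by (intro sum_nonneg) (auto simp: less_imp_le K_def)
  ultimately have "?S\<^sup>2 \<le> (4 * (of_int T)\<^sup>2 * (of_int m)\<^sup>2 * (harm_int m)\<^sup>2 * TM) * (24 * TM * of_int T ^ 4 * of_int m ^ 3 * TM\<^sup>2)"
    using TM0 by (intro order_trans[OF \<open>?S\<^sup>2 \<le> A * B\<close> mult_mono]) auto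
  also have "\<dots> = 96 * (of_int T ^ 6 * of_int m ^ 5 * (harm_int m)\<^sup>2 * TM ^ 4)"
    by (simp add: power_numeral_reduce mult_ac)
  \<comment> \<open>The constant 96 is enlarged to 100 so that the bound has an explicit square
    root.\<close>
  also have "\<dots> \<le> 100 * (of_int T ^ 6 * of_int m ^ 5 * (harm_int m)\<^sup>2 * TM ^ 4)"
    using T m TM0 by (intro mult_right_mono) auto
  also have "\<dots> = ?rhs\<^sup>2"
  proof -
    have sq: "(sqrt (real_of_int m))\<^sup>2 = of_int m" using m by simp
    have "?rhs\<^sup>2 = 100 * (of_int T ^ 3)\<^sup>2 * ((of_int m)\<^sup>2)\<^sup>2 * of_int m * (harm_int m)\<^sup>2 * (TM\<^sup>2)\<^sup>2"
      by (simp only: power_mult_distrib sq) simp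
    then show ?thesis using m by (simp add: power_numeral_reduce mult_ac)
  qed
  finally have "?S\<^sup>2 \<le> ?rhs\<^sup>2" .
  moreover have "0 \<le> ?rhs"
    using T m harm_int_ge_1[OF m] by (intro mult_nonneg_nonneg) auto
  ultimately show ?thesis by (rule power2_le_imp_le)
qed

section \<open>Box counts and their Fourier expansion\<close>

definition box_count :: "int \<Rightarrow> int \<Rightarrow> int \<Rightarrow> int \<Rightarrow> int \<Rightarrow> nat" where
  "box_count m n T u v = card {(i, j) \<in> {0..<T} \<times> {0..<T}. m dvd (u + i) * (v + j) - n}"

lemma sum_hyp_indicator:
  assumes m: "m > 0" and n: "coprime n m"
  shows "(\<Sum>z\<in>hyp m n. if m dvd a - fst z \<and> m dvd b - snd z then 1 else (0::complex))
     = (if m dvd a * b - n then 1 else 0)"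
proof -
  define z0 where "z0 = (a mod m, b mod m)"
  have iff: "m dvd a - fst z \<and> m dvd b - snd z \<longleftrightarrow> z = z0" if "z \<in> hyp m n" for z
  proof -
    have "fst z mod m = fst z" "snd z mod m = snd z" using that by (auto simp: hyp_def)
    then show ?thesis by (auto simp: z0_def mod_eq_dvd_iff[symmetric] prod_eq_iff)
  qed
  have "m dvd a * b - n \<longleftrightarrow> z0 \<in> hyp m n"
    using m by (simp add: z0_def hyp_def mod_eq_dvd_iff[symmetric] mod_mult_eq)
  moreover have "(\<Sum>z\<in>hyp m n. if m dvd a - fst z \<and> m dvd b - snd z then 1 else (0::complex))
      = (\<Sum>z\<in>hyp m n. if z = z0 then 1 else 0)"
    by (intro sum.cong refl) (simp add: iff)
  ultimately show ?thesis by simp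
qed

lemma sum_if_card:
  "finite A \<Longrightarrow> (\<Sum>q\<in>A. if P q then 1 else (0::'a::semiring_1)) = of_nat (card {q \<in> A. P q})"
  by (simp flip: sum.inter_filter)

text \<open>Orthogonality in \<open>h\<close> and \<open>k\<close> detects the hyperbola points
  congruent to \<open>(u + i, v + j)\<close>: there is one if this box point satisfies the
  congruence, and none otherwise.\<close>

lemma box_count_fourier:
  assumes m: "m > 0" and T: "T > 0" and n: "coprime n m"
  shows "(\<Sum>h\<in>{0..<m}. \<Sum>k\<in>{0..<m}. cnj (Kloos m n h k) * exp_sum m T h * exp_sum m T k * ee m (h * u) * ee m (k * v))
    = (of_int m)\<^sup>2 * of_nat (box_count m n T u v)"
proof -
  let ?H = "hyp m n" and ?R = "{0..<m}" and ?I = "{0..<T}"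
  let ?f = "\<lambda>h k z i j. ee m ((u + i - fst z) * h) * ee m ((v + j - snd z) * k)"
  have "(\<Sum>h\<in>?R. \<Sum>k\<in>?R. cnj (Kloos m n h k) * exp_sum m T h * exp_sum m T k * ee m (h * u) * ee m (k * v))
      = (\<Sum>h\<in>?R. \<Sum>k\<in>?R. \<Sum>z\<in>?H. \<Sum>i\<in>?I. \<Sum>j\<in>?I. ?f h k z i j)"
  proof (intro sum.cong refl)
    fix h k
    have "cnj (Kloos m n h k) * exp_sum m T h * exp_sum m T k * ee m (h * u) * ee m (k * v)
        = (\<Sum>z\<in>?H. \<Sum>i\<in>?I. \<Sum>j\<in>?I. cnj (ee m (h * fst z + k * snd z)) * ee m (h * i) * ee m (k * j) * ee m (h * u) * ee m (k * v))"
      by (simp add: Kloos_def exp_sum_def case_prod_unfold sum_distrib_left sum_distrib_right mult_ac)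
    also have "\<dots> = (\<Sum>z\<in>?H. \<Sum>i\<in>?I. \<Sum>j\<in>?I. ?f h k z i j)"
      by (intro sum.cong refl) (simp flip: ee_minus ee_add add: algebra_simps)
    finally show "cnj (Kloos m n h k) * exp_sum m T h * exp_sum m T k * ee m (h * u) * ee m (k * v)
        = (\<Sum>z\<in>?H. \<Sum>i\<in>?I. \<Sum>j\<in>?I. ?f h k z i j)" .
  qed
  also have "\<dots> = (\<Sum>h\<in>?R. \<Sum>k\<in>?R. \<Sum>w\<in>?H \<times> ?I \<times> ?I. ?f h k (fst w) (fst (snd w)) (snd (snd w)))"
    by (simp add: sum.cartesian_product case_prod_unfold)
  also have "\<dots> = (\<Sum>h\<in>?R. \<Sum>w\<in>?H \<times> ?I \<times> ?I. \<Sum>k\<in>?R. ?f h k (fst w) (fst (snd w)) (snd (snd w)))"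
    by (intro sum.cong refl sum.swap)
  also have "\<dots> = (\<Sum>w\<in>?H \<times> ?I \<times> ?I. \<Sum>h\<in>?R. \<Sum>k\<in>?R. ?f h k (fst w) (fst (snd w)) (snd (snd w)))"
    by (rule sum.swap)
  also have "\<dots> = (\<Sum>w\<in>?H \<times> ?I \<times> ?I. (\<Sum>h\<in>?R. ee m ((u + fst (snd w) - fst (fst w)) * h))
      * (\<Sum>k\<in>?R. ee m ((v + snd (snd w) - snd (fst w)) * k)))"
    by (simp only: sum_product)
  also have "\<dots> = (\<Sum>w\<in>?H \<times> ?I \<times> ?I. (of_int m)\<^sup>2 *
      (if m dvd u + fst (snd w) - fst (fst w) \<and> m dvd v + snd (snd w) - snd (fst w) then 1 else 0))"
    by (intro sum.cong refl) (simp add: sum_ee[OF m] power2_eq_square)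
  also have "\<dots> = (of_int m)\<^sup>2 * (\<Sum>z\<in>?H. \<Sum>q\<in>?I \<times> ?I.
      (if m dvd u + fst q - fst z \<and> m dvd v + snd q - snd z then 1 else 0))"
    by (simp add: sum_distrib_left sum.cartesian_product case_prod_unfold)
  also have "(\<Sum>z\<in>?H. \<Sum>q\<in>?I \<times> ?I. (if m dvd u + fst q - fst z \<and> m dvd v + snd q - snd z then 1 else (0::complex)))
      = (\<Sum>q\<in>?I \<times> ?I. \<Sum>z\<in>?H. (if m dvd u + fst q - fst z \<and> m dvd v + snd q - snd z then 1 else 0))"
    by (rule sum.swap)
  also have "\<dots> = (\<Sum>q\<in>?I \<times> ?I. if m dvd (u + fst q) * (v + snd q) - n then 1 else 0)"
    by (simp only: sum_hyp_indicator[OF m n])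
  also have "\<dots> = of_nat (card {q \<in> ?I \<times> ?I. m dvd (u + fst q) * (v + snd q) - n})"
    by (rule sum_if_card) simp
  also have "{q \<in> ?I \<times> ?I. m dvd (u + fst q) * (v + snd q) - n} = {(i, j) \<in> ?I \<times> ?I. m dvd (u + i) * (v + j) - n}"
    by auto
  finally show ?thesis by (simp add: box_count_def)
qed

lemma sum_off_origin:
  fixes f :: "int \<Rightarrow> int \<Rightarrow> real"
  assumes "m > 0" "f 0 0 = 0"
  shows "(\<Sum>h\<in>{0..<m}. \<Sum>k\<in>{0..<m}. f h k)
    = (\<Sum>k\<in>{1..<m}. f 0 k) + (\<Sum>h\<in>{1..<m}. f h 0) + (\<Sum>(h, k)\<in>{1..<m} \<times> {1..<m}. f h k)"
proof -
  have R: "{0..<m} = insert 0 {1..<m}" using assms by auto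
  have "(\<Sum>h\<in>{0..<m}. \<Sum>k\<in>{0..<m}. f h k)
      = (\<Sum>k\<in>{1..<m}. f 0 k) + (\<Sum>h\<in>{1..<m}. f h 0 + (\<Sum>k\<in>{1..<m}. f h k))"
    using assms by (simp add: R)
  then show ?thesis by (simp add: sum.distrib sum.cartesian_product)
qed

text \<open>Parseval for the Fourier expansion without its term at the origin, which is the mean.
  The two axes contribute 2 each and the other frequencies 10, once the axis terms have been
  multiplied by \<open>sqrt m * TM\<^sup>2 \<ge> 1\<close>; this is the constant 14.\<close>

lemma box_count_variance_le:
  fixes m T :: int and TM :: real
  assumes m: "m > 0" and T: "T > 0" and Tm: "m \<le> T\<^sup>2" and n: "coprime n m"
    and TM: "\<And>N. N \<noteq> 0 \<Longrightarrow> \<bar>N\<bar> \<le> m\<^sup>2 \<Longrightarrow> real (tau N) \<le> TM"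
  shows "(\<Sum>u\<in>{0..<m}. \<Sum>v\<in>{0..<m}.
            (real (box_count m n T u v) - (of_int T)\<^sup>2 * real (card (hyp m n)) / (of_int m)\<^sup>2)\<^sup>2)
    \<le> 14 * of_int T ^ 3 * sqrt (of_int m) * harm_int m * TM\<^sup>2"
proof -
  let ?R = "{0..<m}"
  define mean where "mean = (real_of_int T)\<^sup>2 * real (card (hyp m n)) / (real_of_int m)\<^sup>2"
  define c where "c h k = cnj (Kloos m n h k) * exp_sum m T h * exp_sum m T k / (of_int m)\<^sup>2" for h k
  define c' where "c' h k = (if h = 0 \<and> k = 0 then 0 else c h k)" for h k
  have m0: "real_of_int m > 0" using m by simp
  have c00: "c 0 0 = of_real mean"
    using T by (simp add: c_def mean_def Kloos_0_0 exp_sum_0 power2_eq_square mult_ac)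
  have split: "(\<Sum>h\<in>?R. \<Sum>k\<in>?R. c' h k * ee m (h * u) * ee m (k * v)) = of_real (real (box_count m n T u v) - mean)" for u v
  proof -
    have "(\<Sum>h\<in>?R. \<Sum>k\<in>?R. c h k * ee m (h * u) * ee m (k * v)) = of_nat (box_count m n T u v)"
    proof -
      have "(\<Sum>h\<in>?R. \<Sum>k\<in>?R. c h k * ee m (h * u) * ee m (k * v))
          = (\<Sum>h\<in>?R. \<Sum>k\<in>?R. cnj (Kloos m n h k) * exp_sum m T h * exp_sum m T k * ee m (h * u) * ee m (k * v)) / (of_int m)\<^sup>2"
        by (simp add: c_def sum_divide_distrib)
      then show ?thesis using m by (simp add: box_count_fourier[OF m T n])
    qed
    moreover have "(\<Sum>h\<in>?R. \<Sum>k\<in>?R. c h k * ee m (h * u) * ee m (k * v))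
        = (\<Sum>h\<in>?R. \<Sum>k\<in>?R. c' h k * ee m (h * u) * ee m (k * v)) + c 0 0"
    proof -
      have "(\<Sum>h\<in>?R. \<Sum>k\<in>?R. c h k * ee m (h * u) * ee m (k * v))
        = (\<Sum>h\<in>?R. \<Sum>k\<in>?R. c' h k * ee m (h * u) * ee m (k * v) + (if k = 0 then if h = 0 then c 0 0 else 0 else 0))"
        by (intro sum.cong refl) (auto simp: c'_def)
      also have "\<dots> = (\<Sum>h\<in>?R. \<Sum>k\<in>?R. c' h k * ee m (h * u) * ee m (k * v)) + c 0 0"
        using m by (simp add: sum.distrib)
      finally show ?thesis .
    qed
    ultimately show ?thesis by (simp add: c00 algebra_simps)
  qed
  define F where "F h k = (if h = 0 \<and> k = 0 then 0 else (cmod (Kloos m n h k))\<^sup>2 * ((cmod (exp_sum m T h))\<^sup>2 * (cmod (exp_sum m T k))\<^sup>2))" for h k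
  have "(\<Sum>u\<in>?R. \<Sum>v\<in>?R. (real (box_count m n T u v) - mean)\<^sup>2)
      = (\<Sum>u\<in>?R. \<Sum>v\<in>?R. (cmod (\<Sum>h\<in>?R. \<Sum>k\<in>?R. c' h k * ee m (h * u) * ee m (k * v)))\<^sup>2)"
    unfolding split by (simp only: norm_of_real power2_abs)
  also have "\<dots> = (of_int m)\<^sup>2 * (\<Sum>h\<in>?R. \<Sum>k\<in>?R. (cmod (c' h k))\<^sup>2)"
    by (rule parseval2[OF m])
  also have "(\<Sum>h\<in>?R. \<Sum>k\<in>?R. (cmod (c' h k))\<^sup>2) = (\<Sum>h\<in>?R. \<Sum>k\<in>?R. F h k / (of_int m) ^ 4)"
    using m by (intro sum.cong refl)
      (auto simp: c'_def c_def F_def norm_mult norm_divide norm_power power_mult_distrib power_divide simp flip: power_mult)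
  also have "\<dots> = (\<Sum>h\<in>?R. \<Sum>k\<in>?R. F h k) / (of_int m) ^ 4"
    by (simp add: sum_divide_distrib)
  also have "(of_int m)\<^sup>2 * \<dots> = (\<Sum>h\<in>?R. \<Sum>k\<in>?R. F h k) / (of_int m)\<^sup>2"
    using m by (simp add: power_numeral_reduce)
  also have "(\<Sum>h\<in>?R. \<Sum>k\<in>?R. F h k) \<le> 14 * of_int T ^ 3 * (of_int m)\<^sup>2 * sqrt (of_int m) * harm_int m * TM\<^sup>2"
  proof -
    have L1: "harm_int m \<ge> 1" using harm_int_ge_1[OF m] .
    have tm: "real (tau m) \<le> TM" using m TM[of m] by (simp add: power2_eq_square)
    have "1 \<le> tau m"
    proof -
      have "card {1::int} \<le> tau m" unfolding tau_def using m finite_posdvd[of m] by (intro card_mono) auto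
      then show ?thesis by simp
    qed
    then have TM1: "TM \<ge> 1" using tm by (metis of_nat_1 of_nat_le_iff order_trans)
    have ax1: "(\<Sum>k\<in>{1..<m}. F 0 k) \<le> 2 * of_int T ^ 3 * (of_int m)\<^sup>2 * harm_int m"
    proof -
      have "(\<Sum>k\<in>{1..<m}. F 0 k) = (of_int T)\<^sup>2 * (\<Sum>k\<in>{1..<m}. (cmod (Kloos m n 0 k))\<^sup>2 * (cmod (exp_sum m T k))\<^sup>2)"
        unfolding sum_distrib_left using T by (intro sum.cong) (auto simp: F_def exp_sum_0)
      also have "\<dots> \<le> (of_int T)\<^sup>2 * (2 * of_int T * (of_int m)\<^sup>2 * harm_int m)"
        by (intro mult_left_mono axis_sum_le m T n) auto
      finally show ?thesis by (simp add: power2_eq_square power3_eq_cube mult_ac)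
    qed
    moreover have "(\<Sum>k\<in>{1..<m}. F k 0) = (\<Sum>k\<in>{1..<m}. F 0 k)"
      by (intro sum.cong refl) (auto simp: F_def Kloos_swap[of m n _ 0])
    moreover have "(\<Sum>(h, k)\<in>{1..<m} \<times> {1..<m}. F h k)
        \<le> 10 * of_int T ^ 3 * (of_int m)\<^sup>2 * sqrt (of_int m) * harm_int m * TM\<^sup>2"
    proof -
      have "(\<Sum>(h, k)\<in>{1..<m} \<times> {1..<m}. F h k) =
          (\<Sum>(h, k)\<in>{1..<m} \<times> {1..<m}. (cmod (Kloos m n h k))\<^sup>2 * ((cmod (exp_sum m T h))\<^sup>2 * (cmod (exp_sum m T k))\<^sup>2))"
        by (intro sum.cong refl) (auto simp: F_def)
      then show ?thesis using off_axis_sum_le[OF m T Tm n TM] by simp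
    qed
    moreover have "of_int T ^ 3 * (of_int m)\<^sup>2 * harm_int m * 1 \<le> of_int T ^ 3 * (of_int m)\<^sup>2 * harm_int m * (sqrt (of_int m) * TM\<^sup>2)"
    proof (intro mult_left_mono)
      have "1 * 1 \<le> sqrt (real_of_int m) * TM\<^sup>2"
        using m TM1 by (intro mult_mono) (auto simp: one_le_power)
      then show "1 \<le> sqrt (real_of_int m) * TM\<^sup>2" by simp
    qed (use T L1 in auto)
    moreover have "(\<Sum>h\<in>?R. \<Sum>k\<in>?R. F h k) = (\<Sum>k\<in>{1..<m}. F 0 k) + (\<Sum>k\<in>{1..<m}. F k 0) + (\<Sum>(h, k)\<in>{1..<m} \<times> {1..<m}. F h k)"
      using m by (intro sum_off_origin) (auto simp: F_def)
    ultimately show ?thesis by (simp add: mult_ac)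
  qed
  finally have "(\<Sum>u\<in>?R. \<Sum>v\<in>?R. (real (box_count m n T u v) - mean)\<^sup>2)
      \<le> 14 * of_int T ^ 3 * (of_int m)\<^sup>2 * sqrt (of_int m) * harm_int m * TM\<^sup>2 / (of_int m)\<^sup>2"
    using m0 by (simp add: divide_right_mono)
  also have "\<dots> = 14 * of_int T ^ 3 * sqrt (of_int m) * harm_int m * TM\<^sup>2" using m0 by simp
  finally show ?thesis by (simp add: mean_def)
qed

section \<open>Divisor bounds\<close>

definition ntau :: "nat \<Rightarrow> nat" where "ntau n = card {d. d dvd n}"

lemma tau_int: "n > 0 \<Longrightarrow> tau (int n) = ntau n"
  unfolding tau_def ntau_def
  by (rule bij_betw_same_card[of nat]) 
     (rule bij_betw_byWitness[of _ int], auto simp: nat_dvd_iff)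

lemma tau_uminus [simp]: "tau (- n) = tau n"
  by (simp add: tau_def)

lemma finite_ndvd: "n > 0 \<Longrightarrow> finite {d::nat. d dvd n}"
  by (simp add: finite_divisors_nat)

lemma ntau_mult_le:
  assumes "a > 0" "b > 0"
  shows "ntau (a * b) \<le> ntau a * ntau b"
proof -
  have "{d. d dvd a * b} \<subseteq> (\<lambda>(x, y). x * y) ` ({d. d dvd a} \<times> {d. d dvd b})"
    by (auto elim!: dvd_productE simp: image_iff)
  then have "card {d. d dvd a * b} \<le> card ({d. d dvd a} \<times> {d. d dvd b})"
    using assms by (intro surj_card_le) (auto simp: finite_ndvd)
  then show ?thesis by (simp add: ntau_def card_cartesian_product)
qed

lemma ntau_prime_power:
  assumes "prime (p::nat)" shows "ntau (p ^ k) = k + 1"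
proof -
  have "{d. d dvd p ^ k} = (\<lambda>i. p ^ i) ` {..k}"
    using assms by (auto simp: divides_primepow_nat)
  moreover have "inj_on (\<lambda>i. p ^ i) {..k}"
    using prime_gt_1_nat[OF assms] by (auto intro!: inj_onI simp: power_inject_exp)
  ultimately show ?thesis by (simp add: ntau_def card_image)
qed

text \<open>Prime powers are split off one at a time. If \<open>p powr e \<ge> 2\<close>, then
  \<open>k + 1 \<le> 2^k\<close> is at most \<open>(p^k) powr e\<close>. Otherwise
  \<open>1 + k * e * ln 2 \<le> 2 powr (k * e)\<close>, and \<open>c \<ge> 1 / (e * ln 2)\<close>
  makes up for the slope \<open>e * ln 2\<close>.\<close>

lemma ntau_le_prod:
  assumes e: "e > (0::real)" and n: "n > 0"
  defines "c \<equiv> max 1 (1 / (e * ln 2))"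
  shows "real (ntau n) \<le> (\<Prod>p\<in>prime_factors n. if real p powr e < 2 then c else 1) * real n powr e"
  using n
proof (induction n rule: less_induct)
  case (less n)
  show ?case
  proof (cases "n = 1")
    case True
    have "{d. d = Suc 0} = {1}" by auto
    then show ?thesis using True by (simp add: ntau_def)
  next
    case False
    then obtain p where p: "prime p" "p dvd n" using prime_factor_nat by blast
    obtain k m where km: "\<not> p dvd m" "n = m * p ^ k"
      using prime_power_canonical[OF p(1) less.prems] by blast
    have k: "k > 0" using km p by (cases k) auto
    have m: "m > 0" using km less.prems by (cases m) auto
    have "1 < p ^ k" by (rule one_less_power[OF prime_gt_1_nat[OF p(1)] k])
    then have mn: "m < n" using m by (simp add: km)
    let ?g = "\<lambda>p::nat. if real p powr e < 2 then c else 1"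
    have p2: "real p \<ge> 2" using prime_ge_2_nat[OF p(1)] by simp
    have step: "real (k + 1) \<le> ?g p * real (p ^ k) powr e"
    proof (cases "real p powr e < 2")
      case True
      have "real k * e * ln 2 \<le> 2 powr (real k * e) - 1"
        using ln_add_one_self_le_self2[of "2 powr (real k * e) - 1"] by (simp add: ln_powr)
      then have 1: "1 + real k * (e * ln 2) \<le> 2 powr (real k * e)" by (simp add: mult_ac)
      have "real (k + 1) \<le> c * (1 + real k * (e * ln 2))"
      proof -
        have "real k * 1 \<le> real k * (c * (e * ln 2))"
          using e by (intro mult_left_mono) (auto simp: c_def max_def field_simps)
        then show ?thesis by (simp add: distrib_left mult_ac c_def)
      qed
      also have "\<dots> \<le> c * 2 powr (real k * e)" using 1 by (intro mult_left_mono) (auto simp: c_def)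
      also have "\<dots> \<le> c * real p powr (real k * e)"
        using p2 e by (intro mult_left_mono powr_mono2) (auto simp: c_def)
      also have "real p powr (real k * e) = real (p ^ k) powr e"
        using p2 by (simp add: powr_powr flip: powr_realpow)
      finally show ?thesis using True by simp
    next
      case False
      have "real (k + 1) \<le> 2 ^ k" using less_exp[of k] by (metis Suc_eq_plus1 Suc_leI of_nat_le_iff of_nat_numeral of_nat_power)
      also have "\<dots> \<le> (real p powr e) ^ k" using False by (intro power_mono) auto
      also have "\<dots> = real (p ^ k) powr e"
        using p2 by (simp add: powr_powr mult.commute flip: powr_realpow)
      finally show ?thesis using False by simp
    qed
    have pf: "prime_factors n = insert p (prime_factors m)" "p \<notin> prime_factors m"
      using km p k m by (auto simp: prime_factors_product prime_prime_factors prime_factors_power)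
    have "real (ntau n) \<le> real (ntau m * ntau (p ^ k))"
      unfolding km(2) using m p2 by (subst of_nat_le_iff, intro ntau_mult_le) auto
    also have "\<dots> = real (ntau m) * real (k + 1)" by (simp add: ntau_prime_power[OF p(1)] distrib_left)
    also have "\<dots> \<le> ((\<Prod>p\<in>prime_factors m. ?g p) * real m powr e) * (?g p * real (p ^ k) powr e)"
      by (intro mult_mono less.IH mn m step) (auto intro!: mult_nonneg_nonneg prod_nonneg simp: c_def)
    also have "\<dots> = (\<Prod>p\<in>prime_factors n. ?g p) * real n powr e"
      using pf by (simp add: km(2) powr_mult mult_ac)
    finally show ?thesis .
  qed
qed

text \<open>Only primes below \<open>2 powr (1 / e)\<close> contribute a factor \<open>c\<close>,
  and their number is bounded independently of \<open>n\<close>.\<close>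

lemma ntau_bound:
  assumes e: "e > (0::real)"
  obtains C where "C \<ge> 1" "\<And>n. n > 0 \<Longrightarrow> real (ntau n) \<le> C * real n powr e"
proof -
  define c where "c = max 1 (1 / (e * ln 2))"
  define B where "B = nat \<lceil>2 powr (1 / e)\<rceil>"
  have c1: "c \<ge> 1" by (simp add: c_def)
  have "real (ntau n) \<le> c ^ B * real n powr e" if n: "n > 0" for n
  proof -
    have "(\<Prod>p\<in>prime_factors n. if real p powr e < 2 then c else 1) = (\<Prod>p\<in>{p \<in> prime_factors n. real p powr e < 2}. c)"
      by (rule prod.inter_filter[symmetric]) simp
    also have "\<dots> = c ^ card {p \<in> prime_factors n. real p powr e < 2}" by simp
    also have "\<dots> \<le> c ^ B"
    proof (rule power_increasing[OF _ c1])
      have "{p \<in> prime_factors n. real p powr e < 2} \<subseteq> {..<B}"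
      proof clarsimp
        fix p :: nat assume "real p powr e < 2"
        then have "(real p powr e) powr (1 / e) < 2 powr (1 / e)" using e by (intro powr_less_mono2) auto
        then have "real p < 2 powr (1 / e)" using e by (simp add: powr_powr)
        then show "p < B" unfolding B_def by linarith
      qed
      then have "card {p \<in> prime_factors n. real p powr e < 2} \<le> card {..<B}" by (intro card_mono) auto
      then show "card {p \<in> prime_factors n. real p powr e < 2} \<le> B" by simp
    qed
    finally have "(\<Prod>p\<in>prime_factors n. if real p powr e < 2 then c else 1) * real n powr e \<le> c ^ B * real n powr e"
      by (intro mult_right_mono) auto
    then show ?thesis using ntau_le_prod[OF e n] unfolding c_def by linarith
  qed
  then show ?thesis using c1 by (intro that[of "c ^ B"]) auto
qed

lemma tau_bound:
  assumes e: "e > (0::real)"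
  obtains C where "C \<ge> 1" "\<And>n. n \<noteq> 0 \<Longrightarrow> real (tau n) \<le> C * \<bar>real_of_int n\<bar> powr e"
proof -
  from ntau_bound[OF e] obtain C where C: "C \<ge> 1" "\<And>n. n > 0 \<Longrightarrow> real (ntau n) \<le> C * real n powr e"
    by blast
  have "real (tau n) \<le> C * \<bar>real_of_int n\<bar> powr e" if "n \<noteq> 0" for n
  proof -
    have "tau n = tau \<bar>n\<bar>" by (simp add: abs_if)
    also have "\<dots> = ntau (nat \<bar>n\<bar>)" using tau_int[of "nat \<bar>n\<bar>"] that by simp
    finally show ?thesis using C(2)[of "nat \<bar>n\<bar>"] that by simp
  qed
  then show ?thesis using C(1) that by blast
qed

lemma tau_mono: "a dvd b \<Longrightarrow> b \<noteq> 0 \<Longrightarrow> tau a \<le> tau b"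
  unfolding tau_def by (intro card_mono) (auto simp: finite_posdvd intro: dvd_trans)

text \<open>Fix a root \<open>x0\<close>. For a root \<open>x\<close>, the divisor
  \<open>g = gcd (x - x0) n\<close> gives \<open>x = x0\<close> modulo \<open>g\<close> and
  \<open>x = - x0\<close> modulo \<open>h = n div g\<close>. For fixed \<open>g\<close> there are at
  most \<open>e = gcd g h\<close> such \<open>x\<close>. If there is any, \<open>e\<close> divides
  \<open>2 * x0\<close>, so \<open>e * e\<close> divides both \<open>n\<close> and
  \<open>4 * x0\<^sup>2\<close>, hence \<open>4 * c\<close>, and the hypothesis on \<open>E\<close>
  covers \<open>e\<close>.\<close>

lemma card_sqrt_mod_le:
  fixes n c :: int and E :: nat
  assumes n: "n > 0" and E: "\<And>e. e > 0 \<Longrightarrow> e * e dvd n \<Longrightarrow> e * e dvd 4 * c \<Longrightarrow> e \<le> int E"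
  shows "card {x \<in> {0..<n}. n dvd x * x - c} \<le> tau n * E" (is "card ?A \<le> _")
proof (cases "?A = {}")
  case False
  then obtain x0 where x0: "n dvd x0 * x0 - c" by blast
  let ?P = "{d. 0 < d \<and> d dvd n}"
  let ?B = "\<lambda>g. {x \<in> {0..<n}. g dvd x - x0 \<and> n div g dvd x - (- x0)}"
  have finP: "finite ?P" using n by (intro finite_posdvd) simp
  have finB: "finite (?B g)" for g by (rule finite_subset[of _ "{0..<n}"]) auto
  have "?A \<subseteq> (\<Union>g\<in>?P. ?B g)"
  proof
    fix x assume x: "x \<in> ?A"
    define g where "g = gcd (x - x0) n"
    have g: "g > 0" "g dvd n" "g dvd x - x0" using n by (simp_all add: g_def)
    have "n dvd x * x - c" using x by simp
    then have "n dvd (x * x - c) - (x0 * x0 - c)" using x0 by (rule dvd_diff)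
    then have "n dvd (x - x0) * (x + x0)" by (simp add: algebra_simps)
    moreover have "n = g * (n div g)" using g by simp
    moreover have xg: "x - x0 = g * ((x - x0) div g)" using g by simp
    ultimately have "g * (n div g) dvd g * ((x - x0) div g * (x + x0))" by (metis mult.assoc)
    then have "g = 0 \<or> n div g dvd (x - x0) div g * (x + x0)" by (simp only: dvd_mult_cancel_left)
    then have "n div g dvd (x - x0) div g * (x + x0)" using g by simp
    moreover have "coprime ((x - x0) div g) (n div g)" unfolding g_def using n by (intro div_gcd_coprime) simp
    ultimately have "n div g dvd x + x0" by (simp add: coprime_commute coprime_dvd_mult_right_iff)
    then have "x \<in> ?B g" using x g by simp
    then show "x \<in> (\<Union>g\<in>?P. ?B g)" using g by blast
  qed
  then have "card ?A \<le> card (\<Union>g\<in>?P. ?B g)" using finP finB by (intro card_mono finite_UN_I) auto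
  also have "\<dots> \<le> (\<Sum>g\<in>?P. card (?B g))" by (rule card_UN_le[OF finP])
  also have "\<dots> \<le> (\<Sum>g\<in>?P. E)"
  proof (rule sum_mono)
    fix g assume g: "g \<in> ?P"
    show "card (?B g) \<le> E"
    proof (cases "?B g = {}")
      case True
      then show ?thesis by (simp only: card.empty)
    next
      case False
      then obtain x1 where x1: "g dvd x1 - x0" "n div g dvd x1 - (- x0)" by blast
      define h where "h = n div g"
      have nh: "n = g * h" using g by (simp add: h_def)
      then have h0: "h > 0" using g n zero_less_mult_pos[of g h] by simp
      define e where "e = gcd g h"
      have e: "e > 0" "e dvd g" "e dvd h" using g by (simp_all add: e_def)
      have "e dvd x1 - (- x0)" "e dvd x1 - x0"
        using dvd_trans[OF e(3), of "x1 - (- x0)"] dvd_trans[OF e(2) x1(1)] x1(2) by (simp_all add: h_def)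
      then have "e dvd (x1 - (- x0)) - (x1 - x0)" by (rule dvd_diff)
      then have "e dvd 2 * x0" by simp
      then have "e * e dvd (2 * x0) * (2 * x0)" by (rule mult_dvd_mono) fact
      then have "e * e dvd 4 * (x0 * x0)" by (simp add: mult_ac)
      moreover have een: "e * e dvd n" unfolding nh using e by (intro mult_dvd_mono)
      then have "e * e dvd 4 * (x0 * x0 - c)" using x0 by (meson dvd_mult dvd_trans)
      ultimately have "e * e dvd 4 * (x0 * x0) - 4 * (x0 * x0 - c)" by (rule dvd_diff)
      then have "e * e dvd 4 * c" by (simp add: algebra_simps)
      then have eE: "e \<le> int E" using E e een by blast
      have "lcm g h * e = g * h" using g h0 by (simp add: e_def lcm_mult_gcd[of g h])
      define L where "L = real_of_int (lcm g h)"
      have l: "of_int n = L * of_int e" unfolding L_def by (metis \<open>lcm g h * e = g * h\<close> nh of_int_mult)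
      have lp: "L > 0" using g h0 by (simp add: L_def lcm_pos_int)
      have "real (card (?B g)) \<le> of_int n / L"
        unfolding h_def[symmetric] L_def using g h0 nh n by (intro card_two_congruences_le) auto
      also have "\<dots> = of_int e" unfolding l using lp by simp
      finally show ?thesis using eE by linarith
    qed
  qed
  also have "\<dots> = tau n * E" by (simp add: tau_def)
  finally show ?thesis .
next
  case True
  then show ?thesis by (simp only: card.empty)
qed

section \<open>Sums of two squares\<close>

definition r2 :: "int \<Rightarrow> nat" where
  "r2 n = card {(u::int, v::int). u * u + v * v = n}"

lemma finite_r2: "finite {(u::int, v::int). u * u + v * v = n}"
proof (rule finite_subset[of _ "{-\<bar>n\<bar>..\<bar>n\<bar>} \<times> {-\<bar>n\<bar>..\<bar>n\<bar>}"])
  have *: "\<bar>u\<bar> \<le> u * u" for u :: int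
    by (cases "u = 0") (use mult_left_mono[of 1 "\<bar>u\<bar>" "\<bar>u\<bar>"] in \<open>auto simp: abs_mult_self_eq\<close>)
  have "u \<in> {-\<bar>n\<bar>..\<bar>n\<bar>} \<and> v \<in> {-\<bar>n\<bar>..\<bar>n\<bar>}" if "u * u + v * v = n" for u v
    using *[of u] *[of v] that by auto
  then show "{(u, v). u * u + v * v = n} \<subseteq> {-\<bar>n\<bar>..\<bar>n\<bar>} \<times> {-\<bar>n\<bar>..\<bar>n\<bar>}" by auto
qed auto

text \<open>A primitive representation gives the square root \<open>u / v\<close> of -1 modulo
  \<open>n\<close>, and there are few square roots. Two representations with the same root satisfy
  \<open>u * v' = u' * v\<close> modulo \<open>n\<close>; in this quadrant both products lie in
  \<open>[0, n)\<close>, so they are equal, and coprimality identifies the pairs.\<close>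

lemma r2_quadrant_le:
  fixes n :: int
  assumes n: "n > 0"
  shows "card {(u::int, v::int). u * u + v * v = n \<and> coprime u v \<and> u > 0 \<and> v \<ge> 0} \<le> tau n * 2" (is "card ?Q \<le> _")
proof -
  let ?A = "{x \<in> {0..<n}. n dvd x * x - (-1)}"
  have cop: "coprime v n" if "(u, v) \<in> ?Q" for u v
  proof -
    have "n = u * u + v * v" "coprime u v" using that by auto
    moreover have "gcd v (v * v + u * u) = gcd v (u * u)" by (rule gcd_add_mult)
    ultimately have "gcd v n = gcd v (u * u)" by (simp add: add.commute)
    also have "\<dots> = 1" using that by (simp add: coprime_commute coprime_iff_gcd_eq_1[symmetric])
    finally show ?thesis by (simp add: coprime_iff_gcd_eq_1)
  qed
  define iv where "iv v = (SOME w. n dvd v * w - 1)" for v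
  have iv: "n dvd v * iv v - 1" if "coprime v n" for v
  proof -
    have "\<exists>w. [v * w = 1] (mod n)" using that cong_solve_coprime_int by blast
    then have "\<exists>w. n dvd v * w - 1" by (simp add: cong_iff_dvd_diff)
    then show ?thesis unfolding iv_def by (rule someI_ex)
  qed
  define f where "f = (\<lambda>(u, v). u * iv v mod n)"
  have fuv: "n dvd f (u, v) * v - u" if "(u, v) \<in> ?Q" for u v
  proof -
    have "n dvd (u * iv v mod n - u * iv v) * v + u * (v * iv v - 1)"
      using iv[OF cop[OF that]] by (intro dvd_add dvd_mult2 dvd_mult) (simp_all add: mod_eq_dvd_iff[symmetric])
    then show ?thesis by (simp add: f_def algebra_simps)
  qed
  have "inj_on f ?Q"
  proof (rule inj_onI)
    fix z z' assume z: "z \<in> ?Q" "z' \<in> ?Q" "f z = f z'"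
    obtain u v u' v' where zz: "z = (u, v)" "z' = (u', v')" by (cases z, cases z') auto
    have q: "u * u + v * v = n" "u' * u' + v' * v' = n" "coprime u v" "coprime u' v'" "u > 0" "u' > 0" "v \<ge> 0" "v' \<ge> 0"
      using z by (auto simp: zz)
    have d1: "n dvd f z * v - u" unfolding zz(1) by (rule fuv[OF z(1)[unfolded zz(1)]])
    have d2: "n dvd f z * v' - u'" unfolding z(3) zz(2) by (rule fuv[OF z(2)[unfolded zz(2)]])
    have "n dvd (f z * v' - u') * v - (f z * v - u) * v'" using d1 d2 by (intro dvd_diff[OF dvd_mult2 dvd_mult2])
    then have d: "n dvd u * v' - u' * v" by (simp add: algebra_simps)
    \<comment> \<open>\<open>a * b\<close> is at most the mean of \<open>a * a \<le> n\<close> and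
      \<open>b * b < n\<close>. Strictness comes from \<open>e > 0\<close>, which is supplied by
      \<open>u > 0\<close> in the quadrant.\<close>
    have lt: "a * b < n" if "a * a + c * c = n" "e * e + b * b = n" "e > 0" for a b c e :: int
    proof -
      have "e * e > 0" using that by simp
      moreover have "c * c \<ge> 0" by simp
      moreover have "(a - b) * (a - b) \<ge> 0" by simp
      then have "2 * (a * b) \<le> a * a + b * b" by (simp add: algebra_simps)
      ultimately show ?thesis using that by linarith
    qed
    have "u * v' < n" "u' * v < n" using lt[OF q(1) q(2) q(6)] lt[OF q(2) q(1) q(5)] by auto
    moreover have "0 \<le> u * v'" "0 \<le> u' * v" using q by auto
    ultimately have e: "u * v' = u' * v" using d by (intro dvd_diff_range_eq[of _ n]) auto
    have "u dvd u' * v" using e by (metis dvd_triv_left)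
    then have "u dvd u'" using q(3) by (simp add: coprime_dvd_mult_left_iff)
    moreover have "u' dvd u * v'" using e by (metis dvd_triv_left)
    then have "u' dvd u" using q(4) by (simp add: coprime_dvd_mult_left_iff)
    ultimately have "u = u'" using q by (simp add: zdvd_antisym_nonneg)
    then show "z = z'" using e q by (simp add: zz)
  qed
  moreover have "f ` ?Q \<subseteq> ?A"
  proof (rule image_subsetI)
    fix z assume z: "z \<in> ?Q"
    obtain u v where zz: "z = (u, v)" by (cases z)
    have q: "n = u * u + v * v" using z by (auto simp: zz)
    have c: "coprime v n" using cop z zz by blast
    have d: "n dvd f z * v - u" using fuv z zz by auto
    have "n dvd (f z * v - u) * (f z * v + u) + n * 1" using d by (intro dvd_add dvd_mult2) simp_all
    moreover have "(f z * v - u) * (f z * v + u) + n * 1 = (v * v) * (f z * f z - (-1))"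
      unfolding q by (simp add: algebra_simps)
    ultimately have "n dvd (v * v) * (f z * f z - (-1))" by (simp only:)
    then have "n dvd f z * f z - (-1)" using c by (simp add: coprime_commute coprime_dvd_mult_right_iff)
    then show "f z \<in> ?A" using n by (simp add: zz f_def)
  qed
  moreover have "finite ?A" by (rule finite_subset[of _ "{0..<n}"]) auto
  ultimately have "card ?Q \<le> card ?A" by (rule card_inj_on_le)
  also have "\<dots> \<le> tau n * 2"
  proof (rule card_sqrt_mod_le[OF n])
    fix e :: int assume e: "e > 0" "e * e dvd 4 * (-1)"
    show "e \<le> int 2"
    proof (rule ccontr)
      assume "\<not> e \<le> int 2"
      then have "3 * 3 \<le> e * e" by (intro mult_mono) auto
      moreover have "e * e \<le> 4" using e by (intro zdvd_imp_le) auto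
      ultimately show False by simp
    qed
  qed
  finally show ?thesis .
qed

text \<open>Dividing by the gcd \<open>g\<close> of the coordinates leads to primitive
  representations of \<open>n div (g * g)\<close>, and rotations by right angles move these into one
  quadrant. At most \<open>tau n\<close> values of \<open>g\<close> occur, each with at most
  \<open>8 * tau n\<close> primitive pairs.\<close>

lemma r2_le:
  fixes n :: int
  assumes n: "n > 0"
  shows "r2 n \<le> 8 * (tau n)\<^sup>2"
proof -
  let ?P = "{d. 0 < d \<and> d dvd n}"
  define S where "S k = {(u::int, v::int). u * u + v * v = k \<and> coprime u v}" for k
  define Q where "Q k = {(u::int, v::int). u * u + v * v = k \<and> coprime u v \<and> u > 0 \<and> v \<ge> 0}" for k
  have finS: "finite (S k)" for k unfolding S_def by (rule finite_subset[OF _ finite_r2[of k]]) auto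
  have finQ: "finite (Q k)" for k unfolding Q_def by (rule finite_subset[OF _ finite_r2[of k]]) auto
  have finP: "finite ?P" using n by (intro finite_posdvd) simp
  have finP': "finite {g \<in> ?P. g * g dvd n}" by (rule finite_subset[OF _ finP]) auto
  have S_le: "card (S k) \<le> 8 * tau k" if k: "k > 0" for k
  proof -
    let ?rot = "\<lambda>(u, v). (- v, u :: int)"
    have "S k \<subseteq> Q k \<union> ?rot ` Q k \<union> (\<lambda>(u, v). (- u, - v)) ` Q k \<union> (\<lambda>(u, v). (v, - u)) ` Q k"
    proof
      fix z assume z: "z \<in> S k"
      obtain u v where zz: "z = (u, v)" by (cases z)
      have uv: "u * u + v * v = k" "coprime u v" using z by (auto simp: S_def zz)
      then have "u \<noteq> 0 \<or> v \<noteq> 0" using k by auto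
      then consider "u > 0" "v \<ge> 0" | "u \<le> 0" "v > 0" | "u < 0" "v \<le> 0" | "u \<ge> 0" "v < 0" by linarith
      then show "z \<in> Q k \<union> ?rot ` Q k \<union> (\<lambda>(u, v). (- u, - v)) ` Q k \<union> (\<lambda>(u, v). (v, - u)) ` Q k"
      proof cases
        case 1 then show ?thesis using uv by (simp add: Q_def zz)
      next
        case 2
        then have "(v, - u) \<in> Q k" using uv by (simp add: Q_def coprime_commute add.commute)
        then have "?rot (v, - u) \<in> ?rot ` Q k" by (rule imageI)
        then show ?thesis by (simp add: zz)
      next
        case 3
        then have "(- u, - v) \<in> Q k" using uv by (simp add: Q_def)
        then have "(\<lambda>(u, v). (- u, - v)) (- u, - v) \<in> (\<lambda>(u, v). (- u, - v)) ` Q k" by (rule imageI)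
        then show ?thesis by (simp add: zz)
      next
        case 4
        then have "(- v, u) \<in> Q k" using uv by (simp add: Q_def coprime_commute add.commute)
        then have "(\<lambda>(u, v). (v, - u)) (- v, u) \<in> (\<lambda>(u, v). (v, - u)) ` Q k" by (rule imageI)
        then show ?thesis by (simp add: zz)
      qed
    qed
    then have "card (S k) \<le> card (Q k \<union> ?rot ` Q k \<union> (\<lambda>(u, v). (- u, - v)) ` Q k \<union> (\<lambda>(u, v). (v, - u)) ` Q k)"
      using finQ by (intro card_mono) auto
    also have "\<dots> \<le> card (Q k) + card (Q k) + card (Q k) + card (Q k)"
      by (intro order_trans[OF card_Un_le] add_mono card_image_le finQ order_refl)
    also have "\<dots> \<le> 8 * tau k" using r2_quadrant_le[OF k] by (simp add: Q_def)
    finally show ?thesis .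
  qed
  have "{(u::int, v::int). u * u + v * v = n} \<subseteq> (\<Union>g\<in>{g \<in> ?P. g * g dvd n}. (\<lambda>(u, v). (g * u, g * v)) ` S (n div (g * g)))"
  proof clarify
    fix u v :: int assume uv: "n = u * u + v * v"
    define g where "g = gcd u v"
    have g0: "g > 0" using n uv by (simp add: g_def) (metis gcd_pos_int mult_zero_left add_0 less_irrefl g_def)
    define a where "a = u div g"
    define b where "b = v div g"
    have ab: "u = g * a" "v = g * b" by (simp_all add: a_def b_def g_def)
    have "coprime a b" unfolding a_def b_def g_def using g0 by (intro div_gcd_coprime) (auto simp: g_def)
    have ngg: "n = (g * g) * (a * a + b * b)" unfolding uv ab by (simp add: algebra_simps)
    then have "n div (g * g) = a * a + b * b" using g0 by simp
    then have "(a, b) \<in> S (n div (g * g))" using \<open>coprime a b\<close> by (simp add: S_def)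
    then have "(u, v) \<in> (\<lambda>(u, v). (g * u, g * v)) ` S (n div (g * g))" using ab by force
    moreover have "g \<in> ?P" "g * g dvd n" using g0 ngg by (auto simp: mult.assoc)
    ultimately show "(u, v) \<in> (\<Union>g\<in>{g. g \<in> {d. 0 < d \<and> d dvd u * u + v * v} \<and> g * g dvd u * u + v * v}. (\<lambda>(u', v'). (g * u', g * v')) ` S ((u * u + v * v) div (g * g)))"
      unfolding uv[symmetric] by blast
  qed
  then have "r2 n \<le> card (\<Union>g\<in>{g \<in> ?P. g * g dvd n}. (\<lambda>(u, v). (g * u, g * v)) ` S (n div (g * g)))"
    unfolding r2_def using finP' finS by (intro card_mono finite_UN_I finite_imageI) auto
  also have "\<dots> \<le> (\<Sum>g\<in>{g \<in> ?P. g * g dvd n}. card ((\<lambda>(u, v). (g * u, g * v)) ` S (n div (g * g))))"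
    by (rule card_UN_le[OF finP'])
  also have "\<dots> \<le> (\<Sum>g\<in>{g \<in> ?P. g * g dvd n}. 8 * tau n)"
  proof (rule sum_mono)
    fix g assume g: "g \<in> {g \<in> ?P. g * g dvd n}"
    then obtain k where k: "n = (g * g) * k" by blast
    have k0: "k > 0" using g k n zero_less_mult_pos[of "g * g" k] by simp
    have "card ((\<lambda>(u, v). (g * u, g * v)) ` S (n div (g * g))) \<le> card (S k)"
      using g k card_image_le[OF finS] by simp
    also have "\<dots> \<le> 8 * tau k" by (rule S_le[OF k0])
    also have "tau k \<le> tau n" by (rule tau_mono) (use k n in auto)
    finally show "card ((\<lambda>(u, v). (g * u, g * v)) ` S (n div (g * g))) \<le> 8 * tau n" by simp
  qed
  also have "\<dots> = card {g \<in> ?P. g * g dvd n} * (8 * tau n)" by simp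
  also have "\<dots> \<le> card ?P * (8 * tau n)"
    by (intro mult_right_mono card_mono finP) auto
  finally show ?thesis by (simp add: tau_def power2_eq_square)
qed

section \<open>Integers composed of the primes of d\<close>

lemma smooth_decomposition:
  fixes r d k :: nat
  assumes "k \<ge> 1" "r > 0" "d > 0" "\<And>p. prime p \<Longrightarrow> p dvd r \<Longrightarrow> p dvd d"
  shows "\<exists>s t. r = s * t ^ k \<and> s dvd d ^ (k - 1)"
  using assms(2,4)
proof (induction r rule: less_induct)
  case (less r)
  show ?case
  proof (cases "\<exists>p. prime p \<and> p ^ k dvd r")
    case True
    then obtain p q where p: "prime p" "r = p ^ k * q" by blast
    have q: "q > 0" using p less.prems(1) by (cases q) auto
    have "1 < p ^ k" using assms(1) by (intro one_less_power prime_gt_1_nat p) auto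
    then have "q < r" using q p by simp
    moreover have "p' dvd d" if "prime p'" "p' dvd q" for p' using less.prems(2) that p by simp
    ultimately obtain s t where "q = s * t ^ k" "s dvd d ^ (k - 1)" using less.IH[OF _ q] by blast
    then have "r = s * (p * t) ^ k" by (simp add: p power_mult_distrib mult_ac)
    then show ?thesis using \<open>s dvd d ^ (k - 1)\<close> by blast
  next
    case False
    \<comment> \<open>No prime occurs in \<open>r\<close> to the power \<open>k\<close>, and every
      prime of \<open>r\<close> divides \<open>d\<close>, so its multiplicity is at most
      \<open>k - 1\<close> times that in \<open>d\<close>.\<close>
    have "r dvd d ^ (k - 1)"
    proof (rule multiplicity_le_imp_dvd)
      fix p :: nat assume p: "prime p"
      show "multiplicity p r \<le> multiplicity p (d ^ (k - 1))"
      proof (cases "p dvd r")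
        case True
        then have "p dvd d" using p less.prems by blast
        then have "multiplicity p d \<ge> 1" using p assms(3) by (metis One_nat_def Suc_leI multiplicity_gt_zero_iff not_prime_unit neq0_conv)
        moreover have "\<not> k \<le> multiplicity p r" using False p by (metis multiplicity_dvd')
        moreover have "multiplicity p (d ^ (k - 1)) = (k - 1) * multiplicity p d"
          using p assms(3) by (simp add: prime_elem_multiplicity_power_distrib)
        ultimately show ?thesis by (metis le_SucE less_Suc_eq_le mult.right_neutral mult_le_mono2 not_less order_trans Suc_pred' assms(1) less_eq_Suc_le One_nat_def)
      next
        case False
        then show ?thesis by (simp add: not_dvd_imp_multiplicity_0)
      qed
    qed (use less.prems in simp)
    then show ?thesis by (intro exI[of _ r] exI[of _ 1]) simp
  qed
qed

text \<open>Write \<open>r = s * t ^ k\<close> with \<open>s\<close> dividing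
  \<open>d ^ (k - 1)\<close>: there are few \<open>s\<close> by the divisor bound and at most
  \<open>M powr (1 / k)\<close> values of \<open>t\<close>. Taking \<open>k \<ge> 2 / e\<close>
  leaves each factor the exponent \<open>e / 2\<close>; the exponent \<open>e'\<close> is small
  enough to compensate the power \<open>k - 1\<close> of \<open>d\<close>.\<close>

lemma smooth_count_bound:
  assumes e: "e > (0::real)"
  obtains C where "C \<ge> 1"
    "\<And>M d. d > 0 \<Longrightarrow> d \<le> M \<Longrightarrow> real (card {r \<in> {1..M::nat}. \<forall>p. prime p \<longrightarrow> p dvd r \<longrightarrow> p dvd d}) \<le> C * real M powr e"
proof -
  define k where "k = nat \<lceil>2 / e\<rceil>"
  have k2: "2 / e \<le> real k" unfolding k_def by linarith
  then have "real k > 0" using e by (smt (verit) divide_pos_pos)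
  then have k1: "k \<ge> 1" by simp
  have ke: "1 / real k \<le> e / 2" using k2 e k1 by (simp add: field_simps)
  define e' where "e' = e / (2 * real k)"
  have e': "e' > 0" using e k1 by (simp add: e'_def)
  from ntau_bound[OF e'] obtain C where C: "C \<ge> 1" "\<And>n. n > 0 \<Longrightarrow> real (ntau n) \<le> C * real n powr e'" by blast
  have "real (card {r \<in> {1..M}. \<forall>p. prime p \<longrightarrow> p dvd r \<longrightarrow> p dvd d}) \<le> C * real M powr e"
    if d: "d > 0" "d \<le> M" for M d :: nat
  proof -
    have M: "real M \<ge> 1" using d by simp
    define T where "T = nat \<lfloor>real M powr (1 / real k)\<rfloor>"
    have sub: "{r \<in> {1..M}. \<forall>p. prime p \<longrightarrow> p dvd r \<longrightarrow> p dvd d} \<subseteq> (\<lambda>(s, t). s * t ^ k) ` ({s. s dvd d ^ (k - 1)} \<times> {1..T})"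
    proof
      fix r assume r: "r \<in> {r \<in> {1..M}. \<forall>p. prime p \<longrightarrow> p dvd r \<longrightarrow> p dvd d}"
      then obtain s t where st: "r = s * t ^ k" "s dvd d ^ (k - 1)"
        using smooth_decomposition[OF k1 _ d(1), of r] by fastforce
      have rpos: "r > 0" "r \<le> M" using r by simp_all
      have s: "s \<ge> 1" using rpos(1) st(1) by (cases "s = 0") simp_all
      have t1: "t \<ge> 1" using rpos(1) st(1) k1 by (cases "t = 0") (simp_all add: power_0_left)
      have "1 * t ^ k \<le> s * t ^ k" using s by (intro mult_right_mono) auto
      then have "t ^ k \<le> M" using rpos(2) unfolding st(1) by linarith
      then have "real t ^ k \<le> real M" by (metis of_nat_le_iff of_nat_power)
      then have "(real t ^ k) powr (1 / real k) \<le> real M powr (1 / real k)" by (intro powr_mono2) auto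
      also have "(real t ^ k) powr (1 / real k) = real t" using t1 k1 by (simp add: powr_powr flip: powr_realpow)
      finally have "t \<le> T" unfolding T_def by linarith
      then show "r \<in> (\<lambda>(s, t). s * t ^ k) ` ({s. s dvd d ^ (k - 1)} \<times> {1..T})" using st t1 by force
    qed
    have fin: "finite {s. s dvd d ^ (k - 1)}" using d by (intro finite_ndvd) simp
    have "card {r \<in> {1..M}. \<forall>p. prime p \<longrightarrow> p dvd r \<longrightarrow> p dvd d} \<le> card ({s. s dvd d ^ (k - 1)} \<times> {1..T})"
      using fin by (intro surj_card_le[OF _ sub]) auto
    also have "\<dots> = ntau (d ^ (k - 1)) * T" by (simp add: card_cartesian_product ntau_def)
    finally have "real (card {r \<in> {1..M}. \<forall>p. prime p \<longrightarrow> p dvd r \<longrightarrow> p dvd d}) \<le> real (ntau (d ^ (k - 1))) * real T"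
      by (simp only: of_nat_le_iff flip: of_nat_mult)
    also have "\<dots> \<le> (C * real M powr (e / 2)) * real M powr (e / 2)"
    proof (intro mult_mono)
      have "real (ntau (d ^ (k - 1))) \<le> C * real (d ^ (k - 1)) powr e'" using C(2)[of "d ^ (k - 1)"] d by simp
      also have "real (d ^ (k - 1)) powr e' = real d powr (real (k - 1) * e')"
        using d by (simp add: powr_powr flip: powr_realpow)
      also have "\<dots> \<le> real M powr (real (k - 1) * e')" using d e' by (intro powr_mono2) auto
      also have "\<dots> \<le> real M powr (e / 2)"
      proof (rule powr_mono[OF _ M])
        have "real (k - 1) * e' \<le> real k * e'" using e' by (intro mult_right_mono) auto
        also have "\<dots> = e / 2" using k1 by (simp add: e'_def)
        finally show "real (k - 1) * e' \<le> e / 2" .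
      qed
      finally show "real (ntau (d ^ (k - 1))) \<le> C * real M powr (e / 2)" using C(1) by simp
      have "real T \<le> real M powr (1 / real k)" unfolding T_def by simp
      also have "\<dots> \<le> real M powr (e / 2)" by (rule powr_mono[OF ke M])
      finally show "real T \<le> real M powr (e / 2)" .
    qed (use C(1) in auto)
    also have "\<dots> = C * real M powr e" using M by (simp flip: powr_add)
    finally show ?thesis .
  qed
  then show ?thesis using C(1) that by blast
qed

section \<open>The Moebius function\<close>

definition mu :: "nat \<Rightarrow> real" where
  "mu n = (if squarefree n then (-1) ^ card (prime_factors n) else 0)"

lemma squarefree_eq_prod_prime_factors:
  assumes "squarefree (n::nat)" shows "n = \<Prod>(prime_factors n)"
proof -
  have n: "n > 0" using assms by (cases n) auto
  have "n = (\<Prod>p\<in>prime_factors n. p ^ multiplicity p n)" by (rule prime_factorization_nat[OF n])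
  also have "\<dots> = (\<Prod>p\<in>prime_factors n. p)"
    using assms n by (intro prod.cong refl) (simp add: squarefree_factorial_semiring')
  finally show ?thesis .
qed

lemma prime_factors_prod_primes:
  assumes "finite A" "\<And>p. p \<in> A \<Longrightarrow> prime (p::nat)"
  shows "prime_factors (\<Prod>A) = A"
proof -
  have "0 \<notin> A" using assms(2) not_prime_0 by blast
  then have "prime_factors (\<Prod>A) = \<Union>((prime_factors \<circ> (\<lambda>x. x)) ` A)"
    by (intro prime_factors_prod assms(1)) simp
  also have "\<dots> = (\<Union>p\<in>A. prime_factors p)" by (simp only: comp_def)
  also have "\<dots> = (\<Union>p\<in>A. {p})"
    using assms(2) by (intro SUP_cong refl) (simp add: prime_prime_factors)
  also have "\<dots> = A" by simp
  finally show ?thesis .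
qed

lemma squarefree_prod_primes:
  assumes "finite A" "\<And>p. p \<in> A \<Longrightarrow> prime (p::nat)"
  shows "squarefree (\<Prod>A)"
  using squarefree_prod_coprime[of A id] assms by (auto simp: primes_coprime squarefree_prime)

lemma squarefree_divisors_bij:
  assumes n: "n > (0::nat)"
  shows "bij_betw (\<lambda>A. \<Prod>A) (Pow (prime_factors n)) {e. e dvd n \<and> squarefree e}"
proof (rule bij_betwI[of _ _ _ prime_factors])
  have fin: "finite A" if "A \<in> Pow (prime_factors n)" for A using that finite_subset by auto
  show "(\<lambda>A. \<Prod>A) \<in> Pow (prime_factors n) \<rightarrow> {e. e dvd n \<and> squarefree e}"
  proof
    fix A assume A: "A \<in> Pow (prime_factors n)"
    have "\<Prod>A dvd \<Prod>(prime_factors n)" using A by (intro prod_dvd_prod_subset) auto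
    also have "\<dots> dvd (\<Prod>p\<in>prime_factors n. p ^ multiplicity p n)"
      by (intro prod_dvd_prod dvd_power) (auto simp: prime_factors_multiplicity)
    also have "\<dots> = n" by (rule prime_factorization_nat[OF n, symmetric])
    finally show "\<Prod>A \<in> {e. e dvd n \<and> squarefree e}"
      using A fin[OF A] by (auto intro: squarefree_prod_primes)
  qed
  show "prime_factors \<in> {e. e dvd n \<and> squarefree e} \<rightarrow> Pow (prime_factors n)"
  proof
    fix e assume "e \<in> {e. e dvd n \<and> squarefree e}"
    then have "prime_factors e \<subseteq> prime_factors n" using n by (intro dvd_prime_factors) auto
    then show "prime_factors e \<in> Pow (prime_factors n)" by simp
  qed
  show "prime_factors (\<Prod>A) = A" if "A \<in> Pow (prime_factors n)" for A
    using that fin[OF that] by (intro prime_factors_prod_primes) auto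
  show "\<Prod>(prime_factors e) = e" if "e \<in> {e. e dvd n \<and> squarefree e}" for e
    using that squarefree_eq_prod_prime_factors[of e] by simp
qed

text \<open>The product is expanded over subsets of the prime factors; each subset corresponds to
  the squarefree divisor that is its product.\<close>

lemma sum_mu_divisors:
  fixes g :: "nat \<Rightarrow> real"
  assumes n: "n > 0"
  shows "(\<Sum>e | e dvd n. mu e * (\<Prod>p\<in>prime_factors e. g p)) = (\<Prod>p\<in>prime_factors n. 1 - g p)"
proof -
  let ?f = "\<lambda>e. mu e * (\<Prod>p\<in>prime_factors e. g p)"
  have "(\<Sum>e | e dvd n. ?f e) = (\<Sum>e | e dvd n \<and> squarefree e. ?f e)"
    using n by (intro sum.mono_neutral_right) (auto simp: finite_ndvd mu_def)
  also have "\<dots> = (\<Sum>A\<in>Pow (prime_factors n). ?f (\<Prod>A))"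
    by (rule sum.reindex_bij_betw[OF squarefree_divisors_bij[OF n], symmetric])
  also have "\<dots> = (\<Sum>A\<in>Pow (prime_factors n). (\<Prod>p\<in>A. - g p) * (\<Prod>p\<in>prime_factors n - A. 1))"
  proof (rule sum.cong[OF refl])
    fix A assume A: "A \<in> Pow (prime_factors n)"
    have fA: "finite A" using A finite_subset by auto
    have p: "\<And>p. p \<in> A \<Longrightarrow> prime p" using A by auto
    have "prime_factors (\<Prod>A) = A" "squarefree (\<Prod>A)"
      using prime_factors_prod_primes[OF fA p] squarefree_prod_primes[OF fA p] by auto
    then show "?f (\<Prod>A) = (\<Prod>p\<in>A. - g p) * (\<Prod>p\<in>prime_factors n - A. 1)"
      by (simp add: mu_def prod_uminus)
  qed
  also have "\<dots> = (\<Prod>p\<in>prime_factors n. - g p + 1)" by (rule prod_add[symmetric]) simp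
  finally show ?thesis by simp
qed

lemma sum_mu_divisors_1:
  assumes "n > 0" shows "(\<Sum>e | e dvd n. mu e) = (if n = 1 then 1 else 0)"
proof -
  have "(\<Sum>e | e dvd n. mu e) = (\<Prod>p\<in>prime_factors n. 1 - 1::real)"
    using sum_mu_divisors[OF assms, of "\<lambda>_. 1"] by simp
  also have "\<dots> = (if n = 1 then 1 else 0)"
  proof (cases "n = 1")
    case False
    then obtain p where "p \<in> prime_factors n" using assms prime_factor_nat
      by (metis in_prime_factors_iff neq0_conv)
    then show ?thesis using False by (auto simp: card_gt_0_iff)
  qed simp
  finally show ?thesis .
qed

lemma abs_mu_le_1: "\<bar>mu n\<bar> \<le> 1"
  by (simp add: mu_def)

text \<open>\<open>d\<^sup>2\<close> divides \<open>n\<close> exactly when \<open>d\<close> divides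
  \<open>square_part n\<close>, so this is the usual divisor sum taken at
  \<open>square_part n\<close>.\<close>

lemma sum_mu_square_divisors:
  assumes n: "n > (0::nat)"
  shows "(\<Sum>d | d\<^sup>2 dvd n. mu d) = (if squarefree n then 1 else 0)"
proof -
  have "(\<Sum>d | d\<^sup>2 dvd n. mu d) = (\<Sum>d | d dvd square_part n. mu d)"
    by (simp add: dvd_square_part_iff)
  also have "\<dots> = (if square_part n = 1 then 1 else 0)"
    using n by (intro sum_mu_divisors_1) (simp add: neq0_conv[symmetric] del: neq0_conv)
  also have "square_part n = 1 \<longleftrightarrow> squarefree n"
    unfolding squarefree_def dvd_square_part_iff[symmetric] by (metis dvd_refl nat_dvd_1_iff_1)
  finally show ?thesis .
qed

lemma mu_mult_prime:
  assumes "prime p" "\<not> p dvd e" "e > 0"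
  shows "mu (p * e) = - mu e"
proof -
  have "coprime p e" using assms by (simp add: prime_imp_coprime)
  then have "squarefree (p * e) \<longleftrightarrow> squarefree e"
    using assms by (auto simp: squarefree_prime intro: squarefree_mult_coprime dest: squarefree_multD)
  moreover have "prime_factors (p * e) = insert p (prime_factors e)" "p \<notin> prime_factors e"
    using assms prime_gt_0_nat[OF assms(1)] by (auto simp: prime_factors_product prime_prime_factors)
  ultimately show ?thesis by (simp add: mu_def)
qed

section \<open>Hyperbola points in residue classes\<close>

lemma finite_interval_filter: "finite {b \<in> {x..<y::int}. P b}"
  by (rule finite_subset[of _ "{x..<y}"]) auto

lemma card_residue_interval:
  fixes lo Q r :: int
  assumes Q: "Q > 0"
  shows "card {b \<in> {lo..<lo + Q * int L}. b mod Q = r mod Q} = L"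
proof (induction L)
  case (Suc L)
  define x where "x = lo + Q * int L"
  define b0 where "b0 = x + (r - x) mod Q"
  have b0: "x \<le> b0" "b0 < x + Q" "b0 mod Q = r mod Q"
    using Q by (simp_all add: b0_def mod_add_right_eq)
  have "{b \<in> {x..<x + Q}. b mod Q = r mod Q} = {b0}"
  proof (intro equalityI subsetI)
    fix b assume b: "b \<in> {b \<in> {x..<x + Q}. b mod Q = r mod Q}"
    then have "Q dvd (b - x) - (b0 - x)" using b0 by (simp add: mod_eq_dvd_iff[symmetric])
    then have "b - x = b0 - x" using b b0 by (intro dvd_diff_range_eq[of _ Q]) auto
    then show "b \<in> {b0}" by simp
  qed (use b0 in auto)
  moreover have "{b \<in> {lo..<lo + Q * int (Suc L)}. b mod Q = r mod Q}
      = {b \<in> {lo..<x}. b mod Q = r mod Q} \<union> {b \<in> {x..<x + Q}. b mod Q = r mod Q}"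
  proof -
    have "lo \<le> x" using Q by (simp add: x_def)
    moreover have "lo + Q * int (Suc L) = x + Q" by (simp add: x_def algebra_simps)
    ultimately show ?thesis using Q by auto
  qed
  moreover have "card ({b \<in> {lo..<x}. b mod Q = r mod Q} \<union> {b \<in> {x..<x + Q}. b mod Q = r mod Q})
      = card {b \<in> {lo..<x}. b mod Q = r mod Q} + card {b \<in> {x..<x + Q}. b mod Q = r mod Q}"
    by (intro card_Un_disjoint) (auto intro: finite_subset[of _ "{lo..<x}"] finite_subset[of _ "{x..<x + Q}"])
  ultimately show ?case using Suc.IH by (simp add: x_def)
qed simp

lemma card_residue_interval_bounds:
  fixes lo Q r N :: int
  assumes Q: "Q > 0" and N: "N \<ge> 0"
  shows "\<bar>real (card {b \<in> {lo..<lo + N}. b mod Q = r mod Q}) - of_int N / of_int Q\<bar> \<le> 1"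
proof -
  define L where "L = nat (N div Q)"
  have L: "int L = N div Q" using N Q by (simp add: L_def pos_imp_zdiv_nonneg_iff)
  have "N = Q * (N div Q) + N mod Q" by simp
  then have NL: "Q * int L \<le> N" "N < Q * int (Suc L)"
    using pos_mod_sign[OF Q, of N] pos_mod_bound[OF Q, of N] unfolding L[symmetric] by (simp_all add: distrib_left)
  note fin = finite_interval_filter
  have "{b \<in> {lo..<lo + Q * int L}. b mod Q = r mod Q} \<subseteq> {b \<in> {lo..<lo + N}. b mod Q = r mod Q}"
    using NL by auto
  from card_mono[OF fin this] have 1: "L \<le> card {b \<in> {lo..<lo + N}. b mod Q = r mod Q}"
    by (simp only: card_residue_interval[OF Q])
  have "{b \<in> {lo..<lo + N}. b mod Q = r mod Q} \<subseteq> {b \<in> {lo..<lo + Q * int (Suc L)}. b mod Q = r mod Q}"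
    using NL by auto
  from card_mono[OF fin this] have 2: "card {b \<in> {lo..<lo + N}. b mod Q = r mod Q} \<le> Suc L"
    by (simp only: card_residue_interval[OF Q])
  have "real_of_int (Q * int L) \<le> of_int N" "of_int N < real_of_int (Q * int (Suc L))"
    using NL by (simp_all only: of_int_le_iff of_int_less_iff)
  then have "real L \<le> of_int N / of_int Q" "of_int N / of_int Q \<le> real L + 1"
    using Q by (simp_all add: field_simps)
  then show ?thesis using 1 2 by linarith
qed

text \<open>Multiplication by \<open>w\<close> is injective on classes modulo \<open>m\<close>, so
  each residue is hit by at most one class of \<open>b\<close>, that is at most
  \<open>N / m + 1\<close> times.\<close>

lemma sum_periodic_le:
  fixes lo m w N :: int and F :: "int \<Rightarrow> real"
  assumes m: "m > 0" and N: "N \<ge> 0" and w: "coprime w m" and F: "\<And>u. F u \<ge> 0"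
  shows "(\<Sum>b\<in>{lo..<lo + N}. F (w * b mod m)) \<le> (of_int N / of_int m + 1) * (\<Sum>u\<in>{0..<m}. F u)"
proof -
  have fib: "real (card {b \<in> {lo..<lo + N}. w * b mod m = u}) \<le> of_int N / of_int m + 1" for u
  proof (cases "{b \<in> {lo..<lo + N}. w * b mod m = u} = {}")
    case True
    then show ?thesis using m N by (simp only: card.empty) simp
  next
    case False
    then obtain b0 where b0: "w * b0 mod m = u" by blast
    have "{b \<in> {lo..<lo + N}. w * b mod m = u} \<subseteq> {b \<in> {lo..<lo + N}. b mod m = b0 mod m}"
    proof clarify
      fix b assume "u = w * b mod m"
      then have "w * b mod m = w * b0 mod m" using b0 by simp
      then have "m dvd w * b - w * b0" by (simp only: mod_eq_dvd_iff)
      then have "m dvd w * (b - b0)" by (simp add: algebra_simps)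
      then have "m dvd b - b0" using w by (simp add: coprime_commute coprime_dvd_mult_right_iff)
      then show "b mod m = b0 mod m" by (simp add: mod_eq_dvd_iff)
    qed
    then have "card {b \<in> {lo..<lo + N}. w * b mod m = u} \<le> card {b \<in> {lo..<lo + N}. b mod m = b0 mod m}"
      by (rule card_mono[OF finite_interval_filter])
    then show ?thesis using card_residue_interval_bounds[OF m N, of lo b0] by linarith
  qed
  have "(\<Sum>b\<in>{lo..<lo + N}. F (w * b mod m))
      = (\<Sum>u\<in>{0..<m}. of_nat (card {b \<in> {lo..<lo + N}. w * b mod m = u}) * F u)"
    using m by (intro sum_fun_comp) auto
  also have "\<dots> \<le> (\<Sum>u\<in>{0..<m}. (of_int N / of_int m + 1) * F u)"
    by (intro sum_mono mult_right_mono fib F)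
  finally show ?thesis by (simp add: sum_distrib_left)
qed

text \<open>The box has step \<open>Q\<close>, so all its points share the residue class of
  \<open>(b, c)\<close> modulo \<open>Q\<close>; the hyperbola is \<open>x * y = -1\<close> modulo
  \<open>m\<close>.\<close>

definition step_count :: "int \<Rightarrow> int \<Rightarrow> int \<Rightarrow> int \<Rightarrow> int \<Rightarrow> nat" where
  "step_count m Q T b c = card {(i, j) \<in> {0..<T} \<times> {0..<T}. m dvd (b + Q * i) * (c + Q * j) + 1}"

definition class_pts :: "int \<Rightarrow> (int \<times> int) set \<Rightarrow> int \<Rightarrow> int \<Rightarrow> (int \<times> int) set" where
  "class_pts Q S lo hi = {(b, c) \<in> {lo..<hi} \<times> {lo..<hi}. (b mod Q, c mod Q) \<in> S}"

lemma finite_class_pts [simp]: "finite (class_pts Q S lo hi)"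
  unfolding class_pts_def by (rule finite_subset[of _ "{lo..<hi} \<times> {lo..<hi}"]) auto

lemma card_class_pts:
  assumes Q: "Q > 0" and S: "S \<subseteq> {0..<Q} \<times> {0..<Q}"
  shows "card (class_pts Q S lo (lo + Q * int L)) = card S * L\<^sup>2"
proof -
  let ?P = "class_pts Q S lo (lo + Q * int L)"
  let ?g = "\<lambda>p. (fst p mod Q, snd p mod Q)"
  have finS: "finite S" by (rule finite_subset[OF S]) simp
  have "card ?P = (\<Sum>p\<in>?P. (\<lambda>_. 1) (?g p))" by simp
  also have "\<dots> = (\<Sum>s\<in>S. of_nat (card {p \<in> ?P. ?g p = s}) * (\<lambda>_. 1) s)"
    by (rule sum_fun_comp[OF finite_class_pts finS]) (auto simp: class_pts_def)
  also have "\<dots> = (\<Sum>s\<in>S. L\<^sup>2)"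
  proof (rule sum.cong[OF refl])
    fix s assume s: "s \<in> S"
    then have r: "fst s mod Q = fst s" "snd s mod Q = snd s" using S by auto
    have "{p \<in> ?P. ?g p = s} = {b \<in> {lo..<lo + Q * int L}. b mod Q = fst s mod Q} \<times> {b \<in> {lo..<lo + Q * int L}. b mod Q = snd s mod Q}"
      using s unfolding r by (auto simp: class_pts_def)
    then have "card {p \<in> ?P. ?g p = s} = L * L"
      by (simp only: card_cartesian_product card_residue_interval[OF Q])
    then show "of_nat (card {p \<in> ?P. ?g p = s}) * (\<lambda>_. 1) s = L\<^sup>2" by (simp add: power2_eq_square)
  qed
  finally show ?thesis by simp
qed

text \<open>Dividing both coordinates by \<open>Q\<close> modulo \<open>m\<close> turns steps of
  length \<open>Q\<close> into unit steps and the hyperbola into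
  \<open>x * y = - qi\<^sup>2\<close>, where \<open>qi\<close> is the inverse of
  \<open>Q\<close>.\<close>

lemma step_count_eq_box_count:
  assumes m: "m > 0" and qi: "m dvd Q * qi - 1" and Q: "coprime Q m"
  shows "step_count m Q T b c = box_count m (- (qi * qi)) T (qi * b mod m) (qi * c mod m)"
proof -
  have "m dvd (b + Q * i) * (c + Q * j) + 1 \<longleftrightarrow> m dvd (qi * b mod m + i) * (qi * c mod m + j) - (- (qi * qi))" for i j
  proof -
    define u v where "u = qi * b mod m" and "v = qi * c mod m"
    have ud: "m dvd b - Q * u" if "u = qi * b mod m" for u b
    proof -
      have "m dvd qi * b - qi * b mod m" by (simp add: mod_eq_dvd_iff[symmetric])
      then have "m dvd Q * (qi * b - qi * b mod m) - (Q * qi - 1) * b"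
        by (intro dvd_diff[OF dvd_mult dvd_mult2[OF qi]])
      then show ?thesis by (simp add: that algebra_simps)
    qed
    have "m dvd (b - Q * u) * (c + Q * j) + (Q * u + Q * i) * (c - Q * v) - (Q * qi - 1) * (Q * qi + 1)"
      by (intro dvd_diff[OF dvd_add[OF dvd_mult2[OF ud[OF u_def]] dvd_mult[OF ud[OF v_def]]] dvd_mult2[OF qi]])
    then have d: "m dvd ((b + Q * i) * (c + Q * j) + 1) - (Q * Q) * ((u + i) * (v + j) - (- (qi * qi)))"
      by (simp add: algebra_simps)
    have "m dvd (b + Q * i) * (c + Q * j) + 1 \<longleftrightarrow> m dvd (Q * Q) * ((u + i) * (v + j) - (- (qi * qi)))"
      using dvd_add_right_iff[OF d, of "(Q * Q) * ((u + i) * (v + j) - (- (qi * qi)))"] by simp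
    also have "\<dots> \<longleftrightarrow> m dvd (u + i) * (v + j) - (- (qi * qi))"
      using Q by (intro coprime_dvd_mult_right_iff) (simp add: coprime_commute)
    finally show ?thesis by (simp add: u_def v_def)
  qed
  then show ?thesis by (simp add: step_count_def box_count_def)
qed

lemma card_hyp_eq_units:
  assumes m: "m > 0" and n: "coprime n m"
  shows "card (hyp m n) = card (hyp m 1)"
proof (rule antisym[OF card_hyp_le_units[OF m n]])
  have "(\<lambda>(x, y). (x, n * y mod m)) ` hyp m 1 \<subseteq> hyp m n"
  proof clarify
    fix x y assume xy: "(x, y) \<in> hyp m 1"
    have "m dvd x * (n * y mod m - n * y) + n * (x * y - 1)"
      using xy by (intro dvd_add dvd_mult) (simp_all add: hyp_def mod_eq_dvd_iff[symmetric])
    then have "m dvd x * (n * y mod m) - n" by (simp add: algebra_simps)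
    then show "(x, n * y mod m) \<in> hyp m n" using m xy by (simp add: hyp_def)
  qed
  moreover have "inj_on (\<lambda>(x, y). (x, n * y mod m)) (hyp m 1)"
    using hyp_unique[of _ _ m 1] by (auto simp: inj_on_def)
  ultimately show "card (hyp m 1) \<le> card (hyp m n)" by (intro card_inj_on_le[of _ "hyp m 1"]) auto
qed

text \<open>Cauchy-Schwarz over the base points in the class set. The second moment is enlarged to
  all base points of the square; modulo \<open>m\<close> these cover each residue at most
  \<open>w\<close> times in each coordinate, so it is at most \<open>w\<^sup>2\<close> times the
  full variance. The restriction to classes survives in the number \<open>card S * L\<^sup>2\<close>
  of terms.\<close>

lemma class_sum_deviation:
  fixes m Q T lo :: int and TM :: real
  assumes m: "m > 0" and Q: "Q > 0" and mQ: "coprime Q m" and T: "T > 0" and Tm: "m \<le> T\<^sup>2"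
    and TM: "\<And>N. N \<noteq> 0 \<Longrightarrow> \<bar>N\<bar> \<le> m\<^sup>2 \<Longrightarrow> real (tau N) \<le> TM"
    and S: "S \<subseteq> {0..<Q} \<times> {0..<Q}"
  defines "V \<equiv> 14 * of_int T ^ 3 * sqrt (of_int m) * harm_int m * TM\<^sup>2"
    and "mean \<equiv> (of_int T)\<^sup>2 * real (card (hyp m 1)) / (of_int m)\<^sup>2"
  shows "\<bar>(\<Sum>(b, c)\<in>class_pts Q S lo (lo + Q * int L). real (step_count m Q T b c)) - real (card S) * (real L)\<^sup>2 * mean\<bar>
    \<le> sqrt (real (card S)) * real L * (of_int Q * real L / of_int m + 1) * sqrt V"
proof -
  let ?P = "class_pts Q S lo (lo + Q * int L)" and ?I = "{lo..<lo + Q * int L}" and ?R = "{0..<m}"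
  obtain qi where "[Q * qi = 1] (mod m)" using mQ cong_solve_coprime_int by blast
  then have qi: "m dvd Q * qi - 1" by (simp add: cong_iff_dvd_diff)
  have cqi: "coprime qi m"
  proof -
    have "[qi * Q = 1] (mod m)" using qi by (simp add: cong_iff_dvd_diff mult.commute)
    then show ?thesis using coprime_iff_invertible_int by blast
  qed
  define n where "n = - (qi * qi)"
  have n: "coprime n m" using cqi by (simp add: n_def)
  define w where "w = of_int Q * real L / of_int m + 1"
  have w0: "w \<ge> 0" using Q m by (simp add: w_def)
  define F where "F u v = (real (box_count m n T u v) - mean)\<^sup>2" for u v
  define G where "G b c = real (step_count m Q T b c) - mean" for b c
  have GF: "(G b c)\<^sup>2 = F (qi * b mod m) (qi * c mod m)" for b c
    by (simp add: G_def F_def step_count_eq_box_count[OF m qi mQ] n_def)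
  have mean_eq: "mean = (of_int T)\<^sup>2 * real (card (hyp m n)) / (of_int m)\<^sup>2"
    by (simp add: mean_def card_hyp_eq_units[OF m n])
  have var: "(\<Sum>u\<in>?R. \<Sum>v\<in>?R. F u v) \<le> V"
    unfolding F_def mean_eq V_def by (rule box_count_variance_le[OF m T Tm n TM])
  have "(\<Sum>b\<in>?I. \<Sum>c\<in>?I. (G b c)\<^sup>2) \<le> (\<Sum>b\<in>?I. w * (\<Sum>v\<in>?R. F (qi * b mod m) v))"
  proof (rule sum_mono)
    fix b
    show "(\<Sum>c\<in>?I. (G b c)\<^sup>2) \<le> w * (\<Sum>v\<in>?R. F (qi * b mod m) v)"
      using sum_periodic_le[OF m _ cqi, of "Q * int L" "F (qi * b mod m)" lo] Q
      by (simp add: GF w_def F_def)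
  qed
  also have "\<dots> = w * (\<Sum>b\<in>?I. (\<lambda>u. \<Sum>v\<in>?R. F u v) (qi * b mod m))" by (simp add: sum_distrib_left)
  also have "\<dots> \<le> w * (w * (\<Sum>u\<in>?R. \<Sum>v\<in>?R. F u v))"
  proof (rule mult_left_mono[OF _ w0])
    show "(\<Sum>b\<in>?I. (\<lambda>u. \<Sum>v\<in>?R. F u v) (qi * b mod m)) \<le> w * (\<Sum>u\<in>?R. \<Sum>v\<in>?R. F u v)"
      using sum_periodic_le[OF m _ cqi, of "Q * int L" "\<lambda>u. \<Sum>v\<in>?R. F u v" lo] Q
      by (simp add: w_def F_def sum_nonneg)
  qed
  also have "\<dots> \<le> w * (w * V)" using var w0 by (intro mult_left_mono) auto
  finally have all: "(\<Sum>b\<in>?I. \<Sum>c\<in>?I. (G b c)\<^sup>2) \<le> w\<^sup>2 * V" by (simp add: power2_eq_square mult.assoc)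
  have PG: "(\<Sum>p\<in>?P. (G (fst p) (snd p))\<^sup>2) \<le> w\<^sup>2 * V"
  proof -
    have "(\<Sum>p\<in>?P. (G (fst p) (snd p))\<^sup>2) \<le> (\<Sum>p\<in>?I \<times> ?I. (G (fst p) (snd p))\<^sup>2)"
      by (intro sum_mono2) (auto simp: class_pts_def)
    also have "\<dots> = (\<Sum>b\<in>?I. \<Sum>c\<in>?I. (G b c)\<^sup>2)" by (simp add: sum.cartesian_product case_prod_unfold)
    finally show ?thesis using all by simp
  qed
  have cP: "real (card ?P) = real (card S) * (real L)\<^sup>2" by (simp add: card_class_pts[OF Q S])
  have "(\<Sum>p\<in>?P. 1 * G (fst p) (snd p))\<^sup>2 \<le> (\<Sum>p\<in>?P. 1\<^sup>2) * (\<Sum>p\<in>?P. (G (fst p) (snd p))\<^sup>2)"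
    by (rule Cauchy_Schwarz_ineq_sum)
  also have "\<dots> \<le> (real (card S) * (real L)\<^sup>2) * (w\<^sup>2 * V)"
    using PG cP by (simp add: mult_left_mono)
  finally have "sqrt ((\<Sum>p\<in>?P. G (fst p) (snd p))\<^sup>2) \<le> sqrt ((real (card S) * (real L)\<^sup>2) * (w\<^sup>2 * V))"
    by (simp only: mult_1 real_sqrt_le_iff)
  then have "\<bar>\<Sum>p\<in>?P. G (fst p) (snd p)\<bar> \<le> sqrt (real (card S)) * real L * w * sqrt V"
    using w0 by (simp add: real_sqrt_mult)
  moreover have "(\<Sum>p\<in>?P. G (fst p) (snd p)) = (\<Sum>(b, c)\<in>?P. real (step_count m Q T b c)) - real (card S) * (real L)\<^sup>2 * mean"
    by (simp add: G_def sum_subtractf case_prod_unfold cP)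
  ultimately show ?thesis by (simp add: w_def)
qed

lemma sum_step_count:
  "(\<Sum>(b, c)\<in>class_pts Q S lo hi. step_count m Q T b c)
    = card {(p, i, j). p \<in> class_pts Q S lo hi \<and> i \<in> {0..<T} \<and> j \<in> {0..<T} \<and> m dvd (fst p + Q * i) * (snd p + Q * j) + 1}"
proof -
  have "(\<Sum>(b, c)\<in>class_pts Q S lo hi. step_count m Q T b c)
      = (\<Sum>p\<in>class_pts Q S lo hi. card {(i, j) \<in> {0..<T} \<times> {0..<T}. m dvd (fst p + Q * i) * (snd p + Q * j) + 1})"
    by (simp add: step_count_def case_prod_unfold)
  also have "\<dots> = card (SIGMA p:class_pts Q S lo hi. {(i, j) \<in> {0..<T} \<times> {0..<T}. m dvd (fst p + Q * i) * (snd p + Q * j) + 1})"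
    by (intro card_SigmaI[symmetric] ballI finite_class_pts) (rule finite_subset[of _ "{0..<T} \<times> {0..<T}"], auto)
  finally show ?thesis by (simp add: Sigma_def case_prod_unfold) (rule arg_cong[of _ _ card], auto)
qed

text \<open>Every hyperbola point of the square lies in exactly \<open>T\<^sup>2\<close> boxes of
  step \<open>Q\<close>, one for each offset \<open>(i, j)\<close>. Base points from a square
  extended downwards by \<open>Q * T\<close> catch all these incidences, and base points whose boxes
  stay inside the square catch only such incidences. The two bounds differ from the main term by an
  edge term and by the deviation divided by \<open>T\<^sup>2\<close>.\<close>

lemma hyperbola_box_count:
  fixes m Q T a :: int and TM :: real
  assumes m: "m > 0" and Q: "Q > 0" and mQ: "coprime Q m" and T: "T > 0" and Tm: "m \<le> T\<^sup>2"
    and TM: "\<And>N. N \<noteq> 0 \<Longrightarrow> \<bar>N\<bar> \<le> m\<^sup>2 \<Longrightarrow> real (tau N) \<le> TM"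
    and S: "S \<subseteq> {0..<Q} \<times> {0..<Q}" and a: "a > 0"
  defines "V \<equiv> 14 * of_int T ^ 3 * sqrt (of_int m) * harm_int m * TM\<^sup>2"
    and "L0 \<equiv> 2 * real_of_int a / of_int Q"
    and "\<rho> \<equiv> real (card (hyp m 1)) / (of_int m)\<^sup>2"
  assumes TL: "of_int T + 1 \<le> L0"
  shows "\<bar>real (card {(b, c) \<in> class_pts Q S (-a) a. m dvd b * c + 1}) - real (card S) * L0\<^sup>2 * \<rho>\<bar>
    \<le> real (card S) * \<rho> * ((of_int T + 1) * (2 * L0 + of_int T + 1))
      + sqrt (real (card S)) * (2 * L0) * (2 * of_int Q * L0 / of_int m + 1) * sqrt V / (of_int T)\<^sup>2"
proof -
  define Zs where "Zs = {(b, c) \<in> class_pts Q S (-a) a. m dvd b * c + 1}"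
  have finZ: "finite Zs" unfolding Zs_def by (rule finite_subset[OF _ finite_class_pts]) auto
  define s where "s = real (card S)"
  define mean where "mean = (of_int T)\<^sup>2 * real (card (hyp m 1)) / (of_int m)\<^sup>2"
  have mean: "mean = (of_int T)\<^sup>2 * \<rho>" by (simp add: mean_def \<rho>_def)
  have T0: "real_of_int T \<ge> 1" using T by simp
  have V0: "V \<ge> 0" using T m harm_int_ge_1[OF m] by (simp add: V_def)
  have L00: "L0 > 0" using a Q by (simp add: L0_def)
  have rho0: "\<rho> \<ge> 0" by (simp add: \<rho>_def)
  \<comment> \<open>Both comparison squares have at most \<open>2 * L0\<close> periods
    \<open>Q\<close> along a side, so one error term serves both.\<close>
  define E where "E = sqrt s * (2 * L0) * (of_int Q * (2 * L0) / of_int m + 1) * sqrt V"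
  have E_le: "sqrt s * real L * (of_int Q * real L / of_int m + 1) * sqrt V \<le> E" if "real L \<le> 2 * L0" for L
    unfolding E_def using that Q m L00 V0
    by (intro mult_right_mono mult_mono add_mono divide_right_mono mult_left_mono) (auto simp: s_def)
  \<comment> \<open>The count of class points is exact for sides that are multiples of
    \<open>Q\<close>; rounding \<open>2 * a / Q\<close> down, or up to \<open>f1 + 1\<close>,
    provides such sides.\<close>
  define f1 where "f1 = (2 * a) div Q"
  have f1: "Q * f1 \<le> 2 * a" "2 * a < Q * (f1 + 1)"
    using pos_mod_sign[OF Q, of "2 * a"] pos_mod_bound[OF Q, of "2 * a"] mult_div_mod_eq[of Q "2 * a"]
    unfolding f1_def distrib_left by linarith+
  have "real_of_int (Q * f1) \<le> real_of_int (2 * a)" "real_of_int (2 * a) \<le> real_of_int (Q * (f1 + 1))"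
    using f1 by (simp_all only: of_int_le_iff)
  then have f1r: "of_int f1 \<le> L0" "L0 \<le> of_int f1 + 1"
    using Q by (simp_all add: L0_def field_simps)
  have Tf: "T \<le> f1" using TL f1r by linarith
  have img: "i \<in> {0..<T} \<Longrightarrow> 0 \<le> Q * i \<and> Q * i \<le> Q * T" for i
    using Q by (simp add: mult_left_mono)
  define Lp where "Lp = nat (f1 + 1 + T)"
  have Lp: "int Lp = f1 + 1 + T" using Tf T by (simp add: Lp_def)
  define lo where "lo = - a - Q * T"
  have hi: "a \<le> lo + Q * int Lp" using f1 by (simp add: lo_def Lp algebra_simps)
  let ?Pp = "class_pts Q S lo (lo + Q * int Lp)"
  let ?Wp = "{(p, i, j). p \<in> ?Pp \<and> i \<in> {0..<T} \<and> j \<in> {0..<T} \<and> m dvd (fst p + Q * i) * (snd p + Q * j) + 1}"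
  have finW: "finite {(p, i, j). p \<in> class_pts Q S lo hi \<and> i \<in> {0..<T} \<and> j \<in> {0..<T} \<and> m dvd (fst p + Q * i) * (snd p + Q * j) + 1}" for lo hi
    by (rule finite_subset[of _ "class_pts Q S lo hi \<times> {0..<T} \<times> {0..<T}"]) auto
  have "card (Zs \<times> {0..<T} \<times> {0..<T}) \<le> card ?Wp"
  proof (rule card_inj_on_le[OF _ _ finW])
    show "inj_on (\<lambda>(p, i, j). ((fst p - Q * i, snd p - Q * j), i, j)) (Zs \<times> {0..<T} \<times> {0..<T})"
      by (auto simp: inj_on_def)
    show "(\<lambda>(p, i, j). ((fst p - Q * i, snd p - Q * j), i, j)) ` (Zs \<times> {0..<T} \<times> {0..<T}) \<subseteq> ?Wp"
    proof (rule image_subsetI)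
      fix z assume z: "z \<in> Zs \<times> {0..<T} \<times> {0..<T}"
      obtain b c i j where zz: "z = ((b, c), i, j)" by (metis prod.exhaust)
      have bc: "- a \<le> b" "b < a" "- a \<le> c" "c < a" "(b mod Q, c mod Q) \<in> S" "m dvd b * c + 1" and ij: "i \<in> {0..<T}" "j \<in> {0..<T}"
        using z by (auto simp: zz Zs_def class_pts_def)
      have "(b - Q * i) mod Q = b mod Q" "(c - Q * j) mod Q = c mod Q" by (simp_all add: mod_diff_right_eq[symmetric])
      moreover have "lo \<le> b - Q * i" "lo \<le> c - Q * j" "b - Q * i < lo + Q * int Lp" "c - Q * j < lo + Q * int Lp"
        using bc img[OF ij(1)] img[OF ij(2)] hi by (simp_all add: lo_def)
      ultimately have "(b - Q * i, c - Q * j) \<in> ?Pp" using bc(5) by (simp add: class_pts_def)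
      then show "(case z of (p, i, j) \<Rightarrow> ((fst p - Q * i, snd p - Q * j), i, j)) \<in> ?Wp"
        using bc(6) ij by (simp add: zz)
    qed
  qed
  then have "card Zs * (nat T * nat T) \<le> (\<Sum>(b, c)\<in>?Pp. step_count m Q T b c)"
    unfolding sum_step_count by (simp add: card_cartesian_product)
  then have "real (card Zs * (nat T * nat T)) \<le> real (\<Sum>(b, c)\<in>?Pp. step_count m Q T b c)" by (simp only: of_nat_le_iff)
  then have "real (card Zs) * (of_int T)\<^sup>2 \<le> (\<Sum>(b, c)\<in>?Pp. real (step_count m Q T b c))"
    using T by (simp add: power2_eq_square case_prod_unfold)
  also have "\<dots> \<le> s * (real Lp)\<^sup>2 * mean + sqrt s * real Lp * (of_int Q * real Lp / of_int m + 1) * sqrt V"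
    using class_sum_deviation[OF m Q mQ T Tm TM S, of lo Lp] unfolding s_def mean_def V_def by linarith
  also have "\<dots> \<le> s * (L0 + (of_int T + 1))\<^sup>2 * mean + E"
  proof (rule add_mono)
    have r: "real Lp = of_int f1 + 1 + of_int T" using Lp by (metis of_int_add of_int_of_nat_eq of_int_1)
    have r2: "real Lp \<le> L0 + (of_int T + 1)" using r f1r by linarith
    show "s * (real Lp)\<^sup>2 * mean \<le> s * (L0 + (of_int T + 1))\<^sup>2 * mean"
      using r2 rho0 by (intro mult_right_mono mult_left_mono power_mono) (auto simp: s_def mean)
    show "sqrt s * real Lp * (of_int Q * real Lp / of_int m + 1) * sqrt V \<le> E"
      using r2 TL by (intro E_le) linarith
  qed
  finally have up: "real (card Zs) * (of_int T)\<^sup>2 \<le> s * (L0 + (of_int T + 1))\<^sup>2 * mean + E" .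
  define Lm where "Lm = nat (f1 - T)"
  have Lm: "int Lm = f1 - T" using Tf by (simp add: Lm_def)
  let ?Pm = "class_pts Q S (- a) (- a + Q * int Lm)"
  let ?Wm = "{(p, i, j). p \<in> ?Pm \<and> i \<in> {0..<T} \<and> j \<in> {0..<T} \<and> m dvd (fst p + Q * i) * (snd p + Q * j) + 1}"
  have him: "- a + Q * int Lm + Q * T \<le> a" using f1 by (simp add: Lm algebra_simps)
  have "card ?Wm \<le> card (Zs \<times> {0..<T} \<times> {0..<T})"
  proof (rule card_inj_on_le)
    show "inj_on (\<lambda>(p, i, j). ((fst p + Q * i, snd p + Q * j), i, j)) ?Wm"
      by (auto simp: inj_on_def)
    show "(\<lambda>(p, i, j). ((fst p + Q * i, snd p + Q * j), i, j)) ` ?Wm \<subseteq> Zs \<times> {0..<T} \<times> {0..<T}"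
    proof (rule image_subsetI)
      fix z assume z: "z \<in> ?Wm"
      obtain b c i j where zz: "z = ((b, c), i, j)" by (metis prod.exhaust)
      have bc: "- a \<le> b" "b < - a + Q * int Lm" "- a \<le> c" "c < - a + Q * int Lm" "(b mod Q, c mod Q) \<in> S"
          "m dvd (b + Q * i) * (c + Q * j) + 1" and ij: "i \<in> {0..<T}" "j \<in> {0..<T}"
        using z by (auto simp: zz class_pts_def)
      have "(b + Q * i) mod Q = b mod Q" "(c + Q * j) mod Q = c mod Q" by simp_all
      moreover have "- a \<le> b + Q * i" "- a \<le> c + Q * j" "b + Q * i < a" "c + Q * j < a"
        using bc img[OF ij(1)] img[OF ij(2)] him by linarith+
      ultimately show "(case z of (p, i, j) \<Rightarrow> ((fst p + Q * i, snd p + Q * j), i, j)) \<in> Zs \<times> {0..<T} \<times> {0..<T}"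
        using bc ij by (simp add: zz Zs_def class_pts_def)
    qed
  qed (use finZ in simp)
  then have "(\<Sum>(b, c)\<in>?Pm. step_count m Q T b c) \<le> card Zs * (nat T * nat T)"
    unfolding sum_step_count by (simp add: card_cartesian_product)
  then have "real (\<Sum>(b, c)\<in>?Pm. step_count m Q T b c) \<le> real (card Zs * (nat T * nat T))" by (simp only: of_nat_le_iff)
  then have lowZ: "(\<Sum>(b, c)\<in>?Pm. real (step_count m Q T b c)) \<le> real (card Zs) * (of_int T)\<^sup>2"
    using T by (simp add: power2_eq_square case_prod_unfold)
  have rm: "real Lm = of_int f1 - of_int T" using Lm by (metis of_int_diff of_int_of_nat_eq)
  have "s * (L0 - (of_int T + 1))\<^sup>2 * mean - E \<le> s * (real Lm)\<^sup>2 * mean - sqrt s * real Lm * (of_int Q * real Lm / of_int m + 1) * sqrt V"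
  proof (rule diff_mono)
    show "s * (L0 - (of_int T + 1))\<^sup>2 * mean \<le> s * (real Lm)\<^sup>2 * mean"
      using rm f1r TL rho0 by (intro mult_right_mono mult_left_mono power_mono) (auto simp: s_def mean)
    show "sqrt s * real Lm * (of_int Q * real Lm / of_int m + 1) * sqrt V \<le> E"
      using rm f1r T0 L00 by (intro E_le) linarith
  qed
  also have "\<dots> \<le> (\<Sum>(b, c)\<in>?Pm. real (step_count m Q T b c))"
    using class_sum_deviation[OF m Q mQ T Tm TM S, of "- a" Lm] unfolding s_def mean_def V_def by linarith
  finally have low: "s * (L0 - (of_int T + 1))\<^sup>2 * mean - E \<le> real (card Zs) * (of_int T)\<^sup>2" using lowZ by linarith
  define D where "D = s * \<rho> * ((of_int T + 1) * (2 * L0 + of_int T + 1))"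
  define M where "M = s * L0\<^sup>2 * \<rho>"
  have t2: "(real_of_int T)\<^sup>2 > 0" using T by simp
  have "s * (L0 + (of_int T + 1))\<^sup>2 * mean = (of_int T)\<^sup>2 * (M + D)"
    by (simp add: mean M_def D_def power2_eq_square algebra_simps)
  with up have "(of_int T)\<^sup>2 * real (card Zs) \<le> (of_int T)\<^sup>2 * (M + D) + E" by (simp add: mult.commute)
  also have "\<dots> = (of_int T)\<^sup>2 * (M + D + E / (of_int T)\<^sup>2)" using t2 by (simp add: distrib_left)
  finally have 1: "real (card Zs) \<le> M + D + E / (of_int T)\<^sup>2" using t2 by (simp only: mult_le_cancel_left_pos)
  have "(of_int T)\<^sup>2 * (M - D) \<le> s * (L0 - (of_int T + 1))\<^sup>2 * mean"
  proof -
    have "s * (L0 - (of_int T + 1))\<^sup>2 * mean - (of_int T)\<^sup>2 * (M - D) = (of_int T)\<^sup>2 * (s * \<rho> * (2 * (of_int T + 1)\<^sup>2))"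
      by (simp add: mean M_def D_def power2_eq_square algebra_simps)
    also have "\<dots> \<ge> 0" using rho0 by (simp add: s_def)
    finally show ?thesis by linarith
  qed
  with low have "(of_int T)\<^sup>2 * (M - D) - E \<le> (of_int T)\<^sup>2 * real (card Zs)" by (simp add: mult.commute)
  moreover have "(of_int T)\<^sup>2 * (M - D) - E = (of_int T)\<^sup>2 * (M - D - E / (of_int T)\<^sup>2)"
    using t2 by (simp add: right_diff_distrib)
  ultimately have 2: "M - D - E / (of_int T)\<^sup>2 \<le> real (card Zs)" using t2 by (simp only: mult_le_cancel_left_pos)
  have "\<bar>real (card Zs) - M\<bar> \<le> D + E / (of_int T)\<^sup>2" using 1 2 by linarith
  then show ?thesis by (simp add: Zs_def M_def D_def E_def s_def mult_ac)
qed

section \<open>Local densities\<close>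

lemma dvd_mod_diff: "(m::int) dvd x mod m - x"
  by (simp add: mod_eq_dvd_iff[symmetric])

lemma dvd_diff_imp_iff: "(n::int) dvd a - b \<Longrightarrow> n dvd a \<longleftrightarrow> n dvd b"
  using dvd_add_right_iff[of n "a - b" b] by simp

lemma linear_congruence_solution:
  fixes m w \<alpha> :: int
  assumes m: "m > 0" and c: "coprime \<alpha> m"
  shows "\<exists>i\<in>{0..<m}. m dvd w + \<alpha> * i"
proof -
  obtain x where "[\<alpha> * x = 1] (mod m)" using c cong_solve_coprime_int by blast
  then have d: "m dvd \<alpha> * x - 1" by (simp add: cong_iff_dvd_diff)
  define i where "i = (- w * x) mod m"
  have "m dvd i - (- w * x)" unfolding i_def by (rule dvd_mod_diff)
  then have "m dvd \<alpha> * (i - (- w * x)) - w * (\<alpha> * x - 1)"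
    by (intro dvd_diff[OF dvd_mult dvd_mult[OF d]])
  then have "m dvd w + \<alpha> * i" by (simp add: algebra_simps)
  moreover have "i \<in> {0..<m}" using m by (simp add: i_def)
  ultimately show ?thesis by blast
qed

lemma linear_congruence_unique:
  fixes m w \<alpha> :: int
  assumes c: "coprime \<alpha> m" and "i \<in> {0..<m}" "j \<in> {0..<m}" "m dvd w + \<alpha> * i" "m dvd w + \<alpha> * j"
  shows "i = j"
proof -
  have "m dvd (w + \<alpha> * i) - (w + \<alpha> * j)" by (rule dvd_diff) fact+
  then have "m dvd \<alpha> * (i - j)" by (simp add: algebra_simps)
  then have "m dvd i - j" using c by (simp add: coprime_commute coprime_dvd_mult_right_iff)
  then show ?thesis using assms by (intro dvd_diff_range_eq[of _ m])
qed

lemma card_linear_congruence: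
  fixes m w \<alpha> \<beta> :: int
  assumes m: "m > 0" and c: "coprime \<alpha> m"
  shows "card {(i, j) \<in> {0..<m} \<times> {0..<m}. m dvd w + \<alpha> * i + \<beta> * j} = nat m"
proof -
  have "bij_betw snd {(i, j) \<in> {0..<m} \<times> {0..<m}. m dvd w + \<alpha> * i + \<beta> * j} {0..<m}"
  proof (rule bij_betw_imageI)
    show "inj_on snd {(i, j) \<in> {0..<m} \<times> {0..<m}. m dvd w + \<alpha> * i + \<beta> * j}"
    proof (rule inj_onI)
      fix y z
      assume yz: "y \<in> {(i, j) \<in> {0..<m} \<times> {0..<m}. m dvd w + \<alpha> * i + \<beta> * j}"
        "z \<in> {(i, j) \<in> {0..<m} \<times> {0..<m}. m dvd w + \<alpha> * i + \<beta> * j}" "snd y = snd z"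
      then obtain i i' j where "y = (i, j)" "z = (i', j)" by (cases y, cases z) auto
      with yz show "y = z"
        using linear_congruence_unique[OF c, of i i' "w + \<beta> * j"] by (simp add: algebra_simps)
    qed
    show "snd ` {(i, j) \<in> {0..<m} \<times> {0..<m}. m dvd w + \<alpha> * i + \<beta> * j} = {0..<m}"
    proof (intro equalityI subsetI)
      fix j assume j: "j \<in> {0..<m}"
      obtain i where "i \<in> {0..<m}" "m dvd (w + \<beta> * j) + \<alpha> * i"
        using linear_congruence_solution[OF m c, of "w + \<beta> * j"] by blast
      then have "(i, j) \<in> {(i, j) \<in> {0..<m} \<times> {0..<m}. m dvd w + \<alpha> * i + \<beta> * j}"
        using j by (simp add: algebra_simps)
      then show "j \<in> snd ` {(i, j) \<in> {0..<m} \<times> {0..<m}. m dvd w + \<alpha> * i + \<beta> * j}"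
        by (rule image_eqI[rotated]) simp
    qed auto
  qed
  then show ?thesis using bij_betw_same_card by fastforce
qed

definition local_set :: "int \<Rightarrow> int \<Rightarrow> (int \<times> int \<times> int) set" where
  "local_set q a = {(b, c, e) \<in> {0..<q} \<times> {0..<q} \<times> {0..<q}.
     q dvd a * e - b * c - 1 \<and> q dvd a\<^sup>2 + b\<^sup>2 + c\<^sup>2 + e\<^sup>2}"

text \<open>For \<open>a = m * r\<close> with \<open>m\<close> invertible modulo \<open>q\<close>, the entry \<open>e = (b * c + 1) div a\<close> satisfies
  \<open>m * e = (b * c + 1) div r\<close>; multiplying the quadratic form by \<open>m\<^sup>2\<close> makes the condition depend only
  on \<open>b\<close> and \<open>c\<close> modulo \<open>r * q\<close>.\<close>

definition class_set :: "int \<Rightarrow> int \<Rightarrow> int \<Rightarrow> (int \<times> int) set" where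
  "class_set m r q = {(b, c) \<in> {0..<r * q} \<times> {0..<r * q}.
     r dvd b * c + 1 \<and> q dvd m\<^sup>2 * ((m * r)\<^sup>2 + b\<^sup>2 + c\<^sup>2) + ((b * c + 1) div r)\<^sup>2}"

lemma finite_local_set [simp]: "finite (local_set q a)"
  unfolding local_set_def by (rule finite_subset[of _ "{0..<q} \<times> {0..<q} \<times> {0..<q}"]) auto

lemma finite_class_set [simp]: "finite (class_set m r q)"
  unfolding class_set_def by (rule finite_subset[of _ "{0..<r * q} \<times> {0..<r * q}"]) auto

text \<open>Lift \<open>b0\<close> freely to \<open>b = b0 + q * j\<close> with \<open>j\<close> in
  \<open>{0..<r}\<close>. In the lift \<open>c0 + q * k\<close> the condition modulo
  \<open>r * q\<close> is a linear congruence for \<open>k\<close> modulo \<open>r\<close>, whose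
  coefficient \<open>b\<close> is invertible, so \<open>k\<close> is determined.\<close>

lemma card_lift_fibre:
  fixes q r N b0 c0 :: int
  assumes q: "q > 0" and r: "r > 0" and b0: "b0 \<in> {0..<q}" and c0: "c0 \<in> {0..<q}"
    and N: "q dvd b0 * c0 - N" and cop: "\<And>b. b mod q = b0 \<Longrightarrow> coprime b r"
  shows "card {(b, c) \<in> {0..<r * q} \<times> {0..<r * q}. b mod q = b0 \<and> c mod q = c0 \<and> r * q dvd b * c - N} = nat r"
    (is "card ?F = _")
proof -
  have lt: "x mod q + q * j < r * q" "0 \<le> x mod q + q * j" if "j \<in> {0..<r}" for x j
  proof -
    have "q * (j + 1) \<le> q * r" using that q by (intro mult_left_mono) auto
    then show "x mod q + q * j < r * q" using pos_mod_bound[OF q, of x] by (simp add: algebra_simps)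
    show "0 \<le> x mod q + q * j" using that q by simp
  qed
  have divr: "x div q \<in> {0..<r}" if "x \<in> {0..<r * q}" for x
  proof -
    have "q * (x div q) + x mod q = x" by (rule mult_div_mod_eq)
    moreover have "x < r * q" using that by simp
    ultimately have "q * (x div q) < r * q" using pos_mod_sign[OF q, of x] by linarith
    then have "q * (x div q) < q * r" by (simp add: mult.commute)
    then show ?thesis using that q by (simp add: pos_imp_zdiv_nonneg_iff)
  qed
  have "bij_betw (\<lambda>(b, c). b div q) ?F {0..<r}"
  proof (rule bij_betw_imageI)
    show "inj_on (\<lambda>(b, c). b div q) ?F"
    proof (rule inj_onI, clarify)
      fix b c b' c'
      assume bc: "b \<in> {0..<r * q}" "c \<in> {0..<r * q}" "r * q dvd b * c - N"
        and bc': "b' \<in> {0..<r * q}" "c' \<in> {0..<r * q}" "b' mod q = b mod q" "c' mod q = c mod q" "r * q dvd b' * c' - N"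
        and e: "b0 = b mod q" "c0 = c mod q" "b div q = b' div q"
      have bb: "b = b'" using e(3) bc'(3) by (metis mult_div_mod_eq)
      have "r * q dvd (b * c - N) - (b' * c' - N)" using bc(3) bc'(5) by (rule dvd_diff)
      then have "r * q dvd b * (c - c')" by (simp add: bb algebra_simps)
      moreover have "q dvd c - c'" using bc'(4) by (metis mod_eq_dvd_iff)
      then obtain k where k: "c - c' = q * k" by blast
      ultimately have "q * r dvd q * (b * k)" by (simp add: mult_ac)
      then have "r dvd b * k" using q by simp
      then have "r dvd k" using cop[of b] e by (simp add: coprime_commute coprime_dvd_mult_right_iff)
      then have "r * q dvd c - c'" unfolding k by (simp add: mult.commute mult_dvd_mono)
      then have "c = c'" using bc bc' by (intro dvd_diff_range_eq[of _ "r * q"])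
      then show "b = b' \<and> c = c'" using bb by simp
    qed
    show "(\<lambda>(b, c). b div q) ` ?F = {0..<r}"
    proof (intro equalityI subsetI)
      fix j assume j: "j \<in> {0..<r}"
      define b where "b = b0 + q * j"
      have bm: "b mod q = b0" and bd: "b div q = j" using b0 q by (simp_all add: b_def)
      have "q dvd (b0 * c0 - N) + q * (j * c0)" using N by simp
      then have "q dvd b * c0 - N" by (simp add: b_def algebra_simps)
      then obtain w where w: "b * c0 - N = q * w" by blast
      obtain k where k: "k \<in> {0..<r}" "r dvd w + b * k"
        using linear_congruence_solution[OF r cop[OF bm], of w] by blast
      define c where "c = c0 + q * k"
      have cm: "c mod q = c0" using c0 q by (simp add: c_def)
      have "b * c - N = q * (w + b * k)" using w by (simp add: c_def algebra_simps)
      then have "r * q dvd b * c - N" using k(2) by (simp add: mult.commute mult_dvd_mono)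
      moreover have "b \<in> {0..<r * q}" "c \<in> {0..<r * q}"
        using lt[OF j, of b0] lt[OF k(1), of c0] b0 c0 by (simp_all add: b_def c_def)
      ultimately have "(b, c) \<in> ?F" using bm cm by simp
      then show "j \<in> (\<lambda>(b, c). b div q) ` ?F" using bd by force
    qed (use divr in auto)
  qed
  then have "card ?F = card {0..<r}" by (rule bij_betw_same_card)
  then show ?thesis by simp
qed

text \<open>The fourth entry is recovered modulo \<open>q\<close> as
  \<open>mi * ((b * c + 1) div r)\<close>, where \<open>mi\<close> inverts \<open>m\<close>. This
  maps the classes modulo \<open>r * q\<close> to local solutions, with \<open>r\<close> classes
  over each by \<open>card_lift_fibre\<close>. The coprimality required there holds because a prime
  of \<open>r\<close> divides both \<open>q\<close> and \<open>a = m * r\<close>, whence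
  \<open>b * c = -1\<close> modulo that prime.\<close>

lemma card_class_set:
  fixes m r q :: int
  assumes m: "coprime m q" and q: "q > 0" and r: "r > 0"
    and rad: "\<And>p. prime p \<Longrightarrow> p dvd r \<Longrightarrow> p dvd q"
  shows "card (class_set m r q) = nat r * card (local_set q (m * r))"
proof -
  define a where "a = m * r"
  obtain mi where "[m * mi = 1] (mod q)" using m cong_solve_coprime_int by blast
  then have mi: "q dvd m * mi - 1" by (simp add: cong_iff_dvd_diff)
  define g where "g = (\<lambda>(b::int, c::int). (b mod q, c mod q, mi * ((b * c + 1) div r) mod q))"
  let ?F = "\<lambda>t. {(b, c) \<in> {0..<r * q} \<times> {0..<r * q}. b mod q = fst t \<and> c mod q = fst (snd t) \<and> r * q dvd b * c - (a * snd (snd t) - 1)}"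
  have key: "r dvd b * c + 1 \<and> mi * ((b * c + 1) div r) mod q = e \<longleftrightarrow> r * q dvd b * c - (a * e - 1)"
    if e: "e \<in> {0..<q}" for b c e
  proof
    assume as: "r dvd b * c + 1 \<and> mi * ((b * c + 1) div r) mod q = e"
    define f where "f = (b * c + 1) div r"
    have f: "b * c + 1 = r * f" using as by (simp add: f_def)
    have "q dvd mi * f - e" using as by (auto simp: f_def mod_eq_dvd_iff[symmetric])
    then have "q dvd m * (mi * f - e) - (m * mi - 1) * f" by (intro dvd_diff[OF dvd_mult dvd_mult2[OF mi]])
    then have "q dvd f - m * e" by (simp add: algebra_simps)
    then have "r * q dvd r * (f - m * e)" by (simp add: mult_dvd_mono)
    then show "r * q dvd b * c - (a * e - 1)" using f by (simp add: a_def algebra_simps)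
  next
    assume d: "r * q dvd b * c - (a * e - 1)"
    then obtain k where k: "b * c - (a * e - 1) = r * q * k" by blast
    then have f: "b * c + 1 = r * (m * e + q * k)" by (simp add: a_def algebra_simps)
    then have "(b * c + 1) div r = m * e + q * k" using r by simp
    moreover have "mi * (m * e + q * k) mod q = e mod q"
    proof -
      have "q dvd (m * mi - 1) * e + q * (mi * k)" using mi by simp
      then have "q dvd mi * (m * e + q * k) - e" by (simp add: algebra_simps)
      then show ?thesis by (simp add: mod_eq_dvd_iff)
    qed
    ultimately show "r dvd b * c + 1 \<and> mi * ((b * c + 1) div r) mod q = e" using f e by simp
  qed
  have R_iff: "q dvd m\<^sup>2 * (a\<^sup>2 + b\<^sup>2 + c\<^sup>2) + f\<^sup>2 \<longleftrightarrow> q dvd a\<^sup>2 + (b mod q)\<^sup>2 + (c mod q)\<^sup>2 + e\<^sup>2"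
    if fe: "q dvd f - m * e" for b c f e
  proof -
    have "q dvd (f - m * e) * (f + m * e) + m\<^sup>2 * ((b - b mod q) * (b + b mod q) + (c - c mod q) * (c + c mod q))"
      using fe by (intro dvd_add dvd_mult2 dvd_mult) (simp_all add: minus_mod_eq_mult_div)
    then have d: "q dvd (m\<^sup>2 * (a\<^sup>2 + b\<^sup>2 + c\<^sup>2) + f\<^sup>2) - m\<^sup>2 * (a\<^sup>2 + (b mod q)\<^sup>2 + (c mod q)\<^sup>2 + e\<^sup>2)"
      by (simp add: power2_eq_square algebra_simps)
    have "q dvd m\<^sup>2 * (a\<^sup>2 + b\<^sup>2 + c\<^sup>2) + f\<^sup>2 \<longleftrightarrow> q dvd m\<^sup>2 * (a\<^sup>2 + (b mod q)\<^sup>2 + (c mod q)\<^sup>2 + e\<^sup>2)"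
      using dvd_add_right_iff[OF d, of "m\<^sup>2 * (a\<^sup>2 + (b mod q)\<^sup>2 + (c mod q)\<^sup>2 + e\<^sup>2)"] by simp
    also have "\<dots> \<longleftrightarrow> q dvd a\<^sup>2 + (b mod q)\<^sup>2 + (c mod q)\<^sup>2 + e\<^sup>2"
      using m by (intro coprime_dvd_mult_right_iff) (simp add: coprime_commute)
    finally show ?thesis .
  qed
  have fe: "q dvd f - m * e" "q dvd a * e - (b mod q) * (c mod q) - 1"
    if as: "r * q dvd b * c - (a * e - 1)" and ff: "f = (b * c + 1) div r" for b c e f
  proof -
    obtain k where k: "b * c - (a * e - 1) = r * q * k" using as by blast
    then have "b * c + 1 = r * (m * e + q * k)" by (simp add: a_def algebra_simps)
    then have "f = m * e + q * k" using r ff by simp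
    then show "q dvd f - m * e" by simp
    have x1: "q dvd b - b mod q" "q dvd c - c mod q" by (simp_all add: minus_mod_eq_mult_div)
    have "q dvd (b - b mod q) * c + (b mod q) * (c - c mod q) - q * (r * k)"
      by (intro dvd_diff[OF dvd_add[OF dvd_mult2[OF x1(1)] dvd_mult[OF x1(2)]] dvd_triv_left])
    moreover have "(b - b mod q) * c + (b mod q) * (c - c mod q) - q * (r * k) = a * e - (b mod q) * (c mod q) - 1"
      using k by (simp add: algebra_simps)
    ultimately show "q dvd a * e - (b mod q) * (c mod q) - 1" by simp
  qed
  have fib: "{p \<in> class_set m r q. g p = t} = ?F t" if t: "t \<in> local_set q a" for t
  proof -
    obtain b0 c0 e where tt: "t = (b0, c0, e)" by (metis prod.exhaust)
    have e: "e \<in> {0..<q}" and R: "q dvd a\<^sup>2 + b0\<^sup>2 + c0\<^sup>2 + e\<^sup>2" using t by (auto simp: local_set_def tt)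
    show ?thesis
    proof (intro equalityI subsetI)
      fix p assume p: "p \<in> {p \<in> class_set m r q. g p = t}"
      obtain b c where pp: "p = (b, c)" by (cases p)
      then show "p \<in> ?F t" using p key[OF e, of b c] by (auto simp: class_set_def g_def tt)
    next
      fix p assume p: "p \<in> ?F t"
      obtain b c where pp: "p = (b, c)" by (cases p)
      have bc: "b mod q = b0" "c mod q = c0" "r * q dvd b * c - (a * e - 1)" "b \<in> {0..<r * q}" "c \<in> {0..<r * q}"
        using p by (auto simp: pp tt)
      have "q dvd m\<^sup>2 * (a\<^sup>2 + b\<^sup>2 + c\<^sup>2) + ((b * c + 1) div r)\<^sup>2"
        using R_iff[OF fe(1)[OF bc(3) refl], of b c] R bc(1,2) by simp
      then show "p \<in> {p \<in> class_set m r q. g p = t}"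
        using bc key[OF e, of b c] by (simp add: class_set_def g_def tt pp a_def)
    qed
  qed
  have img: "g ` class_set m r q \<subseteq> local_set q a"
  proof (rule image_subsetI)
    fix p assume p: "p \<in> class_set m r q"
    obtain b c where pp: "p = (b, c)" by (cases p)
    define e where "e = mi * ((b * c + 1) div r) mod q"
    have e: "e \<in> {0..<q}" using q by (simp add: e_def)
    have d: "r * q dvd b * c - (a * e - 1)" using key[OF e, of b c] p by (simp add: class_set_def pp e_def)
    have "q dvd m\<^sup>2 * (a\<^sup>2 + b\<^sup>2 + c\<^sup>2) + ((b * c + 1) div r)\<^sup>2" using p by (simp add: class_set_def pp a_def)
    then have "q dvd a\<^sup>2 + (b mod q)\<^sup>2 + (c mod q)\<^sup>2 + e\<^sup>2" using R_iff[OF fe(1)[OF d refl], of b c] by simp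
    then show "g p \<in> local_set q a"
      using fe(2)[OF d refl] e q by (simp add: local_set_def g_def pp e_def)
  qed
  have "card (class_set m r q) = (\<Sum>p\<in>class_set m r q. (\<lambda>_. 1) (g p))" by simp
  also have "\<dots> = (\<Sum>t\<in>local_set q a. of_nat (card {p \<in> class_set m r q. g p = t}) * (\<lambda>_. 1) t)"
    by (rule sum_fun_comp[OF _ _ img]) simp_all
  also have "\<dots> = (\<Sum>t\<in>local_set q a. nat r)"
  proof (rule sum.cong[OF refl])
    fix t assume t: "t \<in> local_set q a"
    obtain b0 c0 e where tt: "t = (b0, c0, e)" by (metis prod.exhaust)
    have bc: "b0 \<in> {0..<q}" "c0 \<in> {0..<q}" and d: "q dvd a * e - b0 * c0 - 1" using t by (auto simp: local_set_def tt)
    have "card (?F t) = nat r"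
    proof -
      have "q dvd - (a * e - b0 * c0 - 1)" using d by (simp only: dvd_minus_iff)
      then have N: "q dvd b0 * c0 - (a * e - 1)" by (simp add: algebra_simps)
      have "coprime b r" if "b mod q = b0" for b
      proof (rule ccontr)
        assume "\<not> coprime b r"
        then have "\<bar>gcd b r\<bar> \<noteq> 1" by (simp add: coprime_iff_gcd_eq_1)
        then obtain p where p: "prime p" "p dvd b" "p dvd r"
          using prime_factor_int[of "gcd b r"] by (auto intro: dvd_trans)
        then have pq: "p dvd q" using rad by blast
        then have "p dvd b0" using p(2) that by (metis dvd_mod_iff)
        moreover have "p dvd a" using p(3) by (simp add: a_def)
        moreover have "p dvd a * e - b0 * c0 - 1" using pq d by (rule dvd_trans)
        ultimately have "p dvd a * e - b0 * c0" "p dvd a * e - b0 * c0 - 1" by simp_all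
        then have "p dvd (a * e - b0 * c0) - (a * e - b0 * c0 - 1)" by (rule dvd_diff)
        then have "p dvd 1" by simp
        then show False using p(1) not_prime_unit by blast
      qed
      then show ?thesis using card_lift_fibre[OF q r bc N] by (simp add: tt)
    qed
    then show "of_nat (card {p \<in> class_set m r q. g p = t}) * (\<lambda>_. 1) t = nat r" by (simp add: fib[OF t])
  qed
  finally show ?thesis by (simp add: a_def mult.commute)
qed

section \<open>Points on circles modulo n\<close>

definition circ :: "int \<Rightarrow> int \<Rightarrow> nat" where
  "circ c n = card {(u, v) \<in> {0..<n} \<times> {0..<n}. n dvd u\<^sup>2 + v\<^sup>2 - c}"

lemma finite_circ: "finite {(u, v) \<in> {0..<n} \<times> {0..<n::int}. P u v}"
  by (rule finite_subset[of _ "{0..<n} \<times> {0..<n}"]) auto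

lemma dvd_mod_sq_iff:
  fixes n :: int
  shows "n dvd (u mod n)\<^sup>2 + (v mod n)\<^sup>2 - c \<longleftrightarrow> n dvd u\<^sup>2 + v\<^sup>2 - c"
proof -
  have "n dvd (u mod n - u) * (u mod n + u) + (v mod n - v) * (v mod n + v)"
    by (intro dvd_add dvd_mult2 dvd_mod_diff)
  then have d: "n dvd ((u mod n)\<^sup>2 + (v mod n)\<^sup>2 - c) - (u\<^sup>2 + v\<^sup>2 - c)"
    by (simp add: power2_eq_square algebra_simps)
  then show ?thesis by (rule dvd_diff_imp_iff)
qed

text \<open>The variables \<open>a + e, b - c\<close> and \<open>a - e, b + c\<close> separate the
  conditions: adding twice the determinant equation to the form, or subtracting it, gives
  \<open>u\<^sup>2 + v\<^sup>2 = 2\<close> and \<open>w\<^sup>2 + z\<^sup>2 = -2\<close>. The change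
  of variables is invertible because 2 is a unit modulo the odd \<open>q\<close>.\<close>

lemma sum_card_local_set:
  fixes q :: int
  assumes q: "q > 0" "odd q"
  shows "(\<Sum>a\<in>{0..<q}. card (local_set q a)) = circ 2 q * circ (-2) q"
proof -
  let ?R = "{0..<q}"
  let ?C = "\<lambda>c. {(u, v) \<in> ?R \<times> ?R. q dvd u\<^sup>2 + v\<^sup>2 - c}"
  let ?L = "SIGMA a:?R. local_set q a"
  have c2: "coprime 2 q" using q by simp
  obtain h where "[2 * h = 1] (mod q)" using c2 cong_solve_coprime_int by blast
  then have h: "q dvd 2 * h - 1" by (simp add: cong_iff_dvd_diff)
  define f where "f = (\<lambda>(a, b, c, e). (((a + e) mod q, (b - c) mod q), ((a - e) mod q, (b + c) mod q)))"
  define g where "g = (\<lambda>((u, v), (w, z)). (h * (u + w) mod q, h * (v + z) mod q, h * (z - v) mod q, h * (u - w) mod q))"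
  have hh: "h * (x mod q + y mod q) mod q = h * (x + y) mod q" "h * (x mod q - y mod q) mod q = h * (x - y) mod q" for x y
    by (metis mod_add_eq mod_mult_right_eq) (metis mod_diff_eq mod_mult_right_eq)
  have h2: "h * (2 * x) mod q = x mod q" for x
  proof -
    have "q dvd (2 * h - 1) * x" using h by simp
    then have "q dvd h * (2 * x) - x" by (simp add: algebra_simps)
    then show ?thesis by (simp add: mod_eq_dvd_iff)
  qed
  have hs: "(h * x mod q + h * y mod q) mod q = h * (x + y) mod q" "(h * x mod q - h * y mod q) mod q = h * (x - y) mod q" for x y
    by (simp_all add: mod_add_eq mod_diff_eq distrib_left right_diff_distrib)
  have "bij_betw f ?L (?C 2 \<times> ?C (-2))"
  proof (rule bij_betw_byWitness[of _ g])
    show "\<forall>x\<in>?L. g (f x) = x"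
    proof clarify
      fix a b c e assume "a \<in> ?R" "(b, c, e) \<in> local_set q a"
      then have m: "a mod q = a" "b mod q = b" "c mod q = c" "e mod q = e" by (auto simp: local_set_def)
      have s: "(a + e) + (a - e) = 2 * a" "(b - c) + (b + c) = 2 * b" "(b + c) - (b - c) = 2 * c" "(a + e) - (a - e) = 2 * e"
        by simp_all
      show "g (f (a, b, c, e)) = (a, b, c, e)"
        unfolding f_def g_def prod.case hh s h2 m ..
    qed
    show "\<forall>y\<in>?C 2 \<times> ?C (-2). f (g y) = y"
    proof clarify
      fix u v w z assume "u \<in> ?R" "v \<in> ?R" "w \<in> ?R" "z \<in> ?R"
      then have m: "u mod q = u" "v mod q = v" "w mod q = w" "z mod q = z" by simp_all
      have s: "(u + w) + (u - w) = 2 * u" "(v + z) - (z - v) = 2 * v" "(u + w) - (u - w) = 2 * w" "(v + z) + (z - v) = 2 * z"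
        by simp_all
      show "f (g ((u, v), (w, z))) = ((u, v), (w, z))"
        unfolding f_def g_def prod.case hs s h2 m ..
    qed
    show "f ` ?L \<subseteq> ?C 2 \<times> ?C (-2)"
    proof (rule image_subsetI)
      fix x assume x: "x \<in> ?L"
      obtain a b c e where xx: "x = (a, b, c, e)" by (metis prod.exhaust)
      have L: "a \<in> ?R" "(b, c, e) \<in> local_set q a" using x by (simp_all add: xx)
      have d: "q dvd a * e - b * c - 1" "q dvd a\<^sup>2 + b\<^sup>2 + c\<^sup>2 + e\<^sup>2" using L by (auto simp: local_set_def)
      have "q dvd (a\<^sup>2 + b\<^sup>2 + c\<^sup>2 + e\<^sup>2) + 2 * (a * e - b * c - 1)"
        by (rule dvd_add[OF d(2) dvd_mult[OF d(1)]])
      then have 1: "q dvd (a + e)\<^sup>2 + (b - c)\<^sup>2 - 2" by (simp add: power2_eq_square algebra_simps)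
      have "q dvd (a\<^sup>2 + b\<^sup>2 + c\<^sup>2 + e\<^sup>2) - 2 * (a * e - b * c - 1)"
        by (rule dvd_diff[OF d(2) dvd_mult[OF d(1)]])
      then have 2: "q dvd (a - e)\<^sup>2 + (b + c)\<^sup>2 - (-2)" by (simp add: power2_eq_square algebra_simps)
      show "f x \<in> ?C 2 \<times> ?C (-2)"
        using q 1 2 by (simp add: xx f_def dvd_mod_sq_iff[of q _ _ 2] dvd_mod_sq_iff[of q _ _ "-2", simplified])
    qed
    show "g ` (?C 2 \<times> ?C (-2)) \<subseteq> ?L"
    proof (rule image_subsetI)
      fix y assume y: "y \<in> ?C 2 \<times> ?C (-2)"
      obtain u v w z where yy: "y = ((u, v), (w, z))" by (metis prod.exhaust)
      have 1: "q dvd u\<^sup>2 + v\<^sup>2 - 2" and 2: "q dvd w\<^sup>2 + z\<^sup>2 - (-2)" using y by (simp_all add: yy)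
      define a b c e where "a = h * (u + w) mod q" and "b = h * (v + z) mod q" and "c = h * (z - v) mod q" and "e = h * (u - w) mod q"
      have da: "q dvd 2 * a - (u + w)" "q dvd 2 * b - (v + z)" "q dvd 2 * c - (z - v)" "q dvd 2 * e - (u - w)"
      proof -
        have *: "q dvd 2 * (h * x mod q) - x" for x
        proof -
          have "q dvd 2 * (h * x mod q - h * x) + (2 * h - 1) * x"
            by (intro dvd_add dvd_mult dvd_mult2 dvd_mod_diff h)
          then show ?thesis by (simp add: algebra_simps)
        qed
        show "q dvd 2 * a - (u + w)" "q dvd 2 * b - (v + z)" "q dvd 2 * c - (z - v)" "q dvd 2 * e - (u - w)"
          unfolding a_def b_def c_def e_def by (rule *)+
      qed
      have "q dvd (2 * a - (u + w)) * (2 * e) + (u + w) * (2 * e - (u - w)) - ((2 * b - (v + z)) * (2 * c) + (v + z) * (2 * c - (z - v)))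
          + (u\<^sup>2 + v\<^sup>2 - 2) - (w\<^sup>2 + z\<^sup>2 - (-2))"
        by (intro dvd_diff[OF dvd_add[OF dvd_diff[OF dvd_add[OF dvd_mult2[OF da(1)] dvd_mult[OF da(4)]] dvd_add[OF dvd_mult2[OF da(2)] dvd_mult[OF da(3)]]] 1] 2])
      then have "q dvd 4 * (a * e - b * c - 1)" by (simp add: power2_eq_square algebra_simps)
      moreover have c4: "coprime q 4" using c2 coprime_power_left_iff[of 2 2 q] by (simp add: coprime_commute)
      ultimately have x: "q dvd a * e - b * c - 1" by (simp only: coprime_dvd_mult_right_iff)
      have "q dvd (2 * a - (u + w)) * (2 * a + (u + w)) + (2 * b - (v + z)) * (2 * b + (v + z)) + (2 * c - (z - v)) * (2 * c + (z - v))
          + (2 * e - (u - w)) * (2 * e + (u - w)) + (u\<^sup>2 + v\<^sup>2 - 2) * 2 + (w\<^sup>2 + z\<^sup>2 - (-2)) * 2"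
        by (intro dvd_add dvd_mult2 da 1 2)
      then have "q dvd 4 * (a\<^sup>2 + b\<^sup>2 + c\<^sup>2 + e\<^sup>2)" by (simp add: power2_eq_square algebra_simps)
      then have x2: "q dvd a\<^sup>2 + b\<^sup>2 + c\<^sup>2 + e\<^sup>2" using c4 by (simp only: coprime_dvd_mult_right_iff)
      have "a \<in> ?R" "b \<in> ?R" "c \<in> ?R" "e \<in> ?R" using q by (simp_all add: a_def b_def c_def e_def)
      then have "(a, b, c, e) \<in> ?L" using x x2 by (simp add: local_set_def)
      then show "g y \<in> ?L" by (simp add: yy g_def a_def b_def c_def e_def)
    qed
  qed
  then have "card ?L = card (?C 2 \<times> ?C (-2))" by (rule bij_betw_same_card)
  also have "\<dots> = circ 2 q * circ (-2) q" by (simp only: card_cartesian_product circ_def)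
  also have "card ?L = (\<Sum>a\<in>?R. card (local_set q a))" by (intro card_SigmaI) auto
  finally show ?thesis .
qed

lemma circ_mult:
  fixes n1 n2 :: int
  assumes n: "n1 > 0" "n2 > 0" "coprime n1 n2"
  shows "circ c (n1 * n2) = circ c n1 * circ c n2"
proof -
  let ?R = "\<lambda>n. {0..<n::int}"
  let ?C = "\<lambda>n. {(u, v) \<in> ?R n \<times> ?R n. n dvd u\<^sup>2 + v\<^sup>2 - c}"
  let ?f = "\<lambda>x. (x mod n1, x mod n2)"
  have dd: "n1 * n2 dvd x \<longleftrightarrow> n1 dvd x \<and> n2 dvd x" for x
    using n(3) by (auto intro: divides_mult dvd_mult_left dvd_mult_right)
  have inj: "inj_on ?f (?R (n1 * n2))"
  proof (rule inj_onI)
    fix x y assume xy: "x \<in> ?R (n1 * n2)" "y \<in> ?R (n1 * n2)" "?f x = ?f y"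
    then have "n1 dvd x - y" "n2 dvd x - y" by (simp_all add: mod_eq_dvd_iff)
    then have "n1 * n2 dvd x - y" by (simp only: dd)
    then show "x = y" using xy by (intro dvd_diff_range_eq[of _ "n1 * n2"])
  qed
  have sub: "?f ` ?R (n1 * n2) \<subseteq> ?R n1 \<times> ?R n2" using n by auto
  have "card (?f ` ?R (n1 * n2)) = card (?R n1 \<times> ?R n2)"
    using n by (simp add: card_image[OF inj] card_cartesian_product nat_mult_distrib)
  then have img: "?f ` ?R (n1 * n2) = ?R n1 \<times> ?R n2"
    using card_subset_eq[OF _ sub] by simp
  let ?g = "\<lambda>(u, v). ((u mod n1, v mod n1), (u mod n2, v mod n2))"
  have "bij_betw ?g (?C (n1 * n2)) (?C n1 \<times> ?C n2)"
  proof (rule bij_betw_imageI)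
    show "inj_on ?g (?C (n1 * n2))"
      using inj by (auto simp: inj_on_def)
    show "?g ` ?C (n1 * n2) = ?C n1 \<times> ?C n2"
    proof (intro equalityI subsetI)
      fix z assume "z \<in> ?g ` ?C (n1 * n2)"
      then obtain u v where z: "z = ?g (u, v)" and uv: "n1 * n2 dvd u\<^sup>2 + v\<^sup>2 - c" by auto
      then have "n1 dvd u\<^sup>2 + v\<^sup>2 - c" "n2 dvd u\<^sup>2 + v\<^sup>2 - c" by (simp_all only: dd)
      then show "z \<in> ?C n1 \<times> ?C n2" using n by (simp add: z dvd_mod_sq_iff)
    next
      fix z assume z: "z \<in> ?C n1 \<times> ?C n2"
      obtain u1 v1 u2 v2 where zz: "z = ((u1, v1), (u2, v2))" by (metis prod.exhaust)
      have m: "(u1, u2) \<in> ?f ` ?R (n1 * n2)" "(v1, v2) \<in> ?f ` ?R (n1 * n2)" using z unfolding img by (simp_all add: zz)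
      then obtain u v where uv: "u \<in> ?R (n1 * n2)" "v \<in> ?R (n1 * n2)" "(u1, u2) = ?f u" "(v1, v2) = ?f v" by blast
      have zg: "z = ?g (u, v)" using uv by (simp add: zz)
      have "n1 dvd u1\<^sup>2 + v1\<^sup>2 - c" "n2 dvd u2\<^sup>2 + v2\<^sup>2 - c" using z by (simp_all add: zz)
      then have "n1 * n2 dvd u\<^sup>2 + v\<^sup>2 - c" unfolding dd using uv(3,4) by (simp add: dvd_mod_sq_iff)
      then have "(u, v) \<in> ?C (n1 * n2)" using uv by simp
      then show "z \<in> ?g ` ?C (n1 * n2)" unfolding zg by (rule imageI)
    qed
  qed
  then have "card (?C (n1 * n2)) = card (?C n1 \<times> ?C n2)" by (rule bij_betw_same_card)
  then show ?thesis by (simp only: circ_def card_cartesian_product)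
qed

text \<open>Lifting a point modulo \<open>p\<close> amounts to one linear congruence with
  coefficients \<open>2 * u0\<close> and \<open>2 * v0\<close>. They do not both vanish modulo
  \<open>p\<close>, since \<open>p\<close> does not divide \<open>c\<close>, so there are
  \<open>p\<close> lifts.\<close>

lemma circ_prime_square:
  fixes p c :: int
  assumes p: "prime p" "odd p" and c: "\<not> p dvd c"
  shows "circ c (p\<^sup>2) = nat p * circ c p"
proof -
  have p0: "p > 0" using p(1) by (simp add: prime_gt_0_int)
  let ?C = "\<lambda>n. {(u, v) \<in> {0..<n} \<times> {0..<n::int}. n dvd u\<^sup>2 + v\<^sup>2 - c}"
  let ?g = "\<lambda>z. (fst z mod p, snd z mod p)"
  have img: "?g ` ?C (p\<^sup>2) \<subseteq> ?C p"
    using p0 by (auto simp: dvd_mod_sq_iff power2_eq_square[of p] intro: dvd_mult_left)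
  have fib: "card {z \<in> ?C (p\<^sup>2). ?g z = t} = nat p" if t: "t \<in> ?C p" for t
  proof -
    obtain u0 v0 where tt: "t = (u0, v0)" by (cases t)
    have uv: "u0 \<in> {0..<p}" "v0 \<in> {0..<p}" "p dvd u0\<^sup>2 + v0\<^sup>2 - c" using t by (auto simp: tt)
    obtain w where w: "u0\<^sup>2 + v0\<^sup>2 - c = p * w" using uv(3) by blast
    let ?L = "{(i, j) \<in> {0..<p} \<times> {0..<p}. p dvd w + (2 * u0) * i + (2 * v0) * j}"
    have key: "p\<^sup>2 dvd (u0 + p * i)\<^sup>2 + (v0 + p * j)\<^sup>2 - c \<longleftrightarrow> p dvd w + (2 * u0) * i + (2 * v0) * j" for i j
    proof -
      have "(u0 + p * i)\<^sup>2 + (v0 + p * j)\<^sup>2 - c = (u0\<^sup>2 + v0\<^sup>2 - c) + p * ((2 * u0) * i + (2 * v0) * j) + p * p * (i\<^sup>2 + j\<^sup>2)"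
        by (simp add: power2_eq_square algebra_simps)
      also have "\<dots> = p * ((w + (2 * u0) * i + (2 * v0) * j) + p * (i\<^sup>2 + j\<^sup>2))"
        unfolding w by (simp add: algebra_simps)
      finally have "p\<^sup>2 dvd (u0 + p * i)\<^sup>2 + (v0 + p * j)\<^sup>2 - c \<longleftrightarrow> p dvd (w + (2 * u0) * i + (2 * v0) * j) + p * (i\<^sup>2 + j\<^sup>2)"
        using p0 by (simp add: power2_eq_square)
      also have "\<dots> \<longleftrightarrow> p dvd w + (2 * u0) * i + (2 * v0) * j" by (rule dvd_diff_imp_iff) simp
      finally show ?thesis .
    qed
    have rng: "(x + p * i \<in> {0..<p\<^sup>2} \<and> (x + p * i) mod p = x) = (i \<in> {0..<p})" if x: "x \<in> {0..<p}" for x i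
    proof -
      have "(x + p * i) mod p = x" using x by simp
      moreover have "0 \<le> x + p * i \<longleftrightarrow> 0 \<le> i"
      proof
        assume nn: "0 \<le> x + p * i"
        show "0 \<le> i"
        proof (rule ccontr)
          assume "\<not> 0 \<le> i"
          then have "p * i \<le> p * (- 1)" using p0 by (intro mult_left_mono) auto
          then show False using nn x by simp
        qed
      qed (use x p0 in simp)
      moreover have "x + p * i < p\<^sup>2 \<longleftrightarrow> i < p"
      proof
        assume "i < p"
        then have "p * (i + 1) \<le> p * p" using p0 by (intro mult_left_mono) auto
        then show "x + p * i < p\<^sup>2" using x by (simp add: power2_eq_square algebra_simps)
      next
        assume "x + p * i < p\<^sup>2"
        moreover have "0 \<le> x" using x by simp
        ultimately have "p * i < p * p" unfolding power2_eq_square by linarith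
        then show "i < p" using p0 by simp
      qed
      ultimately show ?thesis by auto
    qed
    have "bij_betw (\<lambda>(i, j). (u0 + p * i, v0 + p * j)) ?L {z \<in> ?C (p\<^sup>2). ?g z = t}"
    proof (rule bij_betw_imageI)
      show "inj_on (\<lambda>(i, j). (u0 + p * i, v0 + p * j)) ?L" using p0 by (auto simp: inj_on_def)
      show "(\<lambda>(i, j). (u0 + p * i, v0 + p * j)) ` ?L = {z \<in> ?C (p\<^sup>2). ?g z = t}"
      proof (intro equalityI subsetI)
        fix z assume "z \<in> (\<lambda>(i, j). (u0 + p * i, v0 + p * j)) ` ?L"
        then obtain i j where z: "z = (u0 + p * i, v0 + p * j)" "i \<in> {0..<p}" "j \<in> {0..<p}" "p dvd w + (2 * u0) * i + (2 * v0) * j" by auto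
        then show "z \<in> {z \<in> ?C (p\<^sup>2). ?g z = t}"
          using rng[OF uv(1), of i] rng[OF uv(2), of j] key[of i j] by (simp add: tt)
      next
        fix z assume z: "z \<in> {z \<in> ?C (p\<^sup>2). ?g z = t}"
        obtain u v where zz: "z = (u, v)" by (cases z)
        define i j where "i = u div p" and "j = v div p"
        have e: "u = u0 + p * i" "v = v0 + p * j" using z mult_div_mod_eq[of p u] mult_div_mod_eq[of p v]
          by (simp_all add: zz tt i_def j_def)
        have "i \<in> {0..<p}" "j \<in> {0..<p}" "p dvd w + (2 * u0) * i + (2 * v0) * j"
          using z rng[OF uv(1), of i] rng[OF uv(2), of j] key[of i j] by (simp_all add: zz tt flip: e)
        then have "(i, j) \<in> ?L" by simp
        then have "(\<lambda>(i, j). (u0 + p * i, v0 + p * j)) (i, j) \<in> (\<lambda>(i, j). (u0 + p * i, v0 + p * j)) ` ?L" by (rule imageI)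
        then show "z \<in> (\<lambda>(i, j). (u0 + p * i, v0 + p * j)) ` ?L" by (simp add: zz e)
      qed
    qed
    then have "card {z \<in> ?C (p\<^sup>2). ?g z = t} = card ?L" by (rule bij_betw_same_card[symmetric])
    also have "\<dots> = nat p"
    proof -
      have cop: "coprime (2 * x) p" if "\<not> p dvd x" for x
      proof -
        have "coprime 2 p" using p(2) by simp
        moreover have "coprime x p" using that p(1) by (metis coprime_commute prime_imp_coprime)
        ultimately show ?thesis by simp
      qed
      show ?thesis
      proof (cases "p dvd u0")
        case False
        then show ?thesis using card_linear_congruence[OF p0 cop, of u0 w "2 * v0"] by simp
      next
        case True
        have "\<not> p dvd v0"
        proof
          assume "p dvd v0"
          then have "p dvd u0\<^sup>2 + v0\<^sup>2" using True by (simp add: power2_eq_square)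
          then have "p dvd u0\<^sup>2 + v0\<^sup>2 - (u0\<^sup>2 + v0\<^sup>2 - c)" using uv(3) by (rule dvd_diff)
          then show False using c by simp
        qed
        then have "card {(i, j) \<in> {0..<p} \<times> {0..<p}. p dvd w + (2 * v0) * i + (2 * u0) * j} = nat p"
          using card_linear_congruence[OF p0 cop, of v0 w "2 * u0"] by simp
        moreover have "bij_betw prod.swap {(i, j) \<in> {0..<p} \<times> {0..<p}. p dvd w + (2 * v0) * i + (2 * u0) * j} ?L"
          by (rule bij_betw_byWitness[of _ prod.swap]) (auto simp: algebra_simps)
        then have "card {(i, j) \<in> {0..<p} \<times> {0..<p}. p dvd w + (2 * v0) * i + (2 * u0) * j} = card ?L"
          by (rule bij_betw_same_card)
        ultimately show ?thesis by (simp only:)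
      qed
    qed
    finally show ?thesis .
  qed
  have "card (?C (p\<^sup>2)) = (\<Sum>z\<in>?C (p\<^sup>2). (\<lambda>_. 1) (?g z))" by simp
  also have "\<dots> = (\<Sum>t\<in>?C p. of_nat (card {z \<in> ?C (p\<^sup>2). ?g z = t}) * (\<lambda>_. 1) t)"
    by (rule sum_fun_comp[OF finite_circ finite_circ img])
  also have "\<dots> = (\<Sum>t\<in>?C p. nat p)"
  proof (rule sum.cong[OF refl])
    fix t assume t: "t \<in> ?C p"
    show "of_nat (card {z \<in> ?C (p\<^sup>2). ?g z = t}) * (\<lambda>_. 1) t = nat p" by (simp only: fib[OF t]) simp
  qed
  finally show ?thesis by (simp add: circ_def mult.commute)
qed

text \<open>Pigeonhole: with \<open>p = 2 * k + 1\<close>, the \<open>k + 1\<close> residues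
  \<open>x\<^sup>2\<close> are distinct, so are the \<open>k + 1\<close> residues
  \<open>t - y\<^sup>2\<close>, and together they are more than \<open>p\<close>.\<close>

lemma sum_two_squares_mod_prime:
  fixes p t :: int
  assumes p: "prime p" "odd p"
  shows "\<exists>x y. p dvd x\<^sup>2 + y\<^sup>2 - t"
proof -
  have p0: "p > 0" using p(1) by (simp add: prime_gt_0_int)
  define k where "k = (p - 1) div 2"
  have k: "p = 2 * k + 1" using p(2) by (auto simp: k_def elim!: oddE)
  have inj: "inj_on (\<lambda>x. x\<^sup>2 mod p) {0..k}"
  proof (rule inj_onI)
    fix x y assume xy: "x \<in> {0..k}" "y \<in> {0..k}" "x\<^sup>2 mod p = y\<^sup>2 mod p"
    have "p dvd (x - y) * (x + y)" using xy(3) by (simp add: mod_eq_dvd_iff power2_eq_square algebra_simps)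
    then have "p dvd x - y \<or> p dvd x + y" using p(1) by (simp add: prime_dvd_mult_iff)
    then show "x = y"
    proof
      assume "p dvd x - y"
      then show ?thesis using xy k by (intro dvd_diff_range_eq[of _ p]) auto
    next
      assume d: "p dvd x + y"
      have "x + y = 0"
      proof (rule ccontr)
        assume "x + y \<noteq> 0"
        then have "p \<le> x + y" using d xy by (intro zdvd_imp_le) auto
        then show False using xy k by auto
      qed
      then show ?thesis using xy by auto
    qed
  qed
  define A B where "A = (\<lambda>x. x\<^sup>2 mod p) ` {0..k}" and "B = (\<lambda>y. (t - y\<^sup>2) mod p) ` {0..k}"
  have injB: "inj_on (\<lambda>y. (t - y\<^sup>2) mod p) {0..k}"
  proof (rule inj_onI)
    fix x y assume xy: "x \<in> {0..k}" "y \<in> {0..k}" "(t - x\<^sup>2) mod p = (t - y\<^sup>2) mod p"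
    then have "p dvd (t - x\<^sup>2) - (t - y\<^sup>2)" by (simp only: mod_eq_dvd_iff)
    then have "p dvd y\<^sup>2 - x\<^sup>2" by simp
    then have "y\<^sup>2 mod p = x\<^sup>2 mod p" by (simp only: mod_eq_dvd_iff)
    then show "x = y" using inj xy by (metis inj_onD)
  qed
  have "card A = card {0..k}" "card B = card {0..k}"
    unfolding A_def B_def by (rule card_image[OF inj], rule card_image[OF injB])
  then have "card A = nat (k + 1)" "card B = nat (k + 1)" by simp_all
  moreover have "A \<subseteq> {0..<p}" "B \<subseteq> {0..<p}" using p0 by (auto simp: A_def B_def)
  then have "card (A \<union> B) \<le> card {0..<p}" by (intro card_mono) auto
  moreover have "finite A" "finite B" by (simp_all add: A_def B_def)
  ultimately have "A \<inter> B \<noteq> {}"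
    using card_Un_disjoint[of A B] k p0 by auto
  then obtain x y where "x\<^sup>2 mod p = (t - y\<^sup>2) mod p" by (auto simp: A_def B_def)
  then have "p dvd x\<^sup>2 - (t - y\<^sup>2)" by (simp only: mod_eq_dvd_iff)
  then have "p dvd x\<^sup>2 + y\<^sup>2 - t" by (simp add: algebra_simps)
  then show ?thesis by blast
qed

text \<open>Multiplication by the Gaussian integer \<open>x + i y\<close>, whose norm is
  \<open>c' / c\<close> modulo \<open>p\<close>, maps one circle injectively into the other.\<close>

lemma circ_prime_le:
  fixes p c c' :: int
  assumes p: "prime p" "odd p" and c: "\<not> p dvd c" "\<not> p dvd c'"
  shows "circ c p \<le> circ c' p"
proof -
  have p0: "p > 0" using p(1) by (simp add: prime_gt_0_int)
  have "coprime c p" using c p(1) by (metis coprime_commute prime_imp_coprime)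
  then obtain ci where "[c * ci = 1] (mod p)" using cong_solve_coprime_int by blast
  then have ci: "p dvd c * ci - 1" by (simp add: cong_iff_dvd_diff)
  obtain x y where xy: "p dvd x\<^sup>2 + y\<^sup>2 - c' * ci" using sum_two_squares_mod_prime[OF p] by blast
  have "p dvd c * (x\<^sup>2 + y\<^sup>2 - c' * ci) + (c * ci - 1) * c'" by (intro dvd_add dvd_mult[OF xy] dvd_mult2[OF ci])
  then have cn: "p dvd c * (x\<^sup>2 + y\<^sup>2) - c'" by (simp add: algebra_simps)
  have nN: "coprime (x\<^sup>2 + y\<^sup>2) p"
  proof -
    have "\<not> p dvd x\<^sup>2 + y\<^sup>2"
    proof
      assume "p dvd x\<^sup>2 + y\<^sup>2"
      then have "p dvd c * (x\<^sup>2 + y\<^sup>2) - (c * (x\<^sup>2 + y\<^sup>2) - c')" by (intro dvd_diff[OF dvd_mult cn])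
      then show False using c by simp
    qed
    then show ?thesis using p(1) by (metis coprime_commute prime_imp_coprime)
  qed
  let ?C = "\<lambda>c. {(u, v) \<in> {0..<p} \<times> {0..<p}. p dvd u\<^sup>2 + v\<^sup>2 - c}"
  let ?f = "\<lambda>(u, v). ((x * u - y * v) mod p, (x * v + y * u) mod p)"
  have "inj_on ?f (?C c)"
  proof (rule inj_onI)
    fix z z' assume z: "z \<in> ?C c" "z' \<in> ?C c" "?f z = ?f z'"
    obtain u v u' v' where zz: "z = (u, v)" "z' = (u', v')" by (cases z, cases z') auto
    have 1: "p dvd (x * u - y * v) - (x * u' - y * v')" and 2: "p dvd (x * v + y * u) - (x * v' + y * u')"
      using z(3) by (simp_all add: zz mod_eq_dvd_iff)
    have "p dvd x * ((x * u - y * v) - (x * u' - y * v')) + y * ((x * v + y * u) - (x * v' + y * u'))"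
      by (intro dvd_add dvd_mult 1 2)
    then have "p dvd (x\<^sup>2 + y\<^sup>2) * (u - u')" by (simp add: power2_eq_square algebra_simps)
    then have "p dvd u - u'" using nN by (simp add: coprime_commute coprime_dvd_mult_right_iff)
    then have u: "u = u'" using z by (intro dvd_diff_range_eq[of _ p]) (auto simp: zz)
    have "p dvd x * ((x * v + y * u) - (x * v' + y * u')) - y * ((x * u - y * v) - (x * u' - y * v'))"
      by (intro dvd_diff[OF dvd_mult[OF 2] dvd_mult[OF 1]])
    then have "p dvd (x\<^sup>2 + y\<^sup>2) * (v - v')" by (simp add: power2_eq_square algebra_simps)
    then have "p dvd v - v'" using nN by (simp add: coprime_commute coprime_dvd_mult_right_iff)
    then have "v = v'" using z by (intro dvd_diff_range_eq[of _ p]) (auto simp: zz)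
    then show "z = z'" using u by (simp add: zz)
  qed
  moreover have "?f ` ?C c \<subseteq> ?C c'"
  proof (rule image_subsetI)
    fix z assume z: "z \<in> ?C c"
    obtain u v where zz: "z = (u, v)" by (cases z)
    have d: "p dvd u\<^sup>2 + v\<^sup>2 - c" using z by (simp add: zz)
    have "p dvd (x\<^sup>2 + y\<^sup>2) * (u\<^sup>2 + v\<^sup>2 - c) + (c * (x\<^sup>2 + y\<^sup>2) - c')" by (intro dvd_add dvd_mult[OF d] cn)
    then have "p dvd (x * u - y * v)\<^sup>2 + (x * v + y * u)\<^sup>2 - c'" by (simp add: power2_eq_square algebra_simps)
    then show "?f z \<in> ?C c'" using p0 by (simp add: zz dvd_mod_sq_iff)
  qed
  ultimately show ?thesis unfolding circ_def by (rule card_inj_on_le) (rule finite_circ)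
qed

lemma card_neg_one_roots:
  fixes p :: int
  assumes p: "prime p" "odd p"
  shows "int (card {t \<in> {0..<p}. p dvd t\<^sup>2 + 1}) = 1 + Legendre (-1) p"
proof -
  have p3: "p > 2" using p prime_ge_2_int[of p] by (cases "p = 2") auto
  have m1: "\<not> [-1 = 0] (mod p)" using p3 by (auto simp: cong_iff_dvd_diff zdvd_not_zless)
  show ?thesis
  proof (cases "QuadRes p (-1)")
    case True
    then obtain y where "[y\<^sup>2 = -1] (mod p)" by (auto simp: QuadRes_def)
    then have y: "p dvd y\<^sup>2 + 1" by (simp add: cong_iff_dvd_diff)
    define s where "s = y mod p"
    have s: "s \<in> {0..<p}" "p dvd s\<^sup>2 + 1"
    proof -
      show "s \<in> {0..<p}" using p3 by (simp add: s_def)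
      have "p dvd (y mod p - y) * (y mod p + y) + (y\<^sup>2 + 1)" by (intro dvd_add dvd_mult2 dvd_mod_diff y)
      then show "p dvd s\<^sup>2 + 1" by (simp add: s_def power2_eq_square algebra_simps)
    qed
    have s0: "s \<noteq> 0" using s p3 by (auto dest: zdvd_imp_le)
    have "{t \<in> {0..<p}. p dvd t\<^sup>2 + 1} = {s, p - s}"
    proof (intro equalityI subsetI)
      fix t assume t: "t \<in> {t \<in> {0..<p}. p dvd t\<^sup>2 + 1}"
      then have "p dvd t\<^sup>2 + 1" by simp
      then have "p dvd (t\<^sup>2 + 1) - (s\<^sup>2 + 1)" using s(2) by (rule dvd_diff)
      then have "p dvd (t - s) * (t + s)" by (simp add: power2_eq_square algebra_simps)
      then have "p dvd t - s \<or> p dvd t + s" using p(1) by (simp add: prime_dvd_mult_iff)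
      then show "t \<in> {s, p - s}"
      proof
        assume "p dvd t - s"
        then have "t = s" using t s by (intro dvd_diff_range_eq[of _ p]) auto
        then show ?thesis by simp
      next
        assume "p dvd t + s"
        then have "p dvd (t + s) - p" by (rule dvd_diff) simp
        then have "p dvd t - (p - s)" by (simp add: algebra_simps)
        then have "t = p - s" using t s s0 by (intro dvd_diff_range_eq[of _ p]) auto
        then show ?thesis by simp
      qed
    next
      fix t assume "t \<in> {s, p - s}"
      moreover have "p dvd (p - s)\<^sup>2 + 1"
      proof -
        have "p dvd p * (p - 2 * s) + (s\<^sup>2 + 1)" using s(2) by simp
        then show ?thesis by (simp add: power2_eq_square algebra_simps)
      qed
      ultimately show "t \<in> {t \<in> {0..<p}. p dvd t\<^sup>2 + 1}" using s s0 by auto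
    qed
    moreover have "s \<noteq> p - s" using p(2) by (metis add_diff_cancel_left' diff_add_cancel even_add)
    ultimately show ?thesis using True m1 by (simp add: Legendre_def)
  next
    case False
    have "{t \<in> {0..<p}. p dvd t\<^sup>2 + 1} = {}"
    proof (rule ccontr)
      assume "{t \<in> {0..<p}. p dvd t\<^sup>2 + 1} \<noteq> {}"
      then obtain t where "p dvd t\<^sup>2 + 1" by blast
      then have "[t\<^sup>2 = -1] (mod p)" by (simp add: cong_iff_dvd_diff)
      then show False using False by (auto simp: QuadRes_def)
    qed
    then have "card {t \<in> {0..<p}. p dvd t\<^sup>2 + 1} = 0" by (simp only: card.empty)
    then show ?thesis using False m1 by (simp add: Legendre_def)
  qed
qed

text \<open>All circles with nonzero \<open>c\<close> have equally many points, by comparison in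
  both directions. The circle with \<open>c = 0\<close> consists of the origin and the remaining
  points of the lines \<open>u = t * v\<close> with \<open>t\<^sup>2 = -1\<close>, and the sizes of
  all circles add up to \<open>p\<^sup>2\<close>.\<close>

lemma circ_prime:
  fixes p c :: int
  assumes p: "prime p" "odd p" and c: "\<not> p dvd c"
  shows "int (circ c p) = p - Legendre (-1) p"
proof -
  have p3: "p > 2" using p prime_ge_2_int[of p] by (cases "p = 2") auto
  then have p0: "p > 0" by simp
  let ?R = "{0..<p}"
  let ?T = "{t \<in> ?R. p dvd t\<^sup>2 + 1}"
  have ndvd: "\<not> p dvd x" if "x \<in> {1..<p}" for x using that zdvd_not_zless by auto
  have eq: "circ x p = circ c p" if "x \<in> {1..<p}" for x
    using circ_prime_le[OF p c ndvd[OF that]] circ_prime_le[OF p ndvd[OF that] c] by simp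
  have "circ 0 p = card ({(0::int, 0::int)} \<union> (\<lambda>(v, t). (t * v mod p, v)) ` ({1..<p} \<times> ?T))"
  proof -
    have "{(u, v) \<in> ?R \<times> ?R. p dvd u\<^sup>2 + v\<^sup>2 - 0} = {(0, 0)} \<union> (\<lambda>(v, t). (t * v mod p, v)) ` ({1..<p} \<times> ?T)"
    proof (intro equalityI subsetI)
      fix z assume z: "z \<in> {(u, v) \<in> ?R \<times> ?R. p dvd u\<^sup>2 + v\<^sup>2 - 0}"
      obtain u v where zz: "z = (u, v)" by (cases z)
      have uv: "u \<in> ?R" "v \<in> ?R" "p dvd u\<^sup>2 + v\<^sup>2" using z by (simp_all add: zz)
      show "z \<in> {(0, 0)} \<union> (\<lambda>(v, t). (t * v mod p, v)) ` ({1..<p} \<times> ?T)"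
      proof (cases "v = 0")
        case True
        then have "p dvd u" using uv p(1) by (simp add: prime_dvd_power_iff)
        then have "u = 0" using uv by (auto dest: zdvd_imp_le)
        then show ?thesis using True by (simp add: zz)
      next
        case False
        then have v: "v \<in> {1..<p}" using uv by simp
        have cv: "coprime v p" using ndvd[OF v] p(1) by (metis coprime_commute prime_imp_coprime)
        obtain t where t: "t \<in> ?R" "p dvd - u + v * t" using linear_congruence_solution[OF p0 cv] by blast
        have "p dvd (- u + v * t) * (u + v * t) + (u\<^sup>2 + v\<^sup>2)" by (intro dvd_add dvd_mult2[OF t(2)] uv(3))
        then have "p dvd v\<^sup>2 * (t\<^sup>2 + 1)" by (simp add: power2_eq_square algebra_simps)
        then have "p dvd t\<^sup>2 + 1" using cv by (simp add: coprime_commute coprime_dvd_mult_right_iff)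
        moreover have "t * v mod p = u"
        proof -
          have "p dvd t * v - u" using t(2) by (simp add: algebra_simps)
          then have "t * v mod p = u mod p" by (simp only: mod_eq_dvd_iff)
          then show ?thesis using uv(1) by simp
        qed
        ultimately have "z = (\<lambda>(v, t). (t * v mod p, v)) (v, t)" "(v, t) \<in> {1..<p} \<times> ?T" using v t by (simp_all add: zz)
        then show ?thesis by (intro UnI2) (rule image_eqI)
      qed
    next
      fix z assume "z \<in> {(0, 0)} \<union> (\<lambda>(v, t). (t * v mod p, v)) ` ({1..<p} \<times> ?T)"
      then consider "z = (0, 0)" | v t where "z = (t * v mod p, v)" "v \<in> {1..<p}" "t \<in> ?T" by auto
      then show "z \<in> {(u, v) \<in> ?R \<times> ?R. p dvd u\<^sup>2 + v\<^sup>2 - 0}"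
      proof cases
        case 2
        have "p dvd (t * v mod p - t * v) * (t * v mod p + t * v) + v\<^sup>2 * (t\<^sup>2 + 1)"
          using 2(3) by (intro dvd_add[OF dvd_mult2[OF dvd_mod_diff] dvd_mult]) auto
        then have "p dvd (t * v mod p)\<^sup>2 + v\<^sup>2" by (simp add: power2_eq_square algebra_simps)
        then show ?thesis using 2 p0 by simp
      qed (use p0 in simp)
    qed
    then show ?thesis unfolding circ_def by simp
  qed
  also have "\<dots> = 1 + card ((\<lambda>(v, t). (t * v mod p, v)) ` ({1..<p} \<times> ?T))"
  proof -
    have "finite ((\<lambda>(v, t). (t * v mod p, v)) ` ({1..<p} \<times> ?T))"
      by (intro finite_imageI finite_cartesian_product finite_interval_filter finite_atLeastLessThan_int)
    moreover have "{(0, 0)} \<inter> (\<lambda>(v, t). (t * v mod p, v)) ` ({1..<p} \<times> ?T) = {}" by auto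
    ultimately show ?thesis by (subst card_Un_disjoint) simp_all
  qed
  also have "card ((\<lambda>(v, t). (t * v mod p, v)) ` ({1..<p} \<times> ?T)) = card ({1..<p} \<times> ?T)"
  proof (rule card_image, rule inj_onI)
    fix z z' assume z: "z \<in> {1..<p} \<times> ?T" "z' \<in> {1..<p} \<times> ?T"
      and e: "(\<lambda>(v, t). (t * v mod p, v)) z = (\<lambda>(v, t). (t * v mod p, v)) z'"
    obtain v t t' where zz: "z = (v, t)" "z' = (v, t')" using e by (cases z, cases z') auto
    have v: "v \<in> {1..<p}" using z by (simp add: zz)
    have cv: "coprime v p" using ndvd[OF v] p(1) by (metis coprime_commute prime_imp_coprime)
    have "p dvd t * v - t' * v" using e by (simp add: zz mod_eq_dvd_iff)
    then have "p dvd v * (t - t')" by (simp add: algebra_simps)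
    then have "p dvd t - t'" using cv by (simp add: coprime_commute coprime_dvd_mult_right_iff)
    then have "t = t'" using z by (intro dvd_diff_range_eq[of _ p]) (auto simp: zz)
    then show "z = z'" by (simp add: zz)
  qed
  also have "\<dots> = nat (p - 1) * card ?T" by (simp only: card_cartesian_product) simp
  finally have N0: "int (circ 0 p) = 1 + (p - 1) * (1 + Legendre (-1) p)"
    using p0 card_neg_one_roots[OF p] by simp
  have "(\<Sum>x\<in>?R. circ x p) = nat p * nat p"
  proof -
    let ?h = "\<lambda>z. ((fst z)\<^sup>2 + (snd z)\<^sup>2) mod p"
    have "card (?R \<times> ?R) = (\<Sum>z\<in>?R \<times> ?R. (\<lambda>_. 1) (?h z))" by simp
    also have "\<dots> = (\<Sum>x\<in>?R. of_nat (card {z \<in> ?R \<times> ?R. ?h z = x}) * (\<lambda>_. 1) x)"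
      using p0 by (intro sum_fun_comp) auto
    also have "\<dots> = (\<Sum>x\<in>?R. circ x p)"
    proof (rule sum.cong[OF refl])
      fix x assume x: "x \<in> ?R"
      have "?h z = x \<longleftrightarrow> p dvd (fst z)\<^sup>2 + (snd z)\<^sup>2 - x" for z
      proof -
        have "?h z = x \<longleftrightarrow> ?h z = x mod p" using x by simp
        then show ?thesis by (simp only: mod_eq_dvd_iff)
      qed
      then have "{z \<in> ?R \<times> ?R. ?h z = x} = {(u, v) \<in> ?R \<times> ?R. p dvd u\<^sup>2 + v\<^sup>2 - x}" by auto
      then show "of_nat (card {z \<in> ?R \<times> ?R. ?h z = x}) * (\<lambda>_. 1) x = circ x p" by (simp add: circ_def)
    qed
    finally show ?thesis by (simp add: card_cartesian_product)
  qed
  moreover have "?R = insert 0 {1..<p}" using p0 by auto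
  then have "(\<Sum>x\<in>?R. circ x p) = circ 0 p + (\<Sum>x\<in>{1..<p}. circ x p)" by simp
  moreover have "(\<Sum>x\<in>{1..<p}. circ x p) = nat (p - 1) * circ c p" using eq by simp
  ultimately have "circ 0 p + nat (p - 1) * circ c p = nat p * nat p" by simp
  then have "int (circ 0 p + nat (p - 1) * circ c p) = int (nat p * nat p)" by (simp only:)
  then have "1 + (p - 1) * (1 + Legendre (-1) p) + (p - 1) * int (circ c p) = p * p" using p0 N0 by simp
  then have "(p - 1) * int (circ c p) = (p - 1) * (p - Legendre (-1) p)" by (simp add: algebra_simps)
  then show ?thesis using p3 by simp
qed

section \<open>A uniform bound for the local solution sets\<close>

lemma card_shifted_roots_le:
  fixes q k s t :: int
  assumes q: "q > 0" and k: "k > 0" "k dvd q"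
  shows "real (card {u \<in> {0..<q}. k dvd (u - s)\<^sup>2 - t}) \<le> 2 * of_int q / of_int k * real (card {x \<in> {0..<k}. k dvd x * x - t})"
proof -
  let ?A = "{u \<in> {0..<q}. k dvd (u - s)\<^sup>2 - t}" and ?B = "{x \<in> {0..<k}. k dvd x * x - t}"
  let ?g = "\<lambda>u. (u - s) mod k"
  have kq: "of_int k \<le> real_of_int q" using zdvd_imp_le[OF k(2) q] by simp
  have img: "?g ` ?A \<subseteq> ?B"
  proof (rule image_subsetI)
    fix u assume u: "u \<in> ?A"
    have "k dvd ((u - s) mod k - (u - s)) * ((u - s) mod k + (u - s)) + ((u - s)\<^sup>2 - t)"
      using u by (intro dvd_add[OF dvd_mult2[OF dvd_mod_diff]]) simp
    moreover have "(x - y) * (x + y) + (y\<^sup>2 - t) = x * x - t" for x y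
      by (simp add: power2_eq_square algebra_simps)
    from this[of "?g u" "u - s"] have "((u - s) mod k - (u - s)) * ((u - s) mod k + (u - s)) + ((u - s)\<^sup>2 - t) = ?g u * ?g u - t" .
    ultimately show "?g u \<in> ?B" using k by simp
  qed
  have "real (card ?A) = (\<Sum>u\<in>?A. (\<lambda>_. 1::real) (?g u))" by simp
  also have "\<dots> = (\<Sum>x\<in>?B. of_nat (card {u \<in> ?A. ?g u = x}) * (\<lambda>_. 1::real) x)"
    by (rule sum_fun_comp[OF finite_interval_filter finite_interval_filter img])
  also have "\<dots> \<le> (\<Sum>x\<in>?B. 2 * of_int q / of_int k)"
  proof (rule sum_mono)
    fix x assume x: "x \<in> ?B"
    have "{u \<in> ?A. ?g u = x} \<subseteq> {u \<in> {0..<0 + q}. u mod k = (x + s) mod k}"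
      by (auto simp: mod_add_left_eq)
    then have "card {u \<in> ?A. ?g u = x} \<le> card {u \<in> {0..<0 + q}. u mod k = (x + s) mod k}"
      by (rule card_mono[OF finite_interval_filter])
    then have "real (card {u \<in> ?A. ?g u = x}) \<le> of_int q / of_int k + 1"
      using card_residue_interval_bounds[OF k(1), of q 0 "x + s"] q by linarith
    also have "\<dots> \<le> 2 * of_int q / of_int k" using kq k by (simp add: field_simps)
    finally show "of_nat (card {u \<in> ?A. ?g u = x}) * (\<lambda>_. 1::real) x \<le> 2 * of_int q / of_int k" by simp
  qed
  finally show ?thesis by (simp add: mult.commute)
qed

text \<open>The number of square roots of \<open>c\<close> modulo \<open>q\<close> is at most
  \<open>tau q\<close> times the largest \<open>e\<close> with \<open>e * e\<close> dividing
  \<open>q\<close> and \<open>4 * c\<close>. The square of this \<open>e\<close> is bounded by the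
  sum of \<open>e\<^sup>2\<close> over all such \<open>e\<close>. After exchanging the sums,
  \<open>e * e\<close> divides \<open>(u - s)\<^sup>2 - t\<close> only for a proportion of the
  \<open>u\<close> of order \<open>1 / e\<^sup>2\<close>, up to \<open>tau q\<close>, which cancels
  the weight.\<close>

lemma sum_roots_sq_le:
  fixes q s t :: int
  assumes q: "q > 0" "odd q" and t: "\<bar>t\<bar> = 2"
  shows "(\<Sum>u\<in>{0..<q}. (real (card {v \<in> {0..<q}. q dvd v * v - (t - (u - s)\<^sup>2)}))\<^sup>2) \<le> 4 * of_int q * (real (tau q)) ^ 4"
proof -
  let ?R = "{0..<q}"
  let ?V = "\<lambda>c. card {v \<in> ?R. q dvd v * v - c}"
  define D where "D = {e::int. 0 < e \<and> e * e dvd q}"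
  have Dsub: "D \<subseteq> {d. 0 < d \<and> d dvd q}" by (auto simp: D_def intro: dvd_mult_left)
  have finD: "finite D" by (rule finite_subset[OF Dsub finite_posdvd]) (use q in simp)
  have cardD: "card D \<le> tau q" unfolding tau_def using q by (intro card_mono Dsub finite_posdvd) simp
  have V: "(real (?V c))\<^sup>2 \<le> (real (tau q))\<^sup>2 * (\<Sum>e\<in>D. if e * e dvd 4 * c then (of_int e)\<^sup>2 else 0)" for c
  proof -
    define Dc where "Dc = {e \<in> D. e * e dvd 4 * c}"
    have finDc: "finite Dc" using finD by (simp add: Dc_def)
    have one: "1 \<in> Dc" by (simp add: Dc_def D_def)
    define E where "E = Max Dc"
    have E: "E \<in> Dc" unfolding E_def using finDc one by (intro Max_in) auto
    then have E0: "E > 0" by (simp add: Dc_def D_def)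
    have "?V c \<le> tau q * nat E"
    proof (rule card_sqrt_mod_le[OF q(1)])
      fix e :: int assume "e > 0" "e * e dvd q" "e * e dvd 4 * c"
      then have "e \<in> Dc" by (simp add: Dc_def D_def)
      then show "e \<le> int (nat E)" using finDc E0 by (simp add: E_def)
    qed
    then have "real (?V c) \<le> real (tau q * nat E)" by (simp only: of_nat_le_iff)
    then have "(real (?V c))\<^sup>2 \<le> (real (tau q) * of_int E)\<^sup>2" using E0 by (intro power_mono) auto
    also have "\<dots> = (real (tau q))\<^sup>2 * (of_int E)\<^sup>2" by (simp add: power_mult_distrib)
    also have "(of_int E)\<^sup>2 \<le> (\<Sum>e\<in>Dc. (real_of_int e)\<^sup>2)" using E finDc by (intro member_le_sum) auto
    also have "\<dots> = (\<Sum>e\<in>D. if e * e dvd 4 * c then (of_int e)\<^sup>2 else 0)"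
      unfolding Dc_def using finD by (rule sum.inter_filter)
    finally show ?thesis by (simp add: mult_left_mono)
  qed
  have "(\<Sum>u\<in>?R. (real (?V (t - (u - s)\<^sup>2)))\<^sup>2)
      \<le> (\<Sum>u\<in>?R. (real (tau q))\<^sup>2 * (\<Sum>e\<in>D. if e * e dvd 4 * (t - (u - s)\<^sup>2) then (of_int e)\<^sup>2 else 0))"
    by (intro sum_mono V)
  also have "\<dots> = (real (tau q))\<^sup>2 * (\<Sum>e\<in>D. \<Sum>u\<in>?R. if e * e dvd 4 * (t - (u - s)\<^sup>2) then (of_int e)\<^sup>2 else 0)"
    by (subst sum.swap) (simp only: sum_distrib_left)
  also have "\<dots> \<le> (real (tau q))\<^sup>2 * (\<Sum>e\<in>D. 4 * of_int q * real (tau q))"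
  proof (intro mult_left_mono sum_mono)
    fix e assume e: "e \<in> D"
    define k where "k = e * e"
    have k: "k > 0" "k dvd q" using e by (simp_all add: D_def k_def)
    have ok: "odd k" using q k(2) by (metis dvd_trans)
    have "coprime k 2" using ok by simp
    then have "coprime k (2 * 2)" by (simp only: coprime_mult_right_iff)
    then have c4: "coprime k 4" by simp
    have iff: "e * e dvd 4 * (t - (u - s)\<^sup>2) \<longleftrightarrow> k dvd (u - s)\<^sup>2 - t" for u
    proof -
      have "e * e dvd 4 * (t - (u - s)\<^sup>2) \<longleftrightarrow> k dvd t - (u - s)\<^sup>2"
        unfolding k_def[symmetric] by (rule coprime_dvd_mult_right_iff[OF c4])
      then show ?thesis by (simp only: dvd_diff_commute)
    qed
    have "(\<Sum>u\<in>?R. if e * e dvd 4 * (t - (u - s)\<^sup>2) then (real_of_int e)\<^sup>2 else 0)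
        = (of_int e)\<^sup>2 * real (card {u \<in> ?R. k dvd (u - s)\<^sup>2 - t})"
    proof -
      have "(\<Sum>u\<in>?R. if e * e dvd 4 * (t - (u - s)\<^sup>2) then (real_of_int e)\<^sup>2 else 0)
         = (\<Sum>u\<in>?R. (of_int e)\<^sup>2 * (if k dvd (u - s)\<^sup>2 - t then 1 else 0))"
        unfolding iff by (intro sum.cong refl) simp
      then show ?thesis by (simp only: sum_distrib_left[symmetric] sum_if_card[OF finite_atLeastLessThan_int])
    qed
    also have "\<dots> \<le> (of_int e)\<^sup>2 * (2 * of_int q / of_int k * real (card {x \<in> {0..<k}. k dvd x * x - t}))"
      by (intro mult_left_mono card_shifted_roots_le q k) simp
    also have "\<dots> = 2 * of_int q * real (card {x \<in> {0..<k}. k dvd x * x - t})"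
      using e by (simp add: k_def D_def power2_eq_square)
    also have "\<dots> \<le> 2 * of_int q * real (tau q * 2)"
    proof (intro mult_left_mono)
      \<comment> \<open>Here \<open>|t| = 2\<close>, so a square dividing \<open>4 * t\<close>
        divides 8 and has root at most 2: the square root count for \<open>t\<close> has no large
        factor.\<close>
      have "card {x \<in> {0..<k}. k dvd x * x - t} \<le> tau k * 2"
      proof (rule card_sqrt_mod_le[OF k(1)])
        fix g :: int assume g: "g > 0" "g * g dvd 4 * t"
        show "g \<le> int 2"
        proof (rule ccontr)
          assume "\<not> g \<le> int 2"
          then have "3 * 3 \<le> g * g" by (intro mult_mono) auto
          moreover have "t = 2 \<or> t = - 2" using t by linarith
          then have "g * g dvd 8" using g(2) by auto
          then have "g * g \<le> 8" by (rule zdvd_imp_le) simp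
          ultimately show False by simp
        qed
      qed
      also have "\<dots> \<le> tau q * 2" using tau_mono[OF k(2)] q by simp
      finally show "real (card {x \<in> {0..<k}. k dvd x * x - t}) \<le> real (tau q * 2)" by (simp only: of_nat_le_iff)
    qed (use q in simp)
    finally show "(\<Sum>u\<in>?R. if e * e dvd 4 * (t - (u - s)\<^sup>2) then (real_of_int e)\<^sup>2 else 0) \<le> 4 * of_int q * real (tau q)"
      by simp
  qed simp
  also have "\<dots> = (real (tau q))\<^sup>2 * (real (card D) * (4 * of_int q * real (tau q)))" by simp
  also have "\<dots> \<le> (real (tau q))\<^sup>2 * (real (tau q) * (4 * of_int q * real (tau q)))"
    using cardD q by (intro mult_left_mono mult_right_mono) auto
  also have "\<dots> = 4 * of_int q * (real (tau q)) ^ 4" by (simp add: power_numeral_reduce)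
  finally show ?thesis .
qed

text \<open>For given \<open>u = a + e\<close>, combining the form with twice the determinant makes
  \<open>b - c\<close> a square root of \<open>2 - u\<^sup>2\<close> and \<open>b + c\<close> a
  square root of \<open>-2 - (u - 2 * a)\<^sup>2\<close>. The product of the two root counts is
  bounded by the mean of their squares. Besides the total over \<open>a\<close>, a bound for each
  single \<open>a\<close> is wanted, because the error terms are estimated separately for each top
  left entry.\<close>

lemma card_local_set_le:
  fixes q a :: int
  assumes q: "q > 0" "odd q"
  shows "real (card (local_set q a)) \<le> 4 * of_int q * (real (tau q)) ^ 4"
proof -
  let ?R = "{0..<q}"
  let ?V = "\<lambda>c. {v \<in> ?R. q dvd v * v - c}"
  let ?W = "SIGMA u:?R. ?V (2 - (u - 0)\<^sup>2) \<times> ?V (-2 - (u - 2 * a)\<^sup>2)"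
  let ?f = "\<lambda>(b, c, e). ((a + e) mod q, (b - c) mod q, (b + c) mod q)"
  have finV: "finite (?V c)" for c by (rule finite_interval_filter)
  have c2: "coprime 2 q" using q by simp
  have sqm: "q dvd (x mod q) * (x mod q) - x * x" for x
  proof -
    have "q dvd (x mod q - x) * (x mod q + x)" by (intro dvd_mult2 dvd_mod_diff)
    then show ?thesis by (simp add: algebra_simps)
  qed
  have "inj_on ?f (local_set q a)"
  proof (rule inj_onI)
    fix z z' assume z: "z \<in> local_set q a" "z' \<in> local_set q a" "?f z = ?f z'"
    obtain b c e b' c' e' where zz: "z = (b, c, e)" "z' = (b', c', e')" by (metis prod.exhaust)
    have d: "q dvd (a + e) - (a + e')" "q dvd (b - c) - (b' - c')" "q dvd (b + c) - (b' + c')"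
      using z(3) by (simp_all only: zz prod.case prod.inject mod_eq_dvd_iff)
    have R: "b \<in> ?R" "c \<in> ?R" "e \<in> ?R" "b' \<in> ?R" "c' \<in> ?R" "e' \<in> ?R"
      using z by (auto simp: zz local_set_def)
    have e: "e = e'" using d(1) R by (intro dvd_diff_range_eq[of _ q]) auto
    have "q dvd ((b - c) - (b' - c')) + ((b + c) - (b' + c'))" by (rule dvd_add[OF d(2) d(3)])
    then have "q dvd 2 * (b - b')" by (simp add: algebra_simps)
    then have "q dvd b - b'" using c2 by (simp only: coprime_commute coprime_dvd_mult_right_iff)
    then have b: "b = b'" using R by (intro dvd_diff_range_eq[of _ q])
    have "q dvd c - c'" using d(3) by (simp add: b)
    then have "c = c'" using R by (intro dvd_diff_range_eq[of _ q])
    then show "z = z'" by (simp add: zz e b)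
  qed
  moreover have "?f ` local_set q a \<subseteq> ?W"
  proof (rule image_subsetI)
    fix z assume z: "z \<in> local_set q a"
    obtain b c e where zz: "z = (b, c, e)" by (metis prod.exhaust)
    have d: "q dvd a * e - b * c - 1" "q dvd a\<^sup>2 + b\<^sup>2 + c\<^sup>2 + e\<^sup>2" using z by (auto simp: zz local_set_def)
    define u where "u = (a + e) mod q"
    have su: "q dvd u - (a + e)" unfolding u_def by (rule dvd_mod_diff)
    have 1: "q dvd ((a\<^sup>2 + b\<^sup>2 + c\<^sup>2 + e\<^sup>2) + 2 * (a * e - b * c - 1)) + ((b - c) mod q * ((b - c) mod q) - (b - c) * (b - c)) + (u - (a + e)) * (u + (a + e))" (is "q dvd ?X1")
      by (intro dvd_add[OF dvd_add[OF dvd_add[OF d(2) dvd_mult[OF d(1)]] sqm] dvd_mult2[OF su]])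
    have 2: "q dvd ((a\<^sup>2 + b\<^sup>2 + c\<^sup>2 + e\<^sup>2) - 2 * (a * e - b * c - 1)) + ((b + c) mod q * ((b + c) mod q) - (b + c) * (b + c)) + (u - (a + e)) * (u - 2 * a + e - a)" (is "q dvd ?X2")
      by (intro dvd_add[OF dvd_add[OF dvd_diff[OF d(2) dvd_mult[OF d(1)]] sqm] dvd_mult2[OF su]])
    have 3: "q dvd (b - c) mod q * ((b - c) mod q) - (2 - (u - 0)\<^sup>2)"
    proof -
      have "?X1 = (b - c) mod q * ((b - c) mod q) - (2 - (u - 0)\<^sup>2)" by (simp add: power2_eq_square algebra_simps)
      with 1 show ?thesis by (simp only:)
    qed
    have 4: "q dvd (b + c) mod q * ((b + c) mod q) - (-2 - (u - 2 * a)\<^sup>2)"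
    proof -
      have "?X2 = (b + c) mod q * ((b + c) mod q) - (-2 - (u - 2 * a)\<^sup>2)" by (simp add: power2_eq_square algebra_simps)
      with 2 show ?thesis by (simp only:)
    qed
    show "?f z \<in> ?W" using q 3 4 by (simp add: zz flip: u_def)
      (simp add: u_def)
  qed
  moreover have finW: "finite ?W" by (intro finite_SigmaI finite_cartesian_product finV) simp
  ultimately have "card (local_set q a) \<le> card ?W" by (rule card_inj_on_le)
  also have "card ?W = (\<Sum>u\<in>?R. card (?V (2 - (u - 0)\<^sup>2) \<times> ?V (-2 - (u - 2 * a)\<^sup>2)))"
    by (rule card_SigmaI) (simp, intro ballI finite_cartesian_product finV)
  also have "\<dots> = (\<Sum>u\<in>?R. card (?V (2 - (u - 0)\<^sup>2)) * card (?V (-2 - (u - 2 * a)\<^sup>2)))"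
    by (simp only: card_cartesian_product)
  finally have "real (card (local_set q a)) \<le> (\<Sum>u\<in>?R. real (card (?V (2 - (u - 0)\<^sup>2))) * real (card (?V (-2 - (u - 2 * a)\<^sup>2))))"
    by (simp only: of_nat_le_iff flip: of_nat_mult of_nat_sum)
  also have "\<dots> \<le> (\<Sum>u\<in>?R. ((real (card (?V (2 - (u - 0)\<^sup>2))))\<^sup>2 + (real (card (?V (-2 - (u - 2 * a)\<^sup>2))))\<^sup>2) / 2)"
  proof (rule sum_mono)
    fix u
    have *: "x * y \<le> (x\<^sup>2 + y\<^sup>2) / 2" for x y :: real
    proof -
      have "0 \<le> (x - y)\<^sup>2" by simp
      then show ?thesis by (simp add: power2_eq_square field_simps)
    qed
    show "real (card (?V (2 - (u - 0)\<^sup>2))) * real (card (?V (-2 - (u - 2 * a)\<^sup>2))) \<le> ((real (card (?V (2 - (u - 0)\<^sup>2))))\<^sup>2 + (real (card (?V (-2 - (u - 2 * a)\<^sup>2))))\<^sup>2) / 2"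
      by (rule *)
  qed
  also have "\<dots> = ((\<Sum>u\<in>?R. (real (card (?V (2 - (u - 0)\<^sup>2))))\<^sup>2) + (\<Sum>u\<in>?R. (real (card (?V (-2 - (u - 2 * a)\<^sup>2))))\<^sup>2)) / 2"
    by (simp only: sum.distrib sum_divide_distrib[symmetric])
  also have "\<dots> \<le> (4 * of_int q * (real (tau q)) ^ 4 + 4 * of_int q * (real (tau q)) ^ 4) / 2"
    using sum_roots_sq_le[OF q, of 2 0] sum_roots_sq_le[OF q, of "-2" "2 * a"] by (intro divide_right_mono add_mono) auto
  finally show ?thesis by simp
qed

lemma local_set_mod: "local_set q (a mod q) = local_set q a"
proof -
  have 1: "q dvd (a mod q) * e - b * c - 1 \<longleftrightarrow> q dvd a * e - b * c - 1" for b c e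
  proof (rule dvd_diff_imp_iff)
    have "q dvd (a mod q - a) * e" by (intro dvd_mult2 dvd_mod_diff)
    then show "q dvd ((a mod q) * e - b * c - 1) - (a * e - b * c - 1)" by (simp add: algebra_simps)
  qed
  have 2: "q dvd (a mod q)\<^sup>2 + b\<^sup>2 + c\<^sup>2 + e\<^sup>2 \<longleftrightarrow> q dvd a\<^sup>2 + b\<^sup>2 + c\<^sup>2 + e\<^sup>2" for b c e
  proof (rule dvd_diff_imp_iff)
    have "q dvd (a mod q - a) * (a mod q + a)" by (intro dvd_mult2 dvd_mod_diff)
    then show "q dvd ((a mod q)\<^sup>2 + b\<^sup>2 + c\<^sup>2 + e\<^sup>2) - (a\<^sup>2 + b\<^sup>2 + c\<^sup>2 + e\<^sup>2)"
      by (simp add: power2_eq_square algebra_simps)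
  qed
  show ?thesis unfolding local_set_def 1 2 ..
qed

section \<open>The number of local solutions as a product over primes\<close>

definition local_total :: "nat \<Rightarrow> real" where
  "local_total d = real (circ 2 ((int d)\<^sup>2) * circ (-2) ((int d)\<^sup>2))"

lemma circ_square_prod:
  assumes "finite A" "\<And>p. p \<in> A \<Longrightarrow> prime p \<and> odd (p::nat)" "\<bar>c\<bar> = (2::int)"
  shows "real (circ c ((int (\<Prod>A))\<^sup>2)) = (\<Prod>p\<in>A. real p * (real p - of_int (Legendre (-1) (int p))))"
  using assms(1,2)
proof (induction A rule: finite_induct)
  case empty
  have "{(u, v) \<in> {0..<1} \<times> {0..<1}. (1::int) dvd u\<^sup>2 + v\<^sup>2 - c} = {(0, 0)}" by auto
  then show ?case by (simp add: circ_def)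
next
  case (insert p A)
  have p: "prime p" "odd p" using insert.prems by auto
  have "\<not> int p dvd c"
  proof
    assume "int p dvd c"
    then have "int p dvd 2" using assms(3) by (metis dvd_abs_iff)
    then have "p dvd 2" by presburger
    then show False using p by (metis primes_dvd_imp_eq two_is_prime_nat even_numeral dvd_refl)
  qed
  then have cp: "real (circ c ((int p)\<^sup>2)) = real p * (real p - of_int (Legendre (-1) (int p)))"
  proof -
    have pi: "prime (int p)" "odd (int p)" using p by simp_all
    have "real (circ c (int p)) = real_of_int (int (circ c (int p)))" by simp
    also have "\<dots> = real p - of_int (Legendre (-1) (int p))"
      unfolding circ_prime[OF pi \<open>\<not> int p dvd c\<close>] by simp
    finally show ?thesis using circ_prime_square[OF pi \<open>\<not> int p dvd c\<close>] by simp
  qed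
  have "coprime p (\<Prod>A)" using insert p by (intro prod_coprime_right) (metis insertCI primes_coprime)
  then have cop: "coprime ((int p)\<^sup>2) ((int (\<Prod>A))\<^sup>2)" by (simp add: coprime_int_iff del: of_nat_prod)
  have pos: "\<Prod>A > 0" using insert by (intro prod_pos) (auto simp: prime_gt_0_nat)
  have "(int (\<Prod>(insert p A)))\<^sup>2 = (int p)\<^sup>2 * (int (\<Prod>A))\<^sup>2"
    using insert by (simp add: power_mult_distrib)
  then have "real (circ c ((int (\<Prod>(insert p A)))\<^sup>2)) = real (circ c ((int p)\<^sup>2)) * real (circ c ((int (\<Prod>A))\<^sup>2))"
    using circ_mult[OF _ _ cop, of c] pos prime_gt_0_nat[OF p(1)] by (simp del: of_nat_prod)
  then show ?case using insert by (simp add: cp)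
qed

lemma local_total_eq:
  assumes "squarefree d" "odd d"
  shows "local_total d = (\<Prod>p\<in>prime_factors d. (real p * (real p - of_int (Legendre (-1) (int p))))\<^sup>2)"
proof -
  have A: "prime p \<and> odd p" if "p \<in> prime_factors d" for p
    using that assms(2) by (auto dest: dvd_trans)
  have d: "d = \<Prod>(prime_factors d)" using squarefree_eq_prod_prime_factors[OF assms(1)] .
  have "real (circ c ((int d)\<^sup>2)) = (\<Prod>p\<in>prime_factors d. real p * (real p - of_int (Legendre (-1) (int p))))"
    if "\<bar>c\<bar> = 2" for c
    using circ_square_prod[of "prime_factors d" c] A that d by simp
  then show ?thesis by (simp add: local_total_def power2_eq_square prod.distrib)
qed

section \<open>The leading constant\<close>

definition kap_term :: "nat \<Rightarrow> nat \<Rightarrow> real" where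
  "kap_term d e = (if coprime e d then mu e / (real e)\<^sup>2 else 0)"

text \<open>The value is the product of \<open>1 - 1 / p\<^sup>2\<close> over the primes not
  dividing \<open>d\<close>. It arises as the mean of \<open>psi d a\<close> over \<open>a\<close>
  in a residue class modulo \<open>d\<^sup>2\<close>, the same for every class.\<close>

definition kap :: "nat \<Rightarrow> real" where
  "kap d = (\<Sum>e. kap_term d e)"

lemma kap_term_bound: "\<bar>kap_term d e\<bar> \<le> inverse ((real e)\<^sup>2)"
  using abs_mu_le_1[of e] by (simp add: kap_term_def divide_inverse mult_left_le_one_le abs_mult)

lemma summable_kap_term: "summable (kap_term d)"
proof (rule summable_comparison_test)
  show "\<exists>N. \<forall>n\<ge>N. norm (kap_term d n) \<le> inverse ((real n)\<^sup>2)" using kap_term_bound by auto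
qed (rule inverse_power_summable, simp)

lemma kap_sums: "kap_term d sums kap d"
  unfolding kap_def by (rule summable_sums[OF summable_kap_term])

lemma sum_inverse_squares_tail:
  assumes "M \<ge> 1" shows "(\<Sum>e\<in>{Suc M..N}. inverse ((real e)\<^sup>2)) \<le> 1 / real M"
proof -
  have "(\<Sum>e\<in>{Suc M..N}. inverse ((real e)\<^sup>2)) \<le> 1 / real M - 1 / real N" if "N \<ge> M" for N
    using that
  proof (induction N rule: dec_induct)
    case (step N)
    have "inverse ((real (Suc N))\<^sup>2) \<le> 1 / real N - 1 / real (Suc N)"
    proof -
      have "1 / (real (Suc N))\<^sup>2 \<le> 1 / (real N * real (Suc N))"
        unfolding power2_eq_square using step(1) assms by (intro divide_left_mono mult_right_mono) auto
      then show ?thesis using step(1) assms by (simp add: field_simps)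
    qed
    then show ?case using step by (simp add: sum.cl_ivl_Suc)
  qed simp
  then show ?thesis by (cases "N \<ge> M") (smt (verit) divide_nonneg_nonneg of_nat_0_le_iff, simp)
qed

lemma kap_tail:
  assumes M: "M \<ge> 1" shows "\<bar>kap d - (\<Sum>e\<in>{1..M}. kap_term d e)\<bar> \<le> 1 / real M"
proof -
  have 0: "kap_term d 0 = 0" by (simp add: kap_term_def mu_def)
  have "(\<lambda>N. \<Sum>e\<in>{..N}. kap_term d e) \<longlonglongrightarrow> kap d"
    using kap_sums[of d] by (simp add: sums_def_le)
  then have "(\<lambda>N. \<bar>(\<Sum>e\<in>{..N}. kap_term d e) - (\<Sum>e\<in>{1..M}. kap_term d e)\<bar>) \<longlonglongrightarrow> \<bar>kap d - (\<Sum>e\<in>{1..M}. kap_term d e)\<bar>"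
    by (intro tendsto_intros)
  moreover have "\<exists>N0. \<forall>N\<ge>N0. \<bar>(\<Sum>e\<in>{..N}. kap_term d e) - (\<Sum>e\<in>{1..M}. kap_term d e)\<bar> \<le> 1 / real M"
  proof (intro exI allI impI)
    fix N assume N: "N \<ge> M"
    have "{..N} = insert 0 ({1..M} \<union> {Suc M..N})" using N M by auto
    then have "(\<Sum>e\<in>{..N}. kap_term d e) = (\<Sum>e\<in>{1..M} \<union> {Suc M..N}. kap_term d e)" by (simp add: 0)
    also have "\<dots> = (\<Sum>e\<in>{1..M}. kap_term d e) + (\<Sum>e\<in>{Suc M..N}. kap_term d e)"
      by (intro sum.union_disjoint) auto
    finally have "\<bar>(\<Sum>e\<in>{..N}. kap_term d e) - (\<Sum>e\<in>{1..M}. kap_term d e)\<bar> = \<bar>\<Sum>e\<in>{Suc M..N}. kap_term d e\<bar>" by simp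
    also have "\<dots> \<le> (\<Sum>e\<in>{Suc M..N}. \<bar>kap_term d e\<bar>)" by (rule sum_abs)
    also have "\<dots> \<le> (\<Sum>e\<in>{Suc M..N}. inverse ((real e)\<^sup>2))" by (intro sum_mono kap_term_bound)
    also have "\<dots> \<le> 1 / real M" by (rule sum_inverse_squares_tail[OF M])
    finally show "\<bar>(\<Sum>e\<in>{..N}. kap_term d e) - (\<Sum>e\<in>{1..M}. kap_term d e)\<bar> \<le> 1 / real M" .
  qed
  ultimately show ?thesis by (rule LIMSEQ_le_const2)
qed

text \<open>Separate the \<open>e\<close> divisible by \<open>p\<close>. A nonzero term there has
  the form \<open>p * e'\<close> with \<open>p\<close> not dividing \<open>e'\<close>, and
  \<open>mu (p * e') = - mu e'\<close>, so this part is \<open>- 1 / p\<^sup>2\<close> times the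
  rest.\<close>

lemma kap_prime:
  assumes p: "prime p" "\<not> p dvd d"
  shows "kap d = (1 - 1 / (real p)\<^sup>2) * kap (p * d)"
proof -
  have p0: "p > 0" using p(1) by (rule prime_gt_0_nat)
  define h where "h e = (if p dvd e then kap_term d e else 0)" for e
  have split: "kap_term d e = kap_term (p * d) e + h e" for e
  proof (cases "p dvd e")
    case True
    then have "\<not> coprime e p" using p(1) by (metis coprime_absorb_right coprime_commute not_prime_unit)
    then show ?thesis using True by (simp add: h_def kap_term_def)
  next
    case False
    then have "coprime e p" using p(1) by (metis coprime_commute prime_imp_coprime)
    then show ?thesis using False by (simp add: h_def kap_term_def)
  qed
  have hp: "h (p * e) = - (1 / (real p)\<^sup>2) * kap_term (p * d) e" for e
  proof (cases "p dvd e \<or> e = 0")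
    case True
    then have "\<not> squarefree (p * e)"
    proof
      assume "p dvd e"
      then have "p\<^sup>2 dvd p * e" by (simp add: power2_eq_square)
      then show ?thesis using p(1) by (intro not_squarefreeI[of p]) auto
    qed simp
    then have "mu (p * e) = 0" by (simp add: mu_def)
    moreover have "kap_term (p * d) e = 0"
    proof (cases "e = 0")
      case False
      then have "\<not> coprime e p" using p(1) True by (metis coprime_absorb_right coprime_commute not_prime_unit)
      then show ?thesis by (simp add: kap_term_def)
    qed (simp add: kap_term_def mu_def)
    ultimately show ?thesis by (simp add: h_def kap_term_def)
  next
    case False
    then have "coprime e p" using p(1) by (metis coprime_commute prime_imp_coprime)
    moreover have "coprime p d" using p by (simp add: prime_imp_coprime)
    ultimately show ?thesis using False mu_mult_prime[OF p(1), of e]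
      by (simp add: h_def kap_term_def power_mult_distrib)
  qed
  have sm: "strict_mono (\<lambda>e. p * e)" using p0 by (auto simp: strict_mono_def)
  have hz: "h e = 0" if "e \<notin> range (\<lambda>e. p * e)" for e using that by (auto simp: h_def)
  have A: "(\<lambda>e. h (p * e)) sums (- (1 / (real p)\<^sup>2) * kap (p * d))"
    unfolding hp by (intro sums_mult kap_sums)
  have "h sums (- (1 / (real p)\<^sup>2) * kap (p * d))"
    using sums_mono_reindex[where f = h, OF sm hz] A by blast
  then have "(\<lambda>e. kap_term (p * d) e + h e) sums (kap (p * d) + - (1 / (real p)\<^sup>2) * kap (p * d))"
    by (intro sums_add kap_sums)
  then have "kap_term d sums (kap (p * d) + - (1 / (real p)\<^sup>2) * kap (p * d))" by (simp only: split[symmetric])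
  then show ?thesis using kap_sums[of d] sums_unique2 by (fastforce simp: algebra_simps)
qed

lemma kap_prod:
  assumes "finite A" "\<And>p. p \<in> A \<Longrightarrow> prime (p::nat)"
  shows "kap 1 = (\<Prod>p\<in>A. 1 - 1 / (real p)\<^sup>2) * kap (\<Prod>A)"
  using assms
proof (induction A rule: finite_induct)
  case (insert p A)
  have "prime_factors (\<Prod>A) = A" using insert by (intro prime_factors_prod_primes) auto
  moreover have "\<Prod>A > 0" using insert by (intro prod_pos) (auto simp: prime_gt_0_nat)
  ultimately have "\<not> p dvd \<Prod>A" using insert by (metis in_prime_factors_iff insertI1 neq0_conv)
  then show ?case using insert kap_prime[of p "\<Prod>A"] by (simp add: mult_ac)
qed simp

section \<open>Comparison with the factors beta\<close>

definition beta_d :: "nat \<Rightarrow> real" where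
  "beta_d d = (\<Prod>p\<in>prime_factors d. beta_sq p)"

lemma legendre_neg_one_sq:
  assumes "prime p" "odd (p::nat)"
  shows "(real_of_int (Legendre (-1) (int p)))\<^sup>2 = 1"
proof -
  have "p > 2" using assms prime_ge_2_nat[of p] by (cases "p = 2") auto
  then have "\<not> [-1 = 0] (mod int p)" by (auto simp: cong_iff_dvd_diff zdvd_not_zless)
  then show ?thesis by (simp add: Legendre_def)
qed

text \<open>At an odd prime \<open>p\<close> with Legendre symbol \<open>l\<close>, the local count
  contributes \<open>(p * (p - l))\<^sup>2 / p^6\<close>. As \<open>l\<^sup>2 = 1\<close>, the
  square \<open>(p - l)\<^sup>2\<close> is the numerator \<open>p\<^sup>2 + 1 - 2 * p * l\<close> of
  \<open>beta_sq p\<close>, and the contribution is \<open>(1 - 1 / p\<^sup>2) * beta_sq p\<close>.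
  The factors \<open>1 - 1 / p\<^sup>2\<close> complete \<open>kap d\<close> to
  \<open>kap 1\<close>.\<close>

lemma kap_local_total:
  assumes d: "squarefree d" "odd d"
  shows "kap d * local_total d / (real d) ^ 6 = kap 1 * beta_d d"
proof -
  let ?P = "prime_factors d"
  have A: "prime p \<and> odd p" if "p \<in> ?P" for p
    using that d by (auto dest: dvd_trans)
  have dP: "d = \<Prod>?P" by (rule squarefree_eq_prod_prime_factors[OF d(1)])
  have k1: "kap 1 = (\<Prod>p\<in>?P. 1 - 1 / (real p)\<^sup>2) * kap d"
    using kap_prod[of ?P] A dP by simp
  have k2: "(\<Prod>p\<in>?P. 1 - 1 / (real p)\<^sup>2) * beta_d d = local_total d / (real d) ^ 6"
  proof -
    have "(real d) ^ 6 = (\<Prod>p\<in>?P. real p ^ 6)"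
      by (subst dP) (simp add: prod_power_distrib)
    then have "local_total d / (real d) ^ 6 = (\<Prod>p\<in>?P. (real p * (real p - of_int (Legendre (-1) (int p))))\<^sup>2 / real p ^ 6)"
      by (simp add: local_total_eq[OF d] prod_dividef)
    also have "\<dots> = (\<Prod>p\<in>?P. (1 - 1 / (real p)\<^sup>2) * beta_sq p)"
    proof (rule prod.cong[OF refl])
      fix p assume p: "p \<in> ?P"
      define x where "x = real p"
      define l where "l = real_of_int (Legendre (-1) (int p))"
      have p3: "p > 2" using A[OF p] prime_ge_2_nat[of p] by (cases "p = 2") auto
      then have x: "x > 2" by (simp add: x_def)
      have x2: "x\<^sup>2 > 1" using x by (intro one_less_power) auto
      have l: "l\<^sup>2 = 1" using legendre_neg_one_sq[of p] A[OF p] by (simp add: l_def)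
      have b: "beta_sq p = (x\<^sup>2 + 1 - 2 * x * l) / (x\<^sup>2 * (x\<^sup>2 - 1))"
        using p3 by (simp add: beta_sq_def x_def l_def)
      have "(1 - 1 / x\<^sup>2) * beta_sq p = (x\<^sup>2 + 1 - 2 * x * l) / x ^ 4"
      proof -
        have "1 - 1 / x\<^sup>2 = (x\<^sup>2 - 1) / x\<^sup>2" using x by (simp add: field_simps)
        then show ?thesis unfolding b using x x2 by (simp add: power_numeral_reduce)
      qed
      also have "x\<^sup>2 + 1 - 2 * x * l = (x - l)\<^sup>2"
        using l by (simp add: power2_eq_square algebra_simps)
      also have "(x - l)\<^sup>2 / x ^ 4 = (x * (x - l))\<^sup>2 / x ^ 6"
        using x by (simp add: power_mult_distrib power_numeral_reduce)
      finally show "(real p * (real p - of_int (Legendre (-1) (int p))))\<^sup>2 / real p ^ 6 = (1 - 1 / (real p)\<^sup>2) * beta_sq p"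
        by (simp add: x_def l_def)
    qed
    finally show ?thesis by (simp add: prod.distrib beta_d_def)
  qed
  have "kap d * local_total d / (real d) ^ 6 = kap d * ((\<Prod>p\<in>?P. 1 - 1 / (real p)\<^sup>2) * beta_d d)"
    unfolding k2 by (simp only: times_divide_eq_right)
  also have "\<dots> = kap 1 * beta_d d" unfolding k1 by (simp only: mult_ac)
  finally show ?thesis .
qed

section \<open>Averages over residue classes modulo d^2\<close>

definition psi :: "nat \<Rightarrow> nat \<Rightarrow> real" where
  "psi d a = (\<Sum>e | e dvd a \<and> coprime e d. mu e / real e)"

lemma card_hyp_eq_totient:
  assumes m: "m > (0::nat)" shows "card (hyp (int m) 1) = totient m"
proof (cases "m = 1")
  case True
  have "hyp 1 1 = {(0, 0)}" by (auto simp: hyp_def)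
  then show ?thesis using True by simp
next
  case False
  have inj: "inj_on fst (hyp (int m) 1)" using hyp_unique[of _ _ "int m" 1] by (auto simp: inj_on_def)
  have "fst ` hyp (int m) 1 = int ` totatives m"
  proof (intro equalityI subsetI)
    fix x assume "x \<in> fst ` hyp (int m) 1"
    then obtain y where xy: "(x, y) \<in> hyp (int m) 1" by auto
    have c: "coprime x (int m)" using hyp_coprime[OF xy] by simp
    have x: "0 \<le> x" "x < int m" using xy by (auto simp: hyp_def)
    have "x \<noteq> 0" using c False by auto
    then have "nat x \<in> totatives m" using x c
      by (auto simp: totatives_def) (metis coprime_int_iff int_nat_eq)
    then have "int (nat x) \<in> int ` totatives m" by (rule imageI)
    then show "x \<in> int ` totatives m" using x by simp
  next
    fix x assume "x \<in> int ` totatives m"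
    then obtain k where k: "x = int k" "k > 0" "k \<le> m" "coprime k m" by (auto simp: totatives_def)
    have "k \<noteq> m" using k False by auto
    then have km: "x \<in> {0..<int m}" using k by auto
    have "coprime x (int m)" using k by (simp add: coprime_int_iff)
    then obtain y where "y \<in> {0..<int m}" "int m dvd - 1 + x * y" using linear_congruence_solution[of "int m" x "-1"] m by auto
    then have "(x, y) \<in> hyp (int m) 1" using km by (simp add: hyp_def)
    then show "x \<in> fst ` hyp (int m) 1" by force
  qed
  then have "card (hyp (int m) 1) = card (int ` totatives m)" using card_image[OF inj] by simp
  also have "\<dots> = totient m" by (simp add: card_image totient_def)
  finally show ?thesis .
qed

text \<open>The divisors of \<open>a\<close> prime to \<open>d\<close> are exactly those of
  \<open>m\<close>, so \<open>psi d a\<close> is the proportion of units modulo \<open>m\<close>.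
  Its form as a divisor sum refers to \<open>a\<close> alone, which permits summation over
  \<open>a\<close>.\<close>

lemma psi_eq:
  assumes a: "a = m * r" "m > 0" "r > 0" and m: "coprime m d" and r: "\<And>p. prime p \<Longrightarrow> p dvd r \<Longrightarrow> p dvd d"
  shows "psi d a = real (card (hyp (int m) 1)) / real m"
proof -
  have set: "{e. e dvd a \<and> coprime e d} = {e. e dvd m}"
  proof (intro equalityI subsetI; clarify)
    fix e assume e: "e dvd a" "coprime e d"
    have "coprime e r"
    proof (rule ccontr)
      assume "\<not> coprime e r"
      then have "gcd e r \<noteq> 1" by (simp add: coprime_iff_gcd_eq_1)
      then obtain p where p: "prime p" "p dvd gcd e r" using prime_factor_nat by blast
      then have "p dvd e" "p dvd d" using r by auto
      then show False using e(2) p(1) by (meson coprime_common_divisor not_prime_unit)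
    qed
    then show "e dvd m" using e(1) a(1) by (simp add: coprime_dvd_mult_left_iff)
  next
    fix e assume e: "e dvd m"
    show "e dvd a \<and> coprime e d" using e a(1) coprime_divisors[OF e dvd_refl m] by simp
  qed
  have "psi d a = (\<Sum>e | e dvd m. mu e * (\<Prod>p\<in>prime_factors e. 1 / real p))"
    unfolding psi_def set
  proof (rule sum.cong[OF refl])
    fix e
    show "mu e / real e = mu e * (\<Prod>p\<in>prime_factors e. 1 / real p)"
    proof (cases "squarefree e")
      case True
      have "real e = real (\<Prod>(prime_factors e))"
        by (rule arg_cong[of _ _ real, OF squarefree_eq_prod_prime_factors[OF True]])
      also have "\<dots> = (\<Prod>p\<in>prime_factors e. real p)" by (rule of_nat_prod)
      finally show ?thesis by (simp add: prod_dividef)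
    qed (simp add: mu_def)
  qed
  also have "\<dots> = (\<Prod>p\<in>prime_factors m. 1 - 1 / real p)" by (rule sum_mu_divisors[OF a(2)])
  also have "\<dots> = real (totient m) / real m" using a(2) by (simp add: totient_formula2)
  finally show ?thesis by (simp add: card_hyp_eq_totient[OF a(2)])
qed

text \<open>Writing \<open>a\<close> as the number of \<open>t\<close> in \<open>[1, a]\<close>
  reduces the sum to counts of the class in the intervals \<open>[t, M]\<close>, each known up to an
  error 1.\<close>

lemma sum_class_linear:
  fixes L r :: int and M :: nat
  assumes L: "L > 0"
  shows "\<bar>(\<Sum>a\<in>{a \<in> {1..<1 + int M}. a mod L = r mod L}. real_of_int a) - (real M)\<^sup>2 / (2 * of_int L)\<bar> \<le> 2 * real M"
proof -
  let ?A = "{a \<in> {1..<1 + int M}. a mod L = r mod L}"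
  define c where "c t = real (card {a \<in> {t..<t + (int M + 1 - t)}. a mod L = r mod L})" for t
  have finA: "finite ?A" by (rule finite_interval_filter)
  have "(\<Sum>a\<in>?A. real_of_int a) = (\<Sum>a\<in>?A. \<Sum>t\<in>{1..<1 + int M}. if t \<le> a then 1 else 0)"
  proof (rule sum.cong[OF refl])
    fix a assume a: "a \<in> ?A"
    have "(\<Sum>t\<in>{1..<1 + int M}. if t \<le> a then 1 else (0::real)) = real (card {t \<in> {1..<1 + int M}. t \<le> a})"
      by (rule sum_if_card) simp
    also have "{t \<in> {1..<1 + int M}. t \<le> a} = {1..a}" using a by auto
    finally show "real_of_int a = (\<Sum>t\<in>{1..<1 + int M}. if t \<le> a then 1 else 0)" using a by simp
  qed
  also have "\<dots> = (\<Sum>t\<in>{1..<1 + int M}. \<Sum>a\<in>?A. if t \<le> a then 1 else 0)" by (rule sum.swap)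
  also have "\<dots> = (\<Sum>t\<in>{1..<1 + int M}. c t)"
  proof (rule sum.cong[OF refl])
    fix t assume t: "t \<in> {1..<1 + int M}"
    have "(\<Sum>a\<in>?A. if t \<le> a then 1 else (0::real)) = real (card {a \<in> ?A. t \<le> a})"
      by (rule sum_if_card[OF finA])
    also have "{a \<in> ?A. t \<le> a} = {a \<in> {t..<t + (int M + 1 - t)}. a mod L = r mod L}" using t by auto
    finally show "(\<Sum>a\<in>?A. if t \<le> a then 1 else 0) = c t" by (simp only: c_def)
  qed
  finally have S: "(\<Sum>a\<in>?A. real_of_int a) = (\<Sum>t\<in>{1..<1 + int M}. c t)" .
  have "\<bar>(\<Sum>t\<in>{1..<1 + int M}. c t) - (\<Sum>t\<in>{1..<1 + int M}. of_int (int M + 1 - t) / of_int L)\<bar>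
      = \<bar>\<Sum>t\<in>{1..<1 + int M}. c t - of_int (int M + 1 - t) / of_int L\<bar>" by (simp add: sum_subtractf)
  also have "\<dots> \<le> (\<Sum>t\<in>{1..<1 + int M}. \<bar>c t - of_int (int M + 1 - t) / of_int L\<bar>)" by (rule sum_abs)
  also have "\<dots> \<le> (\<Sum>t\<in>{1..<1 + int M}. 1)"
    unfolding c_def by (intro sum_mono card_residue_interval_bounds[OF L]) auto
  finally have 1: "\<bar>(\<Sum>a\<in>?A. real_of_int a) - (\<Sum>t\<in>{1..<1 + int M}. of_int (int M + 1 - t) / of_int L)\<bar> \<le> real M"
    unfolding S by simp
  have "(\<Sum>t\<in>{1..<1 + int M}. real_of_int (int M + 1 - t)) = (\<Sum>k\<in>{1..M}. real k)"
    by (rule sum.reindex_bij_witness[of _ "\<lambda>k. int M + 1 - int k" "\<lambda>t. nat (int M + 1 - t)"]) auto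
  also have "\<dots> = real M * (real M + 1) / 2"
  proof (induction M)
    case (Suc M)
    then show ?case by (simp add: sum.cl_ivl_Suc field_simps)
  qed simp
  finally have "(\<Sum>t\<in>{1..<1 + int M}. of_int (int M + 1 - t) / of_int L) = real M * (real M + 1) / 2 / real_of_int L"
    by (simp only: sum_divide_distrib[symmetric])
  also have "\<dots> = (real M)\<^sup>2 / (2 * of_int L) + real M / (2 * of_int L)"
    using L by (simp add: power2_eq_square field_simps)
  finally have 2: "(\<Sum>t\<in>{1..<1 + int M}. of_int (int M + 1 - t) / of_int L) = (real M)\<^sup>2 / (2 * of_int L) + real M / (2 * of_int L)" .
  have "real M / (2 * of_int L) \<le> real M / 1" using L by (intro divide_left_mono) auto
  moreover have "real M / (2 * of_int L) \<ge> 0" using L by simp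
  ultimately show ?thesis using 1 unfolding 2 by linarith
qed

text \<open>When \<open>psi\<close> is opened as a divisor sum, \<open>e dvd a\<close> and
  \<open>a = r\<close> modulo \<open>d\<^sup>2\<close> merge into one class modulo
  \<open>e * d\<^sup>2\<close>, because \<open>e\<close> is prime to \<open>d\<close>. The main
  terms form a partial sum of \<open>kap d\<close>, whose tail \<open>1 / M\<close> costs at most
  \<open>M\<close>; the class errors, weighted by \<open>1 / e\<close>, cost \<open>2 * M\<close>
  times a harmonic sum.\<close>

lemma sum_psi_class:
  fixes d M :: nat and r :: int
  assumes d: "d > 0" and M: "M \<ge> 1"
  shows "\<bar>(\<Sum>a\<in>{a \<in> {1..M}. int a mod (int d)\<^sup>2 = r mod (int d)\<^sup>2}. real a * psi d a) - kap d * (real M)\<^sup>2 / (2 * (real d)\<^sup>2)\<bar>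
    \<le> 3 * real M * harm_int (int M)"
proof -
  define q where "q = (int d)\<^sup>2"
  have q: "q > 0" using d by (simp add: q_def)
  let ?A = "{a \<in> {1..M}. int a mod q = r mod q}"
  let ?E = "{e \<in> {1..M}. coprime e d}"
  define I where "I e = (\<Sum>a\<in>{a \<in> ?A. e dvd a}. real a)" for e
  have finA: "finite ?A" by simp
  have "(\<Sum>a\<in>?A. real a * psi d a) = (\<Sum>a\<in>?A. \<Sum>e\<in>?E. if e dvd a then mu e / real e * real a else 0)"
  proof (rule sum.cong[OF refl])
    fix a assume a: "a \<in> ?A"
    have set: "{e. e dvd a \<and> coprime e d} = {e \<in> ?E. e dvd a}" using a by (auto dest: dvd_imp_le intro: Suc_leI dvd_pos_nat)
    have "psi d a = (\<Sum>e\<in>{e \<in> ?E. e dvd a}. mu e / real e)" unfolding psi_def set ..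
    also have "\<dots> = (\<Sum>e\<in>?E. if e dvd a then mu e / real e else 0)" by (rule sum.inter_filter) simp
    finally have ps: "psi d a = (\<Sum>e\<in>?E. if e dvd a then mu e / real e else 0)" .
    show "real a * psi d a = (\<Sum>e\<in>?E. if e dvd a then mu e / real e * real a else 0)"
      unfolding ps sum_distrib_left by (intro sum.cong refl) simp
  qed
  also have "\<dots> = (\<Sum>e\<in>?E. \<Sum>a\<in>?A. if e dvd a then mu e / real e * real a else 0)" by (rule sum.swap)
  also have "\<dots> = (\<Sum>e\<in>?E. mu e / real e * I e)"
  proof (rule sum.cong[OF refl])
    fix e
    have "mu e / real e * I e = (\<Sum>a\<in>{a \<in> ?A. e dvd a}. mu e / real e * real a)" by (simp only: I_def sum_distrib_left)
    also have "\<dots> = (\<Sum>a\<in>?A. if e dvd a then mu e / real e * real a else 0)" using finA by (rule sum.inter_filter)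
    finally show "(\<Sum>a\<in>?A. if e dvd a then mu e / real e * real a else 0) = mu e / real e * I e" ..
  qed
  finally have S: "(\<Sum>a\<in>?A. real a * psi d a) = (\<Sum>e\<in>?E. mu e / real e * I e)" .
  have I: "\<bar>I e - (real M)\<^sup>2 / (2 * (real e * (real d)\<^sup>2))\<bar> \<le> 2 * real M" if e: "e \<in> ?E" for e
  proof -
    have e0: "e > 0" and c: "coprime e d" using e by auto
    have "coprime (int e) q" using c by (simp add: q_def coprime_int_iff)
    then obtain r' where r': "[r' = 0] (mod int e)" "[r' = r] (mod q)" using binary_chinese_remainder_int by blast
    have iff: "(int a mod q = r mod q \<and> e dvd a) \<longleftrightarrow> int a mod (int e * q) = r' mod (int e * q)" for a
    proof -
      have "int a mod (int e * q) = r' mod (int e * q) \<longleftrightarrow> int e * q dvd int a - r'" by (simp only: mod_eq_dvd_iff)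
      also have "\<dots> \<longleftrightarrow> int e dvd int a - r' \<and> q dvd int a - r'"
        using \<open>coprime (int e) q\<close> by (auto intro: divides_mult dvd_mult_left dvd_mult_right)
      also have "int e dvd int a - r' \<longleftrightarrow> int e dvd int a"
      proof (rule dvd_diff_imp_iff)
        have "int e dvd r'" using r'(1) by (simp add: cong_0_iff)
        then show "int e dvd (int a - r') - int a" by simp
      qed
      also have "q dvd int a - r' \<longleftrightarrow> int a mod q = r mod q"
        using r'(2) by (metis cong_def mod_eq_dvd_iff)
      finally show ?thesis by auto
    qed
    have "I e = (\<Sum>a\<in>{a \<in> {1..<1 + int M}. a mod (int e * q) = r' mod (int e * q)}. real_of_int a)"
      unfolding I_def
    proof (rule sum.reindex_bij_witness[of _ nat int], goal_cases)
      case (2 a) then show ?case using iff[of a] by auto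
    next
      case (4 b) then show ?case using iff[of "nat b"] by auto
    qed auto
    then show ?thesis using sum_class_linear[of "int e * q" M r'] e0 q by (simp add: q_def)
  qed
  have main: "(\<Sum>e\<in>?E. mu e / real e * ((real M)\<^sup>2 / (2 * (real e * (real d)\<^sup>2)))) = (real M)\<^sup>2 / (2 * (real d)\<^sup>2) * (\<Sum>e\<in>{1..M}. kap_term d e)"
  proof -
    have "(\<Sum>e\<in>{1..M}. kap_term d e) = (\<Sum>e\<in>?E. mu e / (real e)\<^sup>2)"
      unfolding kap_term_def by (rule sum.inter_filter[symmetric]) simp
    then show ?thesis by (simp add: sum_distrib_left power2_eq_square mult_ac)
  qed
  have "\<bar>(\<Sum>e\<in>?E. mu e / real e * I e) - (\<Sum>e\<in>?E. mu e / real e * ((real M)\<^sup>2 / (2 * (real e * (real d)\<^sup>2))))\<bar>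
      = \<bar>\<Sum>e\<in>?E. mu e / real e * (I e - (real M)\<^sup>2 / (2 * (real e * (real d)\<^sup>2)))\<bar>"
    by (simp only: sum_subtractf[symmetric] right_diff_distrib)
  also have "\<dots> \<le> (\<Sum>e\<in>?E. \<bar>mu e / real e * (I e - (real M)\<^sup>2 / (2 * (real e * (real d)\<^sup>2)))\<bar>)" by (rule sum_abs)
  also have "\<dots> \<le> (\<Sum>e\<in>?E. 1 / real e * (2 * real M))"
  proof (rule sum_mono)
    fix e assume e: "e \<in> ?E"
    have "\<bar>mu e / real e\<bar> \<le> 1 / real e" using abs_mu_le_1[of e] by (simp add: abs_divide divide_right_mono)
    then show "\<bar>mu e / real e * (I e - (real M)\<^sup>2 / (2 * (real e * (real d)\<^sup>2)))\<bar> \<le> 1 / real e * (2 * real M)"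
      unfolding abs_mult using I[OF e] by (intro mult_mono) auto
  qed
  also have "\<dots> \<le> (\<Sum>e\<in>{1..M}. 1 / real e * (2 * real M))" by (intro sum_mono2) auto
  also have "\<dots> = 2 * real M * harm_int (int M)" by (simp add: harm_int_def sum_distrib_left mult_ac)
  finally have 1: "\<bar>(\<Sum>a\<in>?A. real a * psi d a) - (real M)\<^sup>2 / (2 * (real d)\<^sup>2) * (\<Sum>e\<in>{1..M}. kap_term d e)\<bar> \<le> 2 * real M * harm_int (int M)"
    unfolding S main .
  have gen: "\<bar>K * S - K * k\<bar> = K * \<bar>k - S\<bar>" if "K \<ge> 0" for K S k :: real
  proof -
    have "\<bar>K * S - K * k\<bar> = \<bar>K * (S - k)\<bar>" by (simp only: right_diff_distrib)
    then show ?thesis using that by (simp add: abs_mult abs_minus_commute)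
  qed
  have "\<bar>(real M)\<^sup>2 / (2 * (real d)\<^sup>2) * (\<Sum>e\<in>{1..M}. kap_term d e) - (real M)\<^sup>2 / (2 * (real d)\<^sup>2) * kap d\<bar>
      = (real M)\<^sup>2 / (2 * (real d)\<^sup>2) * \<bar>kap d - (\<Sum>e\<in>{1..M}. kap_term d e)\<bar>"
    by (rule gen) simp
  also have "\<dots> \<le> (real M)\<^sup>2 / 1 * (1 / real M)"
  proof (intro mult_mono divide_left_mono kap_tail M)
    have "1 \<le> (real d)\<^sup>2" using d by simp
    then show "1 \<le> 2 * (real d)\<^sup>2" by linarith
  qed (use d in auto)
  also have "\<dots> = real M * 1" using M by (simp add: power2_eq_square)
  also have "\<dots> \<le> real M * harm_int (int M)" using M harm_int_ge_1[of "int M"] by (intro mult_left_mono) auto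
  finally have 2: "\<bar>(real M)\<^sup>2 / (2 * (real d)\<^sup>2) * (\<Sum>e\<in>{1..M}. kap_term d e) - (real M)\<^sup>2 / (2 * (real d)\<^sup>2) * kap d\<bar> \<le> real M * harm_int (int M)" .
  have 3: "kap d * (real M)\<^sup>2 / (2 * (real d)\<^sup>2) = (real M)\<^sup>2 / (2 * (real d)\<^sup>2) * kap d" by simp
  show ?thesis using 1 2 unfolding q_def 3 by linarith
qed

section \<open>Matrices by their largest entry\<close>

text \<open>The quadruple \<open>(a, b, c, e)\<close> is the matrix with rows \<open>(a, b)\<close>
  and \<open>(c, e)\<close>; with \<open>q = 1\<close> the set is the whole matrix ball.\<close>

definition sl2_box :: "nat \<Rightarrow> int \<Rightarrow> (int \<times> int \<times> int \<times> int) set" where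
  "sl2_box M q = {(a, b, c, e). \<bar>a\<bar> \<le> int M \<and> \<bar>b\<bar> \<le> int M \<and> \<bar>c\<bar> \<le> int M \<and> \<bar>e\<bar> \<le> int M \<and>
     a * e - b * c = 1 \<and> q dvd a\<^sup>2 + b\<^sup>2 + c\<^sup>2 + e\<^sup>2}"

text \<open>The pair \<open>(b, c)\<close> stands for the matrix with diagonal \<open>a\<close>, \<open>(b * c + 1) div a\<close>.\<close>

definition hyperbola_pts :: "int \<Rightarrow> int \<Rightarrow> (int \<times> int) set" where
  "hyperbola_pts a q = {(b, c) \<in> {-a..<a} \<times> {-a..<a}. a dvd b * c + 1 \<and> q dvd a\<^sup>2 + b\<^sup>2 + c\<^sup>2 + ((b * c + 1) div a)\<^sup>2}"

lemma finite_sl2_box [simp]: "finite (sl2_box M q)"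
proof (rule finite_subset)
  show "sl2_box M q \<subseteq> {-int M..int M} \<times> {-int M..int M} \<times> {-int M..int M} \<times> {-int M..int M}"
    by (auto simp: sl2_box_def abs_le_iff)
qed auto

lemma finite_hyperbola_pts [simp]: "finite (hyperbola_pts a q)"
  unfolding hyperbola_pts_def by (rule finite_subset[of _ "{-a..<a} \<times> {-a..<a}"]) auto

text \<open>For each \<open>b\<close> that admits some \<open>c\<close>, the divisibility determines
  \<open>c\<close> modulo \<open>a\<close>, and \<open>[-a, a)\<close> contains two members of a
  class.\<close>

lemma card_hyperbola_pts_le: "a > 0 \<Longrightarrow> real (card (hyperbola_pts a q)) \<le> 4 * of_int a"
proof -
  assume a: "a > 0"
  have "hyperbola_pts a q \<subseteq> (SIGMA b:{-a..<a}. {c \<in> {-a..<a}. a dvd b * c + 1})" by (auto simp: hyperbola_pts_def)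
  then have "card (hyperbola_pts a q) \<le> card (SIGMA b:{-a..<a}. {c \<in> {-a..<a}. a dvd b * c + 1})"
    by (intro card_mono finite_SigmaI finite_interval_filter) auto
  also have "\<dots> = (\<Sum>b\<in>{-a..<a}. card {c \<in> {-a..<a}. a dvd b * c + 1})"
    by (intro card_SigmaI ballI finite_interval_filter) simp
  also have "\<dots> \<le> (\<Sum>b\<in>{-a..<a}. 2)"
  proof (rule sum_mono)
    fix b
    show "card {c \<in> {-a..<a}. a dvd b * c + 1} \<le> 2"
    proof (cases "{c \<in> {-a..<a}. a dvd b * c + 1} = {}")
      case True then show ?thesis by (simp only: card.empty)
    next
      case False
      then obtain c0 where c0: "a dvd b * c0 + 1" by blast
      have cop: "coprime b a"
      proof -
        have "gcd b a dvd b * c0 + 1" using c0 by (rule dvd_trans[rotated]) simp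
        moreover have "gcd b a dvd b * c0" by simp
        ultimately have "gcd b a dvd 1" by (simp only: dvd_add_right_iff)
        then show ?thesis by (simp add: coprime_iff_gcd_eq_1)
      qed
      have "{c \<in> {-a..<a}. a dvd b * c + 1} \<subseteq> {c \<in> {-a..<-a + a * int 2}. c mod a = c0 mod a}"
      proof clarsimp
        fix c assume c: "a dvd b * c + 1"
        have "a dvd (b * c + 1) - (b * c0 + 1)" using c c0 by (rule dvd_diff)
        then have "a dvd b * (c - c0)" by (simp add: algebra_simps)
        then have "a dvd c - c0" using cop by (simp add: coprime_commute coprime_dvd_mult_right_iff)
        then show "c mod a = c0 mod a" by (simp only: mod_eq_dvd_iff)
      qed
      from card_mono[OF finite_interval_filter this] show ?thesis
        by (simp only: card_residue_interval[OF a])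
    qed
  qed
  also have "\<dots> = 4 * nat a" using a by simp
  finally have "real (card (hyperbola_pts a q)) \<le> real (4 * nat a)" by (simp only: of_nat_le_iff)
  then show ?thesis using a by simp
qed

text \<open>Collects exceptional matrices, such as those in which two entries of one row or column
  tie for the maximum.\<close>

definition small_cube :: "(int \<times> int \<times> int \<times> int) set" where
  "small_cube = {-1..1} \<times> {-1..1} \<times> {-1..1} \<times> {-1..1}"

lemma card_small_cube: "card small_cube = 81" "finite small_cube"
  by (simp_all add: small_cube_def card_cartesian_product)

lemma in_small_cube: "(a, b, c, e) \<in> small_cube \<longleftrightarrow> \<bar>a\<bar> \<le> 1 \<and> \<bar>b\<bar> \<le> 1 \<and> \<bar>c\<bar> \<le> 1 \<and> \<bar>e\<bar> \<le> 1"
  by (auto simp: small_cube_def)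

definition dominant :: "nat \<Rightarrow> int \<Rightarrow> (int \<times> int \<times> int \<times> int) set" where
  "dominant M q = {(a, b, c, e) \<in> sl2_box M q. \<bar>b\<bar> \<le> \<bar>a\<bar> \<and> \<bar>c\<bar> \<le> \<bar>a\<bar> \<and> \<bar>e\<bar> \<le> \<bar>a\<bar>}"

lemma finite_dominant [simp]: "finite (dominant M q)"
  by (rule finite_subset[OF _ finite_sl2_box[of M q]]) (auto simp: dominant_def)

text \<open>Changing all signs pairs \<open>a > 0\<close> with \<open>a < 0\<close>, hence the
  factor 2. For \<open>a \<ge> 2\<close> the conditions match exactly: \<open>|b| = a\<close> or
  \<open>|c| = a\<close> would make \<open>a\<close> divide 1, so the half-open range loses nothing,
  and \<open>a * |e| = |b * c + 1| \<le> a\<^sup>2 + 1 < a * (a + 1)\<close> gives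
  \<open>|e| \<le> a\<close>. The case \<open>a = 1\<close> goes into the constant.\<close>

lemma card_dominant:
  assumes M: "M \<ge> 1"
  shows "\<bar>real (card (dominant M q)) - 2 * (\<Sum>a\<in>{1..M}. real (card (hyperbola_pts (int a) q)))\<bar> \<le> 100"
proof -
  define P where "P = {(a, b, c, e) \<in> dominant M q. a > 0}"
  define P2 where "P2 = {(a, b, c, e) \<in> dominant M q. a \<ge> 2}"
  have finP: "finite P" "finite P2" by (auto intro!: finite_subset[OF _ finite_dominant[of M q]] simp: P_def P2_def)
  have "dominant M q = P \<union> (\<lambda>(a, b, c, e). (-a, -b, -c, -e)) ` P"
  proof (intro equalityI subsetI)
    fix z assume z: "z \<in> dominant M q"
    obtain a b c e where zz: "z = (a, b, c, e)" by (metis prod.exhaust)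
    have "a \<noteq> 0" using z by (auto simp: zz dominant_def sl2_box_def)
    then consider "a > 0" | "a < 0" by linarith
    then show "z \<in> P \<union> (\<lambda>(a, b, c, e). (-a, -b, -c, -e)) ` P"
    proof cases
      case 2
      then have "(-a, -b, -c, -e) \<in> P" using z by (simp add: zz P_def dominant_def sl2_box_def)
      then have "(\<lambda>(a, b, c, e). (-a, -b, -c, -e)) (-a, -b, -c, -e) \<in> (\<lambda>(a, b, c, e). (-a, -b, -c, -e)) ` P" by (rule imageI)
      then show ?thesis by (simp add: zz)
    qed (use z in \<open>simp add: zz P_def\<close>)
  qed (auto simp: P_def dominant_def sl2_box_def)
  moreover have "card (P \<union> (\<lambda>(a, b, c, e). (-a, -b, -c, -e)) ` P) = card P + card ((\<lambda>(a, b, c, e). (-a, -b, -c, -e)) ` P)"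
    using finP by (intro card_Un_disjoint) (auto simp: P_def)
  moreover have "card ((\<lambda>(a, b, c, e). (-a, -b, -c, -e)) ` P) = card P"
    by (rule card_image) (auto simp: inj_on_def)
  ultimately have dP: "card (dominant M q) = 2 * card P" by simp
  have P2P: "card P2 \<le> card P" using finP by (intro card_mono) (auto simp: P_def P2_def)
  have "P \<subseteq> P2 \<union> ({1} \<times> {-1..1} \<times> {-1..1} \<times> {-1..1})"
    by (auto simp: P_def P2_def dominant_def)
  then have "card P \<le> card (P2 \<union> ({1} \<times> {-1..1} \<times> {-1..1} \<times> {-1..1}))" using finP by (intro card_mono) auto
  also have "\<dots> \<le> card P2 + card ({1::int} \<times> {-1..1::int} \<times> {-1..1::int} \<times> {-1..1::int})" by (rule card_Un_le)
  also have "\<dots> = card P2 + 27" by (simp add: card_cartesian_product)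
  finally have PP2: "card P \<le> card P2 + 27" .
  have "card P2 = card (SIGMA a:{2..M}. hyperbola_pts (int a) q)"
  proof (rule bij_betw_same_card[OF bij_betw_byWitness])
    let ?f = "\<lambda>(a::int, b::int, c::int, e::int). (nat a, b, c)"
    let ?g = "\<lambda>(a::nat, b::int, c::int). (int a, b, c, (b * c + 1) div int a)"
    show "\<forall>z\<in>P2. ?g (?f z) = z"
    proof
      fix z assume z: "z \<in> P2"
      obtain a b c e where zz: "z = (a, b, c, e)" by (metis prod.exhaust)
      have "a \<ge> 2" "a * e - b * c = 1" using z by (auto simp: zz P2_def dominant_def sl2_box_def)
      then have "b * c + 1 = a * e" "a \<noteq> 0" by simp_all
      then show "?g (?f z) = z" using \<open>a \<ge> 2\<close> by (simp add: zz)
    qed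
    show "\<forall>z\<in>(SIGMA a:{2..M}. hyperbola_pts (int a) q). ?f (?g z) = z" by auto
    show "?f ` P2 \<subseteq> (SIGMA a:{2..M}. hyperbola_pts (int a) q)"
    proof (rule image_subsetI)
      fix z assume z: "z \<in> P2"
      obtain a b c e where zz: "z = (a, b, c, e)" by (metis prod.exhaust)
      have h: "a \<ge> 2" "a \<le> int M" "a * e - b * c = 1" "\<bar>b\<bar> \<le> a" "\<bar>c\<bar> \<le> a" "q dvd a\<^sup>2 + b\<^sup>2 + c\<^sup>2 + e\<^sup>2"
        using z by (auto simp: zz P2_def dominant_def sl2_box_def)
      have bc: "b * c + 1 = a * e" using h(3) by simp
      have nd: "\<not> a dvd 1" using h(1) by simp
      have "b \<noteq> a" "c \<noteq> a"
      proof -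
        show "b \<noteq> a"
        proof
          assume "b = a"
          then have "a * (e - c) = 1" using bc by (simp add: right_diff_distrib)
          then show False using nd by (metis dvd_triv_left)
        qed
        show "c \<noteq> a"
        proof
          assume "c = a"
          then have "a * (e - b) = 1" using bc by (simp add: right_diff_distrib mult.commute)
          then show False using nd by (metis dvd_triv_left)
        qed
      qed
      then have "(b, c) \<in> hyperbola_pts a q" using h bc by (auto simp: hyperbola_pts_def)
      moreover have "2 \<le> nat a" "nat a \<le> M" "int (nat a) = a" using h(1,2) by linarith+
      ultimately show "?f z \<in> (SIGMA a:{2..M}. hyperbola_pts (int a) q)" by (simp add: zz)
    qed
    show "?g ` (SIGMA a:{2..M}. hyperbola_pts (int a) q) \<subseteq> P2"
    proof (rule image_subsetI)
      fix z assume z: "z \<in> (SIGMA a:{2..M}. hyperbola_pts (int a) q)"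
      obtain a b c where zz: "z = (a, b, c)" by (metis prod.exhaust)
      have h: "2 \<le> a" "a \<le> M" "- int a \<le> b" "b < int a" "- int a \<le> c" "c < int a" "int a dvd b * c + 1"
        "q dvd (int a)\<^sup>2 + b\<^sup>2 + c\<^sup>2 + ((b * c + 1) div int a)\<^sup>2"
        using z by (auto simp: zz hyperbola_pts_def)
      define e where "e = (b * c + 1) div int a"
      have e: "b * c + 1 = int a * e" using h(7) by (simp add: e_def)
      have "\<bar>b * c\<bar> \<le> int a * int a" unfolding abs_mult using h by (intro mult_mono) auto
      moreover have "int a * \<bar>e\<bar> = \<bar>b * c + 1\<bar>" unfolding e by (simp add: abs_mult)
      ultimately have "int a * \<bar>e\<bar> \<le> int a * int a + 1" by linarith
      then have "int a * \<bar>e\<bar> < int a * (int a + 1)" using h(1) by (simp add: distrib_left)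
      then have "\<bar>e\<bar> \<le> int a" using h(1) by (simp add: mult_less_cancel_left)
      moreover have "\<bar>b\<bar> \<le> int a" "\<bar>c\<bar> \<le> int a" using h by linarith+
      moreover have "int a * e - b * c = 1" using e by linarith
      moreover have "q dvd (int a)\<^sup>2 + b\<^sup>2 + c\<^sup>2 + e\<^sup>2" using h(8) by (simp add: e_def)
      ultimately have "(int a, b, c, e) \<in> P2" using h(1,2) by (simp add: P2_def dominant_def sl2_box_def)
      then show "?g z \<in> P2" by (simp add: zz e_def)
    qed
  qed
  also have "\<dots> = (\<Sum>a\<in>{2..M}. card (hyperbola_pts (int a) q))" by (intro card_SigmaI) auto
  finally have cP2: "card P2 = (\<Sum>a\<in>{2..M}. card (hyperbola_pts (int a) q))" .
  have "(\<Sum>a\<in>{1..M}. card (hyperbola_pts (int a) q)) = card (hyperbola_pts 1 q) + card P2"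
    unfolding cP2 using M by (simp add: sum.atLeast_Suc_atMost numeral_2_eq_2)
  moreover have "card (hyperbola_pts 1 q) \<le> 4" using card_hyperbola_pts_le[of 1 q] by simp
  ultimately have "(\<Sum>a\<in>{1..M}. card (hyperbola_pts (int a) q)) \<le> card P2 + 4" "card P2 \<le> (\<Sum>a\<in>{1..M}. card (hyperbola_pts (int a) q))" by simp_all
  then have "real (\<Sum>a\<in>{1..M}. card (hyperbola_pts (int a) q)) \<le> real (card P2) + 4" "real (card P2) \<le> real (\<Sum>a\<in>{1..M}. card (hyperbola_pts (int a) q))"
    by linarith+
  then show ?thesis using dP PP2 P2P unfolding of_nat_sum by linarith
qed

text \<open>Quarter turns on the left, the right or both sides move a largest entry to the top left
  corner and preserve determinant and form, so \<open>A\<close>, \<open>B\<close>, \<open>C\<close>,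
  \<open>E\<close> have equal size. Two tied largest entries in one row or column have absolute
  value 1. If the diagonal entries tie, \<open>e\<close> is \<open>s * a\<close> with a sign
  \<open>s\<close>, and \<open>b * c = s * a\<^sup>2 - 1\<close> has at most \<open>2 * TM\<close>
  solutions for each \<open>a\<close> and \<open>s\<close>.\<close>

lemma sl2_box_decomposition:
  fixes TM :: real
  assumes M: "M \<ge> 1" and TM: "\<And>N. N \<noteq> 0 \<Longrightarrow> \<bar>N\<bar> \<le> 2 * (int M)\<^sup>2 \<Longrightarrow> real (tau N) \<le> TM"
  shows "\<bar>real (card (sl2_box M q)) - 8 * (\<Sum>a\<in>{1..M}. real (card (hyperbola_pts (int a) q)))\<bar> \<le> 1000 + 24 * real M * TM"
proof -
  define A where "A = dominant M q"
  define B where "B = {(a, b, c, e) \<in> sl2_box M q. \<bar>a\<bar> \<le> \<bar>b\<bar> \<and> \<bar>c\<bar> \<le> \<bar>b\<bar> \<and> \<bar>e\<bar> \<le> \<bar>b\<bar>}"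
  define C where "C = {(a, b, c, e) \<in> sl2_box M q. \<bar>a\<bar> \<le> \<bar>c\<bar> \<and> \<bar>b\<bar> \<le> \<bar>c\<bar> \<and> \<bar>e\<bar> \<le> \<bar>c\<bar>}"
  define E where "E = {(a, b, c, e) \<in> sl2_box M q. \<bar>a\<bar> \<le> \<bar>e\<bar> \<and> \<bar>b\<bar> \<le> \<bar>e\<bar> \<and> \<bar>c\<bar> \<le> \<bar>e\<bar>}"
  have fin: "finite A" "finite B" "finite C" "finite E"
    by (auto intro!: finite_subset[OF _ finite_sl2_box[of M q]] simp: A_def dominant_def B_def C_def E_def)
  have sq: "a\<^sup>2 + b\<^sup>2 + c\<^sup>2 + e\<^sup>2 = b\<^sup>2 + a\<^sup>2 + e\<^sup>2 + c\<^sup>2" "a\<^sup>2 + b\<^sup>2 + c\<^sup>2 + e\<^sup>2 = c\<^sup>2 + e\<^sup>2 + a\<^sup>2 + b\<^sup>2"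
    "a\<^sup>2 + b\<^sup>2 + c\<^sup>2 + e\<^sup>2 = e\<^sup>2 + c\<^sup>2 + b\<^sup>2 + a\<^sup>2" for a b c e :: int by simp_all
  have cB: "card B = card A"
    by (rule bij_betw_same_card, rule bij_betw_byWitness[of _ "\<lambda>(a, b, c, e). (b, -a, e, -c)" "\<lambda>(a, b, c, e). (-b, a, -e, c)"])
      (auto simp: A_def B_def dominant_def sl2_box_def mult.commute add_ac)
  have cC: "card C = card A"
    by (rule bij_betw_same_card, rule bij_betw_byWitness[of _ "\<lambda>(a, b, c, e). (c, e, -a, -b)" "\<lambda>(a, b, c, e). (-c, -e, a, b)"])
      (auto simp: A_def C_def dominant_def sl2_box_def mult.commute add_ac)
  have cE: "card E = card A"
    by (rule bij_betw_same_card, rule bij_betw_byWitness[of _ "\<lambda>(a, b, c, e). (e, -c, -b, a)" "\<lambda>(a, b, c, e). (e, -c, -b, a)"])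
      (auto simp: A_def E_def dominant_def sl2_box_def mult.commute add_ac)
  have cBC: "card (B \<inter> C) = card (A \<inter> E)"
    by (rule bij_betw_same_card, rule bij_betw_byWitness[of _ "\<lambda>(a, b, c, e). (b, -a, e, -c)" "\<lambda>(a, b, c, e). (-b, a, -e, c)"])
      (auto simp: A_def B_def C_def E_def dominant_def sl2_box_def mult.commute add_ac)
  have G: "sl2_box M q = (A \<union> E) \<union> (B \<union> C)"
    unfolding A_def B_def C_def E_def dominant_def by auto
  have unit: "\<bar>x\<bar> = 1" if "x * y - z * w = 1" "\<bar>x\<bar> = \<bar>z\<bar>" for x y z w :: int
  proof -
    have "x dvd z * w" using that(2) by (metis abs_dvd_iff dvd_abs_iff dvd_mult2 dvd_refl)
    then have "x dvd x * y - z * w" by (intro dvd_diff) auto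
    then show ?thesis using that(1) by simp
  qed
  have "(A \<union> E) \<inter> (B \<union> C) \<subseteq> small_cube"
  proof
    fix z assume z: "z \<in> (A \<union> E) \<inter> (B \<union> C)"
    obtain a b c e where zz: "z = (a, b, c, e)" by (metis prod.exhaust)
    have det: "a * e - b * c = 1" using z by (auto simp: zz A_def B_def C_def E_def dominant_def sl2_box_def)
    then have det': "a * e - c * b = 1" "e * a - b * c = 1" "e * a - c * b = 1" by (simp_all add: mult.commute)
    from z consider "z \<in> A" "z \<in> B" | "z \<in> A" "z \<in> C" | "z \<in> E" "z \<in> B" | "z \<in> E" "z \<in> C" by blast
    then show "z \<in> small_cube"
    proof cases
      case 1
      then have "\<bar>a\<bar> = \<bar>b\<bar>" "\<bar>c\<bar> \<le> \<bar>a\<bar>" "\<bar>e\<bar> \<le> \<bar>a\<bar>" by (auto simp: zz A_def B_def dominant_def)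
      then show ?thesis using unit[OF det] by (simp add: zz in_small_cube)
    next
      case 2
      then have "\<bar>a\<bar> = \<bar>c\<bar>" "\<bar>b\<bar> \<le> \<bar>a\<bar>" "\<bar>e\<bar> \<le> \<bar>a\<bar>" by (auto simp: zz A_def C_def dominant_def)
      then show ?thesis using unit[OF det'(1)] by (simp add: zz in_small_cube)
    next
      case 3
      then have "\<bar>e\<bar> = \<bar>b\<bar>" "\<bar>a\<bar> \<le> \<bar>e\<bar>" "\<bar>c\<bar> \<le> \<bar>e\<bar>" by (auto simp: zz E_def B_def)
      then show ?thesis using unit[OF det'(2)] by (simp add: zz in_small_cube)
    next
      case 4
      then have "\<bar>e\<bar> = \<bar>c\<bar>" "\<bar>a\<bar> \<le> \<bar>e\<bar>" "\<bar>b\<bar> \<le> \<bar>e\<bar>" by (auto simp: zz E_def C_def)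
      then show ?thesis using unit[OF det'(3)] by (simp add: zz in_small_cube)
    qed
  qed
  then have s: "card ((A \<union> E) \<inter> (B \<union> C)) \<le> 81"
    using card_mono[OF card_small_cube(2)] card_small_cube(1) by metis
  \<comment> \<open>The range leaves out \<open>a = 1\<close> and \<open>a = -1\<close>, where
    \<open>a * (s * a) - 1\<close> may vanish; these cases are in \<open>small_cube\<close>.\<close>
  define X where "X = ({-int M..int M} - {-1..1}) \<times> {1, -1::int}"
  define Y where "Y = (\<lambda>(a::int, s::int). (\<lambda>b::int. (a, b, (a * (s * a) - 1) div b, s * a)) ` {b. b dvd a * (s * a) - 1})"
  have finX: "finite X" by (simp add: X_def)
  have Xn: "a * (s * a) - 1 \<noteq> 0" "\<bar>a * (s * a) - 1\<bar> \<le> 2 * (int M)\<^sup>2" if "(a, s) \<in> X" for a s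
  proof -
    have as: "\<bar>a\<bar> \<le> int M" "\<bar>a\<bar> \<ge> 2" "s = 1 \<or> s = -1" using that by (auto simp: X_def)
    have "2 * 2 \<le> \<bar>a\<bar> * \<bar>a\<bar>" using as by (intro mult_mono) auto
    moreover have "\<bar>a\<bar> * \<bar>a\<bar> \<le> int M * int M" using as by (intro mult_mono) auto
    ultimately have "4 \<le> a * a" "a * a \<le> int M * int M" by simp_all
    then show "a * (s * a) - 1 \<noteq> 0" "\<bar>a * (s * a) - 1\<bar> \<le> 2 * (int M)\<^sup>2" using as(3) by (auto simp: power2_eq_square)
  qed
  have "A \<inter> E \<subseteq> small_cube \<union> (\<Union>x\<in>X. Y x)"
  proof
    fix z assume z: "z \<in> A \<inter> E"
    obtain a b c e where zz: "z = (a, b, c, e)" by (metis prod.exhaust)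
    have h: "\<bar>a\<bar> = \<bar>e\<bar>" "\<bar>b\<bar> \<le> \<bar>a\<bar>" "\<bar>c\<bar> \<le> \<bar>a\<bar>" "a * e - b * c = 1" "\<bar>a\<bar> \<le> int M"
      using z by (auto simp: zz A_def E_def dominant_def sl2_box_def)
    show "z \<in> small_cube \<union> (\<Union>x\<in>X. Y x)"
    proof (cases "\<bar>a\<bar> \<le> 1")
      case True then show ?thesis using h by (simp add: zz in_small_cube)
    next
      case False
      obtain s where s: "s = 1 \<or> s = -1" "e = s * a" using h(1) by (metis abs_eq_iff mult_1 mult_minus1)
      have X: "(a, s) \<in> X" using False h(5) s by (auto simp: X_def)
      have bc: "b * c = a * (s * a) - 1" using h(4) s by simp
      then have "b \<noteq> 0" using Xn(1)[OF X] by auto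
      then have "c = (a * (s * a) - 1) div b" unfolding bc[symmetric] by simp
      then have "z = (a, b, (a * (s * a) - 1) div b, s * a)" by (simp add: zz s)
      moreover have "b dvd a * (s * a) - 1" unfolding bc[symmetric] by simp
      ultimately have "z \<in> Y (a, s)" by (simp add: Y_def)
      then show ?thesis using X by blast
    qed
  qed
  moreover have finY: "finite (Y x)" if "x \<in> X" for x
    using that Xn(1) card_dvd_le(2) by (cases x) (simp add: Y_def)
  ultimately have "card (A \<inter> E) \<le> card (small_cube \<union> (\<Union>x\<in>X. Y x))"
    using finX card_small_cube(2) by (intro card_mono) auto
  also have "\<dots> \<le> card small_cube + card (\<Union>x\<in>X. Y x)" by (rule card_Un_le)
  also have "\<dots> \<le> 81 + (\<Sum>x\<in>X. card (Y x))" using card_UN_le[OF finX, of Y] card_small_cube(1) by simp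
  finally have "real (card (A \<inter> E)) \<le> real (81 + (\<Sum>x\<in>X. card (Y x)))" by (simp only: of_nat_le_iff)
  also have "\<dots> = 81 + (\<Sum>x\<in>X. real (card (Y x)))" by simp
  also have "\<dots> \<le> 81 + (\<Sum>x\<in>X. 2 * TM)"
  proof (intro add_left_mono sum_mono)
    fix x assume x: "x \<in> X"
    obtain a s where xx: "x = (a, s)" by (cases x)
    have n: "a * (s * a) - 1 \<noteq> 0" "\<bar>a * (s * a) - 1\<bar> \<le> 2 * (int M)\<^sup>2" using Xn x xx by auto
    have "card (Y x) \<le> card {b. b dvd a * (s * a) - 1}" unfolding Y_def xx prod.case
      by (rule card_image_le[OF card_dvd_le(2)[OF n(1)]])
    also have "\<dots> \<le> 2 * tau (a * (s * a) - 1)" by (rule card_dvd_le(1)[OF n(1)])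
    finally have "real (card (Y x)) \<le> 2 * real (tau (a * (s * a) - 1))" by linarith
    then show "real (card (Y x)) \<le> 2 * TM" using TM[OF n] by linarith
  qed
  also have "\<dots> = 81 + real (card X) * (2 * TM)" by simp
  also have "\<dots> \<le> 81 + (6 * real M) * (2 * TM)"
  proof (intro add_left_mono mult_right_mono)
    have "card X \<le> card ({-int M..int M} \<times> {1, -1::int})" unfolding X_def by (intro card_mono) auto
    also have "\<dots> = 4 * M + 2" by (simp add: card_cartesian_product nat_add_distrib)
    finally have "card X \<le> 6 * M" using M by linarith
    then show "real (card X) \<le> 6 * real M" by linarith
    have "1 \<le> (int M)\<^sup>2" using M by simp
    then have "real (tau 1) \<le> TM" by (intro TM) (auto simp del: one_le_power)
    then show "0 \<le> 2 * TM" by (smt (verit) of_nat_0_le_iff)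
  qed
  finally have t: "real (card (A \<inter> E)) \<le> 81 + 12 * real M * TM" by simp
  have "card (A \<union> E) + card (A \<inter> E) = 2 * card A" using card_Un_Int[OF fin(1) fin(4)] cE by simp
  moreover have "card (B \<union> C) + card (B \<inter> C) = 2 * card A" using card_Un_Int[OF fin(2) fin(3)] cB cC by simp
  moreover have "card (sl2_box M q) + card ((A \<union> E) \<inter> (B \<union> C)) = card (A \<union> E) + card (B \<union> C)"
    unfolding G using fin by (intro card_Un_Int[symmetric]) auto
  ultimately have "card (sl2_box M q) + card ((A \<union> E) \<inter> (B \<union> C)) + 2 * card (A \<inter> E) = 4 * card A" using cBC by simp
  then have "real (card (sl2_box M q) + card ((A \<union> E) \<inter> (B \<union> C)) + 2 * card (A \<inter> E)) = real (4 * card A)" by (simp only:)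
  then have "real (card (sl2_box M q)) + real (card ((A \<union> E) \<inter> (B \<union> C))) + 2 * real (card (A \<inter> E)) = 4 * real (card A)" by simp
  moreover have "real (card ((A \<union> E) \<inter> (B \<union> C))) \<le> 81" using s by simp
  moreover have "\<bar>g - 4 * k\<bar> \<le> 243 + 24 * (real M * TM)"
    if "g + u + 2 * v = 4 * k" "u \<le> 81" "v \<le> 81 + 12 * (real M * TM)" "u \<ge> 0" "v \<ge> 0" for g u v k :: real
    unfolding abs_le_iff using that by linarith
  ultimately have "\<bar>real (card (sl2_box M q)) - 4 * real (card A)\<bar> \<le> 243 + 24 * (real M * TM)"
    using t by (simp only: mult.assoc of_nat_0_le_iff)
  moreover have "\<bar>real (card A) - 2 * (\<Sum>a\<in>{1..M}. real (card (hyperbola_pts (int a) q)))\<bar> \<le> 100"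
    unfolding A_def by (rule card_dominant[OF M])
  ultimately show ?thesis by (simp only: mult.assoc)
qed

text \<open>A matrix with form value \<open>R = q * k\<close> yields representations of
  \<open>R + 2\<close> and \<open>R - 2\<close> as sums of two squares, and these determine it.
  There are at most \<open>4 * M\<^sup>2 / q\<close> values of \<open>k\<close>. Since
  \<open>q \<ge> 4\<close>, the number \<open>R - 2\<close> is positive, as the bound for
  \<open>r2\<close> asks.\<close>

lemma card_sl2_box_le:
  fixes RM :: real
  assumes M: "M \<ge> 1" and d: "d \<ge> 2" and RM: "\<And>n. n > 0 \<Longrightarrow> n \<le> 8 * (int M)\<^sup>2 \<Longrightarrow> real (r2 n) \<le> RM"
  shows "real (card (sl2_box M ((int d)\<^sup>2))) \<le> 4 * (real M)\<^sup>2 / (real d)\<^sup>2 * RM\<^sup>2"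
proof -
  define q where "q = (int d)\<^sup>2"
  have q4: "q \<ge> 4" using d power_mono[of 2 "int d" 2] by (simp add: q_def)
  define J where "J = nat (4 * (int M)\<^sup>2 div q)"
  let ?r = "\<lambda>n. {(u::int, v::int). u * u + v * v = n}"
  define W where "W = (\<Union>k\<in>{1..int J}. ?r (q * k + 2) \<times> ?r (q * k - 2))"
  let ?f = "\<lambda>(a::int, b, c, e). ((a + e, b - c), (a - e, b + c))"
  have finW: "finite W" unfolding W_def by (intro finite_UN_I finite_cartesian_product finite_r2) simp
  have "inj_on ?f (sl2_box M q)" by (auto simp: inj_on_def)
  moreover have "?f ` sl2_box M q \<subseteq> W"
  proof (rule image_subsetI)
    fix z assume z: "z \<in> sl2_box M q"
    obtain a b c e where zz: "z = (a, b, c, e)" by (metis prod.exhaust)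
    have h: "\<bar>a\<bar> \<le> int M" "\<bar>b\<bar> \<le> int M" "\<bar>c\<bar> \<le> int M" "\<bar>e\<bar> \<le> int M" "a * e - b * c = 1" "q dvd a\<^sup>2 + b\<^sup>2 + c\<^sup>2 + e\<^sup>2"
      using z by (auto simp: zz sl2_box_def)
    obtain k where k: "a\<^sup>2 + b\<^sup>2 + c\<^sup>2 + e\<^sup>2 = q * k" using h(6) by blast
    have "a \<noteq> 0 \<or> b \<noteq> 0" using h(5) by auto
    then have "a\<^sup>2 + b\<^sup>2 + c\<^sup>2 + e\<^sup>2 > 0"
      by (smt (verit) zero_le_power2 zero_less_power2)
    then have k0: "k > 0" using k q4 by (smt (verit) zero_less_mult_pos)
    have "x\<^sup>2 \<le> (int M)\<^sup>2" if "\<bar>x\<bar> \<le> int M" for x using that by (metis abs_le_square_iff abs_of_nat)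
    from this[OF h(1)] this[OF h(2)] this[OF h(3)] this[OF h(4)] have "q * k \<le> 4 * (int M)\<^sup>2" using k by linarith
    then have "q * k div q \<le> 4 * (int M)\<^sup>2 div q" using q4 by (intro zdiv_mono1) auto
    then have "k \<le> 4 * (int M)\<^sup>2 div q" using q4 by simp
    then have kJ: "k \<in> {1..int J}" using k0 by (simp add: J_def)
    have "(a + e) * (a + e) + (b - c) * (b - c) = q * k + 2" "(a - e) * (a - e) + (b + c) * (b + c) = q * k - 2"
      using k h(5) by (simp_all add: power2_eq_square algebra_simps)
    then have "?f z \<in> ?r (q * k + 2) \<times> ?r (q * k - 2)" by (simp add: zz)
    then show "?f z \<in> W" unfolding W_def by (rule UN_I[OF kJ])
  qed
  ultimately have "card (sl2_box M q) \<le> card W" using finW by (rule card_inj_on_le)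
  also have "\<dots> \<le> (\<Sum>k\<in>{1..int J}. card (?r (q * k + 2) \<times> ?r (q * k - 2)))"
    unfolding W_def by (rule card_UN_le) simp
  finally have "real (card (sl2_box M q)) \<le> real (\<Sum>k\<in>{1..int J}. card (?r (q * k + 2) \<times> ?r (q * k - 2)))" by (simp only: of_nat_le_iff)
  also have "\<dots> = (\<Sum>k\<in>{1..int J}. real (r2 (q * k + 2)) * real (r2 (q * k - 2)))"
    by (simp add: card_cartesian_product r2_def)
  also have "\<dots> \<le> (\<Sum>k\<in>{1..int J}. RM * RM)"
  proof (rule sum_mono)
    fix k assume k: "k \<in> {1..int J}"
    have "k \<le> 4 * (int M)\<^sup>2 div q" using k by (simp add: J_def split: if_splits)
    then have "q * k \<le> q * (4 * (int M)\<^sup>2 div q)" using q4 by (intro mult_left_mono) auto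
    also have "\<dots> \<le> 4 * (int M)\<^sup>2" using mult_div_mod_eq[of q "4 * (int M)\<^sup>2"] pos_mod_sign[of q "4 * (int M)\<^sup>2"] q4 by linarith
    finally have up: "q * k \<le> 4 * (int M)\<^sup>2" .
    have "q * 1 \<le> q * k" using k q4 by (intro mult_left_mono) auto
    then have low: "4 \<le> q * k" using q4 by linarith
    have "1 \<le> (int M)\<^sup>2" using M by simp
    then have "real (r2 (q * k + 2)) \<le> RM" "real (r2 (q * k - 2)) \<le> RM" using up low by (intro RM; linarith)+
    then show "real (r2 (q * k + 2)) * real (r2 (q * k - 2)) \<le> RM * RM"
      by (intro mult_mono) (auto intro: order_trans[OF of_nat_0_le_iff])
  qed
  also have "\<dots> = real J * RM\<^sup>2" by (simp add: power2_eq_square)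
  also have "\<dots> \<le> 4 * (real M)\<^sup>2 / (real d)\<^sup>2 * RM\<^sup>2"
  proof (rule mult_right_mono)
    have "real J = of_int (4 * (int M)\<^sup>2 div q)" using q4 by (simp add: J_def pos_imp_zdiv_nonneg_iff)
    also have "\<dots> \<le> of_int (4 * (int M)\<^sup>2) / of_int q" by (rule real_of_int_div4)
    also have "\<dots> = 4 * (real M)\<^sup>2 / (real d)\<^sup>2" by (simp add: q_def)
    finally show "real J \<le> 4 * (real M)\<^sup>2 / (real d)\<^sup>2" .
  qed simp
  finally show ?thesis by (simp add: q_def)
qed

section \<open>Approximation for a fixed top left entry\<close>

lemma smooth_part_exists:
  fixes a d :: nat
  assumes "a > 0" "d > 0"
  shows "\<exists>r. r > 0 \<and> r dvd a \<and> coprime (a div r) d \<and> (\<forall>p. prime p \<longrightarrow> p dvd r \<longrightarrow> p dvd d)"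
  using assms(1)
proof (induction a rule: less_induct)
  case (less a)
  show ?case
  proof (cases "coprime a d")
    case True then show ?thesis by (intro exI[of _ 1]) auto
  next
    case False
    then have "gcd a d \<noteq> 1" by (simp add: coprime_iff_gcd_eq_1)
    then obtain p where "prime p" "p dvd gcd a d" using prime_factor_nat by blast
    then have p: "prime p" "p dvd a" "p dvd d" by auto
    then obtain k where k: "a = p * k" by blast
    have k0: "k > 0" "k < a" using k less.prems prime_gt_1_nat[OF p(1)] by auto
    from less.IH[OF k0(2,1)] obtain r where r: "r > 0" "r dvd k" "coprime (k div r) d" "\<And>s. prime s \<Longrightarrow> s dvd r \<Longrightarrow> s dvd d" by blast
    have "a div (p * r) = k div r" using p(1) by (simp add: k prime_gt_0_nat)
    then show ?thesis using r p k by (intro exI[of _ "p * r"]) (auto simp: prime_gt_0_nat prime_dvd_mult_iff dest: primes_dvd_imp_eq)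
  qed
qed

text \<open>Changing \<open>b\<close> or \<open>c\<close> by a multiple of \<open>r * q\<close>
  changes \<open>b * c + 1\<close> by a multiple of \<open>r * q\<close>, hence its quotient by
  \<open>r\<close> by a multiple of \<open>q\<close>.\<close>

lemma class_set_mod:
  fixes m r q :: int
  assumes r: "r > 0" and q: "q > 0"
  shows "(b mod (r * q), c mod (r * q)) \<in> class_set m r q \<longleftrightarrow>
    r dvd b * c + 1 \<and> q dvd m\<^sup>2 * ((m * r)\<^sup>2 + b\<^sup>2 + c\<^sup>2) + ((b * c + 1) div r)\<^sup>2"
proof -
  let ?Q = "r * q"
  define b' c' where "b' = b mod ?Q" and "c' = c mod ?Q"
  have in_range: "b' \<in> {0..<?Q}" "c' \<in> {0..<?Q}" using r q by (simp_all add: b'_def c'_def)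
  have b: "?Q dvd b - b'" and c: "?Q dvd c - c'" unfolding b'_def c'_def by (simp_all add: minus_mod_eq_mult_div)
  have bc: "?Q dvd (b * c + 1) - (b' * c' + 1)"
  proof -
    have "(b * c + 1) - (b' * c' + 1) = (b - b') * c + (c - c') * b'" by (simp add: algebra_simps)
    then show ?thesis using dvd_add[OF dvd_mult2[OF b, of c] dvd_mult2[OF c, of b']] by simp
  qed
  have rr: "r dvd b * c + 1 \<longleftrightarrow> r dvd b' * c' + 1" using bc by (intro dvd_diff_imp_iff) (rule dvd_mult_left)
  have qq: "q dvd m\<^sup>2 * ((m * r)\<^sup>2 + b\<^sup>2 + c\<^sup>2) + ((b * c + 1) div r)\<^sup>2 \<longleftrightarrow> q dvd m\<^sup>2 * ((m * r)\<^sup>2 + b'\<^sup>2 + c'\<^sup>2) + ((b' * c' + 1) div r)\<^sup>2"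
    if rd: "r dvd b * c + 1"
  proof (rule dvd_diff_imp_iff)
    obtain f f' where f: "b * c + 1 = r * f" "b' * c' + 1 = r * f'" using rd rr by blast
    have "r * q dvd r * (f - f')" using bc by (simp add: f right_diff_distrib)
    then have ff: "q dvd f - f'" using r by simp
    have bb: "q dvd b - b'" "q dvd c - c'" using b c by (auto intro: dvd_mult_right)
    have "(m\<^sup>2 * ((m * r)\<^sup>2 + b\<^sup>2 + c\<^sup>2) + f\<^sup>2) - (m\<^sup>2 * ((m * r)\<^sup>2 + b'\<^sup>2 + c'\<^sup>2) + f'\<^sup>2)
      = (b - b') * (m\<^sup>2 * (b + b')) + (c - c') * (m\<^sup>2 * (c + c')) + (f - f') * (f + f')"
      by (simp add: power2_eq_square algebra_simps)
    moreover have "q dvd (b - b') * (m\<^sup>2 * (b + b')) + (c - c') * (m\<^sup>2 * (c + c')) + (f - f') * (f + f')"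
      by (rule dvd_add[OF dvd_add[OF dvd_mult2[OF bb(1)] dvd_mult2[OF bb(2)]] dvd_mult2[OF ff]])
    ultimately show "q dvd (m\<^sup>2 * ((m * r)\<^sup>2 + b\<^sup>2 + c\<^sup>2) + ((b * c + 1) div r)\<^sup>2) - (m\<^sup>2 * ((m * r)\<^sup>2 + b'\<^sup>2 + c'\<^sup>2) + ((b' * c' + 1) div r)\<^sup>2)"
      using r by (simp add: f)
  qed
  have "(b', c') \<in> class_set m r q \<longleftrightarrow> r dvd b' * c' + 1 \<and> q dvd m\<^sup>2 * ((m * r)\<^sup>2 + b'\<^sup>2 + c'\<^sup>2) + ((b' * c' + 1) div r)\<^sup>2"
    using in_range by (simp add: class_set_def)
  also have "\<dots> \<longleftrightarrow> r dvd b * c + 1 \<and> q dvd m\<^sup>2 * ((m * r)\<^sup>2 + b\<^sup>2 + c\<^sup>2) + ((b * c + 1) div r)\<^sup>2"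
    using rr qq by blast
  finally show ?thesis unfolding b'_def c'_def .
qed

lemma hyperbola_pts_eq_class_pts:
  fixes m r q :: int
  assumes m: "m > 0" and r: "r > 0" and q: "q > 0" and mr: "coprime m r" and mq: "coprime m q"
  shows "hyperbola_pts (m * r) q = {(b, c) \<in> class_pts (r * q) (class_set m r q) (- (m * r)) (m * r). m dvd b * c + 1}"
proof -
  have "m * r dvd b * c + 1 \<and> q dvd (m * r)\<^sup>2 + b\<^sup>2 + c\<^sup>2 + ((b * c + 1) div (m * r))\<^sup>2 \<longleftrightarrow>
     (r dvd b * c + 1 \<and> q dvd m\<^sup>2 * ((m * r)\<^sup>2 + b\<^sup>2 + c\<^sup>2) + ((b * c + 1) div r)\<^sup>2) \<and> m dvd b * c + 1" for b c
  proof (cases "m * r dvd b * c + 1")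
    case True
    then obtain e where e: "b * c + 1 = m * r * e" by blast
    have "r dvd b * c + 1" "m dvd b * c + 1" using True by (auto intro: dvd_mult_left dvd_mult_right)
    moreover have "(b * c + 1) div (m * r) = e" using m r by (simp add: e)
    moreover have "(b * c + 1) div r = m * e"
    proof -
      have "b * c + 1 = r * (m * e)" by (simp add: e)
      then show ?thesis using r by (simp only: nonzero_mult_div_cancel_left less_imp_neq[OF r, symmetric] not_False_eq_True)
    qed
    moreover have "m\<^sup>2 * ((m * r)\<^sup>2 + b\<^sup>2 + c\<^sup>2) + (m * e)\<^sup>2 = m\<^sup>2 * ((m * r)\<^sup>2 + b\<^sup>2 + c\<^sup>2 + e\<^sup>2)"
      by (simp add: power2_eq_square algebra_simps)
    moreover have "q dvd m\<^sup>2 * ((m * r)\<^sup>2 + b\<^sup>2 + c\<^sup>2 + e\<^sup>2) \<longleftrightarrow> q dvd (m * r)\<^sup>2 + b\<^sup>2 + c\<^sup>2 + e\<^sup>2"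
      using mq by (intro coprime_dvd_mult_right_iff) (simp add: coprime_commute)
    ultimately show ?thesis using True by simp
  next
    case False
    then have "\<not> (m dvd b * c + 1 \<and> r dvd b * c + 1)" using divides_mult[OF _ _ mr] by blast
    then show ?thesis using False by blast
  qed
  then show ?thesis unfolding hyperbola_pts_def class_pts_def class_set_mod[OF r q] by auto
qed

text \<open>The box method is applied with \<open>Q = r * d\<^sup>2\<close> and \<open>T\<close>
  close to \<open>m / (x\<^sup>2 * d)\<close>. Its requirement \<open>m \<le> T\<^sup>2\<close> is
  secured by \<open>m \<ge> 4 * x^8\<close>; for smaller \<open>m\<close> the count and the main
  term are at most of order \<open>B^4 * x^8 * r\<close>, which the bound covers. The term with
  \<open>x\<^sup>2\<close> in the denominator is the edge effect, the one with
  \<open>x^17 * r\<close> the variance.\<close>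

lemma hyperbola_pts_approx:
  fixes m r d M :: nat and B x :: real
  assumes x: "x \<ge> 1" and Mx: "real M = x ^ 20" and B: "B \<ge> 1"
    and tauB: "\<And>N. N \<noteq> 0 \<Longrightarrow> \<bar>N\<bar> \<le> 8 * (int M)\<^sup>2 \<Longrightarrow> real (tau N) \<le> B"
    and harmB: "\<And>m. m \<le> M \<Longrightarrow> harm_int (int m) \<le> B"
    and d: "odd d" "d > 0" "real d \<le> x\<^sup>2"
    and m: "m > 0" and r: "r > 0" and mrM: "m * r \<le> M" and md: "coprime m d"
    and rad: "\<And>p. prime p \<Longrightarrow> p dvd r \<Longrightarrow> p dvd d"
  defines "q \<equiv> (int d)\<^sup>2"
  defines "n \<equiv> real (card (local_set q (int (m * r))))"
  shows "\<bar>real (card (hyperbola_pts (int (m * r)) q)) - 4 * real (m * r) * psi d (m * r) * n / (real d) ^ 4\<bar>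
     \<le> B ^ 4 * (48 * real (m * r) / x\<^sup>2 + 220 * x ^ 17 * real r) / real d"
proof -
  define a where "a = m * r"
  define \<psi> where "\<psi> = psi d a"
  have q0: "q > 0" "odd q" using d by (auto simp: q_def)
  have rq: "real_of_int q = (real d)\<^sup>2" by (simp add: q_def)
  have a0: "a > 0" using m r by (simp add: a_def)
  have aM: "real a \<le> x ^ 20" using mrM Mx unfolding a_def by (metis of_nat_le_iff)
  have mM: "m \<le> M"
  proof -
    have "m * 1 \<le> m * r" using r by (intro mult_le_mono2) simp
    then show ?thesis using mrM by linarith
  qed
  have d1: "real d \<ge> 1" using d by simp
  have psi: "\<psi> = real (card (hyp (int m) 1)) / real m"
    unfolding \<psi>_def a_def by (rule psi_eq[OF refl m r md rad])
  have psi01: "0 \<le> \<psi>" "\<psi> \<le> 1"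
  proof -
    show "0 \<le> \<psi>" by (simp add: psi)
    have "real (totient m) \<le> real m" by (simp only: of_nat_le_iff totient_le)
    then show "\<psi> \<le> 1" using m by (simp add: psi card_hyp_eq_totient)
  qed
  have dM: "real (d\<^sup>2) \<le> real (M)"
  proof -
    have "(real d)\<^sup>2 \<le> (x\<^sup>2)\<^sup>2" using d by (intro power_mono) auto
    also have "\<dots> = x ^ 4" by simp
    also have "\<dots> \<le> x ^ 20" using x by (intro power_increasing) auto
    finally show ?thesis by (simp add: Mx)
  qed
  have "d\<^sup>2 \<le> M" using dM by (simp only: of_nat_le_iff)
  have MM: "M \<le> M\<^sup>2" by (simp add: power2_eq_square)
  have qM: "\<bar>q\<bar> \<le> 8 * (int M)\<^sup>2"
  proof -
    have "d\<^sup>2 \<le> 8 * M\<^sup>2" using \<open>d\<^sup>2 \<le> M\<close> MM by linarith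
    then have "int (d\<^sup>2) \<le> int (8 * M\<^sup>2)" by (simp only: of_nat_le_iff)
    then show ?thesis by (simp add: q_def)
  qed
  have n0: "0 \<le> n" by (simp add: n_def)
  have nB: "n \<le> 4 * (real d)\<^sup>2 * B ^ 4"
  proof -
    have "n \<le> 4 * of_int q * (real (tau q)) ^ 4" unfolding n_def by (rule card_local_set_le[OF q0])
    also have "\<dots> \<le> 4 * of_int q * B ^ 4" using q0 qM by (intro mult_left_mono power_mono tauB) auto
    finally show ?thesis by (simp add: rq)
  qed
  have B4: "B ^ 4 \<ge> 1" using B by simp
  define main where "main = 4 * real a * \<psi> * n / (real d) ^ 4"
  have rM: "real m * real r = real a" by (simp add: a_def)
  show ?thesis
  proof (cases "real m < 4 * x ^ 8")
    case True
    have "main \<le> 16 * real a * B ^ 4"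
    proof -
      have "main \<le> 4 * real a * 1 * (4 * (real d)\<^sup>2 * B ^ 4) / (real d) ^ 4"
        unfolding main_def using psi01 n0 nB by (intro divide_right_mono mult_mono) auto
      also have "\<dots> = 16 * real a * B ^ 4 * (1 / (real d)\<^sup>2)" using d1 by (simp add: field_simps power2_eq_square power4_eq_xxxx)
      also have "\<dots> \<le> 16 * real a * B ^ 4 * 1" using d1 B by (intro mult_left_mono) auto
      finally show ?thesis by simp
    qed
    moreover have "main \<ge> 0" using psi01 n0 by (simp add: main_def)
    moreover have "real (card (hyperbola_pts (int a) q)) \<le> 4 * real a" using card_hyperbola_pts_le[of "int a" q] a0 by simp
    moreover have "4 * real a \<le> 4 * real a * B ^ 4" using mult_left_mono[OF B4, of "4 * real a"] by simp
    ultimately have "\<bar>real (card (hyperbola_pts (int a) q)) - main\<bar> \<le> 20 * real a * B ^ 4"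
      unfolding abs_le_iff using of_nat_0_le_iff[of "card (hyperbola_pts (int a) q)", where ?'a=real] by linarith
    also have "\<dots> = B ^ 4 * (20 * (real m * real r))" by (simp add: rM)
    also have "\<dots> \<le> B ^ 4 * ((48 * real a / x\<^sup>2 + 220 * x ^ 17 * real r) / real d)"
    proof (intro mult_left_mono)
      have "20 * (real m * real r) \<le> 20 * (4 * x ^ 8 * real r)" using True by (intro mult_left_mono mult_right_mono) auto
      also have "\<dots> = 80 * (x ^ 8 * real d) * real r / real d" using d1 by simp
      also have "\<dots> \<le> 220 * x ^ 17 * real r / real d"
      proof (intro divide_right_mono mult_right_mono)
        have "x ^ 8 * real d \<le> x ^ 8 * x ^ 2" using d x by (intro mult_left_mono) auto
        also have "\<dots> = x ^ 10" by (simp flip: power_add)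
        also have "\<dots> \<le> x ^ 17" using x by (intro power_increasing) auto
        moreover have "0 \<le> x ^ 17" using x by simp
        ultimately show "80 * (x ^ 8 * real d) \<le> 220 * x ^ 17" by linarith
      qed auto
      also have "\<dots> \<le> (48 * real a / x\<^sup>2 + 220 * x ^ 17 * real r) / real d" by (intro divide_right_mono) auto
      finally show "20 * (real m * real r) \<le> (48 * real a / x\<^sup>2 + 220 * x ^ 17 * real r) / real d" .
    qed (use B in auto)
    finally show ?thesis by (simp add: main_def \<psi>_def a_def)
  next
    case False
    define t where "t = real m / (x\<^sup>2 * real d)"
    define T where "T = \<lfloor>t\<rfloor>"
    have xd: "x\<^sup>2 * real d \<le> x ^ 4" "x\<^sup>2 * real d > 0" "x\<^sup>2 * real d \<ge> 1"
    proof -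
      have "x\<^sup>2 * real d \<le> x\<^sup>2 * x\<^sup>2" using d x by (intro mult_left_mono) auto
      then show "x\<^sup>2 * real d \<le> x ^ 4" by (simp flip: power_add)
      show "x\<^sup>2 * real d > 0" using x d by simp
      have "1 * 1 \<le> x\<^sup>2 * real d" using x d1 by (intro mult_mono) auto
      then show "x\<^sup>2 * real d \<ge> 1" by simp
    qed
    have m8: "real m \<ge> 4 * x ^ 8" using False by simp
    have t1: "t \<ge> 1"
    proof -
      have "x ^ 4 \<le> x ^ 8" "0 \<le> x ^ 8" using x by (auto intro: power_increasing)
      then show ?thesis unfolding t_def using xd m8 by (simp add: le_divide_eq)
    qed
    have Tt: "T \<ge> 1" "real_of_int T \<le> t" using t1 by (simp_all add: T_def)
    have "t < real_of_int T + 1" unfolding T_def by (rule floor_correct[THEN conjunct2, simplified])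
    moreover have "real_of_int T \<ge> 1" using Tt(1) by simp
    ultimately have "t / 2 \<le> real_of_int T" by linarith
    then have T1: "real_of_int T \<ge> t / 2" "real_of_int T \<le> t" "T \<ge> 1" using Tt by simp_all
    have m0: "real m > 0" using m by simp
    have t2: "real m \<le> (t / 2)\<^sup>2"
    proof -
      have "(x\<^sup>2 * real d)\<^sup>2 \<le> (x ^ 4)\<^sup>2" using xd by (intro power_mono) auto
      also have "\<dots> = x ^ 8" by simp
      finally have "4 * (x\<^sup>2 * real d)\<^sup>2 \<le> real m" using m8 by linarith
      then have "real m * (4 * (x\<^sup>2 * real d)\<^sup>2) \<le> real m * real m" by (intro mult_left_mono) auto
      then have "real m * (4 * (x\<^sup>2 * real d)\<^sup>2) / (4 * (x\<^sup>2 * real d)\<^sup>2) \<le> real m * real m / (4 * (x\<^sup>2 * real d)\<^sup>2)"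
        by (rule divide_right_mono) simp
      moreover have "real m * (4 * (x\<^sup>2 * real d)\<^sup>2) / (4 * (x\<^sup>2 * real d)\<^sup>2) = real m" using x d by simp
      moreover have "real m * real m / (4 * (x\<^sup>2 * real d)\<^sup>2) = (t / 2)\<^sup>2"
        unfolding t_def power_divide by (simp add: power2_eq_square)
      ultimately show ?thesis by linarith
    qed
    have Tm: "int m \<le> T\<^sup>2"
    proof -
      have "(t / 2)\<^sup>2 \<le> (real_of_int T)\<^sup>2" using T1 t1 by (intro power_mono) auto
      then have "real_of_int (int m) \<le> real_of_int (T\<^sup>2)" using t2 by simp
      then show ?thesis by (simp only: of_int_le_iff)
    qed
    define Q where "Q = int r * q"
    have Q0: "Q > 0" using r q0 by (simp add: Q_def)
    have mq: "coprime (int m) q" using md by (simp add: q_def coprime_int_iff)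
    have mr: "coprime (int m) (int r)"
    proof (rule ccontr)
      assume "\<not> coprime (int m) (int r)"
      then have "gcd m r \<noteq> 1" by (simp add: coprime_int_iff coprime_iff_gcd_eq_1)
      then obtain p where "prime p" "p dvd gcd m r" using prime_factor_nat by blast
      then have "p dvd m" "p dvd d" "prime p" using rad by auto
      then show False using md by (metis coprime_common_divisor_nat not_prime_1)
    qed
    have mQ: "coprime Q (int m)" using mr mq by (simp add: Q_def coprime_commute)
    define S where "S = class_set (int m) (int r) q"
    have cS: "real (card S) = real r * n"
    proof -
      have "p dvd q" if p: "prime p" "p dvd int r" for p
      proof -
        obtain p' where p': "p = int p'" using p(1) prime_ge_0_int zero_le_imp_eq_int by blast
        have "p' dvd d" using p by (intro rad) (simp_all add: p')
        then have "p dvd int d" by (simp add: p')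
        then show ?thesis by (simp add: q_def power2_eq_square)
      qed
      then have "card S = nat (int r) * card (local_set q (int m * int r))"
        unfolding S_def using mq q0 r by (intro card_class_set) auto
      then show ?thesis by (simp add: n_def)
    qed
    have Ssub: "S \<subseteq> {0..<Q} \<times> {0..<Q}" by (auto simp: S_def class_set_def Q_def)
    have tauB': "real (tau N) \<le> B" if N: "N \<noteq> 0" "\<bar>N\<bar> \<le> (int m)\<^sup>2" for N
    proof (rule tauB[OF N(1)])
      have "(int m)\<^sup>2 \<le> (int M)\<^sup>2" using mM by (intro power_mono) auto
      then show "\<bar>N\<bar> \<le> 8 * (int M)\<^sup>2" using N(2) by (smt (verit) zero_le_power2)
    qed
    define L0 where "L0 = 2 * real_of_int (int a) / of_int Q"
    have L0: "L0 = 2 * real m / (real d)\<^sup>2" using r by (simp add: L0_def Q_def a_def rq)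
    define \<rho> where "\<rho> = real (card (hyp (int m) 1)) / (of_int (int m))\<^sup>2"
    have rho: "\<rho> = \<psi> / real m" by (simp add: \<rho>_def psi power2_eq_square)
    have TL: "2 * real_of_int T \<le> L0"
    proof -
      have "t \<le> real m / (real d)\<^sup>2" unfolding t_def power2_eq_square[of "real d"]
        using d d1 x by (intro divide_left_mono mult_right_mono) (auto simp: power2_eq_square)
      then show ?thesis using T1 by (simp add: L0)
    qed
    have T1': "real_of_int T \<ge> 1" using T1(3) by simp
    then have TL': "real_of_int T + 1 \<le> L0" using TL by linarith
    define V where "V = 14 * of_int T ^ 3 * sqrt (of_int (int m)) * harm_int (int m) * B\<^sup>2"
    have Z: "hyperbola_pts (int a) q = {(b, c) \<in> class_pts Q S (- int a) (int a). int m dvd b * c + 1}"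
      using hyperbola_pts_eq_class_pts[of "int m" "int r" q] m r q0 mr mq by (simp add: a_def Q_def S_def)
    have key: "\<bar>real (card (hyperbola_pts (int a) q)) - real (card S) * L0\<^sup>2 * \<rho>\<bar>
      \<le> real (card S) * \<rho> * ((of_int T + 1) * (2 * L0 + of_int T + 1))
      + sqrt (real (card S)) * (2 * L0) * (2 * of_int Q * L0 / of_int (int m) + 1) * sqrt V / (of_int T)\<^sup>2"
      unfolding Z V_def L0_def \<rho>_def
      by (rule hyperbola_box_count) (use m Q0 mQ T1 Tm tauB' Ssub a0 TL' in \<open>auto simp: L0_def\<close>)
    have meq: "real (card S) * L0\<^sup>2 * \<rho> = main"
      using m0 d1 unfolding cS L0 rho main_def rM[symmetric] by (simp add: power2_eq_square power4_eq_xxxx field_simps)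
    \<comment> \<open>The edge costs a proportion \<open>T / L0\<close> of the main term:
      \<open>T + 1 \<le> 2 * t\<close> and \<open>2 * L0 + T + 1 \<le> 3 * L0\<close>, where
      \<open>L0 = 2 * m / d\<^sup>2\<close>.\<close>
    have err1: "real (card S) * \<rho> * ((of_int T + 1) * (2 * L0 + of_int T + 1)) \<le> B ^ 4 * (48 * real a / x\<^sup>2) / real d"
    proof -
      have "real (card S) * \<rho> * ((of_int T + 1) * (2 * L0 + of_int T + 1)) \<le> (real r * n * (1 / real m)) * ((2 * t) * (3 * L0))"
      proof (rule mult_mono)
        show "real (card S) * \<rho> \<le> real r * n * (1 / real m)" unfolding cS rho
          using psi01 n0 by (intro mult_left_mono divide_right_mono) auto
        show "(of_int T + 1) * (2 * L0 + of_int T + 1) \<le> (2 * t) * (3 * L0)"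
          using T1 T1' TL' t1 by (intro mult_mono) auto
      qed (use T1' TL' n0 in auto)
      also have "\<dots> = real r * real m * 12 / (x\<^sup>2 * real d * (real d)\<^sup>2) * n"
        using m0 d1 x unfolding t_def L0 by (simp add: field_simps)
      also have "\<dots> \<le> real r * real m * 12 / (x\<^sup>2 * real d * (real d)\<^sup>2) * (4 * (real d)\<^sup>2 * B ^ 4)"
        using nB by (intro mult_left_mono) auto
      also have "\<dots> = B ^ 4 * (48 * real a / x\<^sup>2) / real d"
        using d1 x unfolding rM[symmetric] by (simp add: field_simps)
      finally show ?thesis .
    qed
    have err2: "sqrt (real (card S)) * (2 * L0) * (2 * of_int Q * L0 / of_int (int m) + 1) * sqrt V / (of_int T)\<^sup>2 \<le> B ^ 4 * (220 * x ^ 17 * real r) / real d"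
    proof -
      \<comment> \<open>\<open>W\<^sup>2\<close> majorizes \<open>card S * V / T^4\<close>. The
        factor \<open>112 * B^7\<close> arising there is rounded up to the square
        \<open>121 * B^8\<close>; of \<open>x^34\<close>, two powers come from \<open>1 / T\<close>
        and \<open>x^32\<close> bounds \<open>a * d * sqrt m\<close>.\<close>
      define W where "W = 11 * B ^ 4 * x ^ 17 * real d / real m"
      have W0: "W \<ge> 0" using B x by (simp add: W_def)
      have QL: "2 * of_int Q * L0 / of_int (int m) + 1 \<le> 5 * real r"
      proof -
        have "2 * of_int Q * L0 / of_int (int m) = 4 * real r" using m0 Q0 by (simp add: L0_def a_def)
        then show ?thesis using r by simp
      qed
      have "real (card S) * V / real_of_int T ^ 4 \<le> W\<^sup>2"
      proof -
        have "real (card S) * V / real_of_int T ^ 4 = real (card S) * (14 * sqrt (real m) * harm_int (int m) * B\<^sup>2) / real_of_int T"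
          using T1' unfolding V_def by (simp add: power3_eq_cube power4_eq_xxxx)
        also have "\<dots> \<le> (real r * (4 * (real d)\<^sup>2 * B ^ 4)) * (14 * sqrt (real m) * B * B\<^sup>2) / (t / 2)"
        proof (intro frac_le mult_mono)
          show "real (card S) \<le> real r * (4 * (real d)\<^sup>2 * B ^ 4)" unfolding cS using nB by (intro mult_left_mono) auto
          show "harm_int (int m) \<le> B" by (rule harmB[OF mM])
          have "harm_int (int m) \<ge> 1" using m by (intro harm_int_ge_1) auto
          then show "0 \<le> 14 * sqrt (real m) * harm_int (int m) * B\<^sup>2" "0 \<le> harm_int (int m)" by auto
        qed (use B T1 t1 in auto)
        also have "\<dots> = 112 * B ^ 7 * x\<^sup>2 * (real r * (real d)\<^sup>2 * real d * sqrt (real m) / real m)"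
          using m0 d1 x unfolding t_def by (simp add: field_simps power_add[symmetric]) (simp add: power_numeral_reduce)
        also have "\<dots> \<le> 112 * B ^ 7 * x\<^sup>2 * (x ^ 32 * (real d)\<^sup>2 / (real m)\<^sup>2)"
        proof (rule mult_left_mono)
          have "sqrt (real m) \<le> sqrt (x ^ 20)"
          proof (rule real_sqrt_le_mono)
            have "real m \<le> real M" using mM by simp
            then show "real m \<le> x ^ 20" by (simp add: Mx)
          qed
          also have "sqrt (x ^ 20) = x ^ 10"
          proof (rule real_sqrt_unique)
            show "(x ^ 10)\<^sup>2 = x ^ 20" by (simp flip: power_mult)
          qed (use x in simp)
          finally have sm: "sqrt (real m) \<le> x ^ 10" .
          have "real a * (real d * sqrt (real m)) \<le> x ^ 20 * (x ^ 2 * x ^ 10)"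
            using aM d sm x by (intro mult_mono) auto
          also have "\<dots> = x ^ 32" by (simp flip: power_add)
          finally have "real m * real r * (real d * sqrt (real m)) * ((real d)\<^sup>2 / (real m)\<^sup>2) \<le> x ^ 32 * ((real d)\<^sup>2 / (real m)\<^sup>2)"
            unfolding rM by (intro mult_right_mono) auto
          moreover have "real m * real r * (real d * sqrt (real m)) * ((real d)\<^sup>2 / (real m)\<^sup>2) = real r * (real d)\<^sup>2 * real d * sqrt (real m) / real m"
            using m0 by (simp add: field_simps power2_eq_square)
          ultimately show "real r * (real d)\<^sup>2 * real d * sqrt (real m) / real m \<le> x ^ 32 * (real d)\<^sup>2 / (real m)\<^sup>2" by simp
        qed (use B in auto)
        also have "\<dots> = 112 * B ^ 7 * (x ^ 34 * (real d)\<^sup>2 / (real m)\<^sup>2)" by (simp add: power_add[of x 2 32, simplified])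
        also have "\<dots> \<le> 121 * B ^ 8 * (x ^ 34 * (real d)\<^sup>2 / (real m)\<^sup>2)"
        proof (rule mult_right_mono)
          have "B ^ 7 \<le> B ^ 8" "0 \<le> B ^ 8" using B by (auto intro: power_increasing)
          then show "112 * B ^ 7 \<le> 121 * B ^ 8" by linarith
        qed (use x in simp)
        also have "\<dots> = W\<^sup>2" by (simp add: W_def power_divide power_mult_distrib flip: power_mult)
        finally show ?thesis .
      qed
      then have "sqrt (real (card S) * V / real_of_int T ^ 4) \<le> W" using W0 by (intro real_le_lsqrt)
      moreover have "sqrt (real (card S) * V / real_of_int T ^ 4) = sqrt (real (card S)) * sqrt V / (of_int T)\<^sup>2"
      proof -
        have "sqrt (real_of_int T ^ 4) = (of_int T)\<^sup>2" by (rule real_sqrt_unique) (simp_all flip: power_mult)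
        then show ?thesis by (simp only: real_sqrt_divide real_sqrt_mult)
      qed
      ultimately have sW: "sqrt (real (card S)) * sqrt V / (of_int T)\<^sup>2 \<le> W" by simp
      have "sqrt (real (card S)) * (2 * L0) * (2 * of_int Q * L0 / of_int (int m) + 1) * sqrt V / (of_int T)\<^sup>2
        = (2 * L0) * (2 * of_int Q * L0 / of_int (int m) + 1) * (sqrt (real (card S)) * sqrt V / (of_int T)\<^sup>2)" by simp
      also have "\<dots> \<le> (2 * L0) * (5 * real r) * W"
      proof (rule mult_mono[OF mult_left_mono[OF QL] sW])
        show "0 \<le> sqrt (real (card S)) * sqrt V / (of_int T)\<^sup>2"
        proof -
          have "harm_int (int m) \<ge> 1" using m by (intro harm_int_ge_1) auto
          then have "V \<ge> 0" using T1' by (simp add: V_def)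
          then show ?thesis by simp
        qed
      qed (use L0 in auto)
      also have "\<dots> = B ^ 4 * (220 * x ^ 17 * real r) / real d"
        using m0 d1 unfolding L0 W_def by (simp add: field_simps power2_eq_square)
      finally show ?thesis .
    qed
    have "\<bar>real (card (hyperbola_pts (int a) q)) - main\<bar> \<le> B ^ 4 * (48 * real a / x\<^sup>2) / real d + B ^ 4 * (220 * x ^ 17 * real r) / real d"
      using key err1 err2 unfolding meq by linarith
    also have "\<dots> = B ^ 4 * (48 * real a / x\<^sup>2 + 220 * x ^ 17 * real r) / real d"
      by (simp add: add_divide_distrib distrib_left)
    finally show ?thesis by (simp add: main_def \<psi>_def a_def)
  qed
qed

section \<open>The divisibility counts\<close>

text \<open>A single \<open>f a\<close> may be as large as \<open>a\<close>, but a value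
  \<open>r\<close> is chosen by at most \<open>M div r\<close> of the \<open>a\<close>, so it
  contributes at most \<open>M\<close>. Applied to the part of \<open>a\<close> built from primes of
  \<open>d\<close>, this keeps the factor \<open>r\<close> in the error for each \<open>a\<close>
  harmless on average.\<close>

lemma sum_divisor_choice_le:
  fixes f :: "nat \<Rightarrow> nat"
  assumes f: "\<And>a. a \<in> {1..M} \<Longrightarrow> f a dvd a \<and> f a \<in> R" and R: "R \<subseteq> {1..M}"
  shows "(\<Sum>a\<in>{1..M}. f a) \<le> M * card R"
proof -
  have finR: "finite R" using R by (rule finite_subset) simp
  have "(\<Sum>a\<in>{1..M}. f a) = (\<Sum>r\<in>R. \<Sum>a\<in>{a \<in> {1..M}. f a = r}. f a)"
    by (rule sum.group[symmetric]) (use finR f in auto)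
  also have "\<dots> \<le> (\<Sum>r\<in>R. M)"
  proof (rule sum_mono)
    fix r assume r: "r \<in> R"
    then have r0: "r > 0" using R by auto
    have "{a \<in> {1..M}. f a = r} \<subseteq> (\<lambda>k. r * k) ` {1..M div r}"
    proof
      fix a assume a: "a \<in> {a \<in> {1..M}. f a = r}"
      then have "r dvd a" using f by auto
      then obtain k where k: "a = r * k" by blast
      have "k \<le> M div r" using a r0 by (simp add: k less_eq_div_iff_mult_less_eq mult.commute)
      moreover have "k \<ge> 1" using a k by (cases k) auto
      ultimately show "a \<in> (\<lambda>k. r * k) ` {1..M div r}" using k by auto
    qed
    then have "card {a \<in> {1..M}. f a = r} \<le> card {1..M div r}" by (intro surj_card_le) auto
    then have c: "card {a \<in> {1..M}. f a = r} \<le> M div r" by simp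
    have "(\<Sum>a\<in>{a \<in> {1..M}. f a = r}. f a) = r * card {a \<in> {1..M}. f a = r}" by simp
    also have "\<dots> \<le> r * (M div r)" using c by (rule mult_le_mono2)
    also have "\<dots> \<le> M" by simp
    finally show "(\<Sum>a\<in>{a \<in> {1..M}. f a = r}. f a) \<le> M" .
  qed
  also have "\<dots> = M * card R" by simp
  finally show ?thesis .
qed

text \<open>\<open>B\<close> majorizes every quantity of size \<open>M\<close> to the power \<open>o(1)\<close>; the scale \<open>x\<close> is \<open>M powr (1 / 20)\<close>, so that
  \<open>x ^ 38\<close> is the target error.\<close>

locale divisor_bounds =
  fixes M :: nat and B x :: real
  assumes x: "x \<ge> 1" and Mx: "real M = x ^ 20" and B: "B \<ge> 1"
    and tauB: "\<And>N. N \<noteq> 0 \<Longrightarrow> \<bar>N\<bar> \<le> 8 * (int M)\<^sup>2 \<Longrightarrow> real (tau N) \<le> B"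
    and harmB: "\<And>m. m \<le> M \<Longrightarrow> harm_int (int m) \<le> B"
    and smoothB: "\<And>d. d > 0 \<Longrightarrow> d \<le> M \<Longrightarrow>
      real (card {r \<in> {1..M}. \<forall>p. prime p \<longrightarrow> p dvd r \<longrightarrow> p dvd d}) \<le> B"
begin

lemma M_ge_1: "M \<ge> 1"
proof -
  have "1 \<le> x ^ 20" using x by (rule one_le_power)
  then show ?thesis using Mx by linarith
qed

lemma le_M_of_le_square: "real d \<le> x\<^sup>2 \<Longrightarrow> d\<^sup>2 \<le> M"
proof -
  assume "real d \<le> x\<^sup>2"
  then have "(real d)\<^sup>2 \<le> (x\<^sup>2)\<^sup>2" by (intro power_mono) auto
  also have "\<dots> = x ^ 4" by simp
  also have "\<dots> \<le> x ^ 20" using x by (intro power_increasing) auto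
  also have "\<dots> = real M" by (simp add: Mx)
  finally have "real (d\<^sup>2) \<le> real M" by simp
  then show ?thesis by (simp only: of_nat_le_iff)
qed

lemma card_local_set_le_B:
  assumes d: "odd d" "d > 0" "real d \<le> x\<^sup>2"
  shows "real (card (local_set ((int d)\<^sup>2) a)) \<le> 4 * (real d)\<^sup>2 * B ^ 4"
proof -
  have "M \<le> M\<^sup>2" by (simp add: power2_eq_square)
  then have "d\<^sup>2 \<le> 8 * M\<^sup>2" using le_M_of_le_square[OF d(3)] by linarith
  then have "int (d\<^sup>2) \<le> int (8 * M\<^sup>2)" by (simp only: of_nat_le_iff)
  then have "(int d)\<^sup>2 \<le> 8 * (int M)\<^sup>2" by simp
  then have "real (tau ((int d)\<^sup>2)) \<le> B" using d by (intro tauB) auto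
  moreover have "real (card (local_set ((int d)\<^sup>2) a)) \<le> 4 * of_int ((int d)\<^sup>2) * (real (tau ((int d)\<^sup>2))) ^ 4"
    using d by (intro card_local_set_le) auto
  moreover have "4 * real_of_int ((int d)\<^sup>2) * (real (tau ((int d)\<^sup>2))) ^ 4 \<le> 4 * of_int ((int d)\<^sup>2) * B ^ 4"
    using \<open>real (tau ((int d)\<^sup>2)) \<le> B\<close> by (intro mult_left_mono power_mono) auto
  ultimately show ?thesis by simp
qed

text \<open>Group the \<open>a\<close> by class modulo \<open>d\<^sup>2\<close>: the local count
  depends only on the class, while the main term of the sum of \<open>a * psi d a\<close> is the
  same for all classes. Hence the local counts add up to \<open>local_total d\<close>. In the error,
  48 is 4 from the summand, 4 from the bound for the local counts and 3 from the class sums.\<close>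

lemma sum_hyperbola_pts_main:
  assumes d: "odd d" "d > 0" "real d \<le> x\<^sup>2"
  shows "\<bar>(\<Sum>a\<in>{1..M}. 4 * real a * psi d a * real (card (local_set ((int d)\<^sup>2) (int a))) / (real d) ^ 4)
      - 2 * (kap d * local_total d / (real d) ^ 6) * (real M)\<^sup>2\<bar> \<le> 48 * B ^ 5 * x ^ 20"
proof -
  define q where "q = (int d)\<^sup>2"
  have q: "q > 0" "odd q" using d by (auto simp: q_def)
  define n where "n r = real (card (local_set q r))" for r
  define I where "I r = (\<Sum>a\<in>{a \<in> {1..M}. int a mod q = r}. real a * psi d a)" for r
  define k where "k = kap d * (real M)\<^sup>2 / (2 * (real d)\<^sup>2)"
  have d1: "real d \<ge> 1" using d by simp
  have "(\<Sum>a\<in>{1..M}. 4 * real a * psi d a * n (int a) / (real d) ^ 4)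
     = (\<Sum>r\<in>{0..<q}. \<Sum>a\<in>{a \<in> {1..M}. int a mod q = r}. 4 * real a * psi d a * n (int a) / (real d) ^ 4)"
    using q by (intro sum.group[symmetric]) auto
  also have "\<dots> = (\<Sum>r\<in>{0..<q}. 4 / (real d) ^ 4 * (n r * I r))"
  proof (rule sum.cong[OF refl])
    fix r
    have nr: "n (int a) = n r" if "int a mod q = r" for a
      using local_set_mod[of q "int a"] that by (simp add: n_def)
    have "4 / (real d) ^ 4 * (n r * I r) = (\<Sum>a\<in>{a \<in> {1..M}. int a mod q = r}. 4 / (real d) ^ 4 * (n r * (real a * psi d a)))"
      by (simp only: I_def sum_distrib_left)
    also have "\<dots> = (\<Sum>a\<in>{a \<in> {1..M}. int a mod q = r}. 4 * real a * psi d a * n (int a) / (real d) ^ 4)"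
      by (intro sum.cong refl) (simp add: nr)
    finally show "(\<Sum>a\<in>{a \<in> {1..M}. int a mod q = r}. 4 * real a * psi d a * n (int a) / (real d) ^ 4) = 4 / (real d) ^ 4 * (n r * I r)" ..
  qed
  finally have S: "(\<Sum>a\<in>{1..M}. 4 * real a * psi d a * n (int a) / (real d) ^ 4) = 4 / (real d) ^ 4 * (\<Sum>r\<in>{0..<q}. n r * I r)"
    by (simp only: sum_distrib_left)
  have Ik: "\<bar>I r - k\<bar> \<le> 3 * real M * B" if r: "r \<in> {0..<q}" for r
  proof -
    have "\<bar>I r - k\<bar> \<le> 3 * real M * harm_int (int M)"
      using sum_psi_class[OF d(2) M_ge_1, of r] r by (simp add: I_def k_def q_def)
    also have "\<dots> \<le> 3 * real M * B" using harmB[of M] by (intro mult_left_mono) auto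
    finally show ?thesis .
  qed
  have L: "(\<Sum>r\<in>{0..<q}. n r) = local_total d"
    unfolding n_def local_total_def of_nat_sum[symmetric] using sum_card_local_set[OF q] by (simp add: q_def)
  have "(\<Sum>r\<in>{0..<q}. n r) \<le> (\<Sum>r\<in>{0..<q}. 4 * (real d)\<^sup>2 * B ^ 4)"
    unfolding n_def q_def by (intro sum_mono card_local_set_le_B d)
  also have "\<dots> = 4 * (real d) ^ 4 * B ^ 4" by (simp add: q_def nat_power_eq power2_eq_square power4_eq_xxxx)
  finally have LB: "(\<Sum>r\<in>{0..<q}. n r) \<le> 4 * (real d) ^ 4 * B ^ 4" .
  have "\<bar>(\<Sum>r\<in>{0..<q}. n r * I r) - (\<Sum>r\<in>{0..<q}. n r * k)\<bar> = \<bar>\<Sum>r\<in>{0..<q}. n r * (I r - k)\<bar>"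
    by (simp only: sum_subtractf[symmetric] right_diff_distrib)
  also have "\<dots> \<le> (\<Sum>r\<in>{0..<q}. \<bar>n r * (I r - k)\<bar>)" by (rule sum_abs)
  also have "\<dots> \<le> (\<Sum>r\<in>{0..<q}. n r * (3 * real M * B))"
    using Ik by (intro sum_mono) (simp add: abs_mult n_def mult_left_mono)
  also have "\<dots> = (\<Sum>r\<in>{0..<q}. n r) * (3 * real M * B)" by (simp only: sum_distrib_right)
  also have "\<dots> \<le> 4 * (real d) ^ 4 * B ^ 4 * (3 * real M * B)" using LB B by (intro mult_right_mono) auto
  finally have "\<bar>(\<Sum>r\<in>{0..<q}. n r * I r) - local_total d * k\<bar> \<le> 4 * (real d) ^ 4 * B ^ 4 * (3 * real M * B)"
    by (simp only: sum_distrib_right[symmetric] L)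
  then have "4 / (real d) ^ 4 * \<bar>(\<Sum>r\<in>{0..<q}. n r * I r) - local_total d * k\<bar> \<le> 4 / (real d) ^ 4 * (4 * (real d) ^ 4 * B ^ 4 * (3 * real M * B))"
    by (intro mult_left_mono) auto
  also have "\<dots> = 48 * B ^ 5 * x ^ 20" using d1 by (simp add: Mx eval_nat_numeral)
  finally have fin: "4 / (real d) ^ 4 * \<bar>(\<Sum>r\<in>{0..<q}. n r * I r) - local_total d * k\<bar> \<le> 48 * B ^ 5 * x ^ 20" .
  have "4 / (real d) ^ 4 * (local_total d * k) = 2 * (kap d * local_total d / (real d) ^ 6) * (real M)\<^sup>2"
    using d1 unfolding k_def by (simp add: field_simps eval_nat_numeral)
  then have "\<bar>4 / (real d) ^ 4 * (\<Sum>r\<in>{0..<q}. n r * I r) - 2 * (kap d * local_total d / (real d) ^ 6) * (real M)\<^sup>2\<bar>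
     = \<bar>4 / (real d) ^ 4 * ((\<Sum>r\<in>{0..<q}. n r * I r) - local_total d * k)\<bar>" by (simp only: right_diff_distrib)
  also have "\<dots> = 4 / (real d) ^ 4 * \<bar>(\<Sum>r\<in>{0..<q}. n r * I r) - local_total d * k\<bar>" unfolding abs_mult by simp
  finally show ?thesis using fin S unfolding n_def q_def by simp
qed

text \<open>Summed over \<open>a\<close>, the edge term gives \<open>48 * x^40 / x\<^sup>2\<close>
  and the variance term \<open>220 * x^17\<close> times the sum of the smooth parts, at most
  \<open>x^20 * B\<close>. The error of the main terms adds another 48, where
  \<open>d \<le> x\<^sup>2\<close> makes room for the denominator \<open>d\<close>.\<close>

lemma sum_hyperbola_pts_approx:
  assumes d: "odd d" "d > 0" "real d \<le> x\<^sup>2"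
  shows "\<bar>(\<Sum>a\<in>{1..M}. real (card (hyperbola_pts (int a) ((int d)\<^sup>2)))) - 2 * (kap d * local_total d / (real d) ^ 6) * (real M)\<^sup>2\<bar>
     \<le> 316 * B ^ 5 * x ^ 38 / real d"
proof -
  define q where "q = (int d)\<^sup>2"
  define mn where "mn a = 4 * real a * psi d a * real (card (local_set q (int a))) / (real d) ^ 4" for a
  define R where "R = {r \<in> {1..M}. \<forall>p. prime p \<longrightarrow> p dvd r \<longrightarrow> p dvd d}"
  have d1: "real d \<ge> 1" using d by simp
  have "d\<^sup>2 \<le> M" by (rule le_M_of_le_square[OF d(3)])
  moreover have "d \<le> d\<^sup>2" by (simp add: power2_eq_square)
  ultimately have dM: "d \<le> M" by linarith
  have "\<forall>a\<in>{1..M}. \<exists>r. r > 0 \<and> r dvd a \<and> coprime (a div r) d \<and> (\<forall>p. prime p \<longrightarrow> p dvd r \<longrightarrow> p dvd d)"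
    using smooth_part_exists d(2) by auto
  then obtain f where f: "\<And>a. a \<in> {1..M} \<Longrightarrow> f a > 0 \<and> f a dvd a \<and> coprime (a div f a) d \<and> (\<forall>p. prime p \<longrightarrow> p dvd f a \<longrightarrow> p dvd d)"
    by (metis bchoice)
  have fR: "f a dvd a \<and> f a \<in> R" if a: "a \<in> {1..M}" for a
  proof -
    have "f a \<le> a" using f[OF a] a by (intro dvd_imp_le) auto
    then have "f a \<in> {1..M}" using f[OF a] a by auto
    then show ?thesis using f[OF a] unfolding R_def by blast
  qed
  have "(\<Sum>a\<in>{1..M}. f a) \<le> M * card R" by (rule sum_divisor_choice_le[OF fR]) (auto simp: R_def)
  then have "real (\<Sum>a\<in>{1..M}. f a) \<le> real (M * card R)" by (simp only: of_nat_le_iff)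
  also have "\<dots> = real M * real (card R)" by simp
  also have "\<dots> \<le> real M * B" unfolding R_def using smoothB[OF d(2) dM] by (intro mult_left_mono) auto
  finally have sf: "(\<Sum>a\<in>{1..M}. real (f a)) \<le> x ^ 20 * B" by (simp add: Mx)
  have sa: "(\<Sum>a\<in>{1..M}. real a) \<le> x ^ 40"
  proof -
    have "(\<Sum>a\<in>{1..M}. real a) \<le> (\<Sum>a\<in>{1..M}. real M)" by (intro sum_mono) auto
    also have "\<dots> = x ^ 20 * x ^ 20" by (simp add: Mx)
    also have "\<dots> = x ^ 40" by (simp flip: power_add)
    finally show ?thesis .
  qed
  have "\<bar>(\<Sum>a\<in>{1..M}. real (card (hyperbola_pts (int a) q))) - (\<Sum>a\<in>{1..M}. mn a)\<bar> = \<bar>\<Sum>a\<in>{1..M}. real (card (hyperbola_pts (int a) q)) - mn a\<bar>"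
    by (simp only: sum_subtractf)
  also have "\<dots> \<le> (\<Sum>a\<in>{1..M}. \<bar>real (card (hyperbola_pts (int a) q)) - mn a\<bar>)" by (rule sum_abs)
  also have "\<dots> \<le> (\<Sum>a\<in>{1..M}. B ^ 4 * (48 * real a / x\<^sup>2 + 220 * x ^ 17 * real (f a)) / real d)"
  proof (rule sum_mono)
    fix a assume a: "a \<in> {1..M}"
    define m where "m = a div f a"
    have am: "a = m * f a" using f[OF a] by (simp add: m_def)
    then have m0: "m > 0" using a by (cases m) auto
    have "\<bar>real (card (hyperbola_pts (int (m * f a)) q)) - 4 * real (m * f a) * psi d (m * f a) * real (card (local_set q (int (m * f a)))) / (real d) ^ 4\<bar>
     \<le> B ^ 4 * (48 * real (m * f a) / x\<^sup>2 + 220 * x ^ 17 * real (f a)) / real d"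
      unfolding q_def
      by (rule hyperbola_pts_approx[OF x Mx B tauB harmB d m0]) (use f[OF a] a in \<open>auto simp flip: am simp: m_def[symmetric]\<close>)
    then show "\<bar>real (card (hyperbola_pts (int a) q)) - mn a\<bar> \<le> B ^ 4 * (48 * real a / x\<^sup>2 + 220 * x ^ 17 * real (f a)) / real d"
      unfolding am[symmetric] mn_def .
  qed
  also have "\<dots> = B ^ 4 * (48 * (\<Sum>a\<in>{1..M}. real a) / x\<^sup>2 + 220 * x ^ 17 * (\<Sum>a\<in>{1..M}. real (f a))) / real d"
    by (simp only: sum_divide_distrib[symmetric] sum_distrib_left[symmetric] sum.distrib)
  also have "\<dots> \<le> B ^ 4 * (48 * x ^ 40 / x\<^sup>2 + 220 * x ^ 17 * (x ^ 20 * B)) / real d"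
    using sf sa x B by (intro divide_right_mono mult_left_mono add_mono) auto
  also have "\<dots> \<le> B ^ 4 * (268 * x ^ 38 * B) / real d"
  proof (intro divide_right_mono mult_left_mono)
    have "x ^ (40 - 2) = x ^ 40 / x\<^sup>2" using x by (intro power_diff) auto
    then have "48 * x ^ 40 / x\<^sup>2 = 48 * x ^ (40 - 2)" by (simp only: times_divide_eq_right)
    also have "\<dots> = 48 * x ^ 38" by simp
    also have "\<dots> \<le> 48 * x ^ 38 * B" using mult_left_mono[OF B, of "48 * x ^ 38"] x by simp
    finally have 1: "48 * x ^ 40 / x\<^sup>2 \<le> 48 * x ^ 38 * B" .
    have "x ^ 37 \<le> x ^ 38" using x by (intro power_increasing) auto
    then have "x ^ 37 * B \<le> x ^ 38 * B" using B by (intro mult_right_mono) auto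
    moreover have "220 * x ^ 17 * (x ^ 20 * B) = 220 * (x ^ 37 * B)" by (simp flip: power_add mult.assoc)
    ultimately show "48 * x ^ 40 / x\<^sup>2 + 220 * x ^ 17 * (x ^ 20 * B) \<le> 268 * x ^ 38 * B" using 1 by linarith
  qed (use B in auto)
  also have "\<dots> = 268 * B ^ 5 * x ^ 38 / real d" by (simp add: eval_nat_numeral)
  finally have 1: "\<bar>(\<Sum>a\<in>{1..M}. real (card (hyperbola_pts (int a) q))) - (\<Sum>a\<in>{1..M}. mn a)\<bar> \<le> 268 * B ^ 5 * x ^ 38 / real d" .
  have 2: "\<bar>(\<Sum>a\<in>{1..M}. mn a) - 2 * (kap d * local_total d / (real d) ^ 6) * (real M)\<^sup>2\<bar> \<le> 48 * B ^ 5 * x ^ 20"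
    unfolding mn_def q_def by (rule sum_hyperbola_pts_main[OF d])
  have "48 * B ^ 5 * x ^ 20 = 48 * B ^ 5 * (x ^ 20 * real d / real d)" using d1 by simp
  also have "\<dots> \<le> 48 * B ^ 5 * (x ^ 38 / real d)"
  proof (intro mult_left_mono divide_right_mono)
    have "x ^ 20 * real d \<le> x ^ 20 * x ^ 2" using d x by (intro mult_left_mono) auto
    also have "\<dots> = x ^ 22" by (simp flip: power_add)
    also have "\<dots> \<le> x ^ 38" using x by (intro power_increasing) auto
    finally show "x ^ 20 * real d \<le> x ^ 38" .
  qed (use B in auto)
  finally have 3: "48 * B ^ 5 * x ^ 20 \<le> 48 * B ^ 5 * x ^ 38 / real d" by simp
  have 4: "316 * B ^ 5 * x ^ 38 / real d = 268 * B ^ 5 * x ^ 38 / real d + 48 * B ^ 5 * x ^ 38 / real d"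
    by (simp flip: add_divide_distrib)
  show ?thesis unfolding 4 using 1 2 3 unfolding q_def by linarith
qed

end

text \<open>Squares are 0 or 1 modulo 4, so four of them add up to a multiple of 4 only if all
  entries are even or all are odd, and then the determinant is even. This accounts for the value 0
  of \<open>beta_sq 2\<close>.\<close>

lemma sl2_box_even_empty:
  assumes "even d" shows "sl2_box M ((int d)\<^sup>2) = {}"
proof (rule ccontr)
  assume "sl2_box M ((int d)\<^sup>2) \<noteq> {}"
  then obtain z where "z \<in> sl2_box M ((int d)\<^sup>2)" by blast
  moreover obtain a b c e where "z = (a, b, c, e)" by (metis prod.exhaust)
  ultimately have h: "a * e - b * c = 1" "(int d)\<^sup>2 dvd a\<^sup>2 + b\<^sup>2 + c\<^sup>2 + e\<^sup>2" by (auto simp: sl2_box_def)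
  obtain k where "d = 2 * k" using assms by blast
  then have "4 dvd (int d)\<^sup>2" by (simp add: power_mult_distrib)
  then have "4 dvd a\<^sup>2 + b\<^sup>2 + c\<^sup>2 + e\<^sup>2" using h(2) by (rule dvd_trans)
  moreover have sq: "\<exists>y. (u::int)\<^sup>2 = 4 * y + (if even u then 0 else 1)" for u
  proof (cases "even u")
    case True
    then obtain w where "u = 2 * w" by blast
    then show ?thesis using True by (intro exI[of _ "w * w"]) (simp add: power2_eq_square)
  next
    case False
    then obtain w where "u = 2 * w + 1" by (rule oddE)
    then show ?thesis using False by (intro exI[of _ "w * w + w"]) (simp add: power2_eq_square algebra_simps)
  qed
  obtain y1 y2 y3 y4 where "a\<^sup>2 = 4 * y1 + (if even a then 0 else 1)" "b\<^sup>2 = 4 * y2 + (if even b then 0 else 1)"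
    "c\<^sup>2 = 4 * y3 + (if even c then 0 else 1)" "e\<^sup>2 = 4 * y4 + (if even e then 0 else 1)"
    using sq by meson
  moreover have "odd (a * e - b * c)" using h(1) by simp
  then have "\<not> (even a \<and> even b \<and> even c \<and> even e)" "\<not> (odd a \<and> odd b \<and> odd c \<and> odd e)" by auto
  ultimately show False by (simp split: if_splits; presburger)
qed

context divisor_bounds begin

text \<open>For odd \<open>d\<close> the factor 16 is 8, from the position and sign of the largest
  entry, times 2 from the sum over \<open>a\<close>; the constant 3600 exceeds
  \<open>8 * 316 + 1024\<close>. For even \<open>d\<close> both the count and
  \<open>beta_d d\<close> are zero.\<close>

lemma card_sl2_box_approx:
  assumes d: "squarefree d" "d > 0" "real d \<le> x\<^sup>2"
  shows "\<bar>real (card (sl2_box M ((int d)\<^sup>2))) - 16 * kap 1 * beta_d d * (real M)\<^sup>2\<bar> \<le> 3600 * B ^ 5 * x ^ 38 / real d"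
proof (cases "even d")
  case True
  then have "2 \<in> prime_factors d" using d by (simp add: prime_factors_dvd)
  moreover have "beta_sq 2 = 0" by (simp add: beta_sq_def)
  ultimately have "beta_d d = 0" unfolding beta_d_def by (subst prod_zero_iff) auto
  then show ?thesis using B x by (simp add: sl2_box_even_empty[OF True])
next
  case False
  have d1: "real d \<ge> 1" using d by simp
  have B5: "B \<le> B ^ 5" using B by (metis power_increasing one_le_numeral power_one_right)
  have G: "\<bar>real (card (sl2_box M ((int d)\<^sup>2))) - 8 * (\<Sum>a\<in>{1..M}. real (card (hyperbola_pts (int a) ((int d)\<^sup>2))))\<bar> \<le> 1000 + 24 * real M * B"
    by (rule sl2_box_decomposition[OF M_ge_1 tauB]) auto
  have Z: "\<bar>(\<Sum>a\<in>{1..M}. real (card (hyperbola_pts (int a) ((int d)\<^sup>2)))) - 2 * (kap 1 * beta_d d) * (real M)\<^sup>2\<bar> \<le> 316 * B ^ 5 * x ^ 38 / real d"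
    using sum_hyperbola_pts_approx[OF False d(2,3)] unfolding kap_local_total[OF d(1) False] .
  have "1000 + 24 * real M * B \<le> 1024 * (x ^ 20 * B)"
  proof -
    have "1 * 1 \<le> x ^ 20 * B" using x B by (intro mult_mono) auto
    then show ?thesis by (simp add: Mx mult.commute mult.left_commute)
  qed
  also have "\<dots> = 1024 * ((x ^ 20 * real d) * B / real d)" using d1 by simp
  also have "\<dots> \<le> 1024 * (x ^ 38 * B ^ 5 / real d)"
  proof (intro mult_left_mono divide_right_mono mult_mono B5)
    have "x ^ 20 * real d \<le> x ^ 20 * x ^ 2" using d x by (intro mult_left_mono) auto
    also have "\<dots> = x ^ 22" by (simp flip: power_add)
    also have "\<dots> \<le> x ^ 38" using x by (intro power_increasing) auto
    finally show "x ^ 20 * real d \<le> x ^ 38" .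
  qed (use B x in auto)
  finally have E: "1000 + 24 * real M * B \<le> 1024 * (x ^ 38 * B ^ 5 / real d)" .
  define w where "w = x ^ 38 * B ^ 5 / real d"
  have w: "316 * B ^ 5 * x ^ 38 / real d = 316 * w" "3600 * B ^ 5 * x ^ 38 / real d = 3600 * w" "w \<ge> 0"
    using B x by (simp_all add: w_def)
  show ?thesis using G Z E w(3) unfolding w(1,2) unfolding w_def[symmetric] by (simp only: mult.assoc abs_le_iff) linarith
qed

end

section \<open>The singular series\<close>

lemma beta_sq_bounds:
  assumes p: "prime p" shows "0 \<le> beta_sq p" "beta_sq p \<le> 2 / (real p)\<^sup>2"
proof -
  have "0 \<le> beta_sq p \<and> beta_sq p \<le> 2 / (real p)\<^sup>2"
  proof (cases "p = 2")
    case True then show ?thesis by (simp add: beta_sq_def)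
  next
    case False
    define y where "y = real p"
    define l where "l = real_of_int (Legendre (-1) (int p))"
    have "p \<ge> 3" using False prime_ge_2_nat[OF p] by linarith
    then have y: "y \<ge> 3" by (simp add: y_def)
    have "\<bar>l\<bar> \<le> 1" by (simp add: l_def Legendre_def)
    then have "\<bar>y * l\<bar> \<le> y * 1" unfolding abs_mult using y by (intro mult_mono) auto
    then have yl: "y * l \<le> y" "- y \<le> y * l" by auto
    have "3 * y \<le> y * y" using y by (intro mult_right_mono) auto
    then have yy: "3 * y \<le> y\<^sup>2" by (simp add: power2_eq_square)
    have pos: "y\<^sup>2 > 0" "y\<^sup>2 - 1 > 0" using y yy by linarith+
    have num: "0 \<le> y\<^sup>2 + 1 - 2 * (y * l)" using yl yy y by linarith
    have num2: "y\<^sup>2 + 1 - 2 * (y * l) \<le> 2 * (y\<^sup>2 - 1)" using yl yy y unfolding right_diff_distrib by linarith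
    have b: "beta_sq p = (y\<^sup>2 + 1 - 2 * (y * l)) / (y\<^sup>2 - 1) / y\<^sup>2"
      using False by (simp add: beta_sq_def y_def l_def mult_ac)
    have "(y\<^sup>2 + 1 - 2 * (y * l)) / (y\<^sup>2 - 1) \<le> 2" using num2 pos by (simp only: divide_le_eq) simp
    then have "beta_sq p \<le> 2 / y\<^sup>2" unfolding b using pos by (intro divide_right_mono) auto
    moreover have "0 \<le> beta_sq p" unfolding b using num pos by simp
    ultimately show ?thesis by (simp add: y_def)
  qed
  then show "0 \<le> beta_sq p" "beta_sq p \<le> 2 / (real p)\<^sup>2" by auto
qed

lemma two_power_card_prime_factors_le:
  assumes "d > 0" shows "2 ^ card (prime_factors d) \<le> ntau d"
proof -
  have "2 ^ card (prime_factors d) = card {e. e dvd d \<and> squarefree e}"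
    using bij_betw_same_card[OF squarefree_divisors_bij[OF assms]] by (simp add: card_Pow)
  also have "\<dots> \<le> card {e. e dvd d}" using assms by (intro card_mono) auto
  finally show ?thesis by (simp add: ntau_def)
qed

text \<open>Each prime contributes \<open>beta_sq p \<le> 2 / p\<^sup>2\<close>, and 2 to the number
  of prime factors is at most the number of divisors.\<close>

lemma abs_mu_beta_d_le: "\<bar>mu d * beta_d d\<bar> \<le> real (ntau d) / (real d)\<^sup>2"
proof (cases "squarefree d")
  case False then show ?thesis by (simp add: mu_def)
next
  case True
  let ?P = "prime_factors d"
  have d0: "d > 0" using True by (cases d) auto
  have pr: "prime p" if "p \<in> ?P" for p using that by auto
  have b0: "0 \<le> beta_d d" unfolding beta_d_def using beta_sq_bounds(1) pr by (intro prod_nonneg) auto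
  have "beta_d d \<le> (\<Prod>p\<in>?P. 2 / (real p)\<^sup>2)"
    unfolding beta_d_def using beta_sq_bounds pr by (intro prod_mono) auto
  also have "\<dots> = 2 ^ card ?P / (\<Prod>p\<in>?P. (real p)\<^sup>2)" by (simp add: prod_dividef)
  also have "(\<Prod>p\<in>?P. (real p)\<^sup>2) = (\<Prod>p\<in>?P. real p)\<^sup>2" by (rule prod_power_distrib[symmetric])
  also have "(\<Prod>p\<in>?P. real p) = real d"
  proof -
    have "(\<Prod>p\<in>?P. real p) = real (\<Prod>?P)" by simp
    then show ?thesis using squarefree_eq_prod_prime_factors[OF True] by metis
  qed
  also have "2 ^ card ?P / (real d)\<^sup>2 \<le> real (ntau d) / (real d)\<^sup>2"
  proof (rule divide_right_mono)
    have "real (2 ^ card ?P) \<le> real (ntau d)"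
      using two_power_card_prime_factors_le[OF d0] by (simp only: of_nat_le_iff)
    then show "2 ^ card ?P \<le> real (ntau d)" by simp
  qed simp
  finally have b1: "beta_d d \<le> real (ntau d) / (real d)\<^sup>2" .
  have "\<bar>mu d * beta_d d\<bar> = \<bar>mu d\<bar> * beta_d d" using b0 by (simp add: abs_mult)
  also have "\<dots> \<le> 1 * beta_d d" using abs_mu_le_1 b0 by (intro mult_right_mono) auto
  finally show ?thesis using b1 by linarith
qed

text \<open>By the mean value theorem each term is at most twice the decrement of
  \<open>y powr (\<delta> - 1)\<close> over a unit interval, the 2 majorizing
  \<open>1 / (1 - \<delta>)\<close>; the decrements telescope.\<close>

lemma sum_powr_tail:
  fixes \<delta> :: real
  assumes \<delta>: "0 < \<delta>" "\<delta> \<le> 1 / 2" and D: "D \<ge> 1"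
  shows "(\<Sum>d\<in>{Suc D..N}. real d powr (\<delta> - 2)) \<le> 2 * real D powr (\<delta> - 1)"
proof -
  have "(\<Sum>d\<in>{Suc D..N}. real d powr (\<delta> - 2)) \<le> 2 * (real D powr (\<delta> - 1) - real N powr (\<delta> - 1))" if "N \<ge> D" for N
    using that
  proof (induction N rule: dec_induct)
    case (step N)
    have N: "real N > 0" using step(1) D by simp
    have "\<exists>z>real N. z < real (Suc N) \<and> real (Suc N) powr (\<delta> - 1) - real N powr (\<delta> - 1) = (real (Suc N) - real N) * ((\<delta> - 1) * z powr (\<delta> - 1 - 1))"
    proof (rule MVT2)
      fix y assume "real N \<le> y"
      then have "y > 0" using N by linarith
      then show "((\<lambda>y. y powr (\<delta> - 1)) has_real_derivative (\<delta> - 1) * y powr (\<delta> - 1 - 1)) (at y)"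
        by (rule has_real_derivative_powr)
    qed simp
    then obtain z where z: "z > real N" "z < real (Suc N)"
      "real (Suc N) powr (\<delta> - 1) - real N powr (\<delta> - 1) = (real (Suc N) - real N) * ((\<delta> - 1) * z powr (\<delta> - 1 - 1))" by blast
    have "real (Suc N) powr (\<delta> - 2) \<le> z powr (\<delta> - 2)" using z N \<delta> by (intro powr_mono2') auto
    also have "\<dots> \<le> 2 * ((1 - \<delta>) * z powr (\<delta> - 2))"
    proof -
      have "1 * z powr (\<delta> - 2) \<le> (2 * (1 - \<delta>)) * z powr (\<delta> - 2)" using \<delta> by (intro mult_right_mono) auto
      then show ?thesis by (simp only: mult_1 mult.assoc)
    qed
    also have "\<dots> = 2 * (real N powr (\<delta> - 1) - real (Suc N) powr (\<delta> - 1))"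
    proof -
      have "real (Suc N) powr (\<delta> - 1) - real N powr (\<delta> - 1) = (\<delta> - 1) * z powr (\<delta> - 2)" using z(3) by simp
      then show ?thesis by (simp add: algebra_simps)
    qed
    finally show ?case using step by (simp add: sum.cl_ivl_Suc)
  qed simp
  note A = this
  show ?thesis
  proof (cases "N \<ge> D")
    case True
    have "0 \<le> real N powr (\<delta> - 1)" by simp
    then have "2 * (real D powr (\<delta> - 1) - real N powr (\<delta> - 1)) \<le> 2 * real D powr (\<delta> - 1)" by simp
    with A[OF True] show ?thesis by (rule order_trans)
  qed simp
qed

text \<open>The product over primes up to \<open>N\<close> is the finite sum of
  \<open>mu e * beta_d e\<close> over the divisors \<open>e\<close> of \<open>W\<close>, the product
  of these primes. Once \<open>N \<ge> D\<close> it contains every squarefree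
  \<open>e \<le> D\<close>, and the other divisors contribute a tail bounded independently of
  \<open>N\<close>; the estimate passes to the limit.\<close>

lemma sing_series_approx:
  fixes \<delta> C :: real
  assumes \<delta>: "0 < \<delta>" "\<delta> \<le> 1 / 2" and D: "D \<ge> 1" and C: "C \<ge> 1"
    and tau: "\<And>n. n > 0 \<Longrightarrow> real (ntau n) \<le> C * real n powr \<delta>"
  shows "\<bar>sing_series_sq - (\<Sum>d\<in>{1..D}. mu d * beta_d d)\<bar> \<le> 2 * C * real D powr (\<delta> - 1)"
proof -
  define P where "P N = (\<Prod>p\<le>N. if prime p then 1 - beta_sq p else 1)" for N
  define F where "F = (\<Sum>d\<in>{1..D}. mu d * beta_d d)"
  have lim: "P \<longlonglongrightarrow> sing_series_sq"
    unfolding P_def using has_prod_sing_series_sq by (rule has_prod_imp_tendsto)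
  have bound: "\<bar>mu d * beta_d d\<bar> \<le> C * real d powr (\<delta> - 2)" if "d > 0" for d
  proof -
    have "\<bar>mu d * beta_d d\<bar> \<le> real (ntau d) / (real d)\<^sup>2" by (rule abs_mu_beta_d_le)
    also have "\<dots> \<le> C * real d powr \<delta> / (real d)\<^sup>2" using tau[OF that] by (rule divide_right_mono) simp
    also have "\<dots> = C * real d powr (\<delta> - 2)" using that by (simp add: powr_diff)
    finally show ?thesis .
  qed
  have "\<bar>P N - F\<bar> \<le> 2 * C * real D powr (\<delta> - 1)" if N: "N \<ge> D" for N
  proof -
    define A where "A = {p. p \<le> N \<and> prime p}"
    define W where "W = \<Prod>A"
    have A: "finite A" "\<And>p. p \<in> A \<Longrightarrow> prime p" unfolding A_def by auto
    have W0: "W > 0" unfolding W_def using A(2) by (intro prod_pos) (auto simp: prime_gt_0_nat)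
    have pW: "prime_factors W = A" unfolding W_def by (rule prime_factors_prod_primes[OF A])
    have "P N = (\<Prod>p\<in>{p \<in> {..N}. prime p}. 1 - beta_sq p)" unfolding P_def by (rule prod.inter_filter[symmetric]) simp
    also have "{p \<in> {..N}. prime p} = prime_factors W" unfolding pW A_def by auto
    also have "(\<Prod>p\<in>prime_factors W. 1 - beta_sq p) = (\<Sum>e | e dvd W. mu e * beta_d e)"
      unfolding beta_d_def by (rule sum_mu_divisors[OF W0, symmetric])
    finally have PN: "P N = (\<Sum>e | e dvd W. mu e * beta_d e)" .
    have finW: "finite {e. e dvd W}" using W0 by simp
    have WW: "W \<ge> e" if "e dvd W" for e using that W0 by (rule dvd_imp_le)
    have split: "(\<Sum>e | e dvd W. mu e * beta_d e) = (\<Sum>e | e dvd W \<and> e \<le> D. mu e * beta_d e) + (\<Sum>e | e dvd W \<and> D < e. mu e * beta_d e)"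
      using finW by (subst sum.union_disjoint[symmetric]) (auto intro!: sum.cong)
    have "(\<Sum>e | e dvd W \<and> e \<le> D. mu e * beta_d e) = F"
      unfolding F_def
    proof (rule sum.mono_neutral_left)
      show "{e. e dvd W \<and> e \<le> D} \<subseteq> {1..D}" using W0 by (auto simp: Suc_le_eq intro: Nat.gr0I)
      show "\<forall>i\<in>{1..D} - {e. e dvd W \<and> e \<le> D}. mu i * beta_d i = 0"
      proof
        fix i assume i: "i \<in> {1..D} - {e. e dvd W \<and> e \<le> D}"
        have "\<not> squarefree i"
        proof
          assume sq: "squarefree i"
          have "prime_factors i \<subseteq> A"
          proof
            fix p assume p: "p \<in> prime_factors i"
            then have "p dvd i" "prime p" by auto
            then have "p \<le> i" using i by (intro dvd_imp_le) auto
            then show "p \<in> A" using \<open>prime p\<close> i N by (auto simp: A_def)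
          qed
          then have "\<Prod>(prime_factors i) dvd W" unfolding W_def by (intro prod_dvd_prod_subset A(1))
          then have "i dvd W" using squarefree_eq_prod_prime_factors[OF sq] by metis
          then show False using i by simp
        qed
        then show "mu i * beta_d i = 0" by (simp add: mu_def)
      qed
    qed simp
    then have "\<bar>P N - F\<bar> = \<bar>\<Sum>e | e dvd W \<and> D < e. mu e * beta_d e\<bar>" using PN split by simp
    also have "\<dots> \<le> (\<Sum>e | e dvd W \<and> D < e. \<bar>mu e * beta_d e\<bar>)" by (rule sum_abs)
    also have "\<dots> \<le> (\<Sum>e | e dvd W \<and> D < e. C * real e powr (\<delta> - 2))" using bound by (intro sum_mono) auto
    also have "\<dots> \<le> (\<Sum>e\<in>{Suc D..W}. C * real e powr (\<delta> - 2))"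
      using WW C by (intro sum_mono2) auto
    also have "\<dots> = C * (\<Sum>e\<in>{Suc D..W}. real e powr (\<delta> - 2))" by (simp only: sum_distrib_left)
    also have "\<dots> \<le> C * (2 * real D powr (\<delta> - 1))" using C by (intro mult_left_mono sum_powr_tail[OF \<delta> D]) auto
    finally show ?thesis by simp
  qed
  then have ev: "\<forall>\<^sub>F N in sequentially. \<bar>P N - F\<bar> \<le> 2 * C * real D powr (\<delta> - 1)" by (rule eventually_sequentiallyI)
  have "(\<lambda>N. \<bar>P N - F\<bar>) \<longlonglongrightarrow> \<bar>sing_series_sq - F\<bar>" by (intro tendsto_intros lim)
  then show ?thesis using ev unfolding F_def[symmetric] by (rule tendsto_upperbound) simp
qed

section \<open>Squarefree values by Moebius inversion\<close>

definition sqfree_box :: "nat \<Rightarrow> (int \<times> int \<times> int \<times> int) set" where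
  "sqfree_box M = {(a, b, c, e) \<in> sl2_box M 1. squarefree (a\<^sup>2 + b\<^sup>2 + c\<^sup>2 + e\<^sup>2)}"

lemma squarefree_nat_iff:
  assumes "n > (0::int)" shows "squarefree (nat n) \<longleftrightarrow> squarefree n"
proof
  assume s: "squarefree (nat n)"
  show "squarefree n"
  proof (rule squarefreeI)
    fix y assume "y\<^sup>2 dvd n"
    then have "int ((nat \<bar>y\<bar>)\<^sup>2) dvd int (nat n)" using assms by simp
    then have "(nat \<bar>y\<bar>)\<^sup>2 dvd nat n" by (simp only: int_dvd_int_iff)
    then have "nat \<bar>y\<bar> dvd 1" using s by (rule squarefreeD[rotated])
    then show "is_unit y" by simp
  qed
next
  assume s: "squarefree n"
  show "squarefree (nat n)"
  proof (rule squarefreeI)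
    fix y assume "y\<^sup>2 dvd nat n"
    then have "int (y\<^sup>2) dvd int (nat n)" by (simp only: int_dvd_int_iff)
    then have "(int y)\<^sup>2 dvd n" using assms by simp
    then have "int y dvd 1" using s by (rule squarefreeD[rotated])
    then show "is_unit y" by simp
  qed
qed

text \<open>The form is positive and at most \<open>4 * M\<^sup>2\<close> on the box, so only
  \<open>d \<le> 2 * M\<close> can have a square dividing it.\<close>

lemma card_sqfree_box:
  "real (card (sqfree_box M)) = (\<Sum>d\<in>{1..2 * M}. mu d * real (card (sl2_box M ((int d)\<^sup>2))))"
proof -
  define R where "R = (\<lambda>(a::int, b::int, c::int, e::int). a\<^sup>2 + b\<^sup>2 + c\<^sup>2 + e\<^sup>2)"
  let ?G = "sl2_box M 1"
  have mem: "R z > 0" "R z \<le> (int (2 * M))\<^sup>2" if "z \<in> ?G" for z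
  proof -
    obtain a b c e where zz: "z = (a, b, c, e)" by (metis prod.exhaust)
    have h: "\<bar>a\<bar> \<le> int M" "\<bar>b\<bar> \<le> int M" "\<bar>c\<bar> \<le> int M" "\<bar>e\<bar> \<le> int M" "a * e - b * c = 1"
      using that by (auto simp: zz sl2_box_def)
    have sq: "u\<^sup>2 \<le> (int M)\<^sup>2" if "\<bar>u\<bar> \<le> int M" for u using that by (metis abs_le_square_iff abs_of_nat)
    have "(int (2 * M))\<^sup>2 = 4 * (int M)\<^sup>2" by (simp add: power_mult_distrib)
    then show "R z \<le> (int (2 * M))\<^sup>2" using sq[OF h(1)] sq[OF h(2)] sq[OF h(3)] sq[OF h(4)] by (simp add: R_def zz)
    have "a \<noteq> 0 \<or> b \<noteq> 0" using h(5) by auto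
    then have "0 < a\<^sup>2 + b\<^sup>2" by (simp add: sum_power2_gt_zero_iff)
    moreover have "0 \<le> c\<^sup>2" "0 \<le> e\<^sup>2" by simp_all
    ultimately have "0 < a\<^sup>2 + b\<^sup>2 + c\<^sup>2 + e\<^sup>2" by linarith
    then show "R z > 0" by (simp add: R_def zz)
  qed
  have key: "(\<Sum>d\<in>{1..2 * M}. if (int d)\<^sup>2 dvd R z then mu d else 0) = (if squarefree (R z) then 1 else 0)" if z: "z \<in> ?G" for z
  proof -
    define n where "n = nat (R z)"
    have n0: "n > 0" and Rn: "R z = int n" using mem(1)[OF z] by (simp_all add: n_def)
    have dv: "(int d)\<^sup>2 dvd R z \<longleftrightarrow> d\<^sup>2 dvd n" for d
    proof -
      have "(int d)\<^sup>2 dvd R z \<longleftrightarrow> int (d\<^sup>2) dvd int n" by (simp add: Rn)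
      then show ?thesis by (simp only: int_dvd_int_iff)
    qed
    have "{d. d\<^sup>2 dvd n} = {d \<in> {1..2 * M}. d\<^sup>2 dvd n}"
    proof (intro equalityI subsetI)
      fix d assume d: "d \<in> {d. d\<^sup>2 dvd n}"
      then have "d\<^sup>2 \<le> n" using n0 by (auto intro: dvd_imp_le)
      moreover have "int n \<le> int ((2 * M)\<^sup>2)" using mem(2)[OF z] Rn by simp
      then have "n \<le> (2 * M)\<^sup>2" by (simp only: of_nat_le_iff)
      ultimately have "d\<^sup>2 \<le> (2 * M)\<^sup>2" by linarith
      then have "d \<le> 2 * M" by (simp only: power2_nat_le_eq_le)
      moreover have "d \<noteq> 0" using d n0 by (intro notI) simp
      ultimately show "d \<in> {d \<in> {1..2 * M}. d\<^sup>2 dvd n}" using d by simp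
    qed simp
    then have "(\<Sum>d\<in>{1..2 * M}. if d\<^sup>2 dvd n then mu d else 0) = (\<Sum>d | d\<^sup>2 dvd n. mu d)"
      using sum.inter_filter[of "{1..2 * M}" mu "\<lambda>d. d\<^sup>2 dvd n"] by simp
    also have "\<dots> = (if squarefree n then 1 else 0)" by (rule sum_mu_square_divisors[OF n0])
    also have "squarefree n \<longleftrightarrow> squarefree (R z)" unfolding n_def by (rule squarefree_nat_iff[OF mem(1)[OF z]])
    finally show ?thesis by (simp only: dv)
  qed
  have "sqfree_box M = {z \<in> ?G. squarefree (R z)}" by (auto simp: sqfree_box_def R_def)
  then have "real (card (sqfree_box M)) = (\<Sum>z\<in>{z \<in> ?G. squarefree (R z)}. 1)" by simp
  also have "\<dots> = (\<Sum>z\<in>?G. if squarefree (R z) then 1 else 0)" by (rule sum.inter_filter) simp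
  also have "\<dots> = (\<Sum>z\<in>?G. \<Sum>d\<in>{1..2 * M}. if (int d)\<^sup>2 dvd R z then mu d else 0)"
    by (rule sum.cong[OF refl]) (rule key[symmetric])
  also have "\<dots> = (\<Sum>d\<in>{1..2 * M}. \<Sum>z\<in>?G. if (int d)\<^sup>2 dvd R z then mu d else 0)" by (rule sum.swap)
  also have "\<dots> = (\<Sum>d\<in>{1..2 * M}. mu d * real (card (sl2_box M ((int d)\<^sup>2))))"
  proof (rule sum.cong[OF refl])
    fix d
    have "sl2_box M ((int d)\<^sup>2) = {z \<in> ?G. (int d)\<^sup>2 dvd R z}" by (auto simp: sl2_box_def R_def)
    then have "mu d * real (card (sl2_box M ((int d)\<^sup>2))) = (\<Sum>z\<in>{z \<in> ?G. (int d)\<^sup>2 dvd R z}. mu d)" by simp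
    also have "\<dots> = (\<Sum>z\<in>?G. if (int d)\<^sup>2 dvd R z then mu d else 0)" by (rule sum.inter_filter) simp
    finally show "(\<Sum>z\<in>?G. if (int d)\<^sup>2 dvd R z then mu d else 0) = mu d * real (card (sl2_box M ((int d)\<^sup>2)))" ..
  qed
  finally show ?thesis .
qed

context divisor_bounds begin

definition cutoff :: nat where "cutoff = nat \<lfloor>x\<^sup>2\<rfloor>"

lemma cutoff: "cutoff \<ge> 1" "real cutoff \<le> x\<^sup>2" "x\<^sup>2 \<le> 2 * real cutoff" "cutoff \<le> M"
proof -
  have x2: "1 \<le> x\<^sup>2" using x by (rule one_le_power)
  then have f1: "1 \<le> \<lfloor>x\<^sup>2\<rfloor>" by (simp only: one_le_floor)
  then have c: "real cutoff = of_int \<lfloor>x\<^sup>2\<rfloor>" by (simp add: cutoff_def)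
  show "cutoff \<ge> 1" using f1 unfolding cutoff_def by linarith
  then have c1: "real cutoff \<ge> 1" by simp
  show le: "real cutoff \<le> x\<^sup>2" unfolding c by (rule of_int_floor_le)
  have "x\<^sup>2 < real cutoff + 1" unfolding c by (rule floor_correct[THEN conjunct2, simplified])
  then show "x\<^sup>2 \<le> 2 * real cutoff" using c1 by linarith
  have "cutoff \<le> cutoff\<^sup>2" by (simp add: power2_eq_square)
  then show "cutoff \<le> M" using le_M_of_le_square[OF le] by linarith
qed

lemma card_sl2_box_tail:
  assumes d: "d \<ge> 2"
  shows "real (card (sl2_box M ((int d)\<^sup>2))) \<le> 256 * B ^ 4 * x ^ 40 * inverse ((real d)\<^sup>2)"
proof -
  have r: "real (r2 n) \<le> 8 * B\<^sup>2" if n: "n > 0" "n \<le> 8 * (int M)\<^sup>2" for n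
  proof -
    have "real (r2 n) \<le> real (8 * (tau n)\<^sup>2)" using r2_le[OF n(1)] by (simp only: of_nat_le_iff)
    also have "\<dots> = 8 * (real (tau n))\<^sup>2" by simp
    also have "\<dots> \<le> 8 * B\<^sup>2" using n by (intro mult_left_mono power_mono tauB) auto
    finally show ?thesis .
  qed
  have "real (card (sl2_box M ((int d)\<^sup>2))) \<le> 4 * (real M)\<^sup>2 / (real d)\<^sup>2 * (8 * B\<^sup>2)\<^sup>2"
    by (rule card_sl2_box_le[OF M_ge_1 d r])
  also have "\<dots> = 256 * B ^ 4 * x ^ 40 * inverse ((real d)\<^sup>2)"
    by (simp add: Mx divide_inverse power_mult_distrib flip: power_mult)
  finally show ?thesis .
qed

text \<open>Up to \<open>cutoff\<close> the errors proportional to \<open>1 / d\<close> sum to a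
  harmonic number, which is the sixth factor \<open>B\<close>. Beyond it the bounds proportional to
  \<open>1 / d\<^sup>2\<close> leave \<open>x^40 / cutoff\<close>, of order \<open>x^38\<close>
  because \<open>cutoff\<close> is about \<open>x\<^sup>2\<close>. The constant 4200 exceeds 3600 +
  512.\<close>

lemma card_sqfree_box_approx:
  "\<bar>real (card (sqfree_box M)) - 16 * kap 1 * (\<Sum>d\<in>{1..cutoff}. mu d * beta_d d) * (real M)\<^sup>2\<bar> \<le> 4200 * B ^ 6 * x ^ 38"
proof -
  let ?D = cutoff
  define g where "g d = mu d * real (card (sl2_box M ((int d)\<^sup>2)))" for d
  define k where "k = 16 * kap 1 * (real M)\<^sup>2"
  have "real (card (sqfree_box M)) = (\<Sum>d\<in>{1..2 * M}. g d)" unfolding g_def by (rule card_sqfree_box)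
  also have "{1..2 * M} = {1..?D} \<union> {Suc ?D..2 * M}" using cutoff(1,4) by auto
  also have "(\<Sum>d\<in>{1..?D} \<union> {Suc ?D..2 * M}. g d) = (\<Sum>d\<in>{1..?D}. g d) + (\<Sum>d\<in>{Suc ?D..2 * M}. g d)"
    by (rule sum.union_disjoint) auto
  finally have S: "real (card (sqfree_box M)) = (\<Sum>d\<in>{1..?D}. g d) + (\<Sum>d\<in>{Suc ?D..2 * M}. g d)" .
  have "\<bar>\<Sum>d\<in>{Suc ?D..2 * M}. g d\<bar> \<le> (\<Sum>d\<in>{Suc ?D..2 * M}. \<bar>g d\<bar>)" by (rule sum_abs)
  also have "\<dots> \<le> (\<Sum>d\<in>{Suc ?D..2 * M}. 256 * B ^ 4 * x ^ 40 * inverse ((real d)\<^sup>2))"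
  proof (rule sum_mono)
    fix d assume d: "d \<in> {Suc ?D..2 * M}"
    then have "d \<ge> 2" using cutoff(1) by simp
    have "\<bar>g d\<bar> = \<bar>mu d\<bar> * real (card (sl2_box M ((int d)\<^sup>2)))" by (simp add: g_def abs_mult)
    also have "\<dots> \<le> 1 * real (card (sl2_box M ((int d)\<^sup>2)))" using abs_mu_le_1 by (intro mult_right_mono) auto
    finally show "\<bar>g d\<bar> \<le> 256 * B ^ 4 * x ^ 40 * inverse ((real d)\<^sup>2)"
      using card_sl2_box_tail[OF \<open>d \<ge> 2\<close>] by simp
  qed
  also have "\<dots> = 256 * B ^ 4 * x ^ 40 * (\<Sum>d\<in>{Suc ?D..2 * M}. inverse ((real d)\<^sup>2))" by (simp only: sum_distrib_left)
  also have "\<dots> \<le> 256 * B ^ 4 * x ^ 40 * (2 / x\<^sup>2)"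
  proof (rule mult_left_mono)
    have "(\<Sum>d\<in>{Suc ?D..2 * M}. inverse ((real d)\<^sup>2)) \<le> 1 / real ?D" by (rule sum_inverse_squares_tail[OF cutoff(1)])
    also have "\<dots> \<le> 2 / x\<^sup>2" using cutoff(1,3) x by (simp add: field_simps)
    finally show "(\<Sum>d\<in>{Suc ?D..2 * M}. inverse ((real d)\<^sup>2)) \<le> 2 / x\<^sup>2" .
  qed (use B x in auto)
  also have "\<dots> = 512 * B ^ 4 * (x ^ 40 / x ^ 2)" by simp
  also have "x ^ 40 / x ^ 2 = x ^ (40 - 2)" using x by (intro power_diff[symmetric]) auto
  also have "512 * B ^ 4 * x ^ (40 - 2) = 512 * (B ^ 4 * x ^ 38)" by simp
  also have "\<dots> \<le> 512 * (B ^ 6 * x ^ 38)"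
    using B x by (intro mult_left_mono mult_right_mono power_increasing) auto
  finally have tail: "\<bar>\<Sum>d\<in>{Suc ?D..2 * M}. g d\<bar> \<le> 512 * (B ^ 6 * x ^ 38)" .
  have "\<bar>(\<Sum>d\<in>{1..?D}. g d) - (\<Sum>d\<in>{1..?D}. k * (mu d * beta_d d))\<bar> = \<bar>\<Sum>d\<in>{1..?D}. g d - k * (mu d * beta_d d)\<bar>"
    by (simp only: sum_subtractf)
  also have "\<dots> \<le> (\<Sum>d\<in>{1..?D}. \<bar>g d - k * (mu d * beta_d d)\<bar>)" by (rule sum_abs)
  also have "\<dots> \<le> (\<Sum>d\<in>{1..?D}. 3600 * B ^ 5 * x ^ 38 * (1 / real d))"
  proof (rule sum_mono)
    fix d assume d: "d \<in> {1..?D}"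
    show "\<bar>g d - k * (mu d * beta_d d)\<bar> \<le> 3600 * B ^ 5 * x ^ 38 * (1 / real d)"
    proof (cases "squarefree d")
      case False then show ?thesis using B x by (simp add: g_def mu_def)
    next
      case True
      have "real d \<le> real ?D" using d by simp
      then have "real d \<le> x\<^sup>2" using cutoff(2) by linarith
      then have a: "\<bar>real (card (sl2_box M ((int d)\<^sup>2))) - 16 * kap 1 * beta_d d * (real M)\<^sup>2\<bar> \<le> 3600 * B ^ 5 * x ^ 38 / real d"
        using True d by (intro card_sl2_box_approx) auto
      have "g d - k * (mu d * beta_d d) = mu d * (real (card (sl2_box M ((int d)\<^sup>2))) - 16 * kap 1 * beta_d d * (real M)\<^sup>2)"
        by (simp add: g_def k_def algebra_simps)
      then have "\<bar>g d - k * (mu d * beta_d d)\<bar> = \<bar>mu d\<bar> * \<bar>real (card (sl2_box M ((int d)\<^sup>2))) - 16 * kap 1 * beta_d d * (real M)\<^sup>2\<bar>"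
        by (simp only: abs_mult)
      also have "\<dots> \<le> 1 * (3600 * B ^ 5 * x ^ 38 / real d)" using abs_mu_le_1 a by (intro mult_mono) auto
      finally show ?thesis by simp
    qed
  qed
  also have "\<dots> = 3600 * B ^ 5 * x ^ 38 * harm_int (int ?D)" by (simp add: harm_int_def sum_distrib_left)
  also have "\<dots> \<le> 3600 * B ^ 5 * x ^ 38 * B" using harmB[OF cutoff(4)] B x by (intro mult_left_mono) auto
  also have "\<dots> = 3600 * (B ^ 6 * x ^ 38)" by (simp add: eval_nat_numeral)
  finally have main: "\<bar>(\<Sum>d\<in>{1..?D}. g d) - (\<Sum>d\<in>{1..?D}. k * (mu d * beta_d d))\<bar> \<le> 3600 * (B ^ 6 * x ^ 38)" .
  have kk: "(\<Sum>d\<in>{1..?D}. k * (mu d * beta_d d)) = 16 * kap 1 * (\<Sum>d\<in>{1..?D}. mu d * beta_d d) * (real M)\<^sup>2"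
    by (simp add: k_def sum_distrib_left sum_distrib_right mult_ac)
  have w: "0 \<le> B ^ 6 * x ^ 38" using B x by simp
  have gen: "\<bar>u + v - z\<bar> \<le> 4200 * w" if "\<bar>v\<bar> \<le> 512 * w" "\<bar>u - z\<bar> \<le> 3600 * w" "0 \<le> w" for u v z w :: real
    using that by linarith
  have "\<bar>real (card (sqfree_box M)) - 16 * kap 1 * (\<Sum>d\<in>{1..?D}. mu d * beta_d d) * (real M)\<^sup>2\<bar> \<le> 4200 * (B ^ 6 * x ^ 38)"
    unfolding S kk[symmetric] by (rule gen[OF tail main w])
  then show ?thesis by (simp only: mult.assoc)
qed

text \<open>The number of all matrices is the case \<open>d = 1\<close> of
  \<open>card_sl2_box_approx\<close>, with the same leading factor \<open>k\<close>. Replacing the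
  truncated sum by the singular series costs \<open>k\<close> times
  \<open>4 * B / x\<^sup>2\<close>, again of order \<open>B * x^38\<close>. The three summands of
  the constant belong to these two comparisons and to the truncated Moebius sum.\<close>

lemma sqfree_box_sl2_box_approx:
  fixes \<delta> C :: real
  assumes \<delta>: "0 < \<delta>" "\<delta> \<le> 1 / 2" and C: "C \<ge> 1"
    and tau: "\<And>n. n > 0 \<Longrightarrow> real (ntau n) \<le> C * real n powr \<delta>" and CB: "C * real M powr \<delta> \<le> B"
  shows "\<bar>real (card (sqfree_box M)) - sing_series_sq * real (card (sl2_box M 1))\<bar>
    \<le> (4200 + 64 * \<bar>kap 1\<bar> + 3600 * \<bar>sing_series_sq\<bar>) * (B ^ 6 * x ^ 38)"
proof -
  let ?D = cutoff
  define F where "F = (\<Sum>d\<in>{1..?D}. mu d * beta_d d)"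
  define k where "k = 16 * kap 1 * (real M)\<^sup>2"
  define w where "w = B ^ 6 * x ^ 38"
  have s1: "\<bar>real (card (sqfree_box M)) - k * F\<bar> \<le> 4200 * w"
    using card_sqfree_box_approx by (simp add: F_def k_def w_def mult_ac)
  have D0: "real ?D > 0" using cutoff(1) by simp
  have "\<bar>sing_series_sq - F\<bar> \<le> 2 * C * real ?D powr (\<delta> - 1)"
    unfolding F_def by (rule sing_series_approx[OF \<delta> cutoff(1) C tau])
  also have "real ?D powr (\<delta> - 1) = real ?D powr \<delta> * (1 / real ?D)" using D0 by (simp add: powr_diff)
  also have "2 * C * (real ?D powr \<delta> * (1 / real ?D)) \<le> 2 * C * (real M powr \<delta> * (2 / x\<^sup>2))"
  proof (intro mult_left_mono mult_mono)
    show "real ?D powr \<delta> \<le> real M powr \<delta>" using cutoff(4) \<delta> by (intro powr_mono2) auto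
    show "1 / real ?D \<le> 2 / x\<^sup>2" using cutoff(3) D0 x by (simp add: field_simps)
  qed (use C in auto)
  also have "\<dots> = 4 * (C * real M powr \<delta>) / x\<^sup>2" by simp
  also have "\<dots> \<le> 4 * B / x\<^sup>2" using CB by (intro divide_right_mono) auto
  finally have sF: "\<bar>sing_series_sq - F\<bar> \<le> 4 * B / x\<^sup>2" .
  have "\<bar>k * F - k * sing_series_sq\<bar> = \<bar>k\<bar> * \<bar>sing_series_sq - F\<bar>"
    by (simp add: abs_mult abs_minus_commute flip: right_diff_distrib)
  also have "\<dots> \<le> \<bar>k\<bar> * (4 * B / x\<^sup>2)" using sF by (intro mult_left_mono) auto
  also have "\<dots> = 64 * \<bar>kap 1\<bar> * B * (x ^ 40 / x ^ 2)" by (simp add: k_def abs_mult Mx flip: power_mult)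
  also have "x ^ 40 / x ^ 2 = x ^ (40 - 2)" using x by (intro power_diff[symmetric]) auto
  also have "64 * \<bar>kap 1\<bar> * B * x ^ (40 - 2) = 64 * \<bar>kap 1\<bar> * (B * x ^ 38)" by simp
  also have "\<dots> \<le> 64 * \<bar>kap 1\<bar> * w" unfolding w_def
  proof (intro mult_left_mono mult_right_mono)
    show "B \<le> B ^ 6" using power_increasing[of 1 6 B] B by simp
  qed (use x in auto)
  finally have s2: "\<bar>k * F - k * sing_series_sq\<bar> \<le> 64 * \<bar>kap 1\<bar> * w" .
  have b1: "beta_d 1 = 1" by (simp add: beta_d_def)
  have x2: "1 \<le> x\<^sup>2" using x by (rule one_le_power)
  have "\<bar>real (card (sl2_box M ((int 1)\<^sup>2))) - 16 * kap 1 * beta_d 1 * (real M)\<^sup>2\<bar> \<le> 3600 * B ^ 5 * x ^ 38 / real 1"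
    using x2 by (intro card_sl2_box_approx) auto
  then have "\<bar>real (card (sl2_box M 1)) - k\<bar> \<le> 3600 * (B ^ 5 * x ^ 38)" by (simp add: b1[simplified] k_def mult_ac)
  also have "\<dots> \<le> 3600 * w" unfolding w_def using B x by (intro mult_left_mono mult_right_mono power_increasing) auto
  finally have "\<bar>sing_series_sq\<bar> * \<bar>real (card (sl2_box M 1)) - k\<bar> \<le> \<bar>sing_series_sq\<bar> * (3600 * w)" by (intro mult_left_mono) auto
  moreover have "\<bar>k * sing_series_sq - sing_series_sq * real (card (sl2_box M 1))\<bar> = \<bar>sing_series_sq\<bar> * \<bar>real (card (sl2_box M 1)) - k\<bar>"
  proof -
    have "k * sing_series_sq - sing_series_sq * real (card (sl2_box M 1)) = sing_series_sq * (k - real (card (sl2_box M 1)))"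
      by (simp add: algebra_simps)
    then show ?thesis by (simp only: abs_mult abs_minus_commute)
  qed
  ultimately have s3: "\<bar>k * sing_series_sq - sing_series_sq * real (card (sl2_box M 1))\<bar> \<le> \<bar>sing_series_sq\<bar> * (3600 * w)" by simp
  have gen: "\<bar>s - t\<bar> \<le> p + q + r" if "\<bar>s - u\<bar> \<le> p" "\<bar>u - v\<bar> \<le> q" "\<bar>v - t\<bar> \<le> r" for s t u v p q r :: real
    using that by linarith
  have "\<bar>real (card (sqfree_box M)) - sing_series_sq * real (card (sl2_box M 1))\<bar> \<le> 4200 * w + 64 * \<bar>kap 1\<bar> * w + \<bar>sing_series_sq\<bar> * (3600 * w)"
    by (rule gen[OF s1 s2 s3])
  also have "\<dots> = (4200 + 64 * \<bar>kap 1\<bar> + 3600 * \<bar>sing_series_sq\<bar>) * w" by (simp add: algebra_simps)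
  finally show ?thesis unfolding w_def .
qed

end

section \<open>The choice of the majorant and the return to \<open>Gamma_ball\<close>\<close>

lemma harm_int_le_ln:
  assumes "M \<ge> 1" shows "harm_int (int M) \<le> ln (real M) + 1"
  using assms
proof (induction M rule: dec_induct)
  case base then show ?case by (simp add: harm_int_def)
next
  case (step N)
  have N: "real N > 0" using step(1) by simp
  have "ln (real N / real (Suc N)) \<le> real N / real (Suc N) - 1" using N by (intro ln_le_minus_one) simp
  moreover have "ln (real N / real (Suc N)) = ln (real N) - ln (real (Suc N))" using N by (simp add: ln_div)
  moreover have "real N / real (Suc N) - 1 = - (1 / real (Suc N))" by (simp add: field_simps)
  ultimately have "1 / real (Suc N) \<le> ln (real (Suc N)) - ln (real N)" by linarith
  moreover have "harm_int (int (Suc N)) = harm_int (int N) + 1 / real (Suc N)"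
    unfolding harm_int_def nat_int by (simp add: sum.cl_ivl_Suc)
  ultimately show ?case using step by linarith
qed

lemma sl2_box_1_bij:
  assumes X: "X \<ge> 1"
  shows "bij_betw (\<lambda>A::int^2^2. (A $ 1 $ 1, A $ 1 $ 2, A $ 2 $ 1, A $ 2 $ 2)) (Gamma_ball X) (sl2_box (nat \<lfloor>X\<rfloor>) 1)"
proof (rule bij_betw_byWitness[where f' = "\<lambda>(a, b, c, e). (vector [vector [a, b], vector [c, e]] :: int^2^2)"])
  have f: "int (nat \<lfloor>X\<rfloor>) = \<lfloor>X\<rfloor>" using X by simp
  have ball: "A \<in> Gamma_ball X \<longleftrightarrow> A $ 1 $ 1 * A $ 2 $ 2 - A $ 1 $ 2 * A $ 2 $ 1 = 1 \<and>
    \<bar>A $ 1 $ 1\<bar> \<le> \<lfloor>X\<rfloor> \<and> \<bar>A $ 1 $ 2\<bar> \<le> \<lfloor>X\<rfloor> \<and> \<bar>A $ 2 $ 1\<bar> \<le> \<lfloor>X\<rfloor> \<and> \<bar>A $ 2 $ 2\<bar> \<le> \<lfloor>X\<rfloor>" for A :: "int^2^2"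
    by (simp add: Gamma_ball_def SL2Z_def det_2 norm_infty_def flip: le_floor_iff)
  show "\<forall>A\<in>Gamma_ball X. (\<lambda>(a, b, c, e). (vector [vector [a, b], vector [c, e]] :: int^2^2)) (A $ 1 $ 1, A $ 1 $ 2, A $ 2 $ 1, A $ 2 $ 2) = A"
    by (simp add: vec_eq_iff forall_2)
  show "\<forall>z\<in>sl2_box (nat \<lfloor>X\<rfloor>) 1. (\<lambda>A::int^2^2. (A $ 1 $ 1, A $ 1 $ 2, A $ 2 $ 1, A $ 2 $ 2)) ((\<lambda>(a, b, c, e). (vector [vector [a, b], vector [c, e]] :: int^2^2)) z) = z"
    by auto
  show "(\<lambda>A::int^2^2. (A $ 1 $ 1, A $ 1 $ 2, A $ 2 $ 1, A $ 2 $ 2)) ` Gamma_ball X \<subseteq> sl2_box (nat \<lfloor>X\<rfloor>) 1"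
    by (rule image_subsetI) (use X in \<open>simp add: ball sl2_box_def f\<close>)
  show "(\<lambda>(a, b, c, e). (vector [vector [a, b], vector [c, e]] :: int^2^2)) ` sl2_box (nat \<lfloor>X\<rfloor>) 1 \<subseteq> Gamma_ball X"
    using X by (auto simp: ball sl2_box_def f)
qed

lemma N_count_eq: "X \<ge> 1 \<Longrightarrow> N_count X = card (sl2_box (nat \<lfloor>X\<rfloor>) 1)"
  unfolding N_count_def by (rule bij_betw_same_card[OF sl2_box_1_bij])

lemma S_sq_eq: "X \<ge> 1 \<Longrightarrow> S_sq X = card (sqfree_box (nat \<lfloor>X\<rfloor>))"
proof -
  assume X: "X \<ge> 1"
  let ?f = "\<lambda>A::int^2^2. (A $ 1 $ 1, A $ 1 $ 2, A $ 2 $ 1, A $ 2 $ 2)"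
  have bij: "bij_betw ?f (Gamma_ball X) (sl2_box (nat \<lfloor>X\<rfloor>) 1)" by (rule sl2_box_1_bij[OF X])
  have "?f ` {A \<in> Gamma_ball X. squarefree (R_form A)} = sqfree_box (nat \<lfloor>X\<rfloor>)"
    unfolding sqfree_box_def bij_betw_imp_surj_on[OF bij, symmetric] by (auto simp: R_form_def)
  then have "bij_betw ?f {A \<in> Gamma_ball X. squarefree (R_form A)} (sqfree_box (nat \<lfloor>X\<rfloor>))"
    using bij by (intro bij_betw_subset[OF bij]) auto
  then show ?thesis unfolding S_sq_def by (rule bij_betw_same_card)
qed

text \<open>Each majorant is a small power of \<open>M\<close>. The exponent \<open>2 * e\<close>
  comes from arguments of \<open>tau\<close> as large as \<open>8 * M\<^sup>2\<close>, where
  \<open>8 powr e \<le> 8\<close> goes into \<open>K\<close>. The parameter \<open>C3\<close> lets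
  \<open>K\<close> dominate one further constant chosen beforehand.\<close>

lemma divisor_bounds_exists:
  fixes e C3 :: real
  assumes e: "0 < e" "e \<le> 1 / 4" and C3: "C3 \<ge> 0"
  obtains K where "K \<ge> 1" "K \<ge> C3"
    "\<And>M. M \<ge> 1 \<Longrightarrow> divisor_bounds M (K * real M powr (2 * e)) (real M powr (1 / 20))"
proof -
  obtain C1 where C1: "C1 \<ge> 1" "\<And>n. n \<noteq> 0 \<Longrightarrow> real (tau n) \<le> C1 * \<bar>real_of_int n\<bar> powr e"
    using tau_bound[OF e(1)] by blast
  obtain C2 where C2: "C2 \<ge> 1" "\<And>M d. d > 0 \<Longrightarrow> d \<le> M \<Longrightarrow> real (card {r \<in> {1..M::nat}. \<forall>p. prime p \<longrightarrow> p dvd r \<longrightarrow> p dvd d}) \<le> C2 * real M powr e"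
    using smooth_count_bound[OF e(1)] by blast
  define K where "K = 8 * C1 + C2 + (1 + 1 / e) + C3"
  have e': "0 \<le> 1 / e" using e by simp
  have K: "8 * C1 \<le> K" "C2 \<le> K" "1 + 1 / e \<le> K" "C3 \<le> K" "1 \<le> K" using C1(1) C2(1) C3 e' unfolding K_def by linarith+
  have "divisor_bounds M (K * real M powr (2 * e)) (real M powr (1 / 20))" if M: "M \<ge> 1" for M
  proof
    have M1: "real M \<ge> 1" using M by simp
    have p1: "1 \<le> real M powr (2 * e)" using M1 e by (intro ge_one_powr_ge_zero) auto
    have pe: "real M powr e \<le> real M powr (2 * e)" using M1 e by (intro powr_mono) auto
    show "1 \<le> real M powr (1 / 20)" using M1 by (intro ge_one_powr_ge_zero) auto
    show "real M = (real M powr (1 / 20)) ^ 20" using M1 by (simp add: powr_powr flip: powr_realpow)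
    have "1 * 1 \<le> K * real M powr (2 * e)" using K(5) p1 by (intro mult_mono) auto
    then show "1 \<le> K * real M powr (2 * e)" by simp
    show "real (tau N) \<le> K * real M powr (2 * e)" if N: "N \<noteq> 0" "\<bar>N\<bar> \<le> 8 * (int M)\<^sup>2" for N
    proof -
      have "real_of_int \<bar>N\<bar> \<le> real_of_int (8 * (int M)\<^sup>2)" using N(2) by (simp only: of_int_le_iff)
      then have N': "\<bar>real_of_int N\<bar> \<le> 8 * (real M)\<^sup>2" by simp
      have "real (tau N) \<le> C1 * \<bar>real_of_int N\<bar> powr e" by (rule C1(2)[OF N(1)])
      also have "\<dots> \<le> C1 * (8 * (real M)\<^sup>2) powr e" using N' e C1(1) by (intro mult_left_mono powr_mono2) auto
      also have "(8 * (real M)\<^sup>2) powr e = 8 powr e * (real M)\<^sup>2 powr e" by (rule powr_mult)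
      also have "(real M)\<^sup>2 powr e = real M powr (2 * e)" using M1 by (simp add: powr_powr flip: powr_numeral)
      also have "C1 * (8 powr e * real M powr (2 * e)) \<le> C1 * (8 powr 1 * real M powr (2 * e))"
        using e C1(1) by (intro mult_left_mono mult_right_mono powr_mono) auto
      also have "\<dots> = 8 * C1 * real M powr (2 * e)" by simp
      also have "\<dots> \<le> K * real M powr (2 * e)" using K(1) by (intro mult_right_mono) auto
      finally show ?thesis .
    qed
    show "harm_int (int m) \<le> K * real M powr (2 * e)" if m: "m \<le> M" for m
    proof -
      have "harm_int (int m) \<le> harm_int (int M)" unfolding harm_int_def using m by (intro sum_mono2) auto
      also have "\<dots> \<le> ln (real M) + 1" by (rule harm_int_le_ln[OF M])
      also have "\<dots> \<le> real M powr e / e + real M powr (2 * e)" using ln_powr_bound[OF M1 e(1)] p1 by (intro add_mono) auto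
      also have "\<dots> \<le> real M powr (2 * e) / e + real M powr (2 * e)" using pe e by (intro add_right_mono divide_right_mono) auto
      also have "\<dots> = (1 + 1 / e) * real M powr (2 * e)" by (simp add: algebra_simps)
      also have "\<dots> \<le> K * real M powr (2 * e)" using K(3) by (intro mult_right_mono) auto
      finally show ?thesis .
    qed
    show "real (card {r \<in> {1..M}. \<forall>p. prime p \<longrightarrow> p dvd r \<longrightarrow> p dvd d}) \<le> K * real M powr (2 * e)" if d: "d > 0" "d \<le> M" for d
    proof -
      have "real (card {r \<in> {1..M}. \<forall>p. prime p \<longrightarrow> p dvd r \<longrightarrow> p dvd d}) \<le> C2 * real M powr e" by (rule C2(2)[OF d])
      also have "\<dots> \<le> K * real M powr (2 * e)" using K(2,5) pe by (intro mult_mono) auto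
      finally show ?thesis .
    qed
  qed
  then show ?thesis using K(5) K(4) that by blast
qed

theorem theorem1p1:
  fixes \<epsilon> :: real
  assumes "\<epsilon> > 0"
  shows "\<exists>C::real. \<forall>\<^sub>F X::real in at_top.
           \<bar>real (S_sq X) - sing_series_sq * real (N_count X)\<bar> \<le> C * X powr (19 / 10 + \<epsilon>)"
proof -
  \<comment> \<open>\<open>B ^ 6\<close> with \<open>B\<close> of order
    \<open>M powr (2 * e)\<close> has exponent \<open>12 * e\<close>, which has to stay below
    \<open>\<epsilon>\<close>; the cap \<open>1 / 4\<close> meets the ranges demanded of
    \<open>e\<close> by the majorant and by the tail of the singular series.\<close>
  define e where "e = min (\<epsilon> / 12) (1 / 4)"
  have e: "0 < e" "e \<le> 1 / 4" "12 * e \<le> \<epsilon>" "e \<le> 1 / 2" using assms unfolding e_def by auto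
  obtain C where C: "C \<ge> 1" "\<And>n. n > 0 \<Longrightarrow> real (ntau n) \<le> C * real n powr e"
    using ntau_bound[OF e(1)] by blast
  have C0: "C \<ge> 0" using C(1) by simp
  obtain K where K: "K \<ge> 1" "K \<ge> C"
    "\<And>M. M \<ge> 1 \<Longrightarrow> divisor_bounds M (K * real M powr (2 * e)) (real M powr (1 / 20))"
    using divisor_bounds_exists[OF e(1,2) C0] by blast
  define c where "c = 4200 + 64 * \<bar>kap 1\<bar> + 3600 * \<bar>sing_series_sq\<bar>"
  have c0: "c \<ge> 0" unfolding c_def by simp
  have "\<bar>real (S_sq X) - sing_series_sq * real (N_count X)\<bar> \<le> (c * K ^ 6) * X powr (19 / 10 + \<epsilon>)" if X: "X \<ge> 1" for X
  proof -
    define M where "M = nat \<lfloor>X\<rfloor>"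
    have "1 \<le> \<lfloor>X\<rfloor>" using X by simp
    then have M: "M \<ge> 1" and MX: "real M = of_int \<lfloor>X\<rfloor>" unfolding M_def by linarith+
    have M1: "real M \<ge> 1" using M by simp
    have MleX: "real M \<le> X" unfolding MX by (rule of_int_floor_le)
    define B where "B = K * real M powr (2 * e)"
    interpret divisor_bounds M B "real M powr (1 / 20)" unfolding B_def by (rule K(3)[OF M])
    have CB: "C * real M powr e \<le> B" unfolding B_def using K(1,2) M1 e by (intro mult_mono powr_mono) auto
    have "\<bar>real (card (sqfree_box M)) - sing_series_sq * real (card (sl2_box M 1))\<bar> \<le> c * (B ^ 6 * (real M powr (1 / 20)) ^ 38)"
      unfolding c_def by (rule sqfree_box_sl2_box_approx[OF e(1,4) C CB])
    also have "B ^ 6 * (real M powr (1 / 20)) ^ 38 = K ^ 6 * real M powr (12 * e + 19 / 10)"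
    proof -
      have p: "(real M powr u) ^ n = real M powr (u * real n)" for u n
        using M1 by (simp add: powr_powr flip: powr_realpow)
      have "B ^ 6 * (real M powr (1 / 20)) ^ 38 = K ^ 6 * (real M powr (2 * e * real 6) * real M powr (1 / 20 * real 38))"
        unfolding B_def power_mult_distrib p by (simp only: mult.assoc)
      also have "\<dots> = K ^ 6 * real M powr (2 * e * real 6 + 1 / 20 * real 38)" by (simp only: powr_add)
      also have "2 * e * real 6 + 1 / 20 * real 38 = 12 * e + 19 / 10" by simp
      finally show ?thesis .
    qed
    also have "c * (K ^ 6 * real M powr (12 * e + 19 / 10)) \<le> c * (K ^ 6 * X powr (19 / 10 + \<epsilon>))"
    proof (intro mult_left_mono)
      have "real M powr (12 * e + 19 / 10) \<le> X powr (12 * e + 19 / 10)" using MleX M1 e by (intro powr_mono2) auto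
      also have "\<dots> \<le> X powr (19 / 10 + \<epsilon>)" using X e by (intro powr_mono) auto
      finally show "real M powr (12 * e + 19 / 10) \<le> X powr (19 / 10 + \<epsilon>)" .
    qed (use K(1) c0 in auto)
    finally show ?thesis unfolding N_count_eq[OF X] S_sq_eq[OF X] M_def[symmetric] by (simp only: mult.assoc)
  qed
  then have "\<forall>\<^sub>F X in at_top. \<bar>real (S_sq X) - sing_series_sq * real (N_count X)\<bar> \<le> (c * K ^ 6) * X powr (19 / 10 + \<epsilon>)"
    by (rule eventually_at_top_linorderI)
  then show ?thesis by blast
qed

end
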